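(* Let $K$ be a Hopf algebra over $\Bbbk$ with bijective antipode, $V\in{}^{K}_{K}\mathcal{YD}$ finite-dimensional and $\mathcal{E}\in{}^{K}_{K}\mathcal{YD}$ a post-Nichols algebra of $V$ with $\operatorname{GKdim}\mathcal{E}<\infty$. If $V^*$ is pre-bounded, then $\mathcal{E}$ is finitely generated and $\operatorname{GKdim}\mathcal{E} = \operatorname{GKdim}\mathcal{E}^d$, where $\mathcal{E}^d$ is the graded dual of $\mathcal{E}$. In particular, if the only pre-Nichols algebra of $V^*$ with finite $\operatorname{GKdim}$ is $\mathcal{B}(V^* )$, then $\mathcal{E} = \mathcal{B}(V)$.
   Context: $\Bbbk$ is an algebraically closed field of characteristic $0$; $\operatorname{GKdim}$ is Gelfand-Kirillov dimension; ${}^{K}_{K}\mathcal{YD}$ is the category of Yetter-Drinfeld modules over $K$; $\mathcal{B}(V)$ is the Nichols algebra of $V$. Post-Nichols algebra of $V$: a coradically graded connected Hopf algebra $\mathcal{E} = \oplus_{n\ge0}\mathcal{E}^n$ in ${}^{K}_{K}\mathcal{YD}$ (that is, $\mathcal{E}^0=\Bbbk$ and the coradical filtration is the one given by the grading) such that $\mathcal{E}^1\simeq V$. Pre-Nichols algebra of $V$: a graded connected Hopf algebra $\mathcal{B} = \oplus_{n\ge0}\mathcal{B}^n$ in ${}^{K}_{K}\mathcal{YD}$ such that $\mathcal{B}^1\simeq V$ generates $\mathcal{B}$ as an algebra. If $\mathcal{E}$ is a post-Nichols algebra of $V$, there is an inclusion $\mathcal{B}(V)\hookrightarrow\mathcal{E}$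 of graded Hopf algebras in ${}^{K}_{K}\mathcal{YD}$, and the graded dual $\mathcal{E}^d$ is a pre-Nichols algebra of $V^*$, and vice versa. The pre-Nichols algebras of $V$, viewed as quotients of $T(V)$, form a poset with the ordering given by the (canonical) surjections: $\mathcal{B}' < \mathcal{B}$ if $\mathcal{B}$ is a proper quotient of $\mathcal{B}'$, so that $\mathcal{B}(V)$ is the largest element. $V$ is called pre-bounded if every chain $\dots<\mathcal{B}[3]<\mathcal{B}[2]<\mathcal{B}[1]<\mathcal{B}[0] = \mathcal{B}(V)$ of pre-Nichols algebras of $V$ with finite $\operatorname{GKdim}$ is finite. *)

theory Defs
  imports
    "HOL-Computational_Algebra.Polynomial"
    "HOL-Library.Function_Algebras"
    "HOL-Library.Poly_Mapping"
    "HOL-Library.Extended_Real"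
begin

section \<open>Vector spaces and tensors\<close>

text \<open>
  A vector space is a subspace \<open>carr X\<close> of an ambient vector space with scalar
  multiplication \<open>scl X\<close>; the addition is that of the ambient type.
\<close>

record ('k, 'a) vspace =
  carr :: "'a set"
  scl :: "'k \<Rightarrow> 'a \<Rightarrow> 'a"

locale vs =
  fixes X :: "('k::field, 'a::ab_group_add, 'z) vspace_scheme"
  assumes ambient: "vector_space (scl X)"
    and subspace_carr: "module.subspace (scl X) (carr X)"

definition lin :: "('k::field, 'a::ab_group_add, 'y) vspace_scheme \<Rightarrow>
    ('k, 'b::ab_group_add, 'z) vspace_scheme \<Rightarrow> ('a \<Rightarrow> 'b) \<Rightarrow> bool" where
  "lin X Y f \<longleftrightarrow>
     f ` carr X \<subseteq> carr Y \<and>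
     (\<forall>x\<in>carr X. \<forall>x'\<in>carr X. f (x + x') = f x + f x') \<and>
     (\<forall>c. \<forall>x\<in>carr X. f (scl X c x) = scl Y c (f x))"

definition lform :: "('k::field, 'a::ab_group_add, 'y) vspace_scheme \<Rightarrow> ('a \<Rightarrow> 'k) \<Rightarrow> bool" where
  "lform X f \<longleftrightarrow>
     (\<forall>x\<in>carr X. \<forall>x'\<in>carr X. f (x + x') = f x + f x') \<and>
     (\<forall>c. \<forall>x\<in>carr X. f (scl X c x) = c * f x)"

definition finite_dim :: "('k::field, 'a::ab_group_add, 'y) vspace_scheme \<Rightarrow> bool" where
  "finite_dim X \<longleftrightarrow> (\<exists>F. finite F \<and> module.span (scl X) F = carr X)"

text \<open>
  An element \<open>\<Sum>\<^sub>i x\<^sub>i \<otimes> y\<^sub>i\<close> of \<open>X \<otimes> Y\<close> is represented by the list of the pairs \<open>(x\<^sub>i, y\<^sub>i)\<close>,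
  and a map into \<open>X \<otimes> Y\<close> by a choice of such representatives (this is Sweedler notation).
  Two lists represent the same tensor iff every bilinear map takes the same value on both; as
  \<open>X \<otimes> Y\<close> is a vector space, it suffices to test bilinear forms. Everything below depends on
  the lists only through the tensors they represent. Likewise for triple tensor products.
\<close>

definition bilinear_form :: "('k::field, 'a::ab_group_add, 'x) vspace_scheme \<Rightarrow>
    ('k, 'b::ab_group_add, 'y) vspace_scheme \<Rightarrow> ('a \<Rightarrow> 'b \<Rightarrow> 'k) \<Rightarrow> bool" where
  "bilinear_form X Y \<beta> \<longleftrightarrow>
     (\<forall>y\<in>carr Y. lform X (\<lambda>x. \<beta> x y)) \<and> (\<forall>x\<in>carr X. lform Y (\<lambda>y. \<beta> x y))"

definition trilinear_form :: "('k::field, 'a::ab_group_add, 'x) vspace_scheme \<Rightarrow>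
    ('k, 'b::ab_group_add, 'y) vspace_scheme \<Rightarrow> ('k, 'c::ab_group_add, 'z) vspace_scheme \<Rightarrow>
    ('a \<Rightarrow> 'b \<Rightarrow> 'c \<Rightarrow> 'k) \<Rightarrow> bool" where
  "trilinear_form X Y Z \<beta> \<longleftrightarrow>
     (\<forall>y\<in>carr Y. \<forall>z\<in>carr Z. lform X (\<lambda>x. \<beta> x y z)) \<and>
     (\<forall>x\<in>carr X. \<forall>z\<in>carr Z. lform Y (\<lambda>y. \<beta> x y z)) \<and>
     (\<forall>x\<in>carr X. \<forall>y\<in>carr Y. lform Z (\<lambda>z. \<beta> x y z))"

definition teq :: "('k::field, 'a::ab_group_add, 'x) vspace_scheme \<Rightarrow>
    ('k, 'b::ab_group_add, 'y) vspace_scheme \<Rightarrow> ('a \<times> 'b) list \<Rightarrow> ('a \<times> 'b) list \<Rightarrow> bool" where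
  "teq X Y s t \<longleftrightarrow>
     (\<forall>\<beta>. bilinear_form X Y \<beta> \<longrightarrow> (\<Sum>(x, y)\<leftarrow>s. \<beta> x y) = (\<Sum>(x, y)\<leftarrow>t. \<beta> x y))"

definition teq3 :: "('k::field, 'a::ab_group_add, 'x) vspace_scheme \<Rightarrow>
    ('k, 'b::ab_group_add, 'y) vspace_scheme \<Rightarrow> ('k, 'c::ab_group_add, 'z) vspace_scheme \<Rightarrow>
    ('a \<times> 'b \<times> 'c) list \<Rightarrow> ('a \<times> 'b \<times> 'c) list \<Rightarrow> bool" where
  "teq3 X Y Z s t \<longleftrightarrow>
     (\<forall>\<beta>. trilinear_form X Y Z \<beta> \<longrightarrow>
        (\<Sum>(x, y, z)\<leftarrow>s. \<beta> x y z) = (\<Sum>(x, y, z)\<leftarrow>t. \<beta> x y z))"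

text \<open>
  The tensor represented by \<open>t\<close> is a sum of pure tensors \<open>x \<otimes> y\<close> with \<open>(x, y) \<in> S\<close>. For
  \<open>S = \<Union>\<^sub>i X\<^sub>i \<times> Y\<^sub>i\<close> with subspaces \<open>X\<^sub>i\<close>, \<open>Y\<^sub>i\<close> this means \<open>t \<in> \<Sum>\<^sub>i X\<^sub>i \<otimes> Y\<^sub>i\<close>.
\<close>

definition in_tensor :: "('k::field, 'a::ab_group_add, 'x) vspace_scheme \<Rightarrow>
    ('k, 'b::ab_group_add, 'y) vspace_scheme \<Rightarrow> ('a \<times> 'b) set \<Rightarrow> ('a \<times> 'b) list \<Rightarrow> bool" where
  "in_tensor X Y S t \<longleftrightarrow> (\<exists>s. set s \<subseteq> S \<and> teq X Y t s)"

definition lin_tensor :: "('k::field, 'a::ab_group_add, 'x) vspace_scheme \<Rightarrow>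
    ('k, 'b::ab_group_add, 'y) vspace_scheme \<Rightarrow> ('k, 'c::ab_group_add, 'z) vspace_scheme \<Rightarrow>
    ('a \<Rightarrow> ('b \<times> 'c) list) \<Rightarrow> bool" where
  "lin_tensor X Y Z \<delta> \<longleftrightarrow>
     (\<forall>x\<in>carr X. set (\<delta> x) \<subseteq> carr Y \<times> carr Z) \<and>
     (\<forall>x\<in>carr X. \<forall>x'\<in>carr X. teq Y Z (\<delta> (x + x')) (\<delta> x @ \<delta> x')) \<and>
     (\<forall>c. \<forall>x\<in>carr X. teq Y Z (\<delta> (scl X c x)) [(scl Y c y, z). (y, z) \<leftarrow> \<delta> x])"

section \<open>Algebras, coalgebras, Hopf algebras\<close>

record ('k, 'a) alg = "('k, 'a) vspace" +
  mul :: "'a \<Rightarrow> 'a \<Rightarrow> 'a"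
  unit :: "'a"

record ('k, 'a) hopf = "('k, 'a) alg" +
  cop :: "'a \<Rightarrow> ('a \<times> 'a) list"
  eps :: "'a \<Rightarrow> 'k"
  antip :: "'a \<Rightarrow> 'a"

locale algebra = vs A for A :: "('k::field, 'a::ab_group_add, 'z) alg_scheme" +
  assumes mul_lin_left: "b \<in> carr A \<Longrightarrow> lin A A (\<lambda>a. mul A a b)"
    and mul_lin_right: "a \<in> carr A \<Longrightarrow> lin A A (\<lambda>b. mul A a b)"
    and mul_assoc: "\<lbrakk>a \<in> carr A; b \<in> carr A; c \<in> carr A\<rbrakk> \<Longrightarrow>
      mul A (mul A a b) c = mul A a (mul A b c)"
    and unit_carr: "unit A \<in> carr A"
    and unit_left: "a \<in> carr A \<Longrightarrow> mul A (unit A) a = a"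
    and unit_right: "a \<in> carr A \<Longrightarrow> mul A a (unit A) = a"

locale coalgebra = vs C for C :: "('k::field, 'a::ab_group_add, 'z) hopf_scheme" +
  assumes cop_lin: "lin_tensor C C C (cop C)"
    and eps_lin: "lform C (eps C)"
    and coassoc: "x \<in> carr C \<Longrightarrow>
      teq3 C C C [(a1, a2, b). (a, b) \<leftarrow> cop C x, (a1, a2) \<leftarrow> cop C a]
                 [(a, b1, b2). (a, b) \<leftarrow> cop C x, (b1, b2) \<leftarrow> cop C b]"
    and counit_left: "x \<in> carr C \<Longrightarrow> (\<Sum>(a, b)\<leftarrow>cop C x. scl C (eps C a) b) = x"
    and counit_right: "x \<in> carr C \<Longrightarrow> (\<Sum>(a, b)\<leftarrow>cop C x. scl C (eps C b) a) = x"

text \<open>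
  The braiding \<open>c\<close> enters through the multiplication
  \<open>(a \<otimes> b)(a' \<otimes> b') = a c(b \<otimes> a') b'\<close> of \<open>H \<otimes> H\<close>.
\<close>

locale braided_hopf = algebra H + coalgebra H
  for H :: "('k::field, 'a::ab_group_add, 'z) hopf_scheme"
    and br :: "'a \<Rightarrow> 'a \<Rightarrow> ('a \<times> 'a) list" +
  assumes cop_mul: "\<lbrakk>x \<in> carr H; y \<in> carr H\<rbrakk> \<Longrightarrow>
      teq H H (cop H (mul H x y))
        [(mul H a u, mul H v b'). (a, b) \<leftarrow> cop H x, (a', b') \<leftarrow> cop H y, (u, v) \<leftarrow> br b a']"
    and cop_unit: "teq H H (cop H (unit H)) [(unit H, unit H)]"
    and eps_mul: "\<lbrakk>x \<in> carr H; y \<in> carr H\<rbrakk> \<Longrightarrow> eps H (mul H x y) = eps H x * eps H y"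
    and eps_unit: "eps H (unit H) = 1"
    and antip_lin: "lin H H (antip H)"
    and antip_left: "x \<in> carr H \<Longrightarrow>
      (\<Sum>(a, b)\<leftarrow>cop H x. mul H (antip H a) b) = scl H (eps H x) (unit H)"
    and antip_right: "x \<in> carr H \<Longrightarrow>
      (\<Sum>(a, b)\<leftarrow>cop H x. mul H a (antip H b)) = scl H (eps H x) (unit H)"

locale hopf_algebra = braided_hopf H "\<lambda>x y. [(y, x)]"
  for H :: "('k::field, 'a::ab_group_add, 'z) hopf_scheme"

definition generated :: "('k::field, 'a::ab_group_add, 'z) alg_scheme \<Rightarrow> 'a set \<Rightarrow> 'a set" where
  "generated A F = module.span (scl A) {foldr (mul A) xs (unit A) | xs. set xs \<subseteq> F}"

definition finitely_generated :: "('k::field, 'a::ab_group_add, 'z) alg_scheme \<Rightarrow> bool" where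
  "finitely_generated A \<longleftrightarrow> (\<exists>F. finite F \<and> F \<subseteq> carr A \<and> generated A F = carr A)"

text \<open>\<open>words_upto A W n = k + W + W\<^sup>2 + \<dots> + W\<^sup>n\<close>\<close>

definition words_upto :: "('k::field, 'a::ab_group_add, 'z) alg_scheme \<Rightarrow> 'a set \<Rightarrow> nat \<Rightarrow> 'a set"
  where
  "words_upto A W n =
     module.span (scl A) {foldr (mul A) xs (unit A) | xs. set xs \<subseteq> W \<and> length xs \<le> n}"

definition GKdim :: "('k::field, 'a::ab_group_add, 'z) alg_scheme \<Rightarrow> ereal" where
  "GKdim A =
     (SUP W \<in> {W. W \<subseteq> carr A \<and> (\<exists>F. finite F \<and> W = module.span (scl A) F)}.
        limsup (\<lambda>n. ereal (log (real n) (real (vector_space.dim (scl A) (words_upto A W n))))))"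

section \<open>The coradical filtration\<close>

definition subcoalgebra :: "('k::field, 'a::ab_group_add, 'z) hopf_scheme \<Rightarrow> 'a set \<Rightarrow> bool" where
  "subcoalgebra C D \<longleftrightarrow>
     D \<subseteq> carr C \<and> module.subspace (scl C) D \<and> (\<forall>x\<in>D. in_tensor C C (D \<times> D) (cop C x))"

definition simple_subcoalgebra :: "('k::field, 'a::ab_group_add, 'z) hopf_scheme \<Rightarrow> 'a set \<Rightarrow> bool"
  where
  "simple_subcoalgebra C D \<longleftrightarrow>
     subcoalgebra C D \<and> D \<noteq> {0} \<and> (\<forall>D'. subcoalgebra C D' \<and> D' \<subseteq> D \<longrightarrow> D' = {0} \<or> D' = D)"

definition coradical :: "('k::field, 'a::ab_group_add, 'z) hopf_scheme \<Rightarrow> 'a set" where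
  "coradical C = module.span (scl C) (\<Union>{D. simple_subcoalgebra C D})"

primrec coradical_filtration ::
    "('k::field, 'a::ab_group_add, 'z) hopf_scheme \<Rightarrow> nat \<Rightarrow> 'a set" where
  "coradical_filtration C 0 = coradical C"
| "coradical_filtration C (Suc n) =
     {x \<in> carr C. in_tensor C C
        (carr C \<times> coradical_filtration C n \<union> coradical C \<times> carr C) (cop C x)}"

definition primitives :: "('k::field, 'a::ab_group_add, 'z) hopf_scheme \<Rightarrow> 'a set" where
  "primitives H = {x \<in> carr H. teq H H (cop H x) [(x, unit H), (unit H, x)]}"

section \<open>Yetter-Drinfeld modules\<close>

record ('k, 'h, 'a) yd = "('k, 'a) vspace" +
  act :: "'h \<Rightarrow> 'a \<Rightarrow> 'a"
  coact :: "'a \<Rightarrow> ('h \<times> 'a) list"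

locale yd_module = K: hopf_algebra K + V: vs V
  for K :: "('k::field, 'h::ab_group_add, 'y) hopf_scheme"
    and V :: "('k, 'h, 'a::ab_group_add, 'z) yd_scheme" +
  assumes act_lin_left: "v \<in> carr V \<Longrightarrow> lin K V (\<lambda>h. act V h v)"
    and act_lin_right: "h \<in> carr K \<Longrightarrow> lin V V (act V h)"
    and act_mul: "\<lbrakk>g \<in> carr K; h \<in> carr K; v \<in> carr V\<rbrakk> \<Longrightarrow>
      act V (mul K g h) v = act V g (act V h v)"
    and act_unit: "v \<in> carr V \<Longrightarrow> act V (unit K) v = v"
    and coact_lin: "lin_tensor V K V (coact V)"
    and coact_coassoc: "v \<in> carr V \<Longrightarrow>
      teq3 K K V [(h1, h2, w). (h, w) \<leftarrow> coact V v, (h1, h2) \<leftarrow> cop K h]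
                 [(h, g, u). (h, w) \<leftarrow> coact V v, (g, u) \<leftarrow> coact V w]"
    and coact_counit: "v \<in> carr V \<Longrightarrow> (\<Sum>(h, w)\<leftarrow>coact V v. scl V (eps K h) w) = v"
    and yd_compat: "\<lbrakk>h \<in> carr K; v \<in> carr V\<rbrakk> \<Longrightarrow>
      teq K V (coact V (act V h v))
        [(mul K (mul K h1 g) (antip K h3), act V h2 w).
           (h1, h') \<leftarrow> cop K h, (h2, h3) \<leftarrow> cop K h', (g, w) \<leftarrow> coact V v]"

text \<open>
  The left dual \<open>V\<^sup>*\<close> of a finite-dimensional \<open>V\<close>:
  \<open>(h \<cdot> f)(v) = f(S(h) \<cdot> v)\<close> and \<open>f\<^bsub>(-1)\<^esub> f\<^bsub>(0)\<^esub>(v) = S\<^sup>-\<^sup>1(v\<^bsub>(-1)\<^esub>) f(v\<^bsub>(0)\<^esub>)\<close> for all \<open>v\<close>; the latter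
  determines \<open>f\<^bsub>(-1)\<^esub> \<otimes> f\<^bsub>(0)\<^esub>\<close> uniquely. Functionals are extended by zero outside the carrier.
\<close>

definition dual_vspace :: "('k::field, 'a::ab_group_add, 'z) vspace_scheme \<Rightarrow> ('k, 'a \<Rightarrow> 'k) vspace"
  where
  "dual_vspace V =
     \<lparr>carr = {f. lform V f \<and> (\<forall>x. x \<notin> carr V \<longrightarrow> f x = 0)}, scl = (\<lambda>c f x. c * f x)\<rparr>"

definition yd_dual :: "('k::field, 'h::ab_group_add, 'y) hopf_scheme \<Rightarrow>
    ('k, 'h, 'a::ab_group_add, 'z) yd_scheme \<Rightarrow> ('k, 'h, 'a \<Rightarrow> 'k) yd" where
  "yd_dual K V =
     \<lparr>carr = carr (dual_vspace V), scl = scl (dual_vspace V),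
      act = (\<lambda>h f v. if v \<in> carr V then f (act V (antip K h) v) else 0),
      coact = (\<lambda>f. SOME t. set t \<subseteq> carr K \<times> carr (dual_vspace V) \<and>
        (\<forall>v\<in>carr V. (\<Sum>(h, g)\<leftarrow>t. scl K (g v) h) =
           (\<Sum>(h, w)\<leftarrow>coact V v. scl K (f w) (inv_into (carr K) (antip K) h))))\<rparr>"

section \<open>Graded connected Hopf algebras in the Yetter-Drinfeld category\<close>

record ('k, 'h, 'a) yd_hopf = "('k, 'a) hopf" +
  hact :: "'h \<Rightarrow> 'a \<Rightarrow> 'a"
  hcoact :: "'a \<Rightarrow> ('h \<times> 'a) list"
  deg :: "nat \<Rightarrow> 'a set"

definition yd_of :: "('k, 'h, 'a, 'z) yd_hopf_scheme \<Rightarrow> ('k, 'h, 'a) yd" where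
  "yd_of R = \<lparr>carr = carr R, scl = scl R, act = hact R, coact = hcoact R\<rparr>"

text \<open>\<open>c(x \<otimes> y) = x\<^bsub>(-1)\<^esub> \<cdot> y \<otimes> x\<^bsub>(0)\<^esub>\<close>\<close>

definition yd_braiding :: "('k, 'h, 'a, 'z) yd_hopf_scheme \<Rightarrow> 'a \<Rightarrow> 'a \<Rightarrow> ('a \<times> 'a) list" where
  "yd_braiding R x y = [(hact R h y, w). (h, w) \<leftarrow> hcoact R x]"

locale yd_hopf_algebra = YD: yd_module K "yd_of R" + R: braided_hopf R "yd_braiding R"
  for K :: "('k::field, 'h::ab_group_add, 'y) hopf_scheme"
    and R :: "('k, 'h, 'a::ab_group_add, 'z) yd_hopf_scheme" +
  assumes act_mul_R: "\<lbrakk>h \<in> carr K; x \<in> carr R; y \<in> carr R\<rbrakk> \<Longrightarrow>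
      hact R h (mul R x y) = (\<Sum>(h1, h2)\<leftarrow>cop K h. mul R (hact R h1 x) (hact R h2 y))"
    and act_unit_R: "h \<in> carr K \<Longrightarrow> hact R h (unit R) = scl R (eps K h) (unit R)"
    and coact_mul_R: "\<lbrakk>x \<in> carr R; y \<in> carr R\<rbrakk> \<Longrightarrow>
      teq K R (hcoact R (mul R x y))
        [(mul K g h, mul R u w). (g, u) \<leftarrow> hcoact R x, (h, w) \<leftarrow> hcoact R y]"
    and coact_unit_R: "teq K R (hcoact R (unit R)) [(unit K, unit R)]"
    and act_cop_R: "\<lbrakk>h \<in> carr K; x \<in> carr R\<rbrakk> \<Longrightarrow>
      teq R R (cop R (hact R h x))
        [(hact R h1 a, hact R h2 b). (h1, h2) \<leftarrow> cop K h, (a, b) \<leftarrow> cop R x]"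
    and act_eps_R: "\<lbrakk>h \<in> carr K; x \<in> carr R\<rbrakk> \<Longrightarrow> eps R (hact R h x) = eps K h * eps R x"
    and coact_cop_R: "x \<in> carr R \<Longrightarrow>
      teq3 K R R [(h, a, b). (h, w) \<leftarrow> hcoact R x, (a, b) \<leftarrow> cop R w]
        [(mul K g h, u, w). (a, b) \<leftarrow> cop R x, (g, u) \<leftarrow> hcoact R a, (h, w) \<leftarrow> hcoact R b]"
    and coact_eps_R: "x \<in> carr R \<Longrightarrow>
      (\<Sum>(h, w)\<leftarrow>hcoact R x. scl K (eps R w) h) = scl K (eps R x) (unit K)"
    and act_antip_R: "\<lbrakk>h \<in> carr K; x \<in> carr R\<rbrakk> \<Longrightarrow>
      antip R (hact R h x) = hact R h (antip R x)"
    and coact_antip_R: "x \<in> carr R \<Longrightarrow>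
      teq K R (hcoact R (antip R x)) [(h, antip R w). (h, w) \<leftarrow> hcoact R x]"

locale graded_connected_hopf = yd_hopf_algebra K R
  for K :: "('k::field, 'h::ab_group_add, 'y) hopf_scheme"
    and R :: "('k, 'h, 'a::ab_group_add, 'z) yd_hopf_scheme" +
  assumes deg_subspace: "deg R n \<subseteq> carr R \<and> module.subspace (scl R) (deg R n)"
    and deg_direct_sum: "x \<in> carr R \<Longrightarrow>
      \<exists>!c. (\<forall>n. c n \<in> deg R n) \<and> finite {n. c n \<noteq> 0} \<and> x = (\<Sum>n | c n \<noteq> 0. c n)"
    and deg_mul: "\<lbrakk>x \<in> deg R m; y \<in> deg R n\<rbrakk> \<Longrightarrow> mul R x y \<in> deg R (m + n)"
    and deg_unit: "unit R \<in> deg R 0"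
    and deg_cop: "x \<in> deg R n \<Longrightarrow>
      in_tensor R R (\<Union>i\<le>n. deg R i \<times> deg R (n - i)) (cop R x)"
    and deg_eps: "\<lbrakk>x \<in> deg R n; n > 0\<rbrakk> \<Longrightarrow> eps R x = 0"
    and deg_antip: "x \<in> deg R n \<Longrightarrow> antip R x \<in> deg R n"
    and deg_act: "\<lbrakk>h \<in> carr K; x \<in> deg R n\<rbrakk> \<Longrightarrow> hact R h x \<in> deg R n"
    and deg_coact: "x \<in> deg R n \<Longrightarrow> in_tensor K R (carr K \<times> deg R n) (hcoact R x)"
    and connected: "deg R 0 = range (\<lambda>c. scl R c (unit R))"

definition coradically_graded :: "('k::field, 'h, 'a::ab_group_add, 'z) yd_hopf_scheme \<Rightarrow> bool" where
  "coradically_graded R \<longleftrightarrow>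
     (\<forall>n. coradical_filtration R n = module.span (scl R) (\<Union>i\<le>n. deg R i))"

definition degree_one_iso :: "('k::field, 'h::ab_group_add, 'x) hopf_scheme \<Rightarrow>
    ('k, 'h, 'v::ab_group_add, 'y) yd_scheme \<Rightarrow> ('k, 'h, 'a::ab_group_add, 'z) yd_hopf_scheme \<Rightarrow>
    ('v \<Rightarrow> 'a) \<Rightarrow> bool" where
  "degree_one_iso K V R \<iota> \<longleftrightarrow>
     lin V R \<iota> \<and> bij_betw \<iota> (carr V) (deg R 1) \<and>
     (\<forall>h\<in>carr K. \<forall>v\<in>carr V. \<iota> (act V h v) = hact R h (\<iota> v)) \<and>
     (\<forall>v\<in>carr V. teq K R (hcoact R (\<iota> v)) [(h, \<iota> w). (h, w) \<leftarrow> coact V v])"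

definition graded_hopf_hom :: "('k::field, 'h::ab_group_add, 'x) hopf_scheme \<Rightarrow>
    ('k, 'h, 'a::ab_group_add, 'y) yd_hopf_scheme \<Rightarrow> ('k, 'h, 'b::ab_group_add, 'z) yd_hopf_scheme \<Rightarrow>
    ('a \<Rightarrow> 'b) \<Rightarrow> bool" where
  "graded_hopf_hom K R R' \<pi> \<longleftrightarrow>
     lin R R' \<pi> \<and>
     (\<forall>x\<in>carr R. \<forall>y\<in>carr R. \<pi> (mul R x y) = mul R' (\<pi> x) (\<pi> y)) \<and>
     \<pi> (unit R) = unit R' \<and>
     (\<forall>x\<in>carr R. teq R' R' (cop R' (\<pi> x)) [(\<pi> a, \<pi> b). (a, b) \<leftarrow> cop R x]) \<and>
     (\<forall>x\<in>carr R. eps R' (\<pi> x) = eps R x) \<and>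
     (\<forall>x\<in>carr R. antip R' (\<pi> x) = \<pi> (antip R x)) \<and>
     (\<forall>h\<in>carr K. \<forall>x\<in>carr R. hact R' h (\<pi> x) = \<pi> (hact R h x)) \<and>
     (\<forall>x\<in>carr R. teq K R' (hcoact R' (\<pi> x)) [(h, \<pi> w). (h, w) \<leftarrow> hcoact R x]) \<and>
     (\<forall>n. \<pi> ` deg R n \<subseteq> deg R' n)"

section \<open>Nichols, pre-Nichols and post-Nichols algebras\<close>

text \<open>
  All of these come with a fixed identification \<open>\<iota>\<close> of \<open>V\<close> with the component of degree one. For
  pre-Nichols algebras this amounts to a presentation as a quotient of \<open>T(V)\<close>.
\<close>

definition post_nichols :: "('k::field, 'h::ab_group_add, 'x) hopf_scheme \<Rightarrow>
    ('k, 'h, 'v::ab_group_add, 'y) yd_scheme \<Rightarrow> ('k, 'h, 'a::ab_group_add, 'z) yd_hopf_scheme \<Rightarrow>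
    ('v \<Rightarrow> 'a) \<Rightarrow> bool" where
  "post_nichols K V R \<iota> \<longleftrightarrow>
     graded_connected_hopf K R \<and> coradically_graded R \<and> degree_one_iso K V R \<iota>"

definition pre_nichols :: "('k::field, 'h::ab_group_add, 'x) hopf_scheme \<Rightarrow>
    ('k, 'h, 'v::ab_group_add, 'y) yd_scheme \<Rightarrow> ('k, 'h, 'a::ab_group_add, 'z) yd_hopf_scheme \<Rightarrow>
    ('v \<Rightarrow> 'a) \<Rightarrow> bool" where
  "pre_nichols K V R \<iota> \<longleftrightarrow>
     graded_connected_hopf K R \<and> degree_one_iso K V R \<iota> \<and> generated R (deg R 1) = carr R"

text \<open>
  \<open>R\<close> (with \<open>\<iota>\<close>) is the Nichols algebra of \<open>V\<close>, which is unique up to unique isomorphism.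
\<close>

definition nichols :: "('k::field, 'h::ab_group_add, 'x) hopf_scheme \<Rightarrow>
    ('k, 'h, 'v::ab_group_add, 'y) yd_scheme \<Rightarrow> ('k, 'h, 'a::ab_group_add, 'z) yd_hopf_scheme \<Rightarrow>
    ('v \<Rightarrow> 'a) \<Rightarrow> bool" where
  "nichols K V R \<iota> \<longleftrightarrow> pre_nichols K V R \<iota> \<and> primitives R = deg R 1"

text \<open>
  \<open>(R', \<iota>') < (R, \<iota>)\<close> in the poset of pre-Nichols algebras: the canonical map \<open>R' \<rightarrow> R\<close>, i.e. the
  one that is the identity on \<open>V\<close>, exists and \<open>R\<close> is a proper quotient of \<open>R'\<close> by it.
\<close>

definition pre_nichols_less :: "('k::field, 'h::ab_group_add, 'x) hopf_scheme \<Rightarrow>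
    ('k, 'h, 'v::ab_group_add, 'y) yd_scheme \<Rightarrow>
    ('k, 'h, 'a::ab_group_add, 'z) yd_hopf_scheme \<Rightarrow> ('v \<Rightarrow> 'a) \<Rightarrow>
    ('k, 'h, 'b::ab_group_add, 'w) yd_hopf_scheme \<Rightarrow> ('v \<Rightarrow> 'b) \<Rightarrow> bool" where
  "pre_nichols_less K V R' \<iota>' R \<iota> \<longleftrightarrow>
     (\<exists>\<pi>. graded_hopf_hom K R' R \<pi> \<and> (\<forall>v\<in>carr V. \<pi> (\<iota>' v) = \<iota> v) \<and>
          \<pi> ` carr R' = carr R \<and> \<not> inj_on \<pi> (carr R'))"

text \<open>
  A pre-Nichols algebra of a finite-dimensional \<open>V\<close> is generated by \<open>V\<close>, hence of countable
  dimension, hence isomorphic to one carried by a subspace of the space of finitely supported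
  sequences. So ``all pre-Nichols algebras'' may be taken to range over this type.
\<close>

type_synonym ('k, 'h) countable_yd_hopf = "('k, 'h, nat \<Rightarrow>\<^sub>0 'k) yd_hopf"

definition pre_bounded :: "('k::field, 'h::ab_group_add, 'x) hopf_scheme \<Rightarrow>
    ('k, 'h, 'v::ab_group_add, 'y) yd_scheme \<Rightarrow> bool" where
  "pre_bounded K V \<longleftrightarrow>
     \<not> (\<exists>(B :: nat \<Rightarrow> ('k, 'h) countable_yd_hopf) \<iota>.
          (\<forall>n. pre_nichols K V (B n) (\<iota> n) \<and> GKdim (B n) < \<infinity>) \<and>
          nichols K V (B 0) (\<iota> 0) \<and>
          (\<forall>n. pre_nichols_less K V (B (Suc n)) (\<iota> (Suc n)) (B n) (\<iota> n)))"

definition only_nichols_finite_GKdim :: "('k::field, 'h::ab_group_add, 'x) hopf_scheme \<Rightarrow>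
    ('k, 'h, 'v::ab_group_add, 'y) yd_scheme \<Rightarrow> bool" where
  "only_nichols_finite_GKdim K V \<longleftrightarrow>
     (\<forall>(B :: ('k, 'h) countable_yd_hopf) \<iota>. pre_nichols K V B \<iota> \<longrightarrow>
        (GKdim B < \<infinity> \<longleftrightarrow> nichols K V B \<iota>))"

text \<open>
  The underlying algebra of the graded dual \<open>\<Oplus>\<^sub>n (R\<^sup>n)\<^sup>*\<close>, whose elements are the functionals
  vanishing on almost all \<open>R\<^sup>n\<close>. The product is the one dual to the coproduct under the categorical
  pairing \<open>\<langle>f \<otimes> g, x \<otimes> y\<rangle> = f(y) g(x)\<close>, which is the one compatible with \<^const>\<open>yd_dual\<close>; the
  other pairing would give the opposite algebra, which has the same GK-dimension.
\<close>

definition graded_dual :: "('k::field, 'h, 'a::ab_group_add, 'z) yd_hopf_scheme \<Rightarrow>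
    ('k, 'a \<Rightarrow> 'k) alg" where
  "graded_dual R =
     \<lparr>carr = {f \<in> carr (dual_vspace R). finite {n. \<exists>x\<in>deg R n. f x \<noteq> 0}},
      scl = scl (dual_vspace R),
      mul = (\<lambda>f g x. if x \<in> carr R then \<Sum>(a, b)\<leftarrow>cop R x. f b * g a else 0),
      unit = (\<lambda>x. if x \<in> carr R then eps R x else 0)\<rparr>"

end

theory Submission
  imports Defs "HOL-Library.Countable_Set"
begin

text \<open>
  Let \<open>E[m]\<close> be the subalgebra of \<open>E\<close> generated by the components of degree at most \<open>m\<close>. It is a
  locally finite graded Hopf subalgebra in the Yetter-Drinfeld category whose primitive elements have
  degree one, so its graded dual is generated in degree one and is a pre-Nichols algebra of the dual
  of \<open>V\<close>. For a locally finite graded algebra generated in bounded degree the Gelfand-Kirillov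
  dimension is read off the Hilbert series; hence \<open>E[m]\<close> and its graded dual have the same dimension,
  which is at most that of \<open>E\<close>. Proper inclusions among the \<open>E[m]\<close> dualize to proper surjections, so
  pre-boundedness forces \<open>E = E[m]\<close> for some \<open>m\<close>. Moreover \<open>E\<close> is generated in degree one as soon as
  the primitive elements of these duals have degree one.
\<close>

section \<open>Linear maps and tensors\<close>

text \<open>Why a chain is needed: the Gelfand-Kirillov dimension only sees finitely generated
  subalgebras, so as long as \<open>E\<close> is not known to be finitely generated, its Hilbert
  series, and with it the growth of its graded dual, is not controlled by \<open>GKdim E\<close>. On
  each \<open>E[m]\<close> the comparison is possible. The chain of duals starts at the right place
  because \<open>E[1]\<close> has both its generators and its primitive elements in degree one, so
  its dual is the Nichols algebra of the dual of \<open>V\<close>. Pre-boundedness speaks of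
  algebras carried by finitely supported sequences, while the graded dual in the statement consists
  of functionals. Duality is therefore developed once, for an abstract space \<open>D\<close> with a
  pairing \<open>p\<close> against \<open>R\<close>, and instantiated with both. The pairing
  separates the points of \<open>D\<close> and of its tensor powers, so every axiom of the dual
  becomes an identity of scalars, namely the transpose of an axiom of \<open>R\<close>.
  Transposition reverses the two legs of a tensor, and so do the antipode of \<open>K\<close> and
  its inverse; the conventions of \<open>yd_dual\<close> are such that these reversals
  cancel.\<close>

definition kk :: "('k::field, 'k) vspace" where
  "kk = \<lparr>carr = UNIV, scl = (*)\<rparr>"

lemma kk_simps [simp]: "carr kk = UNIV" "scl kk = (*)"
  by (simp_all add: kk_def)

lemma vs_kk: "vs (kk :: ('k::field, 'k) vspace)"
proof -
  have m: "vector_space ((*) :: 'k \<Rightarrow> 'k \<Rightarrow> 'k)"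
    by unfold_locales (auto simp: algebra_simps)
  interpret vector_space "(*) :: 'k \<Rightarrow> 'k \<Rightarrow> 'k" by (rule m)
  show ?thesis
    unfolding vs_def kk_simps using m by (simp add: subspace_UNIV)
qed

text \<open>Linear forms are linear maps into the one-dimensional space \<open>kk\<close>, so one
  set of rules serves both.\<close>

lemma lform_lin: "lform X f \<longleftrightarrow> lin X kk f"
  by (auto simp: lform_def lin_def)

text \<open>\<open>lins\<close> collects linearity rules for all operations and \<open>mems\<close>
  the matching closure rules. Together they show that a Sweedler expression is linear in one of its
  variables by recursion over its syntax.\<close>

named_theorems lins
named_theorems mems

context vs
begin

sublocale VS: vector_space "scl X" by (rule ambient)

lemma zero_mem [mems]: "0 \<in> carr X"
  using subspace_carr by (rule VS.subspace_0)

lemma add_mem [mems]: "x \<in> carr X \<Longrightarrow> y \<in> carr X \<Longrightarrow> x + y \<in> carr X"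
  using subspace_carr by (rule VS.subspace_add)

lemma scl_mem [mems]: "x \<in> carr X \<Longrightarrow> scl X c x \<in> carr X"
  using subspace_carr by (rule VS.subspace_scale)

lemma diff_mem: "x \<in> carr X \<Longrightarrow> y \<in> carr X \<Longrightarrow> x - y \<in> carr X"
  using subspace_carr by (rule VS.subspace_diff)

lemma neg_mem: "x \<in> carr X \<Longrightarrow> - x \<in> carr X"
  using subspace_carr by (rule VS.subspace_neg)

lemma sum_mem: "(\<And>i. i \<in> I \<Longrightarrow> f i \<in> carr X) \<Longrightarrow> sum f I \<in> carr X"
  using subspace_carr by (rule VS.subspace_sum)

lemma sum_list_mem: "(\<And>i. i \<in> set xs \<Longrightarrow> f i \<in> carr X) \<Longrightarrow> sum_list (map f xs) \<in> carr X"
  by (induction xs) (auto simp: zero_mem add_mem)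

lemma span_carr: "F \<subseteq> carr X \<Longrightarrow> VS.span F \<subseteq> carr X"
  using subspace_carr by (rule VS.span_minimal[rotated])

end

lemma scl_sum_list:
  assumes "vs X" shows "scl X c (sum_list (map f xs)) = sum_list (map (\<lambda>i. scl X c (f i)) xs)"
proof -
  interpret vs X by fact
  show ?thesis by (induction xs) (auto simp: VS.scale_right_distrib)
qed

text \<open>For bilinear \<open>f\<close> this is the linear map induced by \<open>f\<close>,
  evaluated at the tensor that \<open>t\<close> represents. A Sweedler calculation is a calculation
  with nested \<open>tsum\<close>.\<close>

definition tsum :: "('a \<times> 'b) list \<Rightarrow> ('a \<Rightarrow> 'b \<Rightarrow> 'c::comm_monoid_add) \<Rightarrow> 'c" where
  "tsum t f = (\<Sum>(x, y)\<leftarrow>t. f x y)"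

definition tsum3 :: "('a \<times> 'b \<times> 'd) list \<Rightarrow> ('a \<Rightarrow> 'b \<Rightarrow> 'd \<Rightarrow> 'c::comm_monoid_add) \<Rightarrow> 'c" where
  "tsum3 t f = (\<Sum>(x, y, z)\<leftarrow>t. f x y z)"

lemma tsum_Nil [simp]: "tsum [] f = 0"
  and tsum_Cons [simp]: "tsum ((a, b) # t) f = f a b + tsum t f"
  and tsum_append [simp]: "tsum (s @ t) f = tsum s f + tsum t f"
  by (simp_all add: tsum_def)

lemma tsum_map [simp]: "tsum (map (\<lambda>(a, b). (f a b, g a b)) t) F = tsum t (\<lambda>a b. F (f a b) (g a b))"
  by (induction t) (auto simp: tsum_def)

lemma tsum_concat [simp]: "tsum (concat (map (\<lambda>(a, b). H a b) t)) F = tsum t (\<lambda>a b. tsum (H a b) F)"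
  by (induction t) (auto simp: tsum_def)

lemma tsum3_map [simp]:
  "tsum3 (map (\<lambda>(a, b). (f a b, g a b, h a b)) t) F = tsum t (\<lambda>a b. F (f a b) (g a b) (h a b))"
  by (induction t) (auto simp: tsum_def tsum3_def)

lemma tsum3_concat [simp]:
  "tsum3 (concat (map (\<lambda>(a, b). H a b) t)) F = tsum t (\<lambda>a b. tsum3 (H a b) F)"
  by (induction t) (auto simp: tsum_def tsum3_def)

lemma tsum_cong:
  "s = t \<Longrightarrow> (\<And>a b. (a, b) \<in> set t \<Longrightarrow> f a b = g a b) \<Longrightarrow> tsum s f = tsum t g"
  by (induction t arbitrary: s) (auto simp: tsum_def)

lemma tsum_congC:
  "set t \<subseteq> A \<times> B \<Longrightarrow> (\<And>a b. a \<in> A \<Longrightarrow> b \<in> B \<Longrightarrow> f a b = g a b) \<Longrightarrow> tsum t f = tsum t g"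
  by (rule tsum_cong) auto

lemma tsum_0 [simp]: "tsum t (\<lambda>a b. 0) = 0"
  by (induction t) (auto simp: tsum_def)

lemma tsum_add: "tsum t (\<lambda>a b. f a b + g a b) = tsum t f + tsum t g"
  by (induction t) (auto simp: tsum_def algebra_simps)

lemma tsum_swap: "tsum s (\<lambda>a b. tsum t (\<lambda>c d. F a b c d)) = tsum t (\<lambda>c d. tsum s (\<lambda>a b. F a b c d))"
proof (induction s)
  case (Cons p s)
  then show ?case by (cases p) (simp add: tsum_add)
qed simp

lemma tsum_mult_left: "tsum t (\<lambda>a b. c * f a b) = c * (tsum t f :: 'k::field)"
  by (induction t) (auto simp: algebra_simps)

lemma tsum_mult_right: "tsum t (\<lambda>a b. f a b * c) = (tsum t f :: 'k::field) * c"
  by (induction t) (auto simp: algebra_simps)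

lemma tsum_scl: "vs X \<Longrightarrow> tsum t (\<lambda>a b. scl X c (f a b)) = scl X c (tsum t f)"
  unfolding tsum_def by (subst scl_sum_list) (auto simp: case_prod_unfold)

lemma tsum_sum: "tsum t (\<lambda>a b. sum (f a b) I) = sum (\<lambda>i. tsum t (\<lambda>a b. f a b i)) I"
proof (induction t)
  case (Cons p t)
  then show ?case by (cases p) (simp add: sum.distrib)
qed simp

lemma (in vs) tsum_mem: "(\<And>a b. (a, b) \<in> set t \<Longrightarrow> f a b \<in> carr X) \<Longrightarrow> tsum t f \<in> carr X"
  unfolding tsum_def by (rule sum_list_mem) auto

text \<open>The target is an arbitrary space, so that identities between vectors, and not only
  between scalars, can be read off an equality of tensors.\<close>

definition bilin :: "('k::field, 'a::ab_group_add, 'x) vspace_scheme \<Rightarrow>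
    ('k, 'b::ab_group_add, 'y) vspace_scheme \<Rightarrow> ('k, 'c::ab_group_add, 'z) vspace_scheme \<Rightarrow>
    ('a \<Rightarrow> 'b \<Rightarrow> 'c) \<Rightarrow> bool" where
  "bilin X Y Z \<beta> \<longleftrightarrow>
     (\<forall>y\<in>carr Y. lin X Z (\<lambda>x. \<beta> x y)) \<and> (\<forall>x\<in>carr X. lin Y Z (\<lambda>y. \<beta> x y))"

definition trilin :: "('k::field, 'a::ab_group_add, 'x) vspace_scheme \<Rightarrow>
    ('k, 'b::ab_group_add, 'y) vspace_scheme \<Rightarrow> ('k, 'c::ab_group_add, 'z) vspace_scheme \<Rightarrow>
    ('k, 'd::ab_group_add, 'w) vspace_scheme \<Rightarrow> ('a \<Rightarrow> 'b \<Rightarrow> 'c \<Rightarrow> 'd) \<Rightarrow> bool" where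
  "trilin X Y Z W \<beta> \<longleftrightarrow>
     (\<forall>y\<in>carr Y. \<forall>z\<in>carr Z. lin X W (\<lambda>x. \<beta> x y z)) \<and>
     (\<forall>x\<in>carr X. \<forall>z\<in>carr Z. lin Y W (\<lambda>y. \<beta> x y z)) \<and>
     (\<forall>x\<in>carr X. \<forall>y\<in>carr Y. lin Z W (\<lambda>z. \<beta> x y z))"

section \<open>Rules for linear, bilinear and trilinear maps\<close>

lemma bilinI:
  "(\<And>y. y \<in> carr Y \<Longrightarrow> lin X Z (\<lambda>x. \<beta> x y)) \<Longrightarrow> (\<And>x. x \<in> carr X \<Longrightarrow> lin Y Z (\<lambda>y. \<beta> x y)) \<Longrightarrow>
   bilin X Y Z \<beta>"
  by (simp add: bilin_def)

lemma trilinI: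
  "(\<And>y z. y \<in> carr Y \<Longrightarrow> z \<in> carr Z \<Longrightarrow> lin X W (\<lambda>x. \<beta> x y z)) \<Longrightarrow>
   (\<And>x z. x \<in> carr X \<Longrightarrow> z \<in> carr Z \<Longrightarrow> lin Y W (\<lambda>y. \<beta> x y z)) \<Longrightarrow>
   (\<And>x y. x \<in> carr X \<Longrightarrow> y \<in> carr Y \<Longrightarrow> lin Z W (\<lambda>z. \<beta> x y z)) \<Longrightarrow>
   trilin X Y Z W \<beta>"
  by (simp add: trilin_def)

lemma lin_mem: "lin X Y f \<Longrightarrow> x \<in> carr X \<Longrightarrow> f x \<in> carr Y"
  by (auto simp: lin_def)

lemma lin_id [lins]: "lin X X (\<lambda>x. x)"
  by (auto simp: lin_def)

lemma lin_comp: "lin Y Z g \<Longrightarrow> lin X Y f \<Longrightarrow> lin X Z (\<lambda>x. g (f x))"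
  by (auto simp: lin_def image_subset_iff)

lemma lin_cong: "lin X Y f \<Longrightarrow> (\<And>x. x \<in> carr X \<Longrightarrow> f x = g x) \<Longrightarrow> vs X \<Longrightarrow> lin X Y g"
  unfolding lin_def by (auto simp: image_subset_iff vs.add_mem vs.scl_mem)

lemma lin_add [intro]: "lin X Y f \<Longrightarrow> x \<in> carr X \<Longrightarrow> x' \<in> carr X \<Longrightarrow> f (x + x') = f x + f x'"
  and lin_scl: "lin X Y f \<Longrightarrow> x \<in> carr X \<Longrightarrow> f (scl X c x) = scl Y c (f x)"
  by (auto simp: lin_def)

lemma lin_0: assumes "lin X Y f" "vs X" shows "f 0 = 0"
proof -
  interpret vs X by fact
  have "f (0 + 0) = f 0 + f 0" by (rule lin_add[OF assms(1)]) (auto intro: mems)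
  then show ?thesis by simp
qed

lemma lin_diff: assumes "lin X Y f" "vs X" "x \<in> carr X" "y \<in> carr X" shows "f (x - y) = f x - f y"
proof -
  interpret vs X by fact
  have "f ((x - y) + y) = f (x - y) + f y" by (rule lin_add[OF assms(1)]) (auto intro: diff_mem assms)
  then show ?thesis by simp
qed

lemma lin_sum:
  assumes "lin X Y f" "vs X" "\<And>i. i \<in> I \<Longrightarrow> g i \<in> carr X"
  shows "f (sum g I) = (\<Sum>i\<in>I. f (g i))"
proof -
  interpret vs X by fact
  show ?thesis using assms(3)
    by (induction I rule: infinite_finite_induct)
       (auto simp: lin_0[OF assms(1,2)] lin_add[OF assms(1)] sum_mem)
qed

lemma lin_tsum_out:
  assumes "lin X Y f" "vs X" "\<And>a b. (a, b) \<in> set t \<Longrightarrow> g a b \<in> carr X"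
  shows "f (tsum t g) = tsum t (\<lambda>a b. f (g a b))"
proof -
  interpret vs X by fact
  show ?thesis using assms(3)
  proof (induction t)
    case Nil then show ?case by (simp add: lin_0[OF assms(1,2)])
  next
    case (Cons p t)
    obtain a b where p: "p = (a, b)" by (cases p)
    have "tsum t g \<in> carr X" using Cons.prems by (intro tsum_mem) auto
    then show ?case using Cons p by (simp add: lin_add[OF assms(1)])
  qed
qed

lemma lin_zero [lins]:
  assumes "vs Y" shows "lin X Y (\<lambda>x. 0)"
proof -
  interpret vs Y by fact
  show ?thesis by (auto simp: lin_def zero_mem)
qed

lemma lin_scl_const [lins]:
  assumes "vs Z" "lin X Z f" shows "lin X Z (\<lambda>x. scl Z c (f x))"
proof -
  interpret vs Z by fact
  show ?thesis using assms(2)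
    by (auto simp: lin_def image_subset_iff scl_mem VS.scale_right_distrib VS.scale_scale mult.commute)
qed

lemma lin_scl_left [lins]:
  assumes "vs Z" "lin X kk f" "z \<in> carr Z" shows "lin X Z (\<lambda>x. scl Z (f x) z)"
proof -
  interpret vs Z by fact
  show ?thesis using assms(2,3)
    by (auto simp: lin_def image_subset_iff scl_mem VS.scale_left_distrib)
qed

lemma lin_kk_mult [lins]:
  "lin X kk f \<Longrightarrow> lin X kk (\<lambda>x. f x * c)"
  "lin X kk f \<Longrightarrow> lin X kk (\<lambda>x. c * f x)"
  by (auto simp: lin_def algebra_simps)

lemma lin_plus [lins]:
  assumes "vs Z" "lin X Z f" "lin X Z g" shows "lin X Z (\<lambda>x. f x + g x)"
proof -
  interpret vs Z by fact
  show ?thesis using assms(2,3)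
    by (auto simp: lin_def image_subset_iff add_mem VS.scale_right_distrib algebra_simps)
qed

lemma lin_Sum [lins]:
  assumes "vs Z" "\<And>i. i \<in> I \<Longrightarrow> lin X Z (f i)" shows "lin X Z (\<lambda>x. \<Sum>i\<in>I. f i x)"
  using assms(2)
  by (induction I rule: infinite_finite_induct) (auto intro!: lin_zero lin_plus assms(1))

lemma lin_tsum_const:
  assumes "vs Z" "\<And>a b. (a, b) \<in> set t \<Longrightarrow> lin X Z (\<lambda>x. T x a b)"
  shows "lin X Z (\<lambda>x. tsum t (T x))"
  using assms(2)
proof (induction t)
  case (Cons p t)
  then show ?case by (cases p) (auto intro!: lin_plus assms(1))
qed (simp add: lin_zero assms(1))

lemma bilinD:
  "bilin X Y Z B \<Longrightarrow> lin W X f \<Longrightarrow> y \<in> carr Y \<Longrightarrow> lin W Z (\<lambda>w. B (f w) y)"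
  "bilin X Y Z B \<Longrightarrow> lin W Y g \<Longrightarrow> x \<in> carr X \<Longrightarrow> lin W Z (\<lambda>w. B x (g w))"
  "bilin X Y Z B \<Longrightarrow> x \<in> carr X \<Longrightarrow> y \<in> carr Y \<Longrightarrow> B x y \<in> carr Z"
  using lin_comp[of X Z "\<lambda>x. B x y" W f] lin_comp[of Y Z "\<lambda>y. B x y" W g] lin_mem[of Y Z "\<lambda>y. B x y" y]
  by (simp_all add: bilin_def)

lemma trilinD:
  "trilin X Y V Z B \<Longrightarrow> lin W X f \<Longrightarrow> y \<in> carr Y \<Longrightarrow> v \<in> carr V \<Longrightarrow> lin W Z (\<lambda>w. B (f w) y v)"
  "trilin X Y V Z B \<Longrightarrow> lin W Y g \<Longrightarrow> x \<in> carr X \<Longrightarrow> v \<in> carr V \<Longrightarrow> lin W Z (\<lambda>w. B x (g w) v)"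
  "trilin X Y V Z B \<Longrightarrow> lin W V h \<Longrightarrow> x \<in> carr X \<Longrightarrow> y \<in> carr Y \<Longrightarrow> lin W Z (\<lambda>w. B x y (h w))"
  using lin_comp[of X Z "\<lambda>x. B x y v" W f] lin_comp[of Y Z "\<lambda>y. B x y v" W g]
    lin_comp[of V Z "\<lambda>v. B x y v" W h]
  by (simp_all add: trilin_def)

section \<open>Equality of tensors and maps into arbitrary spaces\<close>

lemma teq_iff: "teq X Y s t \<longleftrightarrow> (\<forall>\<beta>. bilin X Y kk \<beta> \<longrightarrow> tsum s \<beta> = tsum t \<beta>)"
  by (simp add: teq_def bilinear_form_def lform_lin bilin_def tsum_def)

lemma teq3_iff: "teq3 X Y Z s t \<longleftrightarrow> (\<forall>\<beta>. trilin X Y Z kk \<beta> \<longrightarrow> tsum3 s \<beta> = tsum3 t \<beta>)"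
  by (simp add: teq3_def trilinear_form_def lform_lin trilin_def tsum3_def)

text \<open>If \<open>x\<close> and \<open>y\<close> differ, their difference is an independent set,
  so some functional on the ambient space takes the value 1 on it.\<close>

lemma vs_separate:
  assumes "vs X" and eq: "\<And>f. Vector_Spaces.linear (scl X) (*) f \<Longrightarrow> f x = (f y :: 'k::field)"
  shows "x = y"
proof (rule ccontr)
  assume "x \<noteq> y"
  interpret vs X by fact
  interpret K: vs "kk :: ('k, 'k) vspace" by (rule vs_kk)
  interpret vector_space_pair "scl X" "(*) :: 'k \<Rightarrow> 'k \<Rightarrow> 'k"
    using VS.vector_space_axioms K.ambient by (simp add: vector_space_pair_def)
  have "VS.independent {x - y}" using \<open>x \<noteq> y\<close> by simp
  from linear_independent_extend[OF this, of "\<lambda>_. 1"]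
  obtain g where g: "Vector_Spaces.linear (scl X) (*) g" "g (x - y) = 1" by auto
  then interpret g: Vector_Spaces.linear "scl X" "(*)" g by simp
  have "g (x - y) = g x - g y" by (rule g.diff)
  then show False using eq[OF g(1)] g(2) by simp
qed

lemma linear_tsum:
  assumes "Vector_Spaces.linear a b g" shows "g (tsum t B) = tsum t (\<lambda>x y. g (B x y))"
proof -
  interpret Vector_Spaces.linear a b g by fact
  show ?thesis by (induction t) (auto simp: add zero)
qed

lemma linear_tsum3:
  assumes "Vector_Spaces.linear a b g" shows "g (tsum3 t B) = tsum3 t (\<lambda>x y z. g (B x y z))"
proof -
  interpret Vector_Spaces.linear a b g by fact
  show ?thesis by (induction t) (auto simp: add zero tsum3_def)
qed

lemma linear_lin:
  assumes "Vector_Spaces.linear (scl X) (*) g" shows "lin X kk g"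
proof -
  interpret Vector_Spaces.linear "scl X" "(*)" g by fact
  show ?thesis by (auto simp: lin_def add scale)
qed

text \<open>Equality of tensors is defined by bilinear forms only. Composing a bilinear map with the
  functionals on its target, which separate points, extends the test to all bilinear maps.\<close>

lemma teq_tsum:
  assumes t: "teq X Y s t" and B: "bilin X Y Z B" and "vs Z"
  shows "tsum s B = tsum t B"
proof (rule vs_separate[OF \<open>vs Z\<close>])
  fix f assume f: "Vector_Spaces.linear (scl Z) (*) f"
  have "bilin X Y kk (\<lambda>x y. f (B x y))"
    by (intro bilinI lin_comp[OF linear_lin[OF f]] bilinD[OF B] lins)
  then show "f (tsum s B) = f (tsum t B)"
    using t by (simp add: linear_tsum[OF f] teq_iff)
qed

lemma teq3_tsum:
  assumes t: "teq3 X Y W s t" and B: "trilin X Y W Z B" and "vs Z"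
  shows "tsum3 s B = tsum3 t B"
proof (rule vs_separate[OF \<open>vs Z\<close>])
  fix f assume f: "Vector_Spaces.linear (scl Z) (*) f"
  have "trilin X Y W kk (\<lambda>x y w. f (B x y w))"
    by (intro trilinI lin_comp[OF linear_lin[OF f]] trilinD[OF B] lins)
  then show "f (tsum3 s B) = f (tsum3 t B)"
    using t by (simp add: linear_tsum3[OF f] teq3_iff)
qed

lemma lin_tensor_mem: "lin_tensor X Y Z \<delta> \<Longrightarrow> x \<in> carr X \<Longrightarrow> set (\<delta> x) \<subseteq> carr Y \<times> carr Z"
  by (auto simp: lin_tensor_def)

text \<open>\<open>lin_tensor\<close> asserts linearity only up to equality of tensors; after
  evaluation by a bilinear map this becomes genuine linearity. \<open>lin_tensorI\<close> is the
  converse and tests with forms only.\<close>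

lemma lin_tensor_lin:
  assumes d: "lin_tensor X Y Z \<delta>" and "vs W" and B: "bilin Y Z W B" and f: "lin U X f"
  shows "lin U W (\<lambda>x. tsum (\<delta> (f x)) B)"
proof -
  interpret W: vs W by fact
  have "lin X W (\<lambda>x. tsum (\<delta> x) B)"
    unfolding lin_def
  proof (intro conjI ballI allI)
    show "(\<lambda>x. tsum (\<delta> x) B) ` carr X \<subseteq> carr W"
      using lin_tensor_mem[OF d] by (auto intro!: W.tsum_mem bilinD(3)[OF B])
  next
    fix x x' assume "x \<in> carr X" "x' \<in> carr X"
    then have "teq Y Z (\<delta> (x + x')) (\<delta> x @ \<delta> x')" using d by (auto simp: lin_tensor_def)
    from teq_tsum[OF this B \<open>vs W\<close>] show "tsum (\<delta> (x + x')) B = tsum (\<delta> x) B + tsum (\<delta> x') B" by simp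
  next
    fix c x assume x: "x \<in> carr X"
    then have "teq Y Z (\<delta> (scl X c x)) [(scl Y c y, z). (y, z) \<leftarrow> \<delta> x]" using d by (auto simp: lin_tensor_def)
    from teq_tsum[OF this B \<open>vs W\<close>] have "tsum (\<delta> (scl X c x)) B = tsum (\<delta> x) (\<lambda>y z. B (scl Y c y) z)" by simp
    also have "\<dots> = tsum (\<delta> x) (\<lambda>y z. scl W c (B y z))"
      using B by (intro tsum_congC[OF lin_tensor_mem[OF d x]]) (auto simp: bilin_def lin_def)
    finally show "tsum (\<delta> (scl X c x)) B = scl W c (tsum (\<delta> x) B)" by (simp add: tsum_scl[OF \<open>vs W\<close>])
  qed
  from lin_comp[OF this f] show ?thesis .
qed

lemma lin_tensorI:
  assumes m: "\<And>x. x \<in> carr X \<Longrightarrow> set (\<delta> x) \<subseteq> carr Y \<times> carr Z"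
    and l: "\<And>\<beta>. bilin Y Z kk \<beta> \<Longrightarrow> lin X kk (\<lambda>x. tsum (\<delta> x) \<beta>)"
  shows "lin_tensor X Y Z \<delta>"
proof -
  { fix c x \<beta> assume x: "x \<in> carr X" and b: "bilin Y Z kk \<beta>"
    have "tsum (\<delta> (scl X c x)) \<beta> = c * tsum (\<delta> x) \<beta>"
      using l[OF b] x by (simp add: lin_def)
    also have "\<dots> = tsum (\<delta> x) (\<lambda>y z. \<beta> (scl Y c y) z)"
      unfolding tsum_mult_left[symmetric] using b
      by (intro tsum_congC[OF m[OF x]]) (auto simp: bilin_def lin_def)
    finally have "tsum (\<delta> (scl X c x)) \<beta> = tsum (\<delta> x) (\<lambda>y z. \<beta> (scl Y c y) z)" . }
  moreover have "tsum (\<delta> (x + x')) \<beta> = tsum (\<delta> x) \<beta> + tsum (\<delta> x') \<beta>"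
    if "x \<in> carr X" "x' \<in> carr X" "bilin Y Z kk \<beta>" for x x' \<beta>
    using l[OF that(3)] that by (simp add: lin_def)
  ultimately show ?thesis using m by (auto simp: lin_tensor_def teq_iff)
qed

text \<open>
  A tensor is determined by contracting its last factor with a family \<open>Q\<close> of functionals that
  separates points: expand the last factor in a basis of the span of the vectors that occur.
\<close>

lemma separation:
  fixes \<tau> :: "'i \<Rightarrow> 'd::ab_group_add \<Rightarrow> 'k::field"
  assumes "vs D" and Q0: "\<And>d. d \<in> carr D \<Longrightarrow> (\<And>q. q \<in> Q \<Longrightarrow> q d = 0) \<Longrightarrow> d = 0"
    and Q: "\<And>q. q \<in> Q \<Longrightarrow> lin D kk q"
    and mem: "\<And>i. i \<in> set s \<union> set t \<Longrightarrow> \<delta> i \<in> carr D"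
    and \<tau>: "\<And>i. i \<in> set s \<union> set t \<Longrightarrow> lin D kk (\<tau> i)"
    and hyp: "\<And>q b. q \<in> Q \<Longrightarrow> b \<in> carr D \<Longrightarrow>
      (\<Sum>i\<leftarrow>s. \<tau> i b * q (\<delta> i)) = (\<Sum>i\<leftarrow>t. \<tau> i b * q (\<delta> i))"
  shows "(\<Sum>i\<leftarrow>s. \<tau> i (\<delta> i)) = (\<Sum>i\<leftarrow>t. \<tau> i (\<delta> i))"
proof -
  interpret vs D by fact
  obtain B where B: "B \<subseteq> \<delta> ` (set s \<union> set t)" "VS.independent B" "\<delta> ` (set s \<union> set t) \<subseteq> VS.span B"
    by (rule VS.maximal_independent_subset)
  have finB: "finite B" using B(1) by (rule finite_subset) simp
  have Bc: "b \<in> carr D" if "b \<in> B" for b using B(1) mem that by auto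
  define r where "r i b = VS.representation B (\<delta> i) b" for i b
  have rep: "\<delta> i = (\<Sum>b\<in>B. scl D (r i b) b)" if "i \<in> set s \<union> set t" for i
    unfolding r_def using B(3) that by (intro VS.sum_representation_eq[symmetric] B(2) finB) auto
  have expand: "f (\<delta> i) = (\<Sum>b\<in>B. r i b * f b)" if "i \<in> set s \<union> set t" "lin D kk f" for f i
    by (subst rep[OF that(1)], subst lin_sum[OF that(2) \<open>vs D\<close>])
       (simp_all add: scl_mem Bc lin_scl[OF that(2) Bc])
  have key: "(\<Sum>i\<leftarrow>s. \<tau> i b * r i b') = (\<Sum>i\<leftarrow>t. \<tau> i b * r i b')" if b: "b \<in> B" "b' \<in> B" for b b'
  proof -
    define A where "A c = (\<Sum>i\<leftarrow>s. \<tau> i b * r i c) - (\<Sum>i\<leftarrow>t. \<tau> i b * r i c)" for c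
    have eq: "(\<Sum>i\<leftarrow>u. \<tau> i b * q (\<delta> i)) = (\<Sum>c\<in>B. (\<Sum>i\<leftarrow>u. \<tau> i b * r i c) * q c)"
      if "set u \<subseteq> set s \<union> set t" "q \<in> Q" for u q
      using that(1)
    proof (induction u)
      case (Cons i u)
      have "q (\<delta> i) = (\<Sum>b\<in>B. r i b * q b)" using Cons.prems Q[OF that(2)] by (intro expand) auto
      then show ?case using Cons by (simp add: algebra_simps sum.distrib sum_distrib_left)
    qed simp
    \<comment> \<open>The difference of the two contractions of the first factor by
      \<open>\<tau> _ b\<close> is a vector of \<open>D\<close> that all of \<open>Q\<close> kills.
      It vanishes, and independence of \<open>B\<close> makes each of its coordinates
      vanish.\<close>
    have "(\<Sum>c\<in>B. scl D (A c) c) = 0"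
    proof (rule Q0)
      show "(\<Sum>c\<in>B. scl D (A c) c) \<in> carr D" by (intro sum_mem scl_mem Bc)
    next
      fix q assume q: "q \<in> Q"
      have "q (\<Sum>c\<in>B. scl D (A c) c) = (\<Sum>c\<in>B. A c * q c)"
        by (subst lin_sum[OF Q[OF q] \<open>vs D\<close>]) (simp_all add: scl_mem Bc lin_scl[OF Q[OF q] Bc])
      also have "\<dots> = (\<Sum>i\<leftarrow>s. \<tau> i b * q (\<delta> i)) - (\<Sum>i\<leftarrow>t. \<tau> i b * q (\<delta> i))"
        by (simp add: eq[OF _ q] A_def algebra_simps sum_subtractf)
      also have "\<dots> = 0" using hyp[OF q Bc[OF b(1)]] by simp
      finally show "q (\<Sum>c\<in>B. scl D (A c) c) = 0" .
    qed
    then have "A b' = 0" using VS.independentD[OF B(2) finB subset_refl] b(2) by blast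
    then show ?thesis by (simp add: A_def)
  qed
  have "(\<Sum>i\<leftarrow>u. \<tau> i (\<delta> i)) = (\<Sum>b\<in>B. \<Sum>i\<leftarrow>u. \<tau> i b * r i b)" if "set u \<subseteq> set s \<union> set t" for u
    using that
  proof (induction u)
    case (Cons i u)
    have "\<tau> i (\<delta> i) = (\<Sum>b\<in>B. r i b * \<tau> i b)" using Cons.prems \<tau> by (intro expand) auto
    then show ?case using Cons by (simp add: algebra_simps sum.distrib)
  qed simp
  then show ?thesis using key by simp
qed

text \<open>Used twice: with \<open>D\<close> the dual and \<open>Q\<close> the evaluations at
  elements of \<open>R\<close>, and with \<open>D\<close> the algebra itself and \<open>Q\<close>
  functionals of single homogeneous components.\<close>

locale separated = vs D for D :: "('k::field, 'd::ab_group_add, 'z) vspace_scheme" +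
  fixes Q :: "('d \<Rightarrow> 'k) set"
  assumes sep0: "\<And>d. d \<in> carr D \<Longrightarrow> (\<And>q. q \<in> Q \<Longrightarrow> q d = 0) \<Longrightarrow> d = 0"
    and sep_lin: "\<And>q. q \<in> Q \<Longrightarrow> lin D kk q"
begin

lemma teq_sepR:
  assumes "set s \<subseteq> UNIV \<times> carr D" "set t \<subseteq> UNIV \<times> carr D"
    and h: "\<And>\<phi> q. lin X kk \<phi> \<Longrightarrow> q \<in> Q \<Longrightarrow> tsum s (\<lambda>x d. \<phi> x * q d) = tsum t (\<lambda>x d. \<phi> x * q d)"
    and X: "set s \<subseteq> carr X \<times> UNIV" "set t \<subseteq> carr X \<times> UNIV"
  shows "teq X D s t"
  unfolding teq_iff
proof (intro allI impI)
  fix \<beta> assume b: "bilin X D kk \<beta>"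
  \<comment> \<open>The list entries serve as their own indices: the first factor is absorbed into
    the coefficient functional, the second is the vector to be expanded.\<close>
  have "(\<Sum>i\<leftarrow>s. (\<lambda>(x, d). \<beta> x) i (snd i)) = (\<Sum>i\<leftarrow>t. (\<lambda>(x, d). \<beta> x) i (snd i))"
  proof (rule separation[OF vs_axioms sep0 sep_lin])
    fix q d assume q: "q \<in> Q" and "d \<in> carr D"
    then have "lin X kk (\<lambda>x. \<beta> x d)" using b by (auto simp: bilin_def)
    from h[OF this q]
    show "(\<Sum>i\<leftarrow>s. (case i of (x, d) \<Rightarrow> \<beta> x) d * q (snd i)) = (\<Sum>i\<leftarrow>t. (case i of (x, d) \<Rightarrow> \<beta> x) d * q (snd i))"
      by (simp add: tsum_def case_prod_unfold)
  qed (use assms b in \<open>auto simp: bilin_def\<close>)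
  then show "tsum s \<beta> = tsum t \<beta>" by (simp add: tsum_def case_prod_unfold)
qed

lemma teq_sepL:
  assumes "set s \<subseteq> carr D \<times> carr X" "set t \<subseteq> carr D \<times> carr X"
    and h: "\<And>\<phi> q. lin X kk \<phi> \<Longrightarrow> q \<in> Q \<Longrightarrow> tsum s (\<lambda>d x. q d * \<phi> x) = tsum t (\<lambda>d x. q d * \<phi> x)"
  shows "teq D X s t"
proof -
  have sw: "tsum (map (\<lambda>(a, b). (b, a)) u) f = tsum u (\<lambda>a b. f b a)" for u and f :: "_ \<Rightarrow> _ \<Rightarrow> 'k"
    by (induction u) auto
  have "teq X D (map (\<lambda>(a, b). (b, a)) s) (map (\<lambda>(a, b). (b, a)) t)"
    using assms by (intro teq_sepR) (auto simp: sw mult.commute)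
  then have e: "tsum s (\<lambda>a b. \<beta> b a) = tsum t (\<lambda>a b. \<beta> b a)" if "bilin X D kk \<beta>" for \<beta>
    using that unfolding teq_iff sw by blast
  show ?thesis unfolding teq_iff
  proof (intro allI impI)
    fix \<beta> assume "bilin D X kk \<beta>"
    then have "bilin X D kk (\<lambda>x d. \<beta> d x)" by (auto simp: bilin_def)
    from e[OF this] show "tsum s \<beta> = tsum t \<beta>" .
  qed
qed

lemma teq3_sep:
  assumes s: "set s \<subseteq> carr X \<times> carr Y \<times> carr D" and t: "set t \<subseteq> carr X \<times> carr Y \<times> carr D"
    and h: "\<And>\<beta> q. bilin X Y kk \<beta> \<Longrightarrow> q \<in> Q \<Longrightarrow>
      tsum3 s (\<lambda>x y d. \<beta> x y * q d) = tsum3 t (\<lambda>x y d. \<beta> x y * q d)"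
  shows "teq3 X Y D s t"
  unfolding teq3_iff
proof (intro allI impI)
  fix \<beta> assume b: "trilin X Y D kk \<beta>"
  have "(\<Sum>i\<leftarrow>s. (\<lambda>(x, y, d). \<beta> x y) i (snd (snd i))) = (\<Sum>i\<leftarrow>t. (\<lambda>(x, y, d). \<beta> x y) i (snd (snd i)))"
  proof (rule separation[OF vs_axioms sep0 sep_lin])
    fix q d assume q: "q \<in> Q" and "d \<in> carr D"
    then have "bilin X Y kk (\<lambda>x y. \<beta> x y d)" using b by (auto simp: bilin_def trilin_def)
    from h[OF this q]
    show "(\<Sum>i\<leftarrow>s. (case i of (x, y, d) \<Rightarrow> \<beta> x y) d * q (snd (snd i))) = (\<Sum>i\<leftarrow>t. (case i of (x, y, d) \<Rightarrow> \<beta> x y) d * q (snd (snd i)))"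
      by (simp add: tsum3_def case_prod_unfold)
  qed (use s t b in \<open>auto simp: trilin_def\<close>)
  then show "tsum3 s \<beta> = tsum3 t \<beta>" by (simp add: tsum3_def case_prod_unfold)
qed

lemma teq_sep2:
  assumes s: "set s \<subseteq> carr D \<times> carr D" and t: "set t \<subseteq> carr D \<times> carr D"
    and h: "\<And>q q'. q \<in> Q \<Longrightarrow> q' \<in> Q \<Longrightarrow>
      tsum s (\<lambda>d e. q d * q' e) = tsum t (\<lambda>d e. q d * q' e)"
  shows "teq D D s t"
proof (rule teq_sepR)
  fix \<phi> q assume ph: "lin D kk \<phi>" and q: "q \<in> Q"
  \<comment> \<open>Contracting the second slot with \<open>q\<close> leaves a tensor in D \<otimes>
    \<open>kk\<close>, to which separation in the first slot applies. Afterwards \<open>q'\<close>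
    may be replaced by the arbitrary form \<open>\<phi>\<close>.\<close>
  have "teq D kk (map (\<lambda>(a, b). (a, q b)) s) (map (\<lambda>(a, b). (a, q b)) t)"
  proof (rule teq_sepL)
    fix \<phi> :: "'k \<Rightarrow> 'k" and q'
    assume "lin kk kk \<phi>" and q': "q' \<in> Q"
    then have ph: "\<phi> x = x * \<phi> 1" for x using lin_scl[of kk kk \<phi> 1 x] by simp
    have "tsum u (\<lambda>a b. q' a * \<phi> (q b)) = tsum u (\<lambda>a b. q' a * q b) * \<phi> 1" for u
      unfolding tsum_mult_right[symmetric] by (simp add: ph[of "q _"] mult.assoc)
    then show "tsum (map (\<lambda>(a, b). (a, q b)) s) (\<lambda>d x. q' d * \<phi> x) =
        tsum (map (\<lambda>(a, b). (a, q b)) t) (\<lambda>d x. q' d * \<phi> x)"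
      using h[OF q' q] by simp
  qed (use s t in auto)
  moreover have "bilin D kk kk (\<lambda>x y. \<phi> x * y)"
    by (intro bilinI lins lin_comp[OF ph])
  ultimately show "tsum s (\<lambda>x d. \<phi> x * q d) = tsum t (\<lambda>x d. \<phi> x * q d)"
    by (auto simp: teq_iff)
qed (use s t in auto)

text \<open>The slots are treated one at a time: the last by \<open>teq3_sep\<close>, then the
  middle one by \<open>separation\<close>, with the factor \<open>q' e\<close> carried along in the
  coefficient.\<close>

lemma teq3_sep2:
  assumes s: "set s \<subseteq> carr X \<times> carr D \<times> carr D" and t: "set t \<subseteq> carr X \<times> carr D \<times> carr D"
    and h: "\<And>\<phi> q q'. lin X kk \<phi> \<Longrightarrow> q \<in> Q \<Longrightarrow> q' \<in> Q \<Longrightarrow>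
      tsum3 s (\<lambda>x d e. \<phi> x * q d * q' e) = tsum3 t (\<lambda>x d e. \<phi> x * q d * q' e)"
  shows "teq3 X D D s t"
proof (rule teq3_sep[OF s t])
  fix \<beta> q' assume b: "bilin X D kk \<beta>" and q': "q' \<in> Q"
  have "(\<Sum>i\<leftarrow>s. (\<lambda>(x, d, e) d. \<beta> x d * q' e) i (fst (snd i))) = (\<Sum>i\<leftarrow>t. (\<lambda>(x, d, e) d. \<beta> x d * q' e) i (fst (snd i)))"
  proof (rule separation[OF vs_axioms sep0 sep_lin])
    fix q d assume q: "q \<in> Q" and "d \<in> carr D"
    then have "lin X kk (\<lambda>x. \<beta> x d)" using b by (auto simp: bilin_def)
    from h[OF this q q']
    show "(\<Sum>i\<leftarrow>s. (case i of (x, d, e) \<Rightarrow> \<lambda>d. \<beta> x d * q' e) d * q (fst (snd i))) =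
      (\<Sum>i\<leftarrow>t. (case i of (x, d, e) \<Rightarrow> \<lambda>d. \<beta> x d * q' e) d * q (fst (snd i)))"
      by (simp add: tsum3_def case_prod_unfold mult.commute mult.left_commute)
  qed (use s t b in \<open>auto simp: bilin_def intro!: lins\<close>)
  then show "tsum3 s (\<lambda>x d e. \<beta> x d * q' e) = tsum3 t (\<lambda>x d e. \<beta> x d * q' e)"
    by (simp add: tsum3_def case_prod_unfold)
qed

lemma teq3_sep3:
  assumes s: "set s \<subseteq> carr D \<times> carr D \<times> carr D" and t: "set t \<subseteq> carr D \<times> carr D \<times> carr D"
    and h: "\<And>q q' q''. q \<in> Q \<Longrightarrow> q' \<in> Q \<Longrightarrow> q'' \<in> Q \<Longrightarrow>
      tsum3 s (\<lambda>x d e. q x * q' d * q'' e) = tsum3 t (\<lambda>x d e. q x * q' d * q'' e)"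
  shows "teq3 D D D s t"
proof (rule teq3_sep2[OF s t])
  fix \<phi> q' q'' assume b: "lin D kk \<phi>" and q': "q' \<in> Q" and q'': "q'' \<in> Q"
  have "(\<Sum>i\<leftarrow>s. (\<lambda>(x, d, e) x. \<phi> x * q' d * q'' e) i (fst i)) = (\<Sum>i\<leftarrow>t. (\<lambda>(x, d, e) x. \<phi> x * q' d * q'' e) i (fst i))"
  proof (rule separation[OF vs_axioms sep0 sep_lin])
    fix q d assume q: "q \<in> Q" and "d \<in> carr D"
    have *: "(\<Sum>i\<leftarrow>u. (case i of (x, d, e) \<Rightarrow> \<lambda>x. \<phi> x * q' d * q'' e) d * q (fst i)) =
       \<phi> d * tsum3 u (\<lambda>x d e. q x * q' d * q'' e)" for u
      by (induction u) (auto simp: tsum3_def algebra_simps)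
    show "(\<Sum>i\<leftarrow>s. (case i of (x, d, e) \<Rightarrow> \<lambda>x. \<phi> x * q' d * q'' e) d * q (fst i)) =
      (\<Sum>i\<leftarrow>t. (case i of (x, d, e) \<Rightarrow> \<lambda>x. \<phi> x * q' d * q'' e) d * q (fst i))"
      unfolding * h[OF q q' q''] ..
  qed (use s t in \<open>auto intro!: lins b\<close>)
  then show "tsum3 s (\<lambda>x d e. \<phi> x * q' d * q'' e) = tsum3 t (\<lambda>x d e. \<phi> x * q' d * q'' e)"
    by (simp add: tsum3_def case_prod_unfold)
qed

end

section \<open>Sweedler calculus\<close>

declare vs_kk [lins] UNIV_I [mems]

lemma tsum3_map_Pair [simp]: "tsum3 (map (Pair a) t) F = tsum t (F a)"
  by (induction t) (auto simp: tsum_def tsum3_def)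

context vs
begin

lemmas [lins] = vs_axioms

end

context algebra
begin

lemma mul_mem [mems]: "a \<in> carr A \<Longrightarrow> b \<in> carr A \<Longrightarrow> mul A a b \<in> carr A"
  using lin_mem[OF mul_lin_right] .

lemmas unit_mem [mems] = unit_carr

lemma lin_mul [lins]:
  "lin X A f \<Longrightarrow> b \<in> carr A \<Longrightarrow> lin X A (\<lambda>x. mul A (f x) b)"
  "lin X A f \<Longrightarrow> a \<in> carr A \<Longrightarrow> lin X A (\<lambda>x. mul A a (f x))"
  using lin_comp[OF mul_lin_left, of b X f] lin_comp[OF mul_lin_right, of a X f] by simp_all

lemma mul_scl:
  "a \<in> carr A \<Longrightarrow> b \<in> carr A \<Longrightarrow> mul A (scl A c a) b = scl A c (mul A a b)"
  "a \<in> carr A \<Longrightarrow> b \<in> carr A \<Longrightarrow> mul A a (scl A c b) = scl A c (mul A a b)"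
  using lin_scl[OF mul_lin_left] lin_scl[OF mul_lin_right] by auto

end

context coalgebra
begin

lemma cop_mem: "x \<in> carr C \<Longrightarrow> set (cop C x) \<subseteq> carr C \<times> carr C"
  using lin_tensor_mem[OF cop_lin] .

lemma cop_cong:
  "x \<in> carr C \<Longrightarrow> (\<And>a b. a \<in> carr C \<Longrightarrow> b \<in> carr C \<Longrightarrow> f a b = g a b) \<Longrightarrow>
   tsum (cop C x) f = tsum (cop C x) g"
  by (rule tsum_congC[OF cop_mem])

lemma lin_eps [lins]: "lin X C f \<Longrightarrow> lin X kk (\<lambda>x. eps C (f x))"
  using eps_lin lin_comp unfolding lform_lin by blast

lemma lin_cop [lins]:
  assumes "vs W" "lin U C f" "\<And>y. y \<in> carr C \<Longrightarrow> lin C W (\<lambda>x. B x y)"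
    "\<And>x. x \<in> carr C \<Longrightarrow> lin C W (\<lambda>y. B x y)"
  shows "lin U W (\<lambda>x. tsum (cop C (f x)) B)"
  using assms by (intro lin_tensor_lin[OF cop_lin] bilinI)

lemma lin_cop_const [lins]:
  assumes "x \<in> carr C" "vs W" "\<And>a b. a \<in> carr C \<Longrightarrow> b \<in> carr C \<Longrightarrow> lin U W (\<lambda>u. T u a b)"
  shows "lin U W (\<lambda>u. tsum (cop C x) (T u))"
  using assms cop_mem[OF assms(1)] by (intro lin_tsum_const) auto

lemma tsum_cop_mem [mems]:
  assumes "x \<in> carr C" "vs W" "\<And>a b. a \<in> carr C \<Longrightarrow> b \<in> carr C \<Longrightarrow> T a b \<in> carr W"
  shows "tsum (cop C x) T \<in> carr W"
  using assms cop_mem[OF assms(1)] by (intro vs.tsum_mem) auto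

lemma cop_assoc:
  assumes "x \<in> carr C" "trilin C C C Z T" "vs Z"
  shows "tsum (cop C x) (\<lambda>a b. tsum (cop C a) (\<lambda>a1 a2. T a1 a2 b)) =
    tsum (cop C x) (\<lambda>a b. tsum (cop C b) (\<lambda>b1 b2. T a b1 b2))"
  using teq3_tsum[OF coassoc[OF assms(1)] assms(2,3)] by simp

text \<open>The counit axiom in the form needed inside a longer expression, under an arbitrary
  linear map.\<close>

lemma eps_cop_left:
  assumes x: "x \<in> carr C" and f: "lin C Z f"
  shows "tsum (cop C x) (\<lambda>a b. scl Z (eps C a) (f b)) = f x"
proof -
  have "f x = f (tsum (cop C x) (\<lambda>a b. scl C (eps C a) b))"
    using counit_left[OF x] by (simp add: tsum_def)
  also have "\<dots> = tsum (cop C x) (\<lambda>a b. f (scl C (eps C a) b))"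
    using cop_mem[OF x] by (intro lin_tsum_out[OF f vs_axioms] scl_mem) auto
  also have "\<dots> = tsum (cop C x) (\<lambda>a b. scl Z (eps C a) (f b))"
    by (intro cop_cong[OF x] lin_scl[OF f])
  finally show ?thesis by simp
qed

lemma eps_cop_right:
  assumes x: "x \<in> carr C" and f: "lin C Z f"
  shows "tsum (cop C x) (\<lambda>a b. scl Z (eps C b) (f a)) = f x"
proof -
  have "f x = f (tsum (cop C x) (\<lambda>a b. scl C (eps C b) a))"
    using counit_right[OF x] by (simp add: tsum_def)
  also have "\<dots> = tsum (cop C x) (\<lambda>a b. f (scl C (eps C b) a))"
    using cop_mem[OF x] by (intro lin_tsum_out[OF f vs_axioms] scl_mem) auto
  also have "\<dots> = tsum (cop C x) (\<lambda>a b. scl Z (eps C b) (f a))"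
    by (intro cop_cong[OF x] lin_scl[OF f])
  finally show ?thesis by simp
qed

end

context braided_hopf
begin

lemma antip_mem [mems]: "x \<in> carr H \<Longrightarrow> antip H x \<in> carr H"
  using lin_mem[OF antip_lin] .

lemma lin_antip [lins]: "lin X H f \<Longrightarrow> lin X H (\<lambda>x. antip H (f x))"
  by (rule lin_comp[OF antip_lin])

lemma cop_mul_tsum:
  assumes "x \<in> carr H" "y \<in> carr H" "bilin H H Z B" "vs Z"
  shows "tsum (cop H (mul H x y)) B = tsum (cop H x) (\<lambda>a b. tsum (cop H y) (\<lambda>a' b'.
    tsum (br b a') (\<lambda>u v. B (mul H a u) (mul H v b'))))"
  using teq_tsum[OF cop_mul[OF assms(1,2)] assms(3,4)] by simp

lemma cop_unit_tsum:
  assumes "bilin H H Z B" "vs Z" shows "tsum (cop H (unit H)) B = B (unit H) (unit H)"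
  using teq_tsum[OF cop_unit assms] by simp

lemma antip_cop_left:
  assumes x: "x \<in> carr H" and f: "lin H Z f"
  shows "tsum (cop H x) (\<lambda>a b. f (mul H (antip H a) b)) = scl Z (eps H x) (f (unit H))"
proof -
  have "tsum (cop H x) (\<lambda>a b. f (mul H (antip H a) b)) = f (tsum (cop H x) (\<lambda>a b. mul H (antip H a) b))"
    using cop_mem[OF x] by (intro lin_tsum_out[OF f vs_axioms, symmetric] mems) auto
  also have "\<dots> = f (scl H (eps H x) (unit H))"
    using antip_left[OF x] by (simp add: tsum_def)
  finally show ?thesis by (simp add: lin_scl[OF f] unit_carr)
qed

lemma antip_cop_right:
  assumes x: "x \<in> carr H" and f: "lin H Z f"
  shows "tsum (cop H x) (\<lambda>a b. f (mul H a (antip H b))) = scl Z (eps H x) (f (unit H))"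
proof -
  have "tsum (cop H x) (\<lambda>a b. f (mul H a (antip H b))) = f (tsum (cop H x) (\<lambda>a b. mul H a (antip H b)))"
    using cop_mem[OF x] by (intro lin_tsum_out[OF f vs_axioms, symmetric] mems) auto
  also have "\<dots> = f (scl H (eps H x) (unit H))"
    using antip_right[OF x] by (simp add: tsum_def)
  finally show ?thesis by (simp add: lin_scl[OF f] unit_carr)
qed

lemma antip_unit: "antip H (unit H) = unit H"
proof -
  have "tsum (cop H (unit H)) (\<lambda>a b. mul H (antip H a) b) = mul H (antip H (unit H)) (unit H)"
    by (rule cop_unit_tsum[where Z=H]) (intro bilinI lins mems; assumption?)+
  then show ?thesis
    using antip_left[OF unit_carr]
    by (simp add: tsum_def unit_right antip_mem unit_carr eps_unit)
qed

lemma eps_antip: assumes x: "x \<in> carr H" shows "eps H (antip H x) = eps H x"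
proof -
  have "eps H (antip H x) = tsum (cop H x) (\<lambda>a b. eps H b * eps H (antip H a))"
    using eps_cop_right[OF x, of kk "\<lambda>a. eps H (antip H a)"] by (simp add: lins)
  also have "\<dots> = tsum (cop H x) (\<lambda>a b. eps H (mul H (antip H a) b))"
    by (intro cop_cong x) (simp add: eps_mul antip_mem)
  also have "\<dots> = eps H x"
    using antip_cop_left[OF x, of kk "eps H"] by (simp add: lins eps_unit)
  finally show ?thesis .
qed

end

section \<open>The antipode of an ordinary Hopf algebra\<close>

context hopf_algebra
begin

lemma cop_mult:
  assumes "x \<in> carr H" "y \<in> carr H" "bilin H H Z B" "vs Z"
  shows "tsum (cop H (mul H x y)) B = tsum (cop H x) (\<lambda>a b. tsum (cop H y) (\<lambda>a' b'. B (mul H a a') (mul H b b')))"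
  using cop_mul_tsum[OF assms] by simp

text \<open>Both sides, as maps H \<otimes> H \<rightarrow> H, are convolution inverses of the
  multiplication. \<open>T\<close> is the triple convolution product; contracting its last two
  factors leaves the left inverse S(gh), contracting its first two leaves the right inverse
  S(h)S(g), and coassociativity in \<open>g\<close> and in \<open>h\<close> links the two.\<close>

lemma antip_mult:
  assumes g: "g \<in> carr H" and h: "h \<in> carr H"
  shows "antip H (mul H g h) = mul H (antip H h) (antip H g)"
proof -
  define T where "T g1 g2 g3 h1 h2 h3 = mul H (antip H (mul H g1 h1))
    (mul H (mul H g2 h2) (mul H (antip H h3) (antip H g3)))" for g1 g2 g3 h1 h2 h3
  \<comment> \<open>The cancellation goes from the inside outwards: \<open>h2\<close> meets
    S(\<open>h3\<close>) first, and only then \<open>g2\<close> meets S(\<open>g3\<close>).\<close>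
  have inner: "tsum (cop H g') (\<lambda>g2 g3. tsum (cop H h') (\<lambda>h2 h3. T g1 g2 g3 h1 h2 h3)) =
      scl H (eps H g') (scl H (eps H h') (antip H (mul H g1 h1)))"
    if m: "g' \<in> carr H" "h' \<in> carr H" "g1 \<in> carr H" "h1 \<in> carr H" for g' h' g1 h1
  proof -
    have "tsum (cop H g') (\<lambda>g2 g3. tsum (cop H h') (\<lambda>h2 h3. T g1 g2 g3 h1 h2 h3)) =
        tsum (cop H g') (\<lambda>g2 g3. scl H (eps H h') (mul H (antip H (mul H g1 h1)) (mul H g2 (antip H g3))))"
    proof (intro cop_cong m)
      fix g2 g3 assume m': "g2 \<in> carr H" "g3 \<in> carr H"
      have "tsum (cop H h') (\<lambda>h2 h3. T g1 g2 g3 h1 h2 h3) = tsum (cop H h') (\<lambda>h2 h3.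
          (\<lambda>z. mul H (antip H (mul H g1 h1)) (mul H g2 (mul H z (antip H g3)))) (mul H h2 (antip H h3)))"
        by (intro cop_cong m) (simp add: T_def m m' mul_assoc mul_mem antip_mem)
      also have "\<dots> = scl H (eps H h') (mul H (antip H (mul H g1 h1)) (mul H g2 (mul H (unit H) (antip H g3))))"
        by (rule antip_cop_right) (intro m m' lins mems; assumption?)+
      finally show "tsum (cop H h') (\<lambda>h2 h3. T g1 g2 g3 h1 h2 h3) =
          scl H (eps H h') (mul H (antip H (mul H g1 h1)) (mul H g2 (antip H g3)))"
        by (simp add: unit_left m' antip_mem)
    qed
    also have "\<dots> = scl H (eps H g') (scl H (eps H h') (mul H (antip H (mul H g1 h1)) (unit H)))"
      by (rule antip_cop_right[where f="\<lambda>z. scl H (eps H h') (mul H (antip H (mul H g1 h1)) z)"]) (intro m lins mems; assumption?)+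
    finally show ?thesis by (simp add: unit_right m mul_mem antip_mem)
  qed
  \<comment> \<open>Here the products \<open>g1 h1\<close> and \<open>g2 h2\<close> are the two legs
    of the coproduct of \<open>g' h'\<close>, so a single use of the antipode axiom
    suffices.\<close>
  have inner': "tsum (cop H g') (\<lambda>g1 g2. tsum (cop H h') (\<lambda>h1 h2. T g1 g2 g3 h1 h2 h3)) =
      scl H (eps H g') (scl H (eps H h') (mul H (antip H h3) (antip H g3)))"
    if m: "g' \<in> carr H" "h' \<in> carr H" "g3 \<in> carr H" "h3 \<in> carr H" for g' h' g3 h3
  proof -
    have "tsum (cop H g') (\<lambda>g1 g2. tsum (cop H h') (\<lambda>h1 h2. T g1 g2 g3 h1 h2 h3)) =
      tsum (cop H g') (\<lambda>g1 g2. tsum (cop H h') (\<lambda>h1 h2.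
        (\<lambda>a b. mul H (mul H (antip H a) b) (mul H (antip H h3) (antip H g3))) (mul H g1 h1) (mul H g2 h2)))"
      by (intro cop_cong m) (simp add: T_def m mul_assoc mul_mem antip_mem)
    also have "\<dots> = tsum (cop H (mul H g' h')) (\<lambda>a b. mul H (mul H (antip H a) b) (mul H (antip H h3) (antip H g3)))"
      by (rule cop_mult[where Z=H, symmetric]) (intro m bilinI lins mems; assumption?)+
    also have "\<dots> = scl H (eps H (mul H g' h')) (mul H (unit H) (mul H (antip H h3) (antip H g3)))"
      by (rule antip_cop_left[where f="\<lambda>z. mul H z (mul H (antip H h3) (antip H g3))"]) (intro m lins mems; assumption?)+
    finally show ?thesis by (simp add: unit_left m mul_mem antip_mem eps_mul)
  qed
  have lT: "lin H H (\<lambda>x. T x g2 g3 h1 h2 h3)" "lin H H (\<lambda>x. T g1 x g3 h1 h2 h3)"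
    "lin H H (\<lambda>x. T g1 g2 x h1 h2 h3)" "lin H H (\<lambda>x. T g1 g2 g3 x h2 h3)"
    "lin H H (\<lambda>x. T g1 g2 g3 h1 x h3)" "lin H H (\<lambda>x. T g1 g2 g3 h1 h2 x)"
    if "g1 \<in> carr H" "g2 \<in> carr H" "g3 \<in> carr H" "h1 \<in> carr H" "h2 \<in> carr H" "h3 \<in> carr H"
    for g1 g2 g3 h1 h2 h3
    unfolding T_def by (intro that lins mems; assumption?)+
  have "antip H (mul H g h) = tsum (cop H g) (\<lambda>g1 g'. scl H (eps H g') (antip H (mul H g1 h)))"
    by (rule eps_cop_right[OF g, symmetric, where f="\<lambda>z. antip H (mul H z h)"]) (intro g h lins mems)
  also have "\<dots> = tsum (cop H g) (\<lambda>g1 g'. tsum (cop H h) (\<lambda>h1 h'. scl H (eps H h') (scl H (eps H g') (antip H (mul H g1 h1)))))"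
    by (intro cop_cong g eps_cop_right[OF h, symmetric, where f="\<lambda>z. scl H _ (antip H (mul H _ z))"] lins mems)
  also have "\<dots> = tsum (cop H g) (\<lambda>g1 g'. tsum (cop H h) (\<lambda>h1 h'.
      tsum (cop H g') (\<lambda>g2 g3. tsum (cop H h') (\<lambda>h2 h3. T g1 g2 g3 h1 h2 h3))))"
    by (intro cop_cong g h) (simp add: inner mult.commute)
  also have "\<dots> = tsum (cop H g) (\<lambda>g1 g'. tsum (cop H g') (\<lambda>g2 g3. tsum (cop H h) (\<lambda>h1 h'.
      tsum (cop H h') (\<lambda>h2 h3. T g1 g2 g3 h1 h2 h3))))"
    by (subst tsum_swap) simp
  also have "\<dots> = tsum (cop H g) (\<lambda>g' g3. tsum (cop H g') (\<lambda>g1 g2. tsum (cop H h) (\<lambda>h1 h'.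
      tsum (cop H h') (\<lambda>h2 h3. T g1 g2 g3 h1 h2 h3))))"
    by (rule cop_assoc[where Z=H, symmetric]) (intro g h trilinI lins mems lT; assumption?)+
  also have "\<dots> = tsum (cop H g) (\<lambda>g' g3. tsum (cop H g') (\<lambda>g1 g2. tsum (cop H h) (\<lambda>h' h3.
      tsum (cop H h') (\<lambda>h1 h2. T g1 g2 g3 h1 h2 h3))))"
    by (intro cop_cong g h cop_assoc[where Z=H, symmetric] trilinI lins mems lT)
  also have "\<dots> = tsum (cop H g) (\<lambda>g' g3. tsum (cop H h) (\<lambda>h' h3.
      tsum (cop H g') (\<lambda>g1 g2. tsum (cop H h') (\<lambda>h1 h2. T g1 g2 g3 h1 h2 h3))))"
    by (subst tsum_swap) simp
  also have "\<dots> = tsum (cop H g) (\<lambda>g' g3. tsum (cop H h) (\<lambda>h' h3. scl H (eps H h') (scl H (eps H g') (mul H (antip H h3) (antip H g3)))))"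
    by (intro cop_cong g h) (simp add: inner' mult.commute)
  also have "\<dots> = tsum (cop H g) (\<lambda>g' g3. scl H (eps H g') (mul H (antip H h) (antip H g3)))"
    by (intro cop_cong g eps_cop_left[OF h, where f="\<lambda>z. scl H _ (mul H (antip H z) _)"] lins mems)
  also have "\<dots> = mul H (antip H h) (antip H g)"
    by (rule eps_cop_left[OF g, where f="\<lambda>z. mul H (antip H h) (antip H z)"]) (intro g h lins mems)
  finally show ?thesis .
qed

text \<open>The same argument for maps H \<rightarrow> H \<otimes> H: both sides are convolution
  inverses of the coproduct. As tensors are only seen through bilinear maps, \<open>B\<close>
  accompanies the whole computation. \<open>T\<close> is the triple product, with \<open>u\<close>
  under the first inverse, \<open>c\<close> and \<open>d\<close> from the coproduct and
  \<open>p\<close>, \<open>q\<close> under the second inverse.\<close>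

lemma antip_cop:
  assumes x: "x \<in> carr H" and B: "bilin H H Z B" and Z: "vs Z"
  shows "tsum (cop H (antip H x)) B = tsum (cop H x) (\<lambda>a b. B (antip H b) (antip H a))"
proof -
  note [lins] = Z bilinD[OF B]
  note [mems] = bilinD(3)[OF B]
  define T where "T u c d p q = tsum (cop H (antip H u)) (\<lambda>a b.
    B (mul H (mul H a c) (antip H q)) (mul H (mul H b d) (antip H p)))" for u c d p q
  have lT: "lin H Z (\<lambda>x. T x c d p q)" "lin H Z (\<lambda>x. T u x d p q)" "lin H Z (\<lambda>x. T u c x p q)"
    "lin H Z (\<lambda>x. T u c d x q)" "lin H Z (\<lambda>x. T u c d p x)"
    if "u \<in> carr H" "c \<in> carr H" "d \<in> carr H" "p \<in> carr H" "q \<in> carr H" for u c d p q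
    unfolding T_def by (intro that lins mems; assumption?)+
  note [lins] = lT
  have inner1: "tsum (cop H y) (\<lambda>u w. tsum (cop H w) (\<lambda>c d. T u c d p q)) =
      scl Z (eps H y) (B (antip H q) (antip H p))"
    if m: "y \<in> carr H" "p \<in> carr H" "q \<in> carr H" for y p q
  proof -
    have b: "bilin H H Z (\<lambda>a b. B (mul H a (antip H q)) (mul H b (antip H p)))"
      by (intro m bilinI lins mems)
    have "tsum (cop H y) (\<lambda>u w. tsum (cop H w) (\<lambda>c d. T u c d p q)) =
       tsum (cop H y) (\<lambda>u w. tsum (cop H (antip H u)) (\<lambda>a b. tsum (cop H w) (\<lambda>c d.
         (\<lambda>a b. B (mul H a (antip H q)) (mul H b (antip H p))) (mul H a c) (mul H b d))))"
      unfolding T_def by (subst tsum_swap) simp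
    also have "\<dots> = tsum (cop H y) (\<lambda>u w. tsum (cop H (mul H (antip H u) w))
        (\<lambda>a b. B (mul H a (antip H q)) (mul H b (antip H p))))"
      by (intro cop_cong m cop_mult[OF _ _ b Z, symmetric] mems)
    also have "\<dots> = scl Z (eps H y) (tsum (cop H (unit H)) (\<lambda>a b. B (mul H a (antip H q)) (mul H b (antip H p))))"
      by (rule antip_cop_left[where f="\<lambda>z. tsum (cop H z) (\<lambda>a b. B (mul H a (antip H q)) (mul H b (antip H p)))"])
         (intro m lins mems; assumption?)+
    also have "\<dots> = scl Z (eps H y) (B (antip H q) (antip H p))"
      by (simp add: cop_unit_tsum[OF b Z] unit_left m antip_mem)
    finally show ?thesis .
  qed
  \<comment> \<open>The four legs have to be regrouped as \<open>c\<close>, (\<open>d\<close>,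
    \<open>p\<close>), \<open>q\<close>: the inner pair cancels first and thereby brings
    \<open>c\<close> next to S(\<open>q\<close>).\<close>
  have inner2: "tsum (cop H v) (\<lambda>w z. tsum (cop H w) (\<lambda>c d. tsum (cop H z) (\<lambda>p q. T u c d p q))) =
      scl Z (eps H v) (tsum (cop H (antip H u)) B)"
    if m: "v \<in> carr H" "u \<in> carr H" for v u
  proof -
    have i: "tsum (cop H t') (\<lambda>d p. T u c d p q) = scl Z (eps H t')
        (tsum (cop H (antip H u)) (\<lambda>a b. B (mul H (mul H a c) (antip H q)) b))"
      if m': "t' \<in> carr H" "c \<in> carr H" "q \<in> carr H" for t' c q
    proof -
      have "tsum (cop H t') (\<lambda>d p. T u c d p q) = tsum (cop H t') (\<lambda>d p.
          (\<lambda>z. tsum (cop H (antip H u)) (\<lambda>a b. B (mul H (mul H a c) (antip H q)) (mul H b z))) (mul H d (antip H p)))"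
        unfolding T_def by (intro cop_cong m m' mems) (simp add: mul_assoc antip_mem m)
      also have "\<dots> = scl Z (eps H t') (tsum (cop H (antip H u)) (\<lambda>a b. B (mul H (mul H a c) (antip H q)) (mul H b (unit H))))"
        by (rule antip_cop_right) (intro m m' lins mems; assumption?)+
      also have "tsum (cop H (antip H u)) (\<lambda>a b. B (mul H (mul H a c) (antip H q)) (mul H b (unit H))) =
          tsum (cop H (antip H u)) (\<lambda>a b. B (mul H (mul H a c) (antip H q)) b)"
        by (intro cop_cong m mems) (simp add: unit_right)
      finally show ?thesis .
    qed
    have "tsum (cop H v) (\<lambda>w z. tsum (cop H w) (\<lambda>c d. tsum (cop H z) (\<lambda>p q. T u c d p q))) =
      tsum (cop H v) (\<lambda>c t. tsum (cop H t) (\<lambda>d z. tsum (cop H z) (\<lambda>p q. T u c d p q)))"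
      by (rule cop_assoc[where Z=Z]) (intro m trilinI lins mems; assumption?)+
    also have "\<dots> = tsum (cop H v) (\<lambda>c t. tsum (cop H t) (\<lambda>t' q. tsum (cop H t') (\<lambda>d p. T u c d p q)))"
      by (intro cop_cong m cop_assoc[where Z=Z, symmetric] trilinI lins mems)
    also have "\<dots> = tsum (cop H v) (\<lambda>c t. tsum (cop H t) (\<lambda>t' q. scl Z (eps H t')
        ((\<lambda>q. tsum (cop H (antip H u)) (\<lambda>a b. B (mul H (mul H a c) (antip H q)) b)) q)))"
      by (intro cop_cong m i)
    also have "\<dots> = tsum (cop H v) (\<lambda>c t. tsum (cop H (antip H u)) (\<lambda>a b. B (mul H (mul H a c) (antip H t)) b))"
      by (intro cop_cong m eps_cop_left lins mems)
    also have "\<dots> = tsum (cop H v) (\<lambda>c t. (\<lambda>z. tsum (cop H (antip H u)) (\<lambda>a b. B (mul H a z) b)) (mul H c (antip H t)))"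
      by (intro cop_cong m mems) (simp add: mul_assoc antip_mem)
    also have "\<dots> = scl Z (eps H v) (tsum (cop H (antip H u)) (\<lambda>a b. B (mul H a (unit H)) b))"
      by (rule antip_cop_right) (intro m lins mems; assumption?)+
    also have "tsum (cop H (antip H u)) (\<lambda>a b. B (mul H a (unit H)) b) = tsum (cop H (antip H u)) B"
      by (intro cop_cong m mems) (simp add: unit_right)
    finally show ?thesis .
  qed
  have "tsum (cop H (antip H x)) B = tsum (cop H x) (\<lambda>u v. scl Z (eps H v) (tsum (cop H (antip H u)) B))"
    by (rule eps_cop_right[OF x, symmetric]) (intro lins mems)
  also have "\<dots> = tsum (cop H x) (\<lambda>u v. tsum (cop H v) (\<lambda>w z. tsum (cop H w) (\<lambda>c d. tsum (cop H z) (\<lambda>p q. T u c d p q))))"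
    by (intro cop_cong x inner2[symmetric])
  also have "\<dots> = tsum (cop H x) (\<lambda>y z. tsum (cop H y) (\<lambda>u w. tsum (cop H w) (\<lambda>c d. tsum (cop H z) (\<lambda>p q. T u c d p q))))"
    by (rule cop_assoc[where Z=Z, symmetric]) (intro x trilinI lins mems; assumption?)+
  also have "\<dots> = tsum (cop H x) (\<lambda>y z. tsum (cop H z) (\<lambda>p q. tsum (cop H y) (\<lambda>u w. tsum (cop H w) (\<lambda>c d. T u c d p q))))"
  proof (intro cop_cong x)
    fix y z assume "y \<in> carr H" "z \<in> carr H"
    have "tsum (cop H y) (\<lambda>u w. tsum (cop H w) (\<lambda>c d. tsum (cop H z) (\<lambda>p q. T u c d p q))) =
       tsum (cop H y) (\<lambda>u w. tsum (cop H z) (\<lambda>p q. tsum (cop H w) (\<lambda>c d. T u c d p q)))"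
      by (subst tsum_swap) simp
    then show "tsum (cop H y) (\<lambda>u w. tsum (cop H w) (\<lambda>c d. tsum (cop H z) (\<lambda>p q. T u c d p q))) =
       tsum (cop H z) (\<lambda>p q. tsum (cop H y) (\<lambda>u w. tsum (cop H w) (\<lambda>c d. T u c d p q)))"
      by (simp add: tsum_swap[of "cop H y"])
  qed
  also have "\<dots> = tsum (cop H x) (\<lambda>y z. scl Z (eps H y) ((\<lambda>z. tsum (cop H z) (\<lambda>p q. B (antip H q) (antip H p))) z))"
    unfolding tsum_scl[OF Z, symmetric] by (intro cop_cong x inner1)
  also have "\<dots> = tsum (cop H x) (\<lambda>p q. B (antip H q) (antip H p))"
    by (rule eps_cop_left[OF x]) (intro lins mems)
  finally show ?thesis .
qed

end

locale hopf_bij = hopf_algebra H for H :: "('k::field, 'a::ab_group_add, 'z) hopf_scheme" +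
  assumes antip_bij: "bij_betw (antip H) (carr H) (carr H)"
begin

definition ainv :: "'a \<Rightarrow> 'a" where
  "ainv = inv_into (carr H) (antip H)"

lemma ainv_mem [mems]: "x \<in> carr H \<Longrightarrow> ainv x \<in> carr H"
  unfolding ainv_def using antip_bij by (metis bij_betw_imp_surj_on inv_into_into)

lemma antip_ainv [simp]: "x \<in> carr H \<Longrightarrow> antip H (ainv x) = x"
  unfolding ainv_def using antip_bij by (metis bij_betw_imp_surj_on f_inv_into_f)

lemma ainv_antip [simp]: "x \<in> carr H \<Longrightarrow> ainv (antip H x) = x"
  unfolding ainv_def using antip_bij by (metis bij_betw_imp_inj_on inv_into_f_f)

lemma ainv_eqI: "x \<in> carr H \<Longrightarrow> y \<in> carr H \<Longrightarrow> antip H y = x \<Longrightarrow> ainv x = y"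
  using ainv_antip by blast

lemma lin_ainv0: "lin H H ainv"
  unfolding lin_def
proof (intro conjI ballI allI)
  fix x x' assume "x \<in> carr H" "x' \<in> carr H"
  then show "ainv (x + x') = ainv x + ainv x'"
    by (intro ainv_eqI mems) (simp_all add: lin_add[OF antip_lin] ainv_mem)
next
  fix c x assume "x \<in> carr H"
  then show "ainv (scl H c x) = scl H c (ainv x)"
    by (intro ainv_eqI mems) (simp_all add: lin_scl[OF antip_lin] ainv_mem)
qed (auto simp: ainv_mem)

lemma lin_ainv [lins]: "lin X H f \<Longrightarrow> lin X H (\<lambda>x. ainv (f x))"
  by (rule lin_comp[OF lin_ainv0])

lemma ainv_mult: "g \<in> carr H \<Longrightarrow> h \<in> carr H \<Longrightarrow> ainv (mul H g h) = mul H (ainv h) (ainv g)"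
  by (intro ainv_eqI mems) (simp_all add: antip_mult ainv_mem)

lemma ainv_unit: "ainv (unit H) = unit H"
  by (intro ainv_eqI mems antip_unit)

lemma eps_ainv: "x \<in> carr H \<Longrightarrow> eps H (ainv x) = eps H x"
  using eps_antip[of "ainv x"] by (simp add: ainv_mem)

text \<open>This is \<open>antip_cop\<close> at the element \<open>ainv x\<close>, with the inverse
  antipode built into the bilinear map.\<close>

lemma ainv_cop:
  assumes x: "x \<in> carr H" and B: "bilin H H Z B" and Z: "vs Z"
  shows "tsum (cop H (ainv x)) B = tsum (cop H x) (\<lambda>a b. B (ainv b) (ainv a))"
proof -
  have "bilin H H Z (\<lambda>a b. B (ainv b) (ainv a))"
    by (intro bilinI bilinD[OF B] lins mems)
  from antip_cop[OF ainv_mem[OF x] this Z]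
  have "tsum (cop H x) (\<lambda>a b. B (ainv b) (ainv a)) =
      tsum (cop H (ainv x)) (\<lambda>a b. B (ainv (antip H a)) (ainv (antip H b)))"
    using x by simp
  also have "\<dots> = tsum (cop H (ainv x)) B"
    by (intro cop_cong ainv_mem x) simp
  finally show ?thesis by simp
qed

end

section \<open>Yetter-Drinfeld modules\<close>

context yd_module
begin

lemma act_mem [mems]: "h \<in> carr K \<Longrightarrow> v \<in> carr V \<Longrightarrow> act V h v \<in> carr V"
  using lin_mem[OF act_lin_right] .

lemma lin_act [lins]:
  "lin X K f \<Longrightarrow> v \<in> carr V \<Longrightarrow> lin X V (\<lambda>x. act V (f x) v)"
  "lin X V g \<Longrightarrow> h \<in> carr K \<Longrightarrow> lin X V (\<lambda>x. act V h (g x))"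
  using lin_comp[OF act_lin_left, of v X f] lin_comp[OF act_lin_right, of h X g] by simp_all

lemma coact_mem: "v \<in> carr V \<Longrightarrow> set (coact V v) \<subseteq> carr K \<times> carr V"
  using lin_tensor_mem[OF coact_lin] .

lemma coact_cong:
  "v \<in> carr V \<Longrightarrow> (\<And>h w. h \<in> carr K \<Longrightarrow> w \<in> carr V \<Longrightarrow> f h w = g h w) \<Longrightarrow>
   tsum (coact V v) f = tsum (coact V v) g"
  by (rule tsum_congC[OF coact_mem])

lemma lin_coact [lins]:
  assumes "vs W" "lin U V f" "\<And>y. y \<in> carr V \<Longrightarrow> lin K W (\<lambda>x. B x y)"
    "\<And>x. x \<in> carr K \<Longrightarrow> lin V W (\<lambda>y. B x y)"
  shows "lin U W (\<lambda>x. tsum (coact V (f x)) B)"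
  using assms by (intro lin_tensor_lin[OF coact_lin] bilinI)

lemma lin_coact_const [lins]:
  assumes "v \<in> carr V" "vs W" "\<And>a b. a \<in> carr K \<Longrightarrow> b \<in> carr V \<Longrightarrow> lin U W (\<lambda>u. T u a b)"
  shows "lin U W (\<lambda>u. tsum (coact V v) (T u))"
  using assms coact_mem[OF assms(1)] by (intro lin_tsum_const) auto

lemma coact_assoc:
  assumes "v \<in> carr V" "trilin K K V Z T" "vs Z"
  shows "tsum (coact V v) (\<lambda>h w. tsum (cop K h) (\<lambda>h1 h2. T h1 h2 w)) =
    tsum (coact V v) (\<lambda>h w. tsum (coact V w) (\<lambda>g u. T h g u))"
  using teq3_tsum[OF coact_coassoc[OF assms(1)] assms(2,3)] by simp

lemma eps_coact:
  assumes v: "v \<in> carr V" and f: "lin V Z f"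
  shows "tsum (coact V v) (\<lambda>h w. scl Z (eps K h) (f w)) = f v"
proof -
  have "f v = f (tsum (coact V v) (\<lambda>h w. scl V (eps K h) w))"
    using coact_counit[OF v] by (simp add: tsum_def)
  also have "\<dots> = tsum (coact V v) (\<lambda>h w. f (scl V (eps K h) w))"
    using coact_mem[OF v] by (intro lin_tsum_out[OF f V.vs_axioms] V.scl_mem) auto
  also have "\<dots> = tsum (coact V v) (\<lambda>h w. scl Z (eps K h) (f w))"
    by (intro coact_cong[OF v] lin_scl[OF f])
  finally show ?thesis by simp
qed

lemma yd_tsum:
  assumes "h \<in> carr K" "v \<in> carr V" "bilin K V Z B" "vs Z"
  shows "tsum (coact V (act V h v)) B = tsum (cop K h) (\<lambda>h1 h'. tsum (cop K h') (\<lambda>h2 h3.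
    tsum (coact V v) (\<lambda>g w. B (mul K (mul K h1 g) (antip K h3)) (act V h2 w))))"
  using teq_tsum[OF yd_compat[OF assms(1,2)] assms(3,4)] by simp

text \<open>The compatibility condition without the antipode. It follows from the condition with
  S(\<open>h3\<close>) by multiplying with a further leg \<open>h4\<close> and cancelling
  S(\<open>h3\<close>)\<open>h4\<close>. This symmetric form is the one that is transposed to the
  dual, in \<open>dcoact_braid\<close>.\<close>

lemma yd_braid:
  assumes h: "h \<in> carr K" and v: "v \<in> carr V" and B: "bilin K V Z B" and Z: "vs Z"
  shows "tsum (cop K h) (\<lambda>h1 h2. tsum (coact V (act V h1 v)) (\<lambda>g w. B (mul K g h2) w)) =
    tsum (cop K h) (\<lambda>h1 h2. tsum (coact V v) (\<lambda>g w. B (mul K h1 g) (act V h2 w)))"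
proof -
  note [lins] = Z bilinD(1,2)[OF B]
  note [mems] = bilinD(3)[OF B]
  define T where "T h1 h2 h3 h4 = tsum (coact V v) (\<lambda>g w.
      B (mul K (mul K (mul K h1 g) (antip K h3)) h4) (act V h2 w))" for h1 h2 h3 h4
  have lT [lins]: "lin K Z (\<lambda>x. T x c d p)" "lin K Z (\<lambda>x. T u x d p)" "lin K Z (\<lambda>x. T u c x p)"
    "lin K Z (\<lambda>x. T u c d x)"
    if "u \<in> carr K" "c \<in> carr K" "d \<in> carr K" "p \<in> carr K" for u c d p
    unfolding T_def by (intro v that lins mems; assumption?)+
  have inner: "tsum (cop K s) (\<lambda>t h4. tsum (cop K t) (\<lambda>h2 h3. T h1 h2 h3 h4)) =
      tsum (coact V v) (\<lambda>g w. B (mul K h1 g) (act V s w))"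
    if m: "s \<in> carr K" "h1 \<in> carr K" for s h1
  proof -
    have i: "tsum (cop K r) (\<lambda>h3 h4. T h1 h2 h3 h4) = scl Z (eps K r) (tsum (coact V v) (\<lambda>g w. B (mul K h1 g) (act V h2 w)))"
      if m': "r \<in> carr K" "h2 \<in> carr K" for r h2
    proof -
      have "tsum (cop K r) (\<lambda>h3 h4. T h1 h2 h3 h4) = tsum (cop K r) (\<lambda>h3 h4.
          (\<lambda>z. tsum (coact V v) (\<lambda>g w. B (mul K (mul K h1 g) z) (act V h2 w))) (mul K (antip K h3) h4))"
        unfolding T_def by (intro K.cop_cong coact_cong v m m' mems) (simp add: K.mul_assoc K.antip_mem K.mul_mem m)
      also have "\<dots> = scl Z (eps K r) (tsum (coact V v) (\<lambda>g w. B (mul K (mul K h1 g) (unit K)) (act V h2 w)))"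
        by (rule K.antip_cop_left) (intro m m' v lins mems; assumption?)+
      also have "tsum (coact V v) (\<lambda>g w. B (mul K (mul K h1 g) (unit K)) (act V h2 w)) =
          tsum (coact V v) (\<lambda>g w. B (mul K h1 g) (act V h2 w))"
        by (intro coact_cong v) (simp add: K.unit_right K.mul_mem m)
      finally show ?thesis .
    qed
    have "tsum (cop K s) (\<lambda>t h4. tsum (cop K t) (\<lambda>h2 h3. T h1 h2 h3 h4)) =
        tsum (cop K s) (\<lambda>h2 r. tsum (cop K r) (\<lambda>h3 h4. T h1 h2 h3 h4))"
      by (rule K.cop_assoc[where Z=Z]) (intro m trilinI lins mems; assumption?)+
    also have "\<dots> = tsum (cop K s) (\<lambda>h2 r. scl Z (eps K r) ((\<lambda>h2. tsum (coact V v) (\<lambda>g w. B (mul K h1 g) (act V h2 w))) h2))"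
      by (intro K.cop_cong m i)
    also have "\<dots> = tsum (coact V v) (\<lambda>g w. B (mul K h1 g) (act V s w))"
      by (rule K.eps_cop_right) (intro m v lins mems; assumption?)+
    finally show ?thesis .
  qed
  have b: "bilin K V Z (\<lambda>g w. B (mul K g h4) w)" if "h4 \<in> carr K" for h4
    by (intro that bilinI lins mems)
  have "tsum (cop K h) (\<lambda>h' h4. tsum (coact V (act V h' v)) (\<lambda>g w. B (mul K g h4) w)) =
    tsum (cop K h) (\<lambda>h' h4. tsum (cop K h') (\<lambda>h1 t. tsum (cop K t) (\<lambda>h2 h3. T h1 h2 h3 h4)))"
    unfolding T_def by (intro K.cop_cong h yd_tsum[OF _ v _ Z] b)
  also have "\<dots> = tsum (cop K h) (\<lambda>h1 s. tsum (cop K s) (\<lambda>t h4. tsum (cop K t) (\<lambda>h2 h3. T h1 h2 h3 h4)))"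
    by (rule K.cop_assoc[where Z=Z]) (intro h trilinI lins mems; assumption?)+
  also have "\<dots> = tsum (cop K h) (\<lambda>h1 s. tsum (coact V v) (\<lambda>g w. B (mul K h1 g) (act V s w)))"
    by (intro K.cop_cong h inner)
  finally show ?thesis .
qed

end

text \<open>\<open>yd_of\<close> changes the record type and not the data; these rules remove it
  from every notion that depends only on carrier and scalar multiplication.\<close>

lemma yd_of_sel [simp]:
  "carr (yd_of R) = carr R" "scl (yd_of R) = scl R" "act (yd_of R) = hact R" "coact (yd_of R) = hcoact R"
  by (simp_all add: yd_of_def)

lemma lin_conv [simp]: "lin X (yd_of R) f = lin X R f" "lin (yd_of R) Y g = lin R Y g"
  by (simp_all add: lin_def)

lemma bilin_conv [simp]: "bilin X (yd_of R) Z B = bilin X R Z B"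
  by (simp add: bilin_def)

lemma vs_conv [simp]: "vs (yd_of R) = vs R"
  by (simp add: vs_def)

lemma trilin_conv [simp]: "trilin X Y (yd_of R) Z B = trilin X Y R Z B"
  by (simp add: trilin_def)

lemma teq_conv [simp]: "teq X (yd_of R) s t = teq X R s t"
  by (simp add: teq_iff)

lemma teq3_conv [simp]: "teq3 X Y (yd_of R) s t = teq3 X Y R s t"
  by (simp add: teq3_iff)

lemma lin_tensor_conv [simp]: "lin_tensor (yd_of R) X (yd_of R) f = lin_tensor R X R f"
  by (simp add: lin_tensor_def)

context yd_hopf_algebra
begin

lemmas hact_mem [mems] = YD.act_mem[unfolded yd_of_sel]
lemmas lin_hact [lins] = YD.lin_act[unfolded yd_of_sel lin_conv]
lemmas hcoact_mem = YD.coact_mem[unfolded yd_of_sel]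
lemmas hcoact_cong = YD.coact_cong[unfolded yd_of_sel]
lemmas lin_hcoact [lins] = YD.lin_coact[unfolded yd_of_sel lin_conv]
lemmas lin_hcoact_const [lins] = YD.lin_coact_const[unfolded yd_of_sel]
lemmas hcoact_assoc = YD.coact_assoc[unfolded yd_of_sel trilin_conv]
lemmas eps_hcoact = YD.eps_coact[unfolded yd_of_sel lin_conv]
lemmas hyd_tsum = YD.yd_tsum[unfolded yd_of_sel bilin_conv]
lemmas hyd_braid = YD.yd_braid[unfolded yd_of_sel bilin_conv]
lemmas hact_mul = YD.act_mul[unfolded yd_of_sel]
lemmas hact_unit = YD.act_unit[unfolded yd_of_sel]

lemma cop_mul_R:
  assumes "x \<in> carr R" "y \<in> carr R" "bilin R R Z B" "vs Z"
  shows "tsum (cop R (mul R x y)) B = tsum (cop R x) (\<lambda>a b. tsum (cop R y) (\<lambda>a' b'.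
    tsum (hcoact R b) (\<lambda>h w. B (mul R a (hact R h a')) (mul R w b'))))"
  using R.cop_mul_tsum[OF assms] by (simp add: yd_braiding_def)

lemma hcoact_mul:
  assumes "x \<in> carr R" "y \<in> carr R" "bilin K R Z B" "vs Z"
  shows "tsum (hcoact R (mul R x y)) B =
    tsum (hcoact R x) (\<lambda>g u. tsum (hcoact R y) (\<lambda>h w. B (mul K g h) (mul R u w)))"
  using teq_tsum[OF coact_mul_R[OF assms(1,2)] assms(3,4)] by simp

lemma hcoact_unit:
  assumes "bilin K R Z B" "vs Z"
  shows "tsum (hcoact R (unit R)) B = B (unit K) (unit R)"
  using teq_tsum[OF coact_unit_R assms] by simp

lemma cop_hact:
  assumes "h \<in> carr K" "x \<in> carr R" "bilin R R Z B" "vs Z"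
  shows "tsum (cop R (hact R h x)) B =
    tsum (cop K h) (\<lambda>h1 h2. tsum (cop R x) (\<lambda>a b. B (hact R h1 a) (hact R h2 b)))"
  using teq_tsum[OF act_cop_R[OF assms(1,2)] assms(3,4)] by simp

lemma hcoact_cop:
  assumes "x \<in> carr R" "trilin K R R Z B" "vs Z"
  shows "tsum (hcoact R x) (\<lambda>h w. tsum (cop R w) (\<lambda>a b. B h a b)) =
    tsum (cop R x) (\<lambda>a b. tsum (hcoact R a) (\<lambda>g u. tsum (hcoact R b) (\<lambda>h w. B (mul K g h) u w)))"
  using teq3_tsum[OF coact_cop_R[OF assms(1)] assms(2,3)] by simp

lemma hcoact_antip:
  assumes "x \<in> carr R" "bilin K R Z B" "vs Z"
  shows "tsum (hcoact R (antip R x)) B = tsum (hcoact R x) (\<lambda>h w. B h (antip R w))"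
  using teq_tsum[OF coact_antip_R[OF assms(1)] assms(2,3)] by simp

lemma hact_mult:
  "h \<in> carr K \<Longrightarrow> x \<in> carr R \<Longrightarrow> y \<in> carr R \<Longrightarrow>
    hact R h (mul R x y) = tsum (cop K h) (\<lambda>h1 h2. mul R (hact R h1 x) (hact R h2 y))"
  using act_mul_R by (simp add: tsum_def)

lemma hcoact_eps:
  assumes x: "x \<in> carr R" and f: "lin K Z f"
  shows "tsum (hcoact R x) (\<lambda>h w. scl Z (eps R w) (f h)) = scl Z (eps R x) (f (unit K))"
proof -
  have "tsum (hcoact R x) (\<lambda>h w. scl Z (eps R w) (f h)) = tsum (hcoact R x) (\<lambda>h w. f (scl K (eps R w) h))"
    by (intro hcoact_cong x) (simp add: lin_scl[OF f])
  also have "\<dots> = f (tsum (hcoact R x) (\<lambda>h w. scl K (eps R w) h))"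
    using hcoact_mem[OF x] by (intro lin_tsum_out[OF f YD.K.vs_axioms, symmetric] mems) auto
  also have "\<dots> = f (scl K (eps R x) (unit K))"
    using coact_eps_R[OF x] by (simp add: tsum_def)
  finally show ?thesis by (simp add: lin_scl[OF f] YD.K.unit_carr)
qed

end

section \<open>Graded components\<close>

context graded_connected_hopf
begin

lemma deg_mem: "x \<in> deg R n \<Longrightarrow> x \<in> carr R"
  using deg_subspace by blast

lemma deg_0: "0 \<in> deg R n" and deg_add: "x \<in> deg R n \<Longrightarrow> y \<in> deg R n \<Longrightarrow> x + y \<in> deg R n"
  and deg_scl: "x \<in> deg R n \<Longrightarrow> scl R c x \<in> deg R n"
  and deg_diff: "x \<in> deg R n \<Longrightarrow> y \<in> deg R n \<Longrightarrow> x - y \<in> deg R n"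
  and deg_sum: "(\<And>i. i \<in> I \<Longrightarrow> f i \<in> deg R n) \<Longrightarrow> sum f I \<in> deg R n"
  using deg_subspace[of n] R.VS.subspace_0 R.VS.subspace_add R.VS.subspace_scale R.VS.subspace_diff
    R.VS.subspace_sum[of "deg R n" I f]
  by simp_all

definition proj :: "nat \<Rightarrow> 'a \<Rightarrow> 'a" where
  "proj n x = (THE c. (\<forall>n. c n \<in> deg R n) \<and> finite {n. c n \<noteq> 0} \<and> x = (\<Sum>n | c n \<noteq> 0. c n)) n"

lemma proj_spec:
  assumes "x \<in> carr R"
  shows "(\<forall>n. proj n x \<in> deg R n) \<and> finite {n. proj n x \<noteq> 0} \<and> x = (\<Sum>n | proj n x \<noteq> 0. proj n x)"
  unfolding proj_def by (rule theI'[OF deg_direct_sum[OF assms]])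

lemma proj_deg: "x \<in> carr R \<Longrightarrow> proj n x \<in> deg R n"
  and proj_fin: "x \<in> carr R \<Longrightarrow> finite {n. proj n x \<noteq> 0}"
  and proj_sum: "x \<in> carr R \<Longrightarrow> (\<Sum>n | proj n x \<noteq> 0. proj n x) = x"
  using proj_spec[of x] by simp_all

lemma proj_mem [mems]: "x \<in> carr R \<Longrightarrow> proj n x \<in> carr R"
  using proj_deg deg_mem by blast

lemma proj_unique0:
  assumes "\<And>n. c n \<in> deg R n" "finite {n. c n \<noteq> 0}" "x = (\<Sum>n | c n \<noteq> 0. c n)"
  shows "proj n x = c n"
proof -
  have "x \<in> carr R" unfolding assms(3) using assms(1) deg_mem by (blast intro: R.sum_mem)
  from deg_direct_sum[OF this]
  have "(THE c. (\<forall>n. c n \<in> deg R n) \<and> finite {n. c n \<noteq> 0} \<and> x = (\<Sum>n | c n \<noteq> 0. c n)) = c"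
    by (rule the1_equality) (use assms in auto)
  then show ?thesis by (simp add: proj_def)
qed

lemma proj_unique:
  assumes "\<And>n. c n \<in> deg R n" "finite I" "\<And>n. n \<notin> I \<Longrightarrow> c n = 0" "x = sum c I"
  shows "proj n x = c n"
proof (rule proj_unique0[OF assms(1)])
  have sub: "{n. c n \<noteq> 0} \<subseteq> I" using assms(3) by auto
  then show "finite {n. c n \<noteq> 0}" using assms(2) finite_subset by blast
  show "x = (\<Sum>n | c n \<noteq> 0. c n)"
    unfolding assms(4) by (rule sum.mono_neutral_right[OF assms(2) sub]) auto
qed

lemma proj_sum_over:
  assumes "x \<in> carr R" "finite I" "{n. proj n x \<noteq> 0} \<subseteq> I"
  shows "(\<Sum>n\<in>I. proj n x) = x"
proof -
  have "(\<Sum>n\<in>I. proj n x) = (\<Sum>n | proj n x \<noteq> 0. proj n x)"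
    by (rule sum.mono_neutral_right[OF assms(2,3)]) auto
  then show ?thesis using proj_sum[OF assms(1)] by simp
qed

lemma proj_homog: "x \<in> deg R n \<Longrightarrow> proj m x = (if m = n then x else 0)"
  by (rule proj_unique[where I="{n}"]) (auto intro: deg_0)

lemma lin_proj0: "lin R R (proj n)"
  unfolding lin_def
proof (intro conjI ballI allI)
  show "proj n ` carr R \<subseteq> carr R" using proj_mem by auto
next
  fix x y assume x: "x \<in> carr R" and y: "y \<in> carr R"
  let ?I = "{n. proj n x \<noteq> 0} \<union> {n. proj n y \<noteq> 0}"
  show "proj n (x + y) = proj n x + proj n y"
  proof (rule proj_unique[where I="?I"])
    show "x + y = (\<Sum>n\<in>?I. proj n x + proj n y)"
      unfolding sum.distrib using x y by (subst (1 2) proj_sum_over) (auto intro: proj_fin)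
  qed (use x y in \<open>auto intro: deg_add proj_deg proj_fin\<close>)
next
  fix c x assume x: "x \<in> carr R"
  let ?I = "{n. proj n x \<noteq> 0}"
  show "proj n (scl R c x) = scl R c (proj n x)"
  proof (rule proj_unique[where I="?I"])
    show "scl R c x = (\<Sum>n\<in>?I. scl R c (proj n x))"
      unfolding R.VS.scale_sum_right[symmetric] using x by (subst proj_sum) auto
  qed (use x in \<open>auto intro: deg_scl proj_deg proj_fin\<close>)
qed

lemma lin_proj [lins]: "lin X R f \<Longrightarrow> lin X R (\<lambda>x. proj n (f x))"
  by (rule lin_comp[OF lin_proj0])

lemma proj_proj [simp]: "x \<in> carr R \<Longrightarrow> proj m (proj n x) = (if m = n then proj n x else 0)"
  by (rule proj_homog[OF proj_deg])

lemma lin_eq_homog: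
  assumes "lin R Z f" "lin R Z g" "\<And>n x. x \<in> deg R n \<Longrightarrow> f x = g x" "x \<in> carr R"
  shows "f x = g x"
proof -
  have "f x = (\<Sum>n | proj n x \<noteq> 0. f (proj n x))"
    by (subst (1) proj_sum[OF assms(4), symmetric], rule lin_sum[OF assms(1) R.vs_axioms])
       (rule proj_mem[OF assms(4)])
  also have "\<dots> = (\<Sum>n | proj n x \<noteq> 0. g (proj n x))"
    by (intro sum.cong refl assms(3)[OF proj_deg[OF assms(4)]])
  also have "\<dots> = g x"
    by (subst (3) proj_sum[OF assms(4), symmetric], rule lin_sum[OF assms(2) R.vs_axioms, symmetric])
       (rule proj_mem[OF assms(4)])
  finally show ?thesis .
qed

text \<open>Glues maps given degree by degree into one map; it serves to make a projection
  homogeneous.\<close>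

definition gsum :: "(nat \<Rightarrow> 'a \<Rightarrow> 'w) \<Rightarrow> 'a \<Rightarrow> 'w::comm_monoid_add" where
  "gsum f x = (\<Sum>n | proj n x \<noteq> 0. f n (proj n x))"

lemma gsum_over:
  assumes "\<And>n. f n 0 = 0" "finite I" "{n. proj n x \<noteq> 0} \<subseteq> I"
  shows "gsum f x = (\<Sum>n\<in>I. f n (proj n x))"
  unfolding gsum_def using assms by (intro sum.mono_neutral_left) auto

lemma gsum_homog:
  assumes "\<And>n. f n 0 = 0" "x \<in> deg R n" shows "gsum f x = f n x"
proof -
  have "{m. proj m x \<noteq> 0} \<subseteq> {n}" using proj_homog[OF assms(2)] by auto
  then show ?thesis using gsum_over[of f "{n}" x, OF assms(1)] proj_homog[OF assms(2)] by simp
qed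

lemma lin_gsum:
  assumes "vs Z" and f: "\<And>n. lin R Z (f n)" shows "lin R Z (gsum f)"
proof -
  interpret Z: vs Z by fact
  note f0 = lin_0[OF f R.vs_axioms]
  show ?thesis
    unfolding lin_def
  proof (intro conjI ballI allI)
    show "gsum f ` carr R \<subseteq> carr Z"
      by (auto simp: gsum_def intro!: Z.sum_mem lin_mem[OF f] proj_mem)
  next
    fix x y assume x: "x \<in> carr R" and y: "y \<in> carr R"
    let ?I = "{n. proj n x \<noteq> 0} \<union> {n. proj n y \<noteq> 0}"
    have pl: "proj n (x + y) = proj n x + proj n y" for n by (rule lin_add[OF lin_proj0 x y])
    have "gsum f (x + y) = (\<Sum>n\<in>?I. f n (proj n (x + y)))"
      using x y by (intro gsum_over) (auto simp: f0 proj_fin pl)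
    also have "\<dots> = (\<Sum>n\<in>?I. f n (proj n x)) + (\<Sum>n\<in>?I. f n (proj n y))"
      by (simp add: pl lin_add[OF f] proj_mem x y sum.distrib)
    also have "\<dots> = gsum f x + gsum f y"
      using x y by (subst (1 2) gsum_over) (auto simp: f0 proj_fin)
    finally show "gsum f (x + y) = gsum f x + gsum f y" .
  next
    fix c x assume x: "x \<in> carr R"
    let ?I = "{n. proj n x \<noteq> 0}"
    have pl: "proj n (scl R c x) = scl R c (proj n x)" for n by (rule lin_scl[OF lin_proj0 x])
    have "gsum f (scl R c x) = (\<Sum>n\<in>?I. f n (proj n (scl R c x)))"
      using x by (intro gsum_over) (auto simp: f0 proj_fin pl)
    also have "\<dots> = scl Z c (\<Sum>n\<in>?I. f n (proj n x))"
      by (simp add: pl lin_scl[OF f] proj_mem x Z.VS.scale_sum_right)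
    finally show "gsum f (scl R c x) = scl Z c (gsum f x)" by (simp add: gsum_def)
  qed
qed

lemma proj0: assumes "x \<in> carr R" shows "proj 0 x = scl R (eps R x) (unit R)"
proof (rule lin_eq_homog[OF _ _ _ assms, of R])
  fix n x assume x: "x \<in> deg R n"
  show "proj 0 x = scl R (eps R x) (unit R)"
  proof (cases "n = 0")
    case True
    then obtain c where c: "x = scl R c (unit R)" using x connected by auto
    have "eps R x = c" unfolding c using lin_scl[of R kk "eps R" "unit R" c] R.unit_carr R.eps_unit
      by (simp add: lins)
    then show ?thesis using x True c by (simp add: proj_homog)
  qed (use x in \<open>simp add: proj_homog deg_eps\<close>)
qed (intro lins mems)+

lemma unit_nz: "unit R \<noteq> 0"
  using R.eps_unit lin_0[of R kk "eps R"] by (auto simp: lins)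

section \<open>Homogeneous components of coproduct and coaction\<close>

lemma deg_cop_list:
  assumes "x \<in> deg R n"
  obtains s where "set s \<subseteq> (\<Union>i\<le>n. deg R i \<times> deg R (n - i))" "teq R R (cop R x) s"
  using deg_cop[OF assms] by (auto simp: in_tensor_def)

text \<open>Only the tensor is known to be homogeneous; the chosen list \<open>cop R x\<close> may
  consist of inhomogeneous pairs. Inserting the projections makes it legitimate to treat the two
  legs as having degrees \<open>i\<close> and \<open>n - i\<close>.\<close>

lemma cop_homog:
  assumes x: "x \<in> deg R n" and B: "bilin R R Z B" and Z: "vs Z"
  shows "tsum (cop R x) B = (\<Sum>i\<le>n. tsum (cop R x) (\<lambda>a b. B (proj i a) (proj (n - i) b)))"
proof -
  interpret Z: vs Z by fact
  note [lins] = Z bilinD(1,2)[OF B]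
  obtain s where s: "set s \<subseteq> (\<Union>i\<le>n. deg R i \<times> deg R (n - i))" "teq R R (cop R x) s"
    by (rule deg_cop_list[OF x])
  have b: "bilin R R Z (\<lambda>a b. \<Sum>i\<le>n. B (proj i a) (proj (n - i) b))"
    by (intro bilinI lins mems)
  have "tsum (cop R x) B = tsum s B" by (rule teq_tsum[OF s(2) B Z])
  also have "\<dots> = tsum s (\<lambda>a b. \<Sum>i\<le>n. B (proj i a) (proj (n - i) b))"
  proof (rule tsum_cong[OF refl])
    fix a b assume "(a, b) \<in> set s"
    then obtain i where i: "i \<le> n" "a \<in> deg R i" "b \<in> deg R (n - i)" using s(1) by auto
    have b0: "B 0 y = 0" if "y \<in> carr R" for y
      using lin_0[of R Z "\<lambda>x. B x y"] that B by (auto simp: bilin_def R.vs_axioms)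
    have "(\<Sum>j\<le>n. B (proj j a) (proj (n - j) b)) = (\<Sum>j\<in>{i}. B (proj j a) (proj (n - j) b))"
      using i by (intro sum.mono_neutral_right) (auto simp: proj_homog[OF i(2)] b0 proj_mem deg_mem)
    then show "B a b = (\<Sum>j\<le>n. B (proj j a) (proj (n - j) b))"
      using i by (simp add: proj_homog)
  qed
  also have "\<dots> = tsum (cop R x) (\<lambda>a b. \<Sum>i\<le>n. B (proj i a) (proj (n - i) b))"
    by (rule teq_tsum[OF s(2) b Z, symmetric])
  finally show ?thesis by (simp add: tsum_sum)
qed

text \<open>By connectedness \<open>proj 0\<close> is the counit times the unit, so the counit
  axioms turn the summands with \<open>i = 0\<close> and \<open>i = n\<close> into 1 \<otimes> x and
  x \<otimes> 1.\<close>

lemma cop_split: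
  assumes x: "x \<in> deg R n" and n: "n > 0" and B: "bilin R R Z B" and Z: "vs Z"
  shows "tsum (cop R x) B = B (unit R) x + B x (unit R) +
    (\<Sum>i\<in>{0<..<n}. tsum (cop R x) (\<lambda>a b. B (proj i a) (proj (n - i) b)))"
proof -
  note [lins] = Z bilinD(1,2)[OF B]
  note xc = deg_mem[OF x]
  have "{..n} = insert 0 (insert n {0<..<n})" using n by auto
  then have "tsum (cop R x) B = tsum (cop R x) (\<lambda>a b. B (proj 0 a) (proj n b)) +
      tsum (cop R x) (\<lambda>a b. B (proj n a) (proj 0 b)) +
      (\<Sum>i\<in>{0<..<n}. tsum (cop R x) (\<lambda>a b. B (proj i a) (proj (n - i) b)))"
    using n by (simp add: cop_homog[OF x B Z] algebra_simps)
  also have "tsum (cop R x) (\<lambda>a b. B (proj 0 a) (proj n b)) =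
      tsum (cop R x) (\<lambda>a b. scl Z (eps R a) (B (unit R) (proj n b)))"
    using B by (intro R.cop_cong xc) (simp add: proj0 bilin_def lin_def R.unit_carr proj_mem)
  also have "\<dots> = B (unit R) (proj n x)"
    by (rule R.eps_cop_left[OF xc]) (intro lins mems)
  also have "proj n x = x" using x by (simp add: proj_homog)
  also have "tsum (cop R x) (\<lambda>a b. B (proj n a) (proj 0 b)) =
      tsum (cop R x) (\<lambda>a b. scl Z (eps R b) (B (proj n a) (unit R)))"
    using B by (intro R.cop_cong xc) (simp add: proj0 bilin_def lin_def R.unit_carr proj_mem)
  also have "\<dots> = B (proj n x) (unit R)"
    by (rule R.eps_cop_right[OF xc]) (intro lins mems)
  also have "proj n x = x" using x by (simp add: proj_homog)
  finally show ?thesis .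
qed

lemma hcoact_homog:
  assumes x: "x \<in> deg R n" and B: "bilin K R Z B" and Z: "vs Z"
  shows "tsum (hcoact R x) B = tsum (hcoact R x) (\<lambda>h w. B h (proj n w))"
proof -
  note [lins] = Z bilinD(1,2)[OF B]
  obtain s where s: "set s \<subseteq> carr K \<times> deg R n" "teq K R (hcoact R x) s"
    using deg_coact[OF x] by (auto simp: in_tensor_def)
  have b: "bilin K R Z (\<lambda>h w. B h (proj n w))"
    by (intro bilinI lins mems)
  have "tsum (hcoact R x) B = tsum s B" by (rule teq_tsum[OF s(2) B Z])
  also have "\<dots> = tsum s (\<lambda>h w. B h (proj n w))"
    using s(1) by (intro tsum_cong[OF refl]) (auto simp: proj_homog)
  also have "\<dots> = tsum (hcoact R x) (\<lambda>h w. B h (proj n w))"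
    by (rule teq_tsum[OF s(2) b Z, symmetric])
  finally show ?thesis .
qed

section \<open>Primitive elements\<close>

lemma prim_iff: "x \<in> primitives R \<longleftrightarrow> x \<in> carr R \<and> teq R R (cop R x) [(x, unit R), (unit R, x)]"
  by (simp add: primitives_def)

lemma prim_tsum:
  assumes "x \<in> primitives R" "bilin R R Z B" "vs Z"
  shows "tsum (cop R x) B = B x (unit R) + B (unit R) x"
  using teq_tsum[OF _ assms(2,3), of "cop R x" "[(x, unit R), (unit R, x)]"] assms(1)
  by (simp add: prim_iff)

lemma deg_1_prim: assumes x: "x \<in> deg R 1" shows "x \<in> primitives R"
  unfolding prim_iff teq_iff
proof (intro conjI allI impI)
  fix \<beta> assume B: "bilin R R kk \<beta>"
  have e: "{0<..<Suc 0} = {}" by auto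
  show "tsum (cop R x) \<beta> = tsum [(x, unit R), (unit R, x)] \<beta>"
    using cop_split[OF x _ B vs_kk] by (simp add: e add.commute)
qed (rule deg_mem[OF x])

text \<open>Applying the counit to both legs of x \<otimes> 1 + 1 \<otimes> x shows that
  \<open>eps R x\<close> equals twice itself.\<close>

lemma prim_eps: assumes x: "x \<in> primitives R" shows "eps R x = 0"
proof -
  have xc: "x \<in> carr R" using x by (simp add: prim_iff)
  have "eps R x = tsum (cop R x) (\<lambda>a b. eps R a * eps R b)"
    using R.eps_cop_left[OF xc, of kk "eps R"] by (simp add: lins)
  also have "\<dots> = eps R x * eps R (unit R) + eps R (unit R) * eps R x"
    by (rule prim_tsum[OF x, of kk]) (intro bilinI lins)+
  finally have "eps R x = eps R x + eps R x" by (simp only: R.eps_unit mult_1_left mult_1_right)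
  then show ?thesis by (metis add_cancel_left_right)
qed

text \<open>By \<open>cop_split\<close> a homogeneous element of positive degree is primitive once
  the components of its coproduct of bidegree (i, n - i) with 0 < i < n vanish, and this may be
  tested with any separating families. The families are coordinate forms in the proof of local
  finiteness and elements of the dual in \<open>dual_generated\<close>.\<close>

lemma prim_criterion:
  assumes x: "x \<in> deg R n" and n: "n > 0"
    and Q: "\<And>i q. 0 < i \<Longrightarrow> i < n \<Longrightarrow> q \<in> Q i \<Longrightarrow> lin R kk q"
    and sep: "\<And>i d. 0 < i \<Longrightarrow> i < n \<Longrightarrow> d \<in> deg R i \<Longrightarrow> (\<And>q. q \<in> Q i \<Longrightarrow> q d = 0) \<Longrightarrow> d = 0"
    and hyp: "\<And>i q q'. 0 < i \<Longrightarrow> i < n \<Longrightarrow> q \<in> Q i \<Longrightarrow> q' \<in> Q (n - i) \<Longrightarrow>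
      tsum (cop R x) (\<lambda>a b. q (proj i a) * q' (proj (n - i) b)) = 0"
  shows "x \<in> primitives R"
proof -
  define P where "P = {(\<lambda>x. \<phi> (proj j x)) | j \<phi>. lin R kk \<phi> \<and> (0 < j \<and> j < n \<longrightarrow> \<phi> \<in> Q j)}"
  interpret S: separated R P
  proof unfold_locales
    fix d assume d: "d \<in> carr R" and z: "\<And>q. q \<in> P \<Longrightarrow> q d = 0"
    have "proj j d = 0" for j
    proof (cases "0 < j \<and> j < n")
      case True
      have "q (proj j d) = 0" if "q \<in> Q j" for q
        using True that Q[of j q] z[of "\<lambda>x. q (proj j x)"] by (auto simp: P_def)
      then show ?thesis using True by (intro sep[of j] proj_deg d) auto
    next
      case False
      then have z': "\<phi> (proj j d) = 0" if "lin R kk \<phi>" for \<phi> using z that by (auto simp: P_def)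
      show ?thesis
      proof (rule vs_separate[OF R.vs_axioms])
        fix f assume f: "Vector_Spaces.linear (scl R) (*) f"
        then show "f (proj j d) = f 0" using z'[OF linear_lin[OF f]] lin_0[OF linear_lin[OF f] R.vs_axioms] by simp
      qed
    qed
    then show "d = 0" using proj_sum[OF d] by simp
  qed (auto simp: P_def intro!: lin_comp[where Y=R] lins)
  have "teq R R (cop R x) [(x, unit R), (unit R, x)]"
  proof (rule S.teq_sep2)
    show "set (cop R x) \<subseteq> carr R \<times> carr R" by (rule R.cop_mem[OF deg_mem[OF x]])
    show "set [(x, unit R), (unit R, x)] \<subseteq> carr R \<times> carr R" using deg_mem[OF x] R.unit_carr by simp
  next
    fix q q' assume "q \<in> P" "q' \<in> P"
    then obtain j \<phi> k \<psi> where q: "q = (\<lambda>x. \<phi> (proj j x))" "lin R kk \<phi>" "0 < j \<and> j < n \<longrightarrow> \<phi> \<in> Q j"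
      and q': "q' = (\<lambda>x. \<psi> (proj k x))" "lin R kk \<psi>" "0 < k \<and> k < n \<longrightarrow> \<psi> \<in> Q k"
      by (auto simp: P_def)
    have l: "lin R kk q" "lin R kk q'" unfolding q(1) q'(1)
      by (intro lin_comp[OF q(2)] lin_comp[OF q'(2)] lins)+
    have z: "\<phi> 0 = 0" "\<psi> 0 = 0" using lin_0 q(2) q'(2) R.vs_axioms by blast+
    have "tsum (cop R x) (\<lambda>a b. q (proj i a) * q' (proj (n - i) b)) = 0" if "i \<in> {0<..<n}" for i
    proof (cases "i = j \<and> k = n - i")
      case True
      then have "tsum (cop R x) (\<lambda>a b. q (proj i a) * q' (proj (n - i) b)) =
          tsum (cop R x) (\<lambda>a b. \<phi> (proj i a) * \<psi> (proj (n - i) b))"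
        by (intro R.cop_cong deg_mem[OF x]) (simp add: q q')
      also have "\<dots> = 0" using True that q(3) q'(3) by (intro hyp) auto
      finally show ?thesis .
    next
      case False
      then have "tsum (cop R x) (\<lambda>a b. q (proj i a) * q' (proj (n - i) b)) = tsum (cop R x) (\<lambda>a b. 0)"
        by (intro R.cop_cong deg_mem[OF x]) (auto simp: q q' z)
      then show ?thesis by simp
    qed
    moreover have "bilin R R kk (\<lambda>a b. q a * q' b)"
      by (intro bilinI lins lin_comp[OF l(1)] lin_comp[OF l(2)])
    ultimately show "tsum (cop R x) (\<lambda>d e. q d * q' e) = tsum [(x, unit R), (unit R, x)] (\<lambda>d e. q d * q' e)"
      by (subst cop_split[OF x n _ vs_kk]) (auto simp: algebra_simps)
  qed
  then show ?thesis using deg_mem[OF x] by (simp add: prim_iff)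
qed

lemma span_deg_01: "x \<in> R.VS.span (deg R 0 \<union> deg R 1) \<Longrightarrow> x = proj 0 x + proj 1 x \<and> x \<in> carr R"
proof (induction rule: R.VS.span_induct_alt)
  case base
  then show ?case using lin_0[OF lin_proj0 R.vs_axioms] by (simp add: R.zero_mem)
next
  case (step c x y)
  have x: "x \<in> carr R" using step(1) deg_mem by blast
  have y: "y = proj 0 y + proj 1 y" "y \<in> carr R" using step by auto
  have "proj 0 (scl R c x + y) + proj 1 (scl R c x + y) =
      scl R c (proj 0 x + proj 1 x) + (proj 0 y + proj 1 y)"
    using x y(2) by (simp add: lin_add[OF lin_proj0] lin_scl[OF lin_proj0] R.scl_mem R.VS.scale_right_distrib)
  also have "proj 0 x + proj 1 x = x" using step(1) by (auto simp: proj_homog)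
  finally show ?case using x y by (simp add: R.scl_mem R.add_mem)
qed

text \<open>The coproduct x \<otimes> 1 + 1 \<otimes> x of a primitive element puts it into the
  first term of the coradical filtration, which is the sum of the components of degrees 0 and 1; its
  component of degree 0 vanishes because its counit does.\<close>

lemma coradically_graded_primitives:
  assumes "coradically_graded R" shows "primitives R = deg R 1"
proof
  have fil: "coradical_filtration R n = R.VS.span (\<Union>i\<le>n. deg R i)" for n
    using assms by (auto simp: coradically_graded_def)
  have c0: "coradical R = deg R 0"
    using fil[of 0] deg_subspace[of 0] by (simp add: R.VS.span_eq_iff)
  have "{..Suc 0} = {0, 1}" by auto
  then have f1: "coradical_filtration R (Suc 0) = R.VS.span (deg R 0 \<union> deg R 1)"
    unfolding fil by simp
  show "primitives R \<subseteq> deg R 1"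
  proof
    fix x assume x: "x \<in> primitives R"
    then have xc: "x \<in> carr R" and t: "teq R R (cop R x) [(x, unit R), (unit R, x)]"
      by (auto simp: prim_iff)
    have "in_tensor R R (carr R \<times> coradical R \<union> coradical R \<times> carr R) (cop R x)"
      unfolding in_tensor_def using xc deg_unit c0 t
      by (intro exI[of _ "[(x, unit R), (unit R, x)]"]) auto
    then have "x \<in> coradical_filtration R (Suc 0)" using xc by simp
    then have "x \<in> R.VS.span (deg R 0 \<union> deg R 1)" unfolding f1 .
    then have "x = proj 0 x + proj 1 x" using span_deg_01 by blast
    also have "proj 0 x = 0" by (simp add: proj0 xc prim_eps[OF x])
    finally show "x \<in> deg R 1" using proj_deg[OF xc, of 1] by simp
  qed
  show "deg R 1 \<subseteq> primitives R" using deg_1_prim by auto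
qed

end

section \<open>Local finiteness\<close>

lemma (in vs) finite_dim_of_separating_forms:
  assumes "finite \<Phi>" "\<And>\<phi>. \<phi> \<in> \<Phi> \<Longrightarrow> lin X kk \<phi>" "VS.subspace U" "U \<subseteq> carr X"
    "\<And>u. u \<in> U \<Longrightarrow> (\<And>\<phi>. \<phi> \<in> \<Phi> \<Longrightarrow> \<phi> u = 0) \<Longrightarrow> u = 0"
  shows "\<exists>F. finite F \<and> U = VS.span F"
  using assms
proof (induction \<Phi> arbitrary: U rule: finite_induct)
  case empty
  then have "U = {0}" using VS.subspace_0 by auto
  then show ?case by (intro exI[of _ "{}"]) simp
next
  case (insert \<phi> \<Phi>)
  have l: "lin X kk \<phi>" using insert.prems by auto
  \<comment> \<open>The kernel of a single form has codimension at most one, and the remaining forms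
    separate its points.\<close>
  let ?U = "{u \<in> U. \<phi> u = 0}"
  have "VS.subspace ?U"
    using insert.prems(2,3) lin_0[OF l vs_axioms]
    by (auto simp: VS.subspace_def lin_add[OF l] lin_scl[OF l] subset_iff)
  then have "\<exists>F. finite F \<and> ?U = VS.span F"
    using insert.prems(1,3,4) by (intro insert.IH) blast+
  then obtain F where F: "finite F" "?U = VS.span F" by blast
  show ?case
  proof (cases "\<exists>u\<in>U. \<phi> u \<noteq> 0")
    case False
    then have "?U = U" by auto
    then show ?thesis using F by auto
  next
    case True
    then obtain u0 where u0: "u0 \<in> U" "\<phi> u0 \<noteq> 0" by auto
    have "U = VS.span (insert u0 F)"
    proof
      show "VS.span (insert u0 F) \<subseteq> U"
        using F(2) u0 insert.prems(2) VS.span_superset[of F] by (intro VS.span_minimal) auto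
      show "U \<subseteq> VS.span (insert u0 F)"
      proof
        fix u assume u: "u \<in> U"
        let ?w = "u - scl X (\<phi> u / \<phi> u0) u0"
        have "?w \<in> U" using u u0 insert.prems(2) by (intro VS.subspace_diff VS.subspace_scale)
        moreover have "\<phi> ?w = 0"
          using u u0 insert.prems(3) by (subst lin_diff[OF l vs_axioms]) (auto simp: lin_scl[OF l] scl_mem subset_iff)
        ultimately have "?w \<in> VS.span F" using F(2) by auto
        then have "?w \<in> VS.span (insert u0 F)" using VS.span_mono[of F "insert u0 F"] by auto
        from VS.span_add[OF this VS.span_scale[OF VS.span_base[of u0 "insert u0 F"], of "\<phi> u / \<phi> u0"]]
        show "u \<in> VS.span (insert u0 F)" by simp
      qed
    qed
    then show ?thesis using F(1) by (intro exI[of _ "insert u0 F"]) simp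
  qed
qed

lemma (in vs) finite_basis:
  assumes "finite F" "U = VS.span F"
  shows "\<exists>B. finite B \<and> VS.independent B \<and> VS.span B = U"
proof -
  obtain B where B: "B \<subseteq> F" "VS.independent B" "F \<subseteq> VS.span B"
    by (rule VS.maximal_independent_subset)
  have "VS.span B = U" unfolding assms(2)
    using B VS.span_mono[OF B(1)] VS.span_minimal[OF B(3) VS.subspace_span] by auto
  then show ?thesis using B finite_subset[OF B(1) assms(1)] by blast
qed

lemma (in vs) lin_representation:
  assumes B: "VS.independent B" and f: "lin Y X f" "\<And>y. y \<in> carr Y \<Longrightarrow> f y \<in> VS.span B"
  shows "lin Y kk (\<lambda>y. VS.representation B (f y) b)"
  using f by (auto simp: lin_def VS.representation_add[OF B] VS.representation_scale[OF B])

context graded_connected_hopf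
begin

text \<open>For n \<ge> 2 the middle components of the coproduct are jointly injective on degree
  \<open>n\<close>: their common kernel consists of primitive elements, which live in degree one.
  They take values in tensor products of components of lower degree, which are finite-dimensional by
  induction.\<close>

lemma locally_finite_if_primitives:
  assumes prim: "primitives R = deg R 1" and one: "\<exists>F. finite F \<and> deg R 1 = R.VS.span F"
  shows "\<exists>F. finite F \<and> deg R n = R.VS.span F"
proof (induction n rule: less_induct)
  case (less n)
  consider "n = 0" | "n = 1" | "n \<ge> 2" by linarith
  then show ?case
  proof cases
    case 1
    have "deg R 0 = R.VS.span {unit R}" using connected by (simp add: R.VS.span_singleton)
    then show ?thesis using 1 by (intro exI[of _ "{unit R}"]) simp
  next
    case 2
    then show ?thesis using one by simp
  next
    case 3
    have "\<forall>i\<in>{..<n}. \<exists>B. finite B \<and> R.VS.independent B \<and> R.VS.span B = deg R i"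
      using less.IH R.finite_basis by (metis lessThan_iff)
    then obtain B where B: "\<And>i. i < n \<Longrightarrow> finite (B i) \<and> R.VS.independent (B i) \<and> R.VS.span (B i) = deg R i"
      by (metis lessThan_iff)
    define q where "q i b x = R.VS.representation (B i) (proj i x) b" for i b x
    have ql: "lin R kk (q i b)" if "i < n" for i b
      unfolding q_def using B[OF that] by (intro R.lin_representation lins) (auto intro: proj_deg)
    define Q where "Q i = q i ` B i" for i
    \<comment> \<open>The coordinates of the middle components of the coproduct in the bases already
      chosen: finitely many forms.\<close>
    define \<Phi> where "\<Phi> = (\<lambda>(i, b, b') x. tsum (cop R x) (\<lambda>u v. q i b (proj i u) * q (n - i) b' (proj (n - i) v))) `
       (SIGMA i:{0<..<n}. B i \<times> B (n - i))"
    show ?thesis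
    proof (rule R.finite_dim_of_separating_forms[of \<Phi>])
      show "finite \<Phi>" unfolding \<Phi>_def using B by (intro finite_imageI finite_SigmaI finite_cartesian_product) auto
    next
      fix \<phi> assume "\<phi> \<in> \<Phi>"
      then obtain i b b' where i: "0 < i" "i < n" and ph: "\<phi> = (\<lambda>x. tsum (cop R x) (\<lambda>u v. q i b (proj i u) * q (n - i) b' (proj (n - i) v)))"
        by (auto simp: \<Phi>_def)
      show "lin R kk \<phi>" unfolding ph using i
        by (intro lins lin_comp[OF ql, of i] lin_comp[OF ql, of "n - i"]) auto
    next
      fix x assume x: "x \<in> deg R n" and z: "\<And>\<phi>. \<phi> \<in> \<Phi> \<Longrightarrow> \<phi> x = 0"
      have "x \<in> primitives R"
      proof (rule prim_criterion[OF x, of Q])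
        fix i d assume i: "0 < i" "i < n" and d: "d \<in> deg R i" and zz: "\<And>q. q \<in> Q i \<Longrightarrow> q d = 0"
        have "d = (\<Sum>b\<in>B i. scl R (R.VS.representation (B i) d b) b)"
          using B[OF i(2)] d by (intro R.VS.sum_representation_eq[symmetric]) auto
        also have "\<dots> = 0"
        proof (intro sum.neutral ballI)
          fix b assume "b \<in> B i"
          then have "q i b d = 0" using zz by (auto simp: Q_def)
          then show "scl R (R.VS.representation (B i) d b) b = 0" using d by (simp add: q_def proj_homog)
        qed
        finally show "d = 0" .
      next
        fix i q1 q2 assume i: "0 < i" "i < n" and "q1 \<in> Q i" "q2 \<in> Q (n - i)"
        then show "tsum (cop R x) (\<lambda>a b. q1 (proj i a) * q2 (proj (n - i) b)) = 0"
          using z by (force simp: Q_def \<Phi>_def)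
      qed (use 3 ql in \<open>auto simp: Q_def\<close>)
      then have "x \<in> deg R 1" using prim by simp
      then have "proj n x = 0" using 3 proj_homog[of x 1 n] by simp
      then show "x = 0" using x by (simp add: proj_homog)
    qed (use deg_subspace in auto)
  qed
qed

end

section \<open>Graded Hopf subalgebras\<close>

context graded_connected_hopf
begin

text \<open>Take any linear projection onto \<open>S\<close> and, on elements of degree
  \<open>n\<close>, keep only the component of degree \<open>n\<close> of its value. The result
  stays in \<open>S\<close> because \<open>S\<close> is graded, and still fixes
  \<open>S\<close>.\<close>

lemma graded_projection_exists:
  assumes S: "S \<subseteq> carr R" "R.VS.subspace S" and gr: "\<And>x n. x \<in> S \<Longrightarrow> proj n x \<in> S"
  shows "\<exists>P. lin R R P \<and> (\<forall>x\<in>carr R. P x \<in> S) \<and> (\<forall>x\<in>S. P x = x) \<and> (\<forall>n. \<forall>x\<in>deg R n. P x \<in> deg R n)"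
proof -
  interpret vector_space_pair "scl R" "scl R"
    by (simp add: vector_space_pair_def R.VS.vector_space_axioms)
  have "Vector_Spaces.linear (scl R) (scl R) (\<lambda>x. x)"
    by (rule R.VS.linear_ident)
  from linear_exists_left_inverse_on[OF this S(2)]
  obtain P0 where P0: "P0 ` UNIV \<subseteq> S" "Vector_Spaces.linear (scl R) (scl R) P0" "\<And>v. v \<in> S \<Longrightarrow> P0 v = v"
    by auto
  interpret P0: Vector_Spaces.linear "scl R" "scl R" P0 by fact
  have l0: "lin R R P0" using P0(1) S(1) by (auto simp: lin_def P0.add P0.scale)
  define f where "f n x = proj n (P0 x)" for n x
  have lf: "lin R R (f n)" for n unfolding f_def by (intro lins l0)
  have f0: "f n 0 = 0" for n using lin_0[OF lf R.vs_axioms] .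
  have h: "gsum f x = proj n (P0 x)" if "x \<in> deg R n" for x n
    using gsum_homog[of f, OF f0 that] by (simp add: f_def)
  show ?thesis
  proof (intro exI conjI ballI allI)
    show "lin R R (gsum f)" by (intro lin_gsum lf R.vs_axioms)
  next
    fix x assume "x \<in> carr R"
    show "gsum f x \<in> S" unfolding gsum_def f_def using P0(1) gr by (intro R.VS.subspace_sum[OF S(2)]) auto
  next
    fix x assume x: "x \<in> S"
    have "gsum f x = (\<Sum>n | proj n x \<noteq> 0. proj n x)"
      unfolding gsum_def f_def using x S by (intro sum.cong refl) (simp add: P0(3) gr subset_iff)
    then show "gsum f x = x" using proj_sum x S by auto
  next
    fix n x assume "x \<in> deg R n"
    moreover have "P0 x \<in> carr R" using P0(1) S(1) by auto
    ultimately show "gsum f x \<in> deg R n" using h by (simp add: proj_deg)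
  qed
qed

end

text \<open>The projection \<open>P\<close> expresses that coaction and coproduct of
  \<open>x\<close> lie in K \<otimes> S and S \<otimes> S without mentioning representatives:
  applying \<open>P\<close> to the legs does not change the tensor. Stability under the antipode is
  derived, not assumed.\<close>

locale sub_hopf = graded_connected_hopf K R
  for K :: "('k::field, 'h::ab_group_add, 'y) hopf_scheme"
    and R :: "('k, 'h, 'a::ab_group_add, 'z) yd_hopf_scheme" +
  fixes S :: "'a set" and P :: "'a \<Rightarrow> 'a"
  assumes S_carr: "S \<subseteq> carr R" and S_subspace: "R.VS.subspace S"
    and P_lin: "lin R R P"
    and P_mem: "x \<in> carr R \<Longrightarrow> P x \<in> S"
    and P_id: "x \<in> S \<Longrightarrow> P x = x"
    and P_deg: "x \<in> deg R n \<Longrightarrow> P x \<in> deg R n"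
    and S_unit: "unit R \<in> S"
    and S_mul: "x \<in> S \<Longrightarrow> y \<in> S \<Longrightarrow> mul R x y \<in> S"
    and S_act: "h \<in> carr K \<Longrightarrow> x \<in> S \<Longrightarrow> hact R h x \<in> S"
    and S_coact: "x \<in> S \<Longrightarrow> bilin K R kk \<beta> \<Longrightarrow>
      tsum (hcoact R x) \<beta> = tsum (hcoact R x) (\<lambda>h w. \<beta> h (P w))"
    and S_cop: "x \<in> S \<Longrightarrow> bilin R R kk \<gamma> \<Longrightarrow>
      tsum (cop R x) \<gamma> = tsum (cop R x) (\<lambda>a b. \<gamma> (P a) (P b))"
begin

text \<open>The lists \<open>cop R x\<close> and \<open>hcoact R x\<close> may have entries outside
  \<open>S\<close>; their images under \<open>P\<close> represent the same tensors with entries in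
  \<open>S\<close>.\<close>

definition sub :: "('k, 'h, 'a, 'z) yd_hopf_scheme" where
  "sub = R\<lparr>carr := S, cop := \<lambda>x. map (\<lambda>(a, b). (P a, P b)) (cop R x),
     hcoact := \<lambda>x. map (\<lambda>(h, w). (h, P w)) (hcoact R x), deg := \<lambda>n. deg R n \<inter> S\<rparr>"

lemma sub_sel [simp]: "carr sub = S" "scl sub = scl R" "mul sub = mul R" "unit sub = unit R"
  "eps sub = eps R" "antip sub = antip R" "hact sub = hact R" "deg sub n = deg R n \<inter> S"
  by (simp_all add: sub_def)

lemma cop_sub: "cop sub x = map (\<lambda>(a, b). (P a, P b)) (cop R x)"
  and hcoact_sub: "hcoact sub x = map (\<lambda>(h, w). (h, P w)) (hcoact R x)"
  by (simp_all add: sub_def)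

lemma S_mem: "x \<in> S \<Longrightarrow> x \<in> carr R" using S_carr by auto

lemma vs_sub: "vs sub"
  unfolding vs_def using R.ambient S_subspace by simp

sublocale SV: vs sub by (rule vs_sub)

lemma lin_subI: "lin R Z f \<Longrightarrow> lin sub Z f"
  using S_carr by (auto simp: lin_def)

text \<open>Maps on \<open>S\<close> extend to \<open>R\<close> by precomposition with
  \<open>P\<close>. The lifting rules below do this in each slot, which makes the axioms of
  \<open>R\<close> available for the verification of those of \<open>sub\<close>.\<close>

lemma lin_subD: "lin sub Z f \<Longrightarrow> lin R Z (\<lambda>x. f (P x))"
  by (rule lin_comp[of sub]) (use P_lin P_mem in \<open>auto simp: lin_def\<close>)

lemma P_lift: "bilin sub sub Z B \<Longrightarrow> bilin R R Z (\<lambda>a b. B (P a) (P b))"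
  by (auto simp: bilin_def P_mem intro: lin_subD[of Z "\<lambda>x. B x _"] lin_subD[of Z "B _"])

lemma P_liftK: "bilin K sub Z B \<Longrightarrow> bilin K R Z (\<lambda>h b. B h (P b))"
  by (auto simp: bilin_def P_mem intro: lin_subD[of Z "B _"])

lemma P_lift3: "trilin sub sub sub Z B \<Longrightarrow> trilin R R R Z (\<lambda>a b c. B (P a) (P b) (P c))"
  by (auto simp: trilin_def P_mem intro: lin_subD[of Z "\<lambda>x. B x _ _"] lin_subD[of Z "\<lambda>x. B _ x _"] lin_subD[of Z "B _ _"])

lemma P_lift3K: "trilin K sub sub Z B \<Longrightarrow> trilin K R R Z (\<lambda>a b c. B a (P b) (P c))"
  by (auto simp: trilin_def P_mem intro: lin_subD[of Z "\<lambda>x. B _ x _"] lin_subD[of Z "B _ _"])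

lemma P_lift3KK: "trilin K K sub Z B \<Longrightarrow> trilin K K R Z (\<lambda>a b c. B a b (P c))"
  by (auto simp: trilin_def P_mem intro: lin_subD[of Z "B _ _"])

lemma bilin_subI: "bilin R R Z B \<Longrightarrow> bilin sub sub Z B"
  using S_carr by (auto simp: bilin_def intro: lin_subI)

lemma cop_sub_mem: "x \<in> S \<Longrightarrow> set (cop sub x) \<subseteq> S \<times> S"
  using R.cop_mem[OF S_mem, of x] by (auto simp: cop_sub intro!: P_mem)

lemma hcoact_sub_mem: "x \<in> S \<Longrightarrow> set (hcoact sub x) \<subseteq> carr K \<times> S"
  using hcoact_mem[OF S_mem, of x] by (auto simp: hcoact_sub intro!: P_mem)

lemma cop_sub_cong:
  "x \<in> S \<Longrightarrow> (\<And>a b. a \<in> S \<Longrightarrow> b \<in> S \<Longrightarrow> f a b = g a b) \<Longrightarrow> tsum (cop sub x) f = tsum (cop sub x) g"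
  by (rule tsum_congC[OF cop_sub_mem])

lemma hcoact_sub_cong:
  "x \<in> S \<Longrightarrow> (\<And>a b. a \<in> carr K \<Longrightarrow> b \<in> S \<Longrightarrow> f a b = g a b) \<Longrightarrow> tsum (hcoact sub x) f = tsum (hcoact sub x) g"
  by (rule tsum_congC[OF hcoact_sub_mem])

lemma cop_sub_tsum:
  assumes "x \<in> S" "bilin R R Z B" "vs Z" shows "tsum (cop sub x) B = tsum (cop R x) B"
proof -
  have "teq R R (cop sub x) (cop R x)"
    using S_cop[OF assms(1)] by (simp add: teq_iff cop_sub)
  from teq_tsum[OF this assms(2,3)] show ?thesis .
qed

lemma hcoact_sub_tsum:
  assumes "x \<in> S" "bilin K R Z B" "vs Z" shows "tsum (hcoact sub x) B = tsum (hcoact R x) B"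
proof -
  have "teq K R (hcoact sub x) (hcoact R x)"
    using S_coact[OF assms(1)] by (simp add: teq_iff hcoact_sub)
  from teq_tsum[OF this assms(2,3)] show ?thesis .
qed

lemma P_proj: assumes "x \<in> carr R" shows "proj n (P x) = P (proj n x)"
proof -
  have "P x = (\<Sum>m | proj m x \<noteq> 0. P (proj m x))"
    by (subst (1) proj_sum[OF assms, symmetric], rule lin_sum[OF P_lin R.vs_axioms]) (rule proj_mem[OF assms])
  then show ?thesis
    by (intro proj_unique[where I="{m. proj m x \<noteq> 0}"])
       (use assms lin_0[OF P_lin R.vs_axioms] in \<open>auto simp: proj_fin intro: P_deg proj_deg\<close>)
qed

lemma S_graded: assumes x: "x \<in> S" shows "proj n x \<in> S"
proof -
  have "P (proj n x) = proj n x" unfolding P_proj[OF S_mem[OF x], symmetric] P_id[OF x] ..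
  then show ?thesis using P_mem[OF proj_mem[OF S_mem[OF x], of n]] by simp
qed

text \<open>In a connected graded Hopf algebra the antipode is determined recursively: for n > 0 the
  antipode axiom and \<open>cop_split\<close> give S(x) = -x minus a sum of products S(x')x'' with
  x' of smaller positive degree. Induction on the degree keeps all these terms in the
  subalgebra.\<close>

lemma S_antip_homog: "x \<in> deg R n \<Longrightarrow> x \<in> S \<Longrightarrow> antip R x \<in> S"
proof (induction n arbitrary: x rule: less_induct)
  case (less n)
  note xS = less.prems(2) and xn = less.prems(1)
  note xc = S_mem[OF xS]
  show ?case
  proof (cases "n = 0")
    case True
    then obtain c where c: "x = scl R c (unit R)" using xn connected by auto
    have "antip R x = x"
      unfolding c using lin_scl[OF R.antip_lin R.unit_carr] R.antip_unit by simp
    then show ?thesis using xS by simp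
  next
    case False
    let ?B = "\<lambda>a b. mul R (antip R a) b"
    have B: "bilin R R R ?B" by (intro bilinI lins mems; (assumption | erule S_mem)?)
    have "tsum (cop R x) (\<lambda>a b. ?B (proj i a) (proj (n - i) b)) \<in> S" if i: "i \<in> {0<..<n}" for i
    proof -
      have "bilin R R R (\<lambda>a b. ?B (proj i a) (proj (n - i) b))" by (intro bilinI lins mems; (assumption | erule S_mem)?)
      from cop_sub_tsum[OF xS this R.vs_axioms]
      have "tsum (cop R x) (\<lambda>a b. ?B (proj i a) (proj (n - i) b)) =
          tsum (cop sub x) (\<lambda>a b. ?B (proj i a) (proj (n - i) b))" by simp
      also have "\<dots> \<in> carr sub"
        using i cop_sub_mem[OF xS] S_carr
        by (intro SV.tsum_mem) (auto intro!: S_mul less.IH[of i] S_graded proj_deg)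
      finally show ?thesis by simp
    qed
    then have m: "(\<Sum>i\<in>{0<..<n}. tsum (cop R x) (\<lambda>a b. ?B (proj i a) (proj (n - i) b))) \<in> carr sub"
      by (intro SV.sum_mem) simp
    have "tsum (cop R x) ?B = 0"
      using R.antip_left[OF xc] deg_eps[OF xn] False by (simp add: tsum_def)
    moreover have "tsum (cop R x) ?B = x + antip R x +
       (\<Sum>i\<in>{0<..<n}. tsum (cop R x) (\<lambda>a b. ?B (proj i a) (proj (n - i) b)))"
      using cop_split[OF xn _ B R.vs_axioms] False xc
      by (simp add: R.antip_unit R.unit_left R.unit_right R.antip_mem)
    ultimately have "antip R x = - (x + (\<Sum>i\<in>{0<..<n}. tsum (cop R x) (\<lambda>a b. ?B (proj i a) (proj (n - i) b))))"
      by (simp add: eq_neg_iff_add_eq_0 algebra_simps)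
    also have "\<dots> \<in> carr sub" using m xS by (intro SV.neg_mem SV.add_mem) simp_all
    finally show ?thesis by simp
  qed
qed

lemma S_antip: assumes x: "x \<in> S" shows "antip R x \<in> S"
proof -
  note xc = S_mem[OF x]
  have "antip R x = (\<Sum>n | proj n x \<noteq> 0. antip R (proj n x))"
    by (subst (1) proj_sum[OF xc, symmetric], rule lin_sum[OF R.antip_lin R.vs_axioms]) (rule proj_mem[OF xc])
  also have "\<dots> \<in> carr sub"
    using xc x by (intro SV.sum_mem) (auto intro!: S_antip_homog proj_deg S_graded)
  finally show ?thesis by simp
qed

section \<open>The Hopf algebra axioms for the subobject\<close>

lemma sub_algebra: "algebra sub"
proof (intro algebra.intro algebra_axioms.intro vs_sub)
  fix b assume "b \<in> carr sub"
  then have b: "b \<in> S" by simp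
  show "lin sub sub (\<lambda>a. mul sub a b)" "lin sub sub (\<lambda>a. mul sub b a)"
    using R.mul_lin_left[of b] R.mul_lin_right[of b] b S_mul S_mem by (auto simp: lin_def)
qed (auto simp: S_mem S_unit R.mul_assoc R.unit_left R.unit_right)

lemma sub_coalgebra: "coalgebra sub"
proof (intro coalgebra.intro coalgebra_axioms.intro vs_sub)
  show "lin_tensor sub sub sub (cop sub)"
  proof (rule lin_tensorI)
    fix \<beta> assume b: "bilin sub sub kk \<beta>"
    have "lin R kk (\<lambda>x. tsum (cop R x) (\<lambda>a b. \<beta> (P a) (P b)))"
      by (intro lins bilinD[OF P_lift[OF b]])
    then show "lin sub kk (\<lambda>x. tsum (cop sub x) \<beta>)"
      by (intro lin_subI) (simp add: cop_sub)
  qed (use cop_sub_mem in auto)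
next
  show "lform sub (eps sub)" unfolding lform_lin using lin_subI[of kk "eps R"] by (simp add: lins)
next
  fix x assume "x \<in> carr sub"
  then have x: "x \<in> S" by simp
  show "teq3 sub sub sub [(a1, a2, b). (a, b) \<leftarrow> cop sub x, (a1, a2) \<leftarrow> cop sub a]
                 [(a, b1, b2). (a, b) \<leftarrow> cop sub x, (b1, b2) \<leftarrow> cop sub b]"
    unfolding teq3_iff
  proof (intro allI impI)
    fix \<beta> assume b: "trilin sub sub sub kk \<beta>"
    \<comment> \<open>The route taken for this and the later axioms: extend the form to
      \<open>R\<close> by inserting \<open>P\<close>, pass from the structure maps of
      \<open>sub\<close> to those of \<open>R\<close> one at a time, apply the axiom of
      \<open>R\<close>, go back and remove \<open>P\<close> by \<open>P_id\<close>.\<close>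
    let ?b = "\<lambda>a b c. \<beta> (P a) (P b) (P c)"
    note t = P_lift3[OF b]
    have "tsum (cop sub x) (\<lambda>a b. tsum (cop sub a) (\<lambda>a1 a2. \<beta> a1 a2 b)) =
        tsum (cop sub x) (\<lambda>a b. tsum (cop sub a) (\<lambda>a1 a2. ?b a1 a2 b))"
      by (intro cop_sub_cong x) (simp_all add: P_id)
    also have "\<dots> = tsum (cop sub x) (\<lambda>a b. tsum (cop R a) (\<lambda>a1 a2. ?b a1 a2 b))"
      by (intro cop_sub_cong x cop_sub_tsum[where Z=kk] vs_kk bilinI trilinD[OF t] lins mems; (assumption | erule S_mem)?)
    also have "\<dots> = tsum (cop R x) (\<lambda>a b. tsum (cop R a) (\<lambda>a1 a2. ?b a1 a2 b))"
      by (intro x cop_sub_tsum[where Z=kk] bilinI trilinD[OF t] lins mems; (assumption | erule S_mem)?)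
    also have "\<dots> = tsum (cop R x) (\<lambda>a b. tsum (cop R b) (\<lambda>b1 b2. ?b a b1 b2))"
      by (rule R.cop_assoc[OF S_mem[OF x] t vs_kk])
    also have "\<dots> = tsum (cop sub x) (\<lambda>a b. tsum (cop R b) (\<lambda>b1 b2. ?b a b1 b2))"
      by (rule cop_sub_tsum[OF x, symmetric, of kk]) (intro bilinI trilinD[OF t] lins mems; (assumption | erule S_mem)?)+
    also have "\<dots> = tsum (cop sub x) (\<lambda>a b. tsum (cop sub b) (\<lambda>b1 b2. ?b a b1 b2))"
      by (intro cop_sub_cong x cop_sub_tsum[where Z=kk, symmetric] vs_kk bilinI trilinD[OF t] lins mems; (assumption | erule S_mem)?)
    also have "\<dots> = tsum (cop sub x) (\<lambda>a b. tsum (cop sub b) (\<lambda>b1 b2. \<beta> a b1 b2))"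
      by (intro cop_sub_cong x) (simp_all add: P_id)
    finally show "tsum3 [(a1, a2, b). (a, b) \<leftarrow> cop sub x, (a1, a2) \<leftarrow> cop sub a] \<beta> =
       tsum3 [(a, b1, b2). (a, b) \<leftarrow> cop sub x, (b1, b2) \<leftarrow> cop sub b] \<beta>" by simp
  qed
next
  fix x assume "x \<in> carr sub"
  then have x: "x \<in> S" by simp
  have "tsum (cop sub x) (\<lambda>a b. scl R (eps R a) b) = tsum (cop R x) (\<lambda>a b. scl R (eps R a) b)"
    by (rule cop_sub_tsum[OF x, of R]) (intro bilinI lins mems; (assumption | erule S_mem)?)+
  then show "(\<Sum>(a, b)\<leftarrow>cop sub x. scl sub (eps sub a) b) = x"
    using R.counit_left[OF S_mem[OF x]] by (simp add: tsum_def)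
  have "tsum (cop sub x) (\<lambda>a b. scl R (eps R b) a) = tsum (cop R x) (\<lambda>a b. scl R (eps R b) a)"
    by (rule cop_sub_tsum[OF x, of R]) (intro bilinI lins mems; (assumption | erule S_mem)?)+
  then show "(\<Sum>(a, b)\<leftarrow>cop sub x. scl sub (eps sub b) a) = x"
    using R.counit_right[OF S_mem[OF x]] by (simp add: tsum_def)
qed

lemma sub_braided: "braided_hopf sub (yd_braiding sub)"
proof (intro braided_hopf.intro braided_hopf_axioms.intro sub_algebra sub_coalgebra)
  fix x y assume "x \<in> carr sub" "y \<in> carr sub"
  then have x: "x \<in> S" and y: "y \<in> S" by simp_all
  show "teq sub sub (cop sub (mul sub x y))
        [(mul sub a u, mul sub v b'). (a, b) \<leftarrow> cop sub x, (a', b') \<leftarrow> cop sub y, (u, v) \<leftarrow> yd_braiding sub b a']"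
    unfolding teq_iff
  proof (intro allI impI)
    fix \<beta> assume b: "bilin sub sub kk \<beta>"
    let ?b = "\<lambda>a b. \<beta> (P a) (P b)"
    note t = P_lift[OF b]
    note [lins] = bilinD[OF t]
    have "tsum (cop sub (mul R x y)) \<beta> = tsum (cop R (mul R x y)) ?b"
      by (simp add: cop_sub)
    also have "\<dots> = tsum (cop R x) (\<lambda>a b. tsum (cop R y) (\<lambda>a' b'.
        tsum (hcoact R b) (\<lambda>h w. ?b (mul R a (hact R h a')) (mul R w b'))))"
      by (rule cop_mul_R[OF S_mem[OF x] S_mem[OF y] t vs_kk])
    also have "\<dots> = tsum (cop sub x) (\<lambda>a b. tsum (cop R y) (\<lambda>a' b'.
        tsum (hcoact R b) (\<lambda>h w. ?b (mul R a (hact R h a')) (mul R w b'))))"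
      by (rule cop_sub_tsum[OF x, symmetric, of kk]) (intro S_mem[OF y] bilinI lins mems; (assumption | erule S_mem)?)+
    also have "\<dots> = tsum (cop sub x) (\<lambda>a b. tsum (cop sub y) (\<lambda>a' b'.
        tsum (hcoact R b) (\<lambda>h w. ?b (mul R a (hact R h a')) (mul R w b'))))"
      by (intro cop_sub_cong x y cop_sub_tsum[where Z=kk, symmetric] vs_kk bilinI lins mems; (assumption | erule S_mem)?)
    also have "\<dots> = tsum (cop sub x) (\<lambda>a b. tsum (cop sub y) (\<lambda>a' b'.
        tsum (hcoact sub b) (\<lambda>h w. ?b (mul R a (hact R h a')) (mul R w b'))))"
      by (intro cop_sub_cong x y hcoact_sub_tsum[where Z=kk, symmetric] vs_kk bilinI lins mems; (assumption | erule S_mem)?)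
    also have "\<dots> = tsum (cop sub x) (\<lambda>a b. tsum (cop sub y) (\<lambda>a' b'.
        tsum (hcoact sub b) (\<lambda>h w. \<beta> (mul R a (hact R h a')) (mul R w b'))))"
      by (intro cop_sub_cong hcoact_sub_cong x y) (simp_all add: P_id S_mul S_act)
    finally show "tsum (cop sub (mul sub x y)) \<beta> = tsum [(mul sub a u, mul sub v b'). (a, b) \<leftarrow> cop sub x,
        (a', b') \<leftarrow> cop sub y, (u, v) \<leftarrow> yd_braiding sub b a'] \<beta>"
      by (simp add: yd_braiding_def del: map_map)
  qed
next
  show "teq sub sub (cop sub (unit sub)) [(unit sub, unit sub)]"
    unfolding teq_iff
  proof (intro allI impI)
    fix \<beta> assume b: "bilin sub sub kk \<beta>"
    have "tsum (cop sub (unit R)) \<beta> = tsum (cop R (unit R)) (\<lambda>a b. \<beta> (P a) (P b))" by (simp add: cop_sub)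
    also have "\<dots> = \<beta> (P (unit R)) (P (unit R))" by (rule R.cop_unit_tsum[OF P_lift[OF b] vs_kk])
    finally show "tsum (cop sub (unit sub)) \<beta> = tsum [(unit sub, unit sub)] \<beta>"
      by (simp add: P_id S_unit)
  qed
next
  show "lin sub sub (antip sub)" using R.antip_lin S_antip S_mem by (auto simp: lin_def)
next
  fix x assume "x \<in> carr sub"
  then have x: "x \<in> S" by simp
  have "tsum (cop sub x) (\<lambda>a b. mul R (antip R a) b) = tsum (cop R x) (\<lambda>a b. mul R (antip R a) b)"
    by (rule cop_sub_tsum[OF x, of R]) (intro bilinI lins mems; (assumption | erule S_mem)?)+
  then show "(\<Sum>(a, b)\<leftarrow>cop sub x. mul sub (antip sub a) b) = scl sub (eps sub x) (unit sub)"
    using R.antip_left[OF S_mem[OF x]] by (simp add: tsum_def)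
  have "tsum (cop sub x) (\<lambda>a b. mul R a (antip R b)) = tsum (cop R x) (\<lambda>a b. mul R a (antip R b))"
    by (rule cop_sub_tsum[OF x, of R]) (intro bilinI lins mems; (assumption | erule S_mem)?)+
  then show "(\<Sum>(a, b)\<leftarrow>cop sub x. mul sub a (antip sub b)) = scl sub (eps sub x) (unit sub)"
    using R.antip_right[OF S_mem[OF x]] by (simp add: tsum_def)
qed (simp_all add: S_mem R.eps_mul R.eps_unit)

lemma sub_yd: "yd_module K (yd_of sub)"
proof (intro yd_module.intro yd_module_axioms.intro YD.K.hopf_algebra_axioms)
  show "vs (yd_of sub)" using vs_sub by simp
next
  fix v assume "v \<in> carr (yd_of sub)"
  then have v: "v \<in> S" by simp
  note vc = S_mem[OF v]
  show "lin K (yd_of sub) (\<lambda>h. act (yd_of sub) h v)"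
    using YD.act_lin_left[of v] v vc by (auto simp: lin_def S_act)
  show "act (yd_of sub) (unit K) v = v" using hact_unit[OF vc] by simp
  show "teq3 K K (yd_of sub) [(h1, h2, w). (h, w) \<leftarrow> coact (yd_of sub) v, (h1, h2) \<leftarrow> cop K h]
                 [(h, g, u). (h, w) \<leftarrow> coact (yd_of sub) v, (g, u) \<leftarrow> coact (yd_of sub) w]"
    unfolding teq3_iff trilin_conv
  proof (intro allI impI)
    fix \<beta> assume b: "trilin K K sub kk \<beta>"
    let ?b = "\<lambda>a b c. \<beta> a b (P c)"
    note t = P_lift3KK[OF b]
    have "tsum (hcoact sub v) (\<lambda>h w. tsum (cop K h) (\<lambda>h1 h2. \<beta> h1 h2 w)) =
        tsum (hcoact R v) (\<lambda>h w. tsum (cop K h) (\<lambda>h1 h2. ?b h1 h2 w))"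
      by (simp add: hcoact_sub)
    also have "\<dots> = tsum (hcoact R v) (\<lambda>h w. tsum (hcoact R w) (\<lambda>g u. ?b h g u))"
      by (rule hcoact_assoc[OF vc t vs_kk])
    also have "\<dots> = tsum (hcoact sub v) (\<lambda>h w. tsum (hcoact R w) (\<lambda>g u. ?b h g u))"
      by (rule hcoact_sub_tsum[OF v, symmetric, of kk]) (intro bilinI trilinD[OF t] lins mems; (assumption | erule S_mem)?)+
    also have "\<dots> = tsum (hcoact sub v) (\<lambda>h w. tsum (hcoact sub w) (\<lambda>g u. \<beta> h g u))"
      by (simp add: hcoact_sub)
    finally show "tsum3 [(h1, h2, w). (h, w) \<leftarrow> coact (yd_of sub) v, (h1, h2) \<leftarrow> cop K h] \<beta> =
       tsum3 [(h, g, u). (h, w) \<leftarrow> coact (yd_of sub) v, (g, u) \<leftarrow> coact (yd_of sub) w] \<beta>" by simp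
  qed
  have "tsum (hcoact sub v) (\<lambda>h w. scl R (eps K h) w) = tsum (hcoact R v) (\<lambda>h w. scl R (eps K h) w)"
    by (rule hcoact_sub_tsum[OF v, of R]) (intro bilinI lins mems; (assumption | erule S_mem)?)+
  then show "(\<Sum>(h, w)\<leftarrow>coact (yd_of sub) v. scl (yd_of sub) (eps K h) w) = v"
    using YD.coact_counit[of v] vc by (simp add: tsum_def)
next
  fix h assume h: "h \<in> carr K"
  show "lin (yd_of sub) (yd_of sub) (act (yd_of sub) h)"
    using YD.act_lin_right[OF h] h by (auto simp: lin_def S_act S_mem)
next
  fix g h v assume "g \<in> carr K" "h \<in> carr K" "v \<in> carr (yd_of sub)"
  then show "act (yd_of sub) (mul K g h) v = act (yd_of sub) g (act (yd_of sub) h v)"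
    by (simp add: hact_mul S_mem)
next
  show "lin_tensor (yd_of sub) K (yd_of sub) (coact (yd_of sub))"
    unfolding lin_tensor_conv yd_of_sel
  proof (rule lin_tensorI)
    fix \<beta> assume b: "bilin K sub kk \<beta>"
    have "lin R kk (\<lambda>x. tsum (hcoact R x) (\<lambda>a b. \<beta> a (P b)))"
      by (intro lins bilinD[OF P_liftK[OF b]])
    then show "lin sub kk (\<lambda>x. tsum (hcoact sub x) \<beta>)"
      by (intro lin_subI) (simp add: hcoact_sub)
  qed (use hcoact_sub_mem in auto)
next
  fix h v assume h: "h \<in> carr K" and "v \<in> carr (yd_of sub)"
  then have v: "v \<in> S" by simp
  note vc = S_mem[OF v]
  show "teq K (yd_of sub) (coact (yd_of sub) (act (yd_of sub) h v))
        [(mul K (mul K h1 g) (antip K h3), act (yd_of sub) h2 w).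
           (h1, h') \<leftarrow> cop K h, (h2, h3) \<leftarrow> cop K h', (g, w) \<leftarrow> coact (yd_of sub) v]"
    unfolding teq_iff bilin_conv
  proof (intro allI impI)
    fix \<beta> assume b: "bilin K sub kk \<beta>"
    let ?b = "\<lambda>a c. \<beta> a (P c)"
    note t = P_liftK[OF b]
    note [lins] = bilinD[OF t]
    have "tsum (hcoact sub (hact R h v)) \<beta> = tsum (hcoact R (hact R h v)) ?b"
      by (simp add: hcoact_sub)
    also have "\<dots> = tsum (cop K h) (\<lambda>h1 h'. tsum (cop K h') (\<lambda>h2 h3.
         tsum (hcoact R v) (\<lambda>g w. ?b (mul K (mul K h1 g) (antip K h3)) (hact R h2 w))))"
      by (rule hyd_tsum[OF h vc t vs_kk])
    also have "\<dots> = tsum (cop K h) (\<lambda>h1 h'. tsum (cop K h') (\<lambda>h2 h3.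
         tsum (hcoact sub v) (\<lambda>g w. ?b (mul K (mul K h1 g) (antip K h3)) (hact R h2 w))))"
      by (intro YD.K.cop_cong h hcoact_sub_tsum[where Z=kk, symmetric] v bilinI lins mems; (assumption | erule S_mem)?)
    also have "\<dots> = tsum (cop K h) (\<lambda>h1 h'. tsum (cop K h') (\<lambda>h2 h3.
         tsum (hcoact sub v) (\<lambda>g w. \<beta> (mul K (mul K h1 g) (antip K h3)) (hact R h2 w))))"
      by (intro YD.K.cop_cong h hcoact_sub_cong v) (simp_all add: P_id S_act)
    finally show "tsum (coact (yd_of sub) (act (yd_of sub) h v)) \<beta> =
      tsum [(mul K (mul K h1 g) (antip K h3), act (yd_of sub) h2 w).
           (h1, h') \<leftarrow> cop K h, (h2, h3) \<leftarrow> cop K h', (g, w) \<leftarrow> coact (yd_of sub) v] \<beta>" by simp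
  qed
qed

lemma sub_yd_hopf: "yd_hopf_algebra K sub"
proof (intro yd_hopf_algebra.intro yd_hopf_algebra_axioms.intro sub_yd sub_braided)
  fix x y assume "x \<in> carr sub" "y \<in> carr sub"
  then have x: "x \<in> S" and y: "y \<in> S" by simp_all
  show "teq K sub (hcoact sub (mul sub x y))
        [(mul K g h, mul sub u w). (g, u) \<leftarrow> hcoact sub x, (h, w) \<leftarrow> hcoact sub y]"
    unfolding teq_iff
  proof (intro allI impI)
    fix \<beta> assume b: "bilin K sub kk \<beta>"
    let ?b = "\<lambda>a c. \<beta> a (P c)"
    note t = P_liftK[OF b]
    note [lins] = bilinD[OF t]
    have "tsum (hcoact sub (mul R x y)) \<beta> = tsum (hcoact R (mul R x y)) ?b" by (simp add: hcoact_sub)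
    also have "\<dots> = tsum (hcoact R x) (\<lambda>g u. tsum (hcoact R y) (\<lambda>h w. ?b (mul K g h) (mul R u w)))"
      by (rule hcoact_mul[OF S_mem[OF x] S_mem[OF y] t vs_kk])
    also have "\<dots> = tsum (hcoact sub x) (\<lambda>g u. tsum (hcoact R y) (\<lambda>h w. ?b (mul K g h) (mul R u w)))"
      by (rule hcoact_sub_tsum[OF x, symmetric, of kk]) (intro S_mem[OF y] bilinI lins mems; (assumption | erule S_mem)?)+
    also have "\<dots> = tsum (hcoact sub x) (\<lambda>g u. tsum (hcoact sub y) (\<lambda>h w. ?b (mul K g h) (mul R u w)))"
      by (intro hcoact_sub_cong x y hcoact_sub_tsum[where Z=kk, symmetric] bilinI lins mems; (assumption | erule S_mem)?)
    also have "\<dots> = tsum (hcoact sub x) (\<lambda>g u. tsum (hcoact sub y) (\<lambda>h w. \<beta> (mul K g h) (mul R u w)))"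
      by (intro hcoact_sub_cong x y) (simp_all add: P_id S_mul)
    finally show "tsum (hcoact sub (mul sub x y)) \<beta> =
        tsum [(mul K g h, mul sub u w). (g, u) \<leftarrow> hcoact sub x, (h, w) \<leftarrow> hcoact sub y] \<beta>" by simp
  qed
next
  show "teq K sub (hcoact sub (unit sub)) [(unit K, unit sub)]"
    unfolding teq_iff
  proof (intro allI impI)
    fix \<beta> assume b: "bilin K sub kk \<beta>"
    have "tsum (hcoact sub (unit R)) \<beta> = tsum (hcoact R (unit R)) (\<lambda>a b. \<beta> a (P b))" by (simp add: hcoact_sub)
    also have "\<dots> = \<beta> (unit K) (P (unit R))" by (rule hcoact_unit[OF P_liftK[OF b] vs_kk])
    finally show "tsum (hcoact sub (unit sub)) \<beta> = tsum [(unit K, unit sub)] \<beta>"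
      by (simp add: P_id S_unit)
  qed
next
  fix h x assume h: "h \<in> carr K" and "x \<in> carr sub"
  then have x: "x \<in> S" by simp
  show "teq sub sub (cop sub (hact sub h x))
        [(hact sub h1 a, hact sub h2 b). (h1, h2) \<leftarrow> cop K h, (a, b) \<leftarrow> cop sub x]"
    unfolding teq_iff
  proof (intro allI impI)
    fix \<beta> assume b: "bilin sub sub kk \<beta>"
    let ?b = "\<lambda>a b. \<beta> (P a) (P b)"
    note t = P_lift[OF b]
    note [lins] = bilinD[OF t]
    have "tsum (cop sub (hact R h x)) \<beta> = tsum (cop R (hact R h x)) ?b" by (simp add: cop_sub)
    also have "\<dots> = tsum (cop K h) (\<lambda>h1 h2. tsum (cop R x) (\<lambda>a b. ?b (hact R h1 a) (hact R h2 b)))"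
      by (rule cop_hact[OF h S_mem[OF x] t vs_kk])
    also have "\<dots> = tsum (cop K h) (\<lambda>h1 h2. tsum (cop sub x) (\<lambda>a b. ?b (hact R h1 a) (hact R h2 b)))"
      by (intro YD.K.cop_cong h cop_sub_tsum[where Z=kk, symmetric] x bilinI lins mems; (assumption | erule S_mem)?)
    also have "\<dots> = tsum (cop K h) (\<lambda>h1 h2. tsum (cop sub x) (\<lambda>a b. \<beta> (hact R h1 a) (hact R h2 b)))"
      by (intro YD.K.cop_cong h cop_sub_cong x) (simp_all add: P_id S_act)
    finally show "tsum (cop sub (hact sub h x)) \<beta> =
        tsum [(hact sub h1 a, hact sub h2 b). (h1, h2) \<leftarrow> cop K h, (a, b) \<leftarrow> cop sub x] \<beta>" by simp
  qed
next
  fix x assume "x \<in> carr sub"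
  then have x: "x \<in> S" by simp
  show "teq3 K sub sub [(h, a, b). (h, w) \<leftarrow> hcoact sub x, (a, b) \<leftarrow> cop sub w]
        [(mul K g h, u, w). (a, b) \<leftarrow> cop sub x, (g, u) \<leftarrow> hcoact sub a, (h, w) \<leftarrow> hcoact sub b]"
    unfolding teq3_iff
  proof (intro allI impI)
    fix \<beta> assume b: "trilin K sub sub kk \<beta>"
    let ?b = "\<lambda>h a b. \<beta> h (P a) (P b)"
    note t = P_lift3K[OF b]
    note [lins] = trilinD[OF t]
    have "tsum (hcoact sub x) (\<lambda>h w. tsum (cop sub w) (\<lambda>a b. \<beta> h a b)) =
        tsum (hcoact sub x) (\<lambda>h w. tsum (cop R w) (\<lambda>a b. ?b h a b))" by (simp add: cop_sub)
    also have "\<dots> = tsum (hcoact R x) (\<lambda>h w. tsum (cop R w) (\<lambda>a b. ?b h a b))"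
      by (rule hcoact_sub_tsum[OF x, of kk]) (intro bilinI lins mems; (assumption | erule S_mem)?)+
    also have "\<dots> = tsum (cop R x) (\<lambda>a b. tsum (hcoact R a) (\<lambda>g u. tsum (hcoact R b) (\<lambda>h w. ?b (mul K g h) u w)))"
      by (rule hcoact_cop[OF S_mem[OF x] t vs_kk])
    also have "\<dots> = tsum (cop sub x) (\<lambda>a b. tsum (hcoact R a) (\<lambda>g u. tsum (hcoact R b) (\<lambda>h w. ?b (mul K g h) u w)))"
      by (rule cop_sub_tsum[OF x, symmetric, of kk]) (intro bilinI lins mems; (assumption | erule S_mem)?)+
    also have "\<dots> = tsum (cop sub x) (\<lambda>a b. tsum (hcoact sub a) (\<lambda>g u. tsum (hcoact sub b) (\<lambda>h w. \<beta> (mul K g h) u w)))"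
      by (simp add: hcoact_sub)
    finally show "tsum3 [(h, a, b). (h, w) \<leftarrow> hcoact sub x, (a, b) \<leftarrow> cop sub w] \<beta> =
        tsum3 [(mul K g h, u, w). (a, b) \<leftarrow> cop sub x, (g, u) \<leftarrow> hcoact sub a, (h, w) \<leftarrow> hcoact sub b] \<beta>"
      by simp
  qed
  have "tsum (hcoact sub x) (\<lambda>h w. scl K (eps R w) h) = tsum (hcoact R x) (\<lambda>h w. scl K (eps R w) h)"
    by (rule hcoact_sub_tsum[OF x, of K]) (intro bilinI lins mems; (assumption | erule S_mem)?)+
  then show "(\<Sum>(h, w)\<leftarrow>hcoact sub x. scl K (eps sub w) h) = scl K (eps sub x) (unit K)"
    using coact_eps_R[OF S_mem[OF x]] by (simp add: tsum_def)
  show "teq K sub (hcoact sub (antip sub x)) [(h, antip sub w). (h, w) \<leftarrow> hcoact sub x]"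
    unfolding teq_iff
  proof (intro allI impI)
    fix \<beta> assume b: "bilin K sub kk \<beta>"
    let ?b = "\<lambda>a c. \<beta> a (P c)"
    note t = P_liftK[OF b]
    note [lins] = bilinD[OF t]
    have "tsum (hcoact sub (antip R x)) \<beta> = tsum (hcoact R (antip R x)) ?b" by (simp add: hcoact_sub)
    also have "\<dots> = tsum (hcoact R x) (\<lambda>h w. ?b h (antip R w))"
      by (rule hcoact_antip[OF S_mem[OF x] t vs_kk])
    also have "\<dots> = tsum (hcoact sub x) (\<lambda>h w. ?b h (antip R w))"
      by (rule hcoact_sub_tsum[OF x, symmetric, of kk]) (intro bilinI lins mems; (assumption | erule S_mem)?)+
    also have "\<dots> = tsum (hcoact sub x) (\<lambda>h w. \<beta> h (antip R w))"
      by (intro hcoact_sub_cong x) (simp_all add: P_id S_antip)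
    finally show "tsum (hcoact sub (antip sub x)) \<beta> = tsum [(h, antip sub w). (h, w) \<leftarrow> hcoact sub x] \<beta>" by simp
  qed
qed (simp_all add: S_mem act_mul_R act_unit_R act_eps_R act_antip_R)

lemma sub_graded: "graded_connected_hopf K sub"
proof (intro graded_connected_hopf.intro graded_connected_hopf_axioms.intro sub_yd_hopf)
  fix n
  show "deg sub n \<subseteq> carr sub \<and> module.subspace (scl sub) (deg sub n)"
    using deg_subspace[of n] S_subspace by (auto simp: R.VS.subspace_inter)
next
  fix x assume "x \<in> carr sub"
  then have x: "x \<in> S" by simp
  note xc = S_mem[OF x]
  show "\<exists>!c. (\<forall>n. c n \<in> deg sub n) \<and> finite {n. c n \<noteq> 0} \<and> x = (\<Sum>n | c n \<noteq> 0. c n)"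
  proof (rule ex1I[of _ "\<lambda>n. proj n x"])
    show "(\<forall>n. proj n x \<in> deg sub n) \<and> finite {n. proj n x \<noteq> 0} \<and> x = (\<Sum>n | proj n x \<noteq> 0. proj n x)"
      using proj_spec[OF xc] S_graded[OF x] by simp
  next
    fix c assume c: "(\<forall>n. c n \<in> deg sub n) \<and> finite {n. c n \<noteq> 0} \<and> x = (\<Sum>n | c n \<noteq> 0. c n)"
    show "c = (\<lambda>n. proj n x)"
      by (rule ext, rule proj_unique0[symmetric]) (use c in auto)
  qed
next
  fix x n assume "x \<in> deg sub n"
  then have x: "x \<in> deg R n" "x \<in> S" by simp_all
  obtain s where s: "set s \<subseteq> (\<Union>i\<le>n. deg R i \<times> deg R (n - i))" "teq R R (cop R x) s"
    by (rule deg_cop_list[OF x(1)])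
  show "in_tensor sub sub (\<Union>i\<le>n. deg sub i \<times> deg sub (n - i)) (cop sub x)"
    unfolding in_tensor_def
  proof (intro exI[of _ "map (\<lambda>(a, b). (P a, P b)) s"] conjI)
    show "set (map (\<lambda>(a, b). (P a, P b)) s) \<subseteq> (\<Union>i\<le>n. deg sub i \<times> deg sub (n - i))"
    proof
      fix p assume "p \<in> set (map (\<lambda>(a, b). (P a, P b)) s)"
      then obtain a b where ab: "(a, b) \<in> set s" "p = (P a, P b)" by auto
      then obtain i where i: "i \<le> n" "a \<in> deg R i" "b \<in> deg R (n - i)" using s(1) by blast
      then have "P a \<in> deg sub i" "P b \<in> deg sub (n - i)"
        using P_deg[OF i(2)] P_deg[OF i(3)] P_mem[OF deg_mem[OF i(2)]] P_mem[OF deg_mem[OF i(3)]] by simp_all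
      then show "p \<in> (\<Union>i\<le>n. deg sub i \<times> deg sub (n - i))" using i(1) ab(2) by blast
    qed
    show "teq sub sub (cop sub x) (map (\<lambda>(a, b). (P a, P b)) s)"
      unfolding teq_iff
    proof (intro allI impI)
      fix \<beta> assume "bilin sub sub kk \<beta>"
      from P_lift[OF this] show "tsum (cop sub x) \<beta> = tsum (map (\<lambda>(a, b). (P a, P b)) s) \<beta>"
        unfolding cop_sub tsum_map using s(2) unfolding teq_iff by blast
    qed
  qed
  obtain s where s: "set s \<subseteq> carr K \<times> deg R n" "teq K R (hcoact R x) s"
    using deg_coact[OF x(1)] by (auto simp: in_tensor_def)
  show "in_tensor K sub (carr K \<times> deg sub n) (hcoact sub x)"
    unfolding in_tensor_def
  proof (intro exI[of _ "map (\<lambda>(a, b). (a, P b)) s"] conjI)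
    show "set (map (\<lambda>(a, b). (a, P b)) s) \<subseteq> carr K \<times> deg sub n"
    proof
      fix p assume "p \<in> set (map (\<lambda>(a, b). (a, P b)) s)"
      then obtain a b where ab: "(a, b) \<in> set s" "p = (a, P b)" by auto
      then have i: "a \<in> carr K" "b \<in> deg R n" using s(1) by blast+
      then show "p \<in> carr K \<times> deg sub n"
        using P_deg[OF i(2)] P_mem[OF deg_mem[OF i(2)]] ab(2) by simp
    qed
    show "teq K sub (hcoact sub x) (map (\<lambda>(a, b). (a, P b)) s)"
      unfolding teq_iff
    proof (intro allI impI)
      fix \<beta> assume "bilin K sub kk \<beta>"
      from P_liftK[OF this] show "tsum (hcoact sub x) \<beta> = tsum (map (\<lambda>(a, b). (a, P b)) s) \<beta>"
        unfolding hcoact_sub tsum_map using s(2) unfolding teq_iff by blast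
    qed
  qed
next
  show "deg sub 0 = range (\<lambda>c. scl sub c (unit sub))"
    using connected S_unit R.VS.subspace_scale[OF S_subspace] by auto
qed (auto intro: deg_mul S_mul deg_unit S_unit deg_eps deg_antip S_antip deg_act S_act)

text \<open>Every bilinear form on \<open>R\<close> restricts to \<open>S\<close>, so an equality of
  tensors over \<open>S\<close> persists over \<open>R\<close>.\<close>

lemma sub_primitives: "primitives sub \<subseteq> primitives R"
proof
  fix x assume p: "x \<in> primitives sub"
  then have x: "x \<in> S" and t: "teq sub sub (cop sub x) [(x, unit R), (unit R, x)]"
    by (auto simp: primitives_def)
  have "teq R R (cop R x) [(x, unit R), (unit R, x)]"
    unfolding teq_iff
  proof (intro allI impI)
    fix \<beta> assume b: "bilin R R kk \<beta>"
    show "tsum (cop R x) \<beta> = tsum [(x, unit R), (unit R, x)] \<beta>"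
      using cop_sub_tsum[OF x b vs_kk] t bilin_subI[OF b] by (simp add: teq_iff)
  qed
  then show "x \<in> primitives R" using S_mem[OF x] by (simp add: primitives_def)
qed

text \<open>Words are formed in the same way in both algebras; only the supremum runs over fewer
  subspaces.\<close>

lemma sub_GKdim: "GKdim sub \<le> GKdim R"
proof -
  have "words_upto sub = words_upto R" by (intro ext) (simp add: words_upto_def)
  then show ?thesis unfolding GKdim_def using S_carr by (intro SUP_subset_mono) auto
qed

end

section \<open>The subalgebras generated in bounded degree\<close>

lemma (in vs) subspace_tsum:
  assumes T: "VS.subspace T" and f: "\<And>a b. (a, b) \<in> set t \<Longrightarrow> f a b \<in> T" shows "tsum t f \<in> T"
  using f by (induction t) (auto simp: tsum_def intro: VS.subspace_0[OF T] VS.subspace_add[OF T])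

context algebra
begin

lemma foldr_mem: "set xs \<subseteq> carr A \<Longrightarrow> foldr (mul A) xs (unit A) \<in> carr A"
  by (induction xs) (auto intro: mems)

lemma generated_carr: "F \<subseteq> carr A \<Longrightarrow> generated A F \<subseteq> carr A"
  unfolding generated_def by (rule span_carr) (use foldr_mem in blast)

lemma generated_subspace: "VS.subspace (generated A F)"
  unfolding generated_def by (rule VS.subspace_span)

lemma generated_word: "set xs \<subseteq> F \<Longrightarrow> foldr (mul A) xs (unit A) \<in> generated A F"
  unfolding generated_def by (rule VS.span_base) auto

lemma generated_unit: "unit A \<in> generated A F"
  using generated_word[of "[]"] by simp

lemma generated_base: "F \<subseteq> carr A \<Longrightarrow> F \<subseteq> generated A F"
  using generated_word[of "[_]" F] by (auto simp: unit_right subset_iff)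

lemma lin_span_closed:
  assumes f: "lin A A f" and G: "G \<subseteq> carr A" and T: "VS.subspace T" and b: "\<And>w. w \<in> G \<Longrightarrow> f w \<in> T"
    and x: "x \<in> VS.span G"
  shows "f x \<in> T"
proof -
  have "x \<in> carr A \<and> f x \<in> T" using x
  proof (induction rule: VS.span_induct_alt)
    case base
    then show ?case using lin_0[OF f vs_axioms] VS.subspace_0[OF T] by (simp add: zero_mem)
  next
    case (step c x y)
    have x: "x \<in> carr A" using step G by auto
    have "f (scl A c x + y) = scl A c (f x) + f y"
      using x step by (simp add: lin_add[OF f] lin_scl[OF f] scl_mem)
    then show ?case using step x b T by (auto intro!: VS.subspace_add VS.subspace_scale mems)
  qed
  then show ?thesis by simp
qed

lemma generated_mul_left:
  assumes F: "F \<subseteq> carr A" and g: "g \<in> F" and w: "w \<in> generated A F"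
  shows "mul A g w \<in> generated A F"
proof (rule lin_span_closed[where f="mul A g" and G="{foldr (mul A) xs (unit A) |xs. set xs \<subseteq> F}", OF _ _ generated_subspace])
  show "lin A A (mul A g)" using mul_lin_right F g by auto
  show "{foldr (mul A) xs (unit A) |xs. set xs \<subseteq> F} \<subseteq> carr A" using F foldr_mem by blast
  show "w \<in> VS.span {foldr (mul A) xs (unit A) |xs. set xs \<subseteq> F}" using w by (simp add: generated_def)
next
  fix w assume "w \<in> {foldr (mul A) xs (unit A) |xs. set xs \<subseteq> F}"
  then obtain xs where "w = foldr (mul A) xs (unit A)" "set xs \<subseteq> F" by auto
  then show "mul A g w \<in> generated A F" using generated_word[of "g # xs" F] g by simp
qed

text \<open>An induction principle for the generated subalgebra. Words are built by
  \<open>foldr\<close>, so stability under multiplication by one generator from the left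
  suffices.\<close>

lemma generated_subset:
  assumes F: "F \<subseteq> carr A" and T: "VS.subspace T" "unit A \<in> T"
    and m: "\<And>g w. g \<in> F \<Longrightarrow> w \<in> T \<Longrightarrow> w \<in> generated A F \<Longrightarrow> mul A g w \<in> T"
  shows "generated A F \<subseteq> T"
proof -
  have "foldr (mul A) xs (unit A) \<in> T \<and> foldr (mul A) xs (unit A) \<in> generated A F" if "set xs \<subseteq> F" for xs
    using that by (induction xs) (auto simp: T generated_unit m generated_mul_left[OF F])
  then show ?thesis unfolding generated_def by (intro VS.span_minimal T) auto
qed

lemma generated_mul:
  assumes F: "F \<subseteq> carr A" and x: "x \<in> generated A F" and y: "y \<in> generated A F"
  shows "mul A x y \<in> generated A F"
proof -
  have yc: "y \<in> carr A" using y generated_carr[OF F] by auto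
  have "generated A F \<subseteq> {x \<in> carr A. mul A x y \<in> generated A F}"
  proof (rule generated_subset[OF F])
    show "VS.subspace {x \<in> carr A. mul A x y \<in> generated A F}"
      using generated_subspace[of F] lin_0[OF mul_lin_left[OF yc] vs_axioms]
      by (auto simp: VS.subspace_def lin_add[OF mul_lin_left[OF yc]] lin_scl[OF mul_lin_left[OF yc]] mems)
    show "unit A \<in> {x \<in> carr A. mul A x y \<in> generated A F}"
      using y yc by (simp add: unit_left unit_carr)
  next
    fix g w assume g: "g \<in> F" and w: "w \<in> {x \<in> carr A. mul A x y \<in> generated A F}"
    have gc: "g \<in> carr A" using F g by auto
    have "mul A (mul A g w) y = mul A g (mul A w y)" using gc w yc by (simp add: mul_assoc)
    then show "mul A g w \<in> {x \<in> carr A. mul A x y \<in> generated A F}"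
      using w gc generated_mul_left[OF F g] by (auto intro: mems)
  qed
  then show ?thesis using x by auto
qed

lemma generated_mono: "F \<subseteq> G \<Longrightarrow> generated A F \<subseteq> generated A G"
  unfolding generated_def by (intro VS.span_mono) auto

end

section \<open>Hopf subalgebras generated in bounded degree\<close>

context graded_connected_hopf
begin

lemma proj_mul_homog:
  assumes g: "g \<in> deg R i" and w: "w \<in> carr R"
  shows "proj n (mul R g w) = (if i \<le> n then mul R g (proj (n - i) w) else 0)"
proof -
  have gc: "g \<in> carr R" by (rule deg_mem[OF g])
  note z = lin_0[OF R.mul_lin_right[OF gc] R.vs_axioms]
  have l: "lin R R (\<lambda>w. if i \<le> n then mul R g (proj (n - i) w) else 0)"
    by (cases "i \<le> n") (auto intro!: lins gc)
  show ?thesis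
  proof (rule lin_eq_homog[OF _ l _ w])
    show "lin R R (\<lambda>w. proj n (mul R g w))" by (intro lins gc)
    fix m x assume x: "x \<in> deg R m"
    have "mul R g x \<in> deg R (i + m)" by (rule deg_mul[OF g x])
    then show "proj n (mul R g x) = (if i \<le> n then mul R g (proj (n - i) x) else 0)"
      using x by (auto simp: proj_homog z)
  qed
qed

definition gens :: "nat \<Rightarrow> 'a set" where "gens m = (\<Union>i\<le>m. deg R i)"

text \<open>The algebra called \<open>E[m]\<close> in the overview.\<close>

definition gen_upto :: "nat \<Rightarrow> 'a set" where "gen_upto m = generated R (gens m)"

lemma gens_carr: "gens m \<subseteq> carr R" using deg_mem by (auto simp: gens_def)

lemma gen_upto_carr: "gen_upto m \<subseteq> carr R"
  unfolding gen_upto_def by (rule R.generated_carr[OF gens_carr])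

lemma gen_upto_subspace: "R.VS.subspace (gen_upto m)"
  unfolding gen_upto_def by (rule R.generated_subspace)

lemma gen_upto_unit: "unit R \<in> gen_upto m"
  unfolding gen_upto_def by (rule R.generated_unit)

lemma gen_upto_mul: "x \<in> gen_upto m \<Longrightarrow> y \<in> gen_upto m \<Longrightarrow> mul R x y \<in> gen_upto m"
  unfolding gen_upto_def by (rule R.generated_mul[OF gens_carr])

lemma gens_gen_upto: "gens m \<subseteq> gen_upto m"
  unfolding gen_upto_def by (rule R.generated_base[OF gens_carr])

lemma deg_gen_upto: "i \<le> m \<Longrightarrow> deg R i \<subseteq> gen_upto m"
  using gens_gen_upto[of m] by (auto simp: gens_def)

lemma gen_upto_mono: "m \<le> n \<Longrightarrow> gen_upto m \<subseteq> gen_upto n"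
  unfolding gen_upto_def by (rule R.generated_mono) (force simp: gens_def)

lemma gen_upto_subset:
  assumes T: "R.VS.subspace T" "unit R \<in> T"
    and m: "\<And>g w. g \<in> gens m \<Longrightarrow> w \<in> T \<Longrightarrow> w \<in> gen_upto m \<Longrightarrow> mul R g w \<in> T"
  shows "gen_upto m \<subseteq> T"
  using R.generated_subset[OF gens_carr T] m unfolding gen_upto_def by blast

lemma subspace_vimage:
  assumes "lin R Z f" "vs Z" "module.subspace (scl Z) T"
  shows "R.VS.subspace {x \<in> carr R. f x \<in> T}"
proof -
  interpret Z: vs Z by fact
  show ?thesis using assms(3) lin_0[OF assms(1) R.vs_axioms]
    by (auto simp: R.VS.subspace_def Z.VS.subspace_def lin_add[OF assms(1)] lin_scl[OF assms(1)] R.zero_mem R.add_mem R.scl_mem)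
qed

lemma subspace_eq:
  assumes f: "lin R Z f" and g: "lin R Z g"
  shows "R.VS.subspace {x \<in> carr R. f x = g x}"
  using lin_0[OF f R.vs_axioms] lin_0[OF g R.vs_axioms]
  by (auto simp: R.VS.subspace_def lin_add[OF f] lin_scl[OF f] lin_add[OF g] lin_scl[OF g]
     R.zero_mem R.add_mem R.scl_mem)

text \<open>The induction has to treat all components at once, since multiplication by a generator
  of degree \<open>i\<close> shifts the degree by \<open>i\<close>.\<close>

lemma gen_upto_graded: assumes x: "x \<in> gen_upto m" shows "proj n x \<in> gen_upto m"
proof -
  have "gen_upto m \<subseteq> (\<Inter>n. {x \<in> carr R. proj n x \<in> gen_upto m})"
  proof (rule gen_upto_subset)
    show "R.VS.subspace (\<Inter>n. {x \<in> carr R. proj n x \<in> gen_upto m})"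
      by (rule R.VS.subspace_Inter) (auto intro!: subspace_vimage[OF lin_proj0 R.vs_axioms gen_upto_subspace])
    show "unit R \<in> (\<Inter>n. {x \<in> carr R. proj n x \<in> gen_upto m})"
      using gen_upto_unit R.VS.subspace_0[OF gen_upto_subspace] by (simp add: R.unit_carr proj_homog[OF deg_unit])
  next
    fix g w assume "g \<in> gens m" and w: "w \<in> (\<Inter>n. {x \<in> carr R. proj n x \<in> gen_upto m})"
    then obtain i where g: "g \<in> deg R i" "g \<in> gen_upto m" using gens_gen_upto by (auto simp: gens_def)
    show "mul R g w \<in> (\<Inter>n. {x \<in> carr R. proj n x \<in> gen_upto m})"
      using w deg_mem[OF g(1)] R.VS.subspace_0[OF gen_upto_subspace] gen_upto_mul[OF g(2)]
      by (auto simp: proj_mul_homog[OF g(1)] R.mul_mem)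
  qed
  then show ?thesis using x by auto
qed

text \<open>Again the induction runs over all of \<open>K\<close> at once: acting on a product
  brings in the legs of the coproduct of \<open>h\<close>.\<close>

lemma gen_upto_act: assumes x: "x \<in> gen_upto m" and h: "h \<in> carr K" shows "hact R h x \<in> gen_upto m"
proof -
  have "gen_upto m \<subseteq> (\<Inter>h\<in>carr K. {x \<in> carr R. hact R h x \<in> gen_upto m})"
  proof (rule gen_upto_subset)
    have "R.VS.subspace {x \<in> carr R. hact R h x \<in> gen_upto m}" if "h \<in> carr K" for h
      by (rule subspace_vimage[OF _ R.vs_axioms gen_upto_subspace]) (intro lins that)
    then show "R.VS.subspace (\<Inter>h\<in>carr K. {x \<in> carr R. hact R h x \<in> gen_upto m})"
      by (intro R.VS.subspace_Inter) auto
    show "unit R \<in> (\<Inter>h\<in>carr K. {x \<in> carr R. hact R h x \<in> gen_upto m})"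
      using gen_upto_unit R.VS.subspace_scale[OF gen_upto_subspace] by (simp add: R.unit_carr act_unit_R)
  next
    fix g w assume "g \<in> gens m" and w: "w \<in> (\<Inter>h\<in>carr K. {x \<in> carr R. hact R h x \<in> gen_upto m})"
    then obtain i where g: "i \<le> m" "g \<in> deg R i" by (auto simp: gens_def)
    have gc: "g \<in> carr R" by (rule deg_mem[OF g(2)])
    have wc: "w \<in> carr R" using w YD.K.unit_carr by blast
    have "hact R h (mul R g w) \<in> gen_upto m" if h: "h \<in> carr K" for h
    proof -
      have "tsum (cop K h) (\<lambda>h1 h2. mul R (hact R h1 g) (hact R h2 w)) \<in> gen_upto m"
      proof (rule R.subspace_tsum[OF gen_upto_subspace])
        fix h1 h2 assume "(h1, h2) \<in> set (cop K h)"
        then have hh: "h1 \<in> carr K" "h2 \<in> carr K" using YD.K.cop_mem[OF h] by auto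
        have "hact R h1 g \<in> gen_upto m" using deg_act[OF hh(1) g(2)] deg_gen_upto[OF g(1)] by auto
        then show "mul R (hact R h1 g) (hact R h2 w) \<in> gen_upto m" using hh w by (auto intro: gen_upto_mul)
      qed
      then show ?thesis using hact_mult[OF h gc wc] by simp
    qed
    then show "mul R g w \<in> (\<Inter>h\<in>carr K. {x \<in> carr R. hact R h x \<in> gen_upto m})"
      using gc wc by (auto intro: R.mul_mem)
  qed
  then show ?thesis using x h by auto
qed

text \<open>The coproduct of an element of degree i \<le> m has legs of degree at most
  \<open>m\<close>, so the condition holds for the generators; it passes to products because the
  coproduct is multiplicative. The braiding involves the coaction of a leg, so stability under the
  coaction has to be settled first.\<close>

lemma gen_upto_sub_hopf: "\<exists>P. sub_hopf K R (gen_upto m) P"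
proof -
  let ?S = "gen_upto m"
  obtain P where P: "lin R R P" "\<And>x. x \<in> carr R \<Longrightarrow> P x \<in> ?S" "\<And>x. x \<in> ?S \<Longrightarrow> P x = x"
      "\<And>n x. x \<in> deg R n \<Longrightarrow> P x \<in> deg R n"
    using graded_projection_exists[OF gen_upto_carr gen_upto_subspace gen_upto_graded] by blast
  have Pc [mems]: "P x \<in> carr R" if "x \<in> carr R" for x using P(2)[OF that] gen_upto_carr by auto
  have lP [lins]: "lin R R f \<Longrightarrow> lin R R (\<lambda>x. P (f x))" for f
    by (rule lin_comp[OF P(1)])
  have Sc: "x \<in> carr R" if "x \<in> ?S" for x using that gen_upto_carr by auto
  \<comment> \<open>The elements whose coaction lies in K \<otimes> S. As an intersection of
    equalizers this is a subspace, so the induction principle for \<open>gen_upto\<close> applies;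
    \<open>CP\<close> below plays the same role for the coproduct.\<close>
  define CO where "CO = {x \<in> carr R. \<forall>\<beta>. bilin K R kk \<beta> \<longrightarrow> tsum (hcoact R x) \<beta> = tsum (hcoact R x) (\<lambda>h w. \<beta> h (P w))}"
  have bP: "bilin K R kk (\<lambda>h w. \<beta> h (P w))" if "bilin K R kk \<beta>" for \<beta>
    by (intro bilinI bilinD[OF that] lins mems)
  have bPP: "bilin R R kk (\<lambda>h w. \<beta> (P h) (P w))" if "bilin R R kk \<beta>" for \<beta>
    by (intro bilinI bilinD[OF that] lins mems)
  have CO_deg: "deg R i \<subseteq> CO" if i: "i \<le> m" for i
  proof
    fix g assume g: "g \<in> deg R i"
    have "tsum (hcoact R g) \<beta> = tsum (hcoact R g) (\<lambda>h w. \<beta> h (P w))" if b: "bilin K R kk \<beta>" for \<beta>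
    proof -
      have "tsum (hcoact R g) \<beta> = tsum (hcoact R g) (\<lambda>h w. \<beta> h (proj i w))"
        by (rule hcoact_homog[OF g b vs_kk])
      also have "\<dots> = tsum (hcoact R g) (\<lambda>h w. \<beta> h (P (proj i w)))"
      proof (intro hcoact_cong deg_mem[OF g])
        fix h w assume "w \<in> carr R"
        then have "proj i w \<in> ?S" using proj_deg deg_gen_upto[OF i] by blast
        then show "\<beta> h (proj i w) = \<beta> h (P (proj i w))" by (simp add: P(3))
      qed
      also have "\<dots> = tsum (hcoact R g) (\<lambda>h w. \<beta> h (P w))"
        by (rule hcoact_homog[OF g bP[OF b] vs_kk, symmetric])
      finally show ?thesis .
    qed
    then show "g \<in> CO" using deg_mem[OF g] by (simp add: CO_def)
  qed
  have CO: "?S \<subseteq> CO"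
  proof (rule gen_upto_subset)
    have "CO = carr R \<inter> (\<Inter>\<beta>\<in>Collect (bilin K R kk). {x \<in> carr R. tsum (hcoact R x) \<beta> = tsum (hcoact R x) (\<lambda>h w. \<beta> h (P w))})"
      by (auto simp: CO_def)
    also have "R.VS.subspace \<dots>"
    proof (intro R.VS.subspace_inter R.subspace_carr R.VS.subspace_Inter ballI)
      fix T assume "T \<in> (\<lambda>\<beta>. {x \<in> carr R. tsum (hcoact R x) \<beta> = tsum (hcoact R x) (\<lambda>h w. \<beta> h (P w))}) ` Collect (bilin K R kk)"
      then obtain \<beta> where b: "bilin K R kk \<beta>" and T: "T = {x \<in> carr R. tsum (hcoact R x) \<beta> = tsum (hcoact R x) (\<lambda>h w. \<beta> h (P w))}"
        by auto
      show "R.VS.subspace T" unfolding T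
        by (rule subspace_eq[where Z=kk]) (intro lins bilinD[OF b] bilinD[OF bP[OF b]]; assumption?)+
    qed
    finally show "R.VS.subspace CO" .
    show "unit R \<in> CO" using CO_deg[of 0] deg_unit by auto
  next
    fix g w assume g0: "g \<in> gens m" and w: "w \<in> CO" "w \<in> gen_upto m"
    have g: "g \<in> CO" "g \<in> carr R" using g0 CO_deg deg_mem by (auto simp: gens_def)
    note wc = Sc[OF w(2)]
    have "tsum (hcoact R (mul R g w)) \<beta> = tsum (hcoact R (mul R g w)) (\<lambda>h w. \<beta> h (P w))" if b: "bilin K R kk \<beta>" for \<beta>
    proof -
      note [lins] = bilinD[OF b]
      have cg: "tsum (hcoact R g) B = tsum (hcoact R g) (\<lambda>h w. B h (P w))" if "bilin K R kk B" for B
        using g(1) that by (simp add: CO_def)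
      have cw: "tsum (hcoact R w) B = tsum (hcoact R w) (\<lambda>h w. B h (P w))" if "bilin K R kk B" for B
        using w(1) that by (simp add: CO_def)
      have *: "tsum (hcoact R (mul R g w)) B = tsum (hcoact R g) (\<lambda>h u. tsum (hcoact R w) (\<lambda>k v. B (mul K h k) (mul R (P u) (P v))))"
        if B: "bilin K R kk B" for B
      proof -
        note [lins] = bilinD[OF B]
        have "tsum (hcoact R (mul R g w)) B = tsum (hcoact R g) (\<lambda>h u. tsum (hcoact R w) (\<lambda>k v. B (mul K h k) (mul R u v)))"
          by (rule hcoact_mul[OF g(2) wc B vs_kk])
        also have "\<dots> = tsum (hcoact R g) (\<lambda>h u. tsum (hcoact R w) (\<lambda>k v. B (mul K h k) (mul R u (P v))))"
          by (intro hcoact_cong g cw bilinI lins mems)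
        also have "\<dots> = tsum (hcoact R g) (\<lambda>h u. tsum (hcoact R w) (\<lambda>k v. B (mul K h k) (mul R (P u) (P v))))"
          by (rule cg) (intro wc bilinI lins mems; assumption?)+
        finally show ?thesis .
      qed
      show ?thesis unfolding *[OF b] *[OF bP[OF b]]
        by (intro hcoact_cong g wc) (simp_all add: P gen_upto_mul)
    qed
    then show "mul R g w \<in> CO" using g wc by (simp add: CO_def R.mul_mem)
  qed
  have CO_rule: "tsum (hcoact R x) \<beta> = tsum (hcoact R x) (\<lambda>h w. \<beta> h (P w))" if "x \<in> ?S" "bilin K R kk \<beta>" for x \<beta>
    using CO that by (auto simp: CO_def)
  define CP where "CP = {x \<in> carr R. \<forall>\<beta>. bilin R R kk \<beta> \<longrightarrow> tsum (cop R x) \<beta> = tsum (cop R x) (\<lambda>h w. \<beta> (P h) (P w))}"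
  have CP_deg: "deg R i \<subseteq> CP" if i: "i \<le> m" for i
  proof
    fix g assume g: "g \<in> deg R i"
    have "tsum (cop R g) \<beta> = tsum (cop R g) (\<lambda>a b. \<beta> (P a) (P b))" if b: "bilin R R kk \<beta>" for \<beta>
    proof -
      have "tsum (cop R g) \<beta> = (\<Sum>j\<le>i. tsum (cop R g) (\<lambda>a b. \<beta> (proj j a) (proj (i - j) b)))"
        by (rule cop_homog[OF g b vs_kk])
      also have "\<dots> = (\<Sum>j\<le>i. tsum (cop R g) (\<lambda>a b. \<beta> (P (proj j a)) (P (proj (i - j) b))))"
      proof (intro sum.cong refl R.cop_cong deg_mem[OF g])
        fix j a b assume j: "j \<in> {..i}" and ab: "a \<in> carr R" "b \<in> carr R"
        have "j \<le> m" "i - j \<le> m" using i j by auto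
        then have "proj j a \<in> ?S" "proj (i - j) b \<in> ?S"
          using proj_deg[OF ab(1), of j] proj_deg[OF ab(2), of "i - j"] deg_gen_upto by blast+
        then show "\<beta> (proj j a) (proj (i - j) b) = \<beta> (P (proj j a)) (P (proj (i - j) b))" by (simp add: P(3))
      qed
      also have "\<dots> = tsum (cop R g) (\<lambda>a b. \<beta> (P a) (P b))"
        by (rule cop_homog[OF g bPP[OF b] vs_kk, symmetric])
      finally show ?thesis .
    qed
    then show "g \<in> CP" using deg_mem[OF g] by (simp add: CP_def)
  qed
  have CP: "?S \<subseteq> CP"
  proof (rule gen_upto_subset)
    have "CP = carr R \<inter> (\<Inter>\<beta>\<in>Collect (bilin R R kk). {x \<in> carr R. tsum (cop R x) \<beta> = tsum (cop R x) (\<lambda>h w. \<beta> (P h) (P w))})"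
      by (auto simp: CP_def)
    also have "R.VS.subspace \<dots>"
    proof (intro R.VS.subspace_inter R.subspace_carr R.VS.subspace_Inter ballI)
      fix T assume "T \<in> (\<lambda>\<beta>. {x \<in> carr R. tsum (cop R x) \<beta> = tsum (cop R x) (\<lambda>h w. \<beta> (P h) (P w))}) ` Collect (bilin R R kk)"
      then obtain \<beta> where b: "bilin R R kk \<beta>" and T: "T = {x \<in> carr R. tsum (cop R x) \<beta> = tsum (cop R x) (\<lambda>h w. \<beta> (P h) (P w))}"
        by auto
      show "R.VS.subspace T" unfolding T
        by (rule subspace_eq[where Z=kk]) (intro lins bilinD[OF b] bilinD[OF bPP[OF b]]; assumption?)+
    qed
    finally show "R.VS.subspace CP" .
    show "unit R \<in> CP" using CP_deg[of 0] deg_unit by auto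
  next
    fix g w assume g0: "g \<in> gens m" and w: "w \<in> CP" "w \<in> gen_upto m"
    have g: "g \<in> CP" "g \<in> carr R" using g0 CP_deg deg_mem by (auto simp: gens_def)
    note wc = Sc[OF w(2)]
    have "tsum (cop R (mul R g w)) \<beta> = tsum (cop R (mul R g w)) (\<lambda>h w. \<beta> (P h) (P w))" if b: "bilin R R kk \<beta>" for \<beta>
    proof -
      have cg: "tsum (cop R g) B = tsum (cop R g) (\<lambda>a b. B (P a) (P b))" if "bilin R R kk B" for B
        using g(1) that by (simp add: CP_def)
      have cw: "tsum (cop R w) B = tsum (cop R w) (\<lambda>a b. B (P a) (P b))" if "bilin R R kk B" for B
        using w(1) that by (simp add: CP_def)
      have *: "tsum (cop R (mul R g w)) B = tsum (cop R g) (\<lambda>a b. tsum (cop R w) (\<lambda>a' b'.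
          tsum (hcoact R (P b)) (\<lambda>h u. B (mul R (P a) (hact R h (P a'))) (mul R (P u) (P b')))))"
        if B: "bilin R R kk B" for B
      proof -
        note [lins] = bilinD[OF B]
        have "tsum (cop R (mul R g w)) B = tsum (cop R g) (\<lambda>a b. tsum (cop R w) (\<lambda>a' b'.
          tsum (hcoact R b) (\<lambda>h u. B (mul R a (hact R h a')) (mul R u b'))))"
          by (rule cop_mul_R[OF g(2) wc B vs_kk])
        also have "\<dots> = tsum (cop R g) (\<lambda>a b. tsum (cop R w) (\<lambda>a' b'.
          tsum (hcoact R b) (\<lambda>h u. B (mul R a (hact R h (P a'))) (mul R u (P b')))))"
          by (intro R.cop_cong g cw bilinI lins mems)
        also have "\<dots> = tsum (cop R g) (\<lambda>a b. tsum (cop R w) (\<lambda>a' b'.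
          tsum (hcoact R (P b)) (\<lambda>h u. B (mul R (P a) (hact R h (P a'))) (mul R u (P b')))))"
          by (rule cg) (intro wc bilinI lins mems; assumption?)+
        \<comment> \<open>The braiding applies the coaction to \<open>P b\<close>, an element of
          \<open>S\<close>; the part already proved places its second leg in \<open>S\<close>
          too.\<close>
        also have "\<dots> = tsum (cop R g) (\<lambda>a b. tsum (cop R w) (\<lambda>a' b'.
          tsum (hcoact R (P b)) (\<lambda>h u. B (mul R (P a) (hact R h (P a'))) (mul R (P u) (P b')))))"
          by (intro R.cop_cong g wc CO_rule bilinI lins mems P(2))
        finally show ?thesis .
      qed
      have "B1 = B2" if "B1 = \<beta> (mul R (P a) (hact R h (P a'))) (mul R (P u) (P b'))"
        "B2 = \<beta> (P (mul R (P a) (hact R h (P a')))) (P (mul R (P u) (P b')))"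
        "a \<in> carr R" "a' \<in> carr R" "b' \<in> carr R" "u \<in> carr R" "h \<in> carr K" for a a' h u b' B1 B2
        using that by (simp add: P gen_upto_mul gen_upto_act)
      then show ?thesis unfolding *[OF b] *[OF bPP[OF b]]
        by (intro R.cop_cong hcoact_cong g wc mems) blast+
    qed
    then show "mul R g w \<in> CP" using g wc by (simp add: CP_def R.mul_mem)
  qed
  have "sub_hopf K R ?S P"
    using CP CO_rule P
    by unfold_locales (auto simp: gen_upto_carr[THEN subsetD] gen_upto_subspace gen_upto_unit gen_upto_mul gen_upto_act CP_def)
  then show ?thesis by blast
qed

end

section \<open>The graded dual\<close>

lemma tsum_prod: "tsum s F * (tsum t G :: 'k::field) = tsum s (\<lambda>a b. tsum t (\<lambda>c d. F a b * G c d))"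
  by (simp add: tsum_mult_left tsum_mult_right)

lemma tsum_concat_map: "tsum (concat (map H xs)) F = (\<Sum>x\<leftarrow>xs. tsum (H x) F)"
  by (induction xs) auto

lemma tsum_map_list: "tsum (map (\<lambda>i. (f i, g i)) xs) F = (\<Sum>i\<leftarrow>xs. F (f i) (g i))"
  by (induction xs) auto

locale locally_finite_hopf = graded_connected_hopf K R
  for K :: "('k::field, 'h::ab_group_add, 'y) hopf_scheme"
    and R :: "('k, 'h, 'a::ab_group_add, 'z) yd_hopf_scheme" +
  assumes locally_finite: "\<exists>F. finite F \<and> deg R n = R.VS.span F"
begin

definition bas :: "nat \<Rightarrow> 'a set" where
  "bas n = (SOME B. finite B \<and> R.VS.independent B \<and> R.VS.span B = deg R n)"

lemma bas: "finite (bas n)" "R.VS.independent (bas n)" "R.VS.span (bas n) = deg R n"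
proof -
  obtain F where "finite F" "deg R n = R.VS.span F" using locally_finite by blast
  then have "\<exists>B. finite B \<and> R.VS.independent B \<and> R.VS.span B = deg R n" by (rule R.finite_basis)
  from someI_ex[OF this] show "finite (bas n)" "R.VS.independent (bas n)" "R.VS.span (bas n) = deg R n"
    unfolding bas_def by auto
qed

lemma bas_deg: "b \<in> bas n \<Longrightarrow> b \<in> deg R n"
  using bas(3) R.VS.span_base by blast

definition crd :: "nat \<Rightarrow> 'a \<Rightarrow> 'a \<Rightarrow> 'k" where
  "crd n b x = R.VS.representation (bas n) (proj n x) b"

lemma lin_crd: "lin R kk (crd n b)"
  unfolding crd_def by (intro R.lin_representation bas lins) (simp add: bas proj_deg)

lemma crd_expand: "x \<in> carr R \<Longrightarrow> (\<Sum>b\<in>bas n. scl R (crd n b x) b) = proj n x"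
  unfolding crd_def by (intro R.VS.sum_representation_eq bas) (auto simp: bas proj_deg)

lemma crd_deg: "x \<in> deg R m \<Longrightarrow> m \<noteq> n \<Longrightarrow> crd n b x = 0"
  by (simp add: crd_def proj_homog R.VS.representation_zero)

lemma crd_bas: "b \<in> bas n \<Longrightarrow> c \<in> bas n \<Longrightarrow> crd n b c = (if b = c then 1 else 0)"
  by (simp add: crd_def proj_homog[OF bas_deg] R.VS.representation_basis[OF bas(2)])

lemma lin_expand:
  assumes f: "lin R Z f" and x: "x \<in> carr R" and Z: "vs Z"
  shows "f (proj n x) = (\<Sum>b\<in>bas n. scl Z (crd n b x) (f b))"
proof -
  have m: "scl R (crd n b x) b \<in> carr R" if "b \<in> bas n" for b
    using deg_mem[OF bas_deg[OF that]] by (rule R.scl_mem)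
  have "f (proj n x) = (\<Sum>b\<in>bas n. f (scl R (crd n b x) b))"
    unfolding crd_expand[OF x, symmetric] by (rule lin_sum[OF f R.vs_axioms m])
  also have "\<dots> = (\<Sum>b\<in>bas n. scl Z (crd n b x) (f b))"
    using deg_mem[OF bas_deg] by (intro sum.cong refl lin_scl[OF f])
  finally show ?thesis .
qed

lemma sum_list_bas: "\<exists>l. set l = bas n \<and> (\<forall>f :: 'a \<Rightarrow> 'w::comm_monoid_add. sum_list (map f l) = sum f (bas n))"
  using finite_distinct_list[OF bas(1)[of n]] sum_list_distinct_conv_sum_set by metis

end

text \<open>\<open>p_fin\<close> and \<open>p_repr\<close> say that the elements of \<open>D\<close>
  induce precisely the functionals on \<open>R\<close> that vanish in almost all degrees, and
  \<open>p_nondeg\<close> that they are determined by them. So \<open>D\<close> is the graded dual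
  up to isomorphism, whatever its elements are.\<close>

locale dual_pairing = locally_finite_hopf K R + KB: hopf_bij K + D: vs D
  for K :: "('k::field, 'h::ab_group_add, 'y) hopf_scheme"
    and R :: "('k, 'h, 'a::ab_group_add, 'z) yd_hopf_scheme"
    and D :: "('k, 'd::ab_group_add) vspace" +
  fixes p :: "'d \<Rightarrow> 'a \<Rightarrow> 'k"
  assumes p_lin1: "x \<in> carr R \<Longrightarrow> lin D kk (\<lambda>d. p d x)"
    and p_lin2: "d \<in> carr D \<Longrightarrow> lin R kk (p d)"
    and p_nondeg: "d \<in> carr D \<Longrightarrow> (\<And>x. x \<in> carr R \<Longrightarrow> p d x = 0) \<Longrightarrow> d = 0"
    and p_fin: "d \<in> carr D \<Longrightarrow> finite {n. \<exists>x\<in>deg R n. p d x \<noteq> 0}"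
    and p_repr: "lin R kk f \<Longrightarrow> finite {n. \<exists>x\<in>deg R n. f x \<noteq> 0} \<Longrightarrow> \<exists>d\<in>carr D. \<forall>x\<in>carr R. p d x = f x"
begin

abbreviation "ainv \<equiv> KB.ainv"

lemma lin_p [lins]:
  "lin U D f \<Longrightarrow> x \<in> carr R \<Longrightarrow> lin U kk (\<lambda>u. p (f u) x)"
  "lin U R g \<Longrightarrow> d \<in> carr D \<Longrightarrow> lin U kk (\<lambda>u. p d (g u))"
  using lin_comp[OF p_lin1, of x U f] lin_comp[OF p_lin2, of d U g] by simp_all

lemma p_eqI:
  assumes "d \<in> carr D" "e \<in> carr D" "\<And>x. x \<in> carr R \<Longrightarrow> p d x = p e x" shows "d = e"
proof -
  have "d - e = 0"
    using assms by (intro p_nondeg D.diff_mem) (simp_all add: lin_diff[OF p_lin1 D.vs_axioms])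
  then show ?thesis by simp
qed

lemma linDI:
  assumes "\<And>u. u \<in> carr U \<Longrightarrow> F u \<in> carr D" "\<And>x. x \<in> carr R \<Longrightarrow> lin U kk (\<lambda>u. p (F u) x)" "vs U"
  shows "lin U D F"
proof -
  interpret U: vs U by fact
  have 1: "p (F (u + u')) x = p (F u) x + p (F u') x" if "u \<in> carr U" "u' \<in> carr U" "x \<in> carr R" for u u' x
    using lin_add[OF assms(2)[OF that(3)]] that by blast
  have 2: "p (F (scl U c u)) x = c * p (F u) x" if "u \<in> carr U" "x \<in> carr R" for u x c
    using lin_scl[OF assms(2)[OF that(2)], of u c] that by simp
  show ?thesis
    unfolding lin_def
  proof (intro conjI ballI allI)
    fix u u' assume u: "u \<in> carr U" "u' \<in> carr U"
    show "F (u + u') = F u + F u'"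
      by (rule p_eqI) (use u assms(1) in \<open>simp_all add: U.add_mem D.add_mem 1 lin_add[OF p_lin1]\<close>)
  next
    fix c u assume u: "u \<in> carr U"
    show "F (scl U c u) = scl D c (F u)"
      by (rule p_eqI) (use u assms(1) in \<open>simp_all add: U.scl_mem D.scl_mem 2 lin_scl[OF p_lin1]\<close>)
  qed (use assms(1) in auto)
qed

sublocale SD: separated D "(\<lambda>x d. p d x) ` carr R"
  by unfold_locales (auto intro: p_nondeg p_lin1)

text \<open>The argument \<open>y\<close> belongs to the first leg and \<open>x\<close> to the
  second: this is the pairing f(y) g(x) that underlies \<open>graded_dual\<close>.\<close>

lemma teqD:
  assumes "set s \<subseteq> carr D \<times> carr D" "set t \<subseteq> carr D \<times> carr D"
    and "\<And>x y. x \<in> carr R \<Longrightarrow> y \<in> carr R \<Longrightarrow> tsum s (\<lambda>d e. p d y * p e x) = tsum t (\<lambda>d e. p d y * p e x)"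
  shows "teq D D s t"
  by (rule SD.teq_sep2) (use assms in auto)

lemma teqK:
  assumes "set s \<subseteq> carr K \<times> carr D" "set t \<subseteq> carr K \<times> carr D"
    and "\<And>\<phi> x. lin K kk \<phi> \<Longrightarrow> x \<in> carr R \<Longrightarrow> tsum s (\<lambda>h d. p d x * \<phi> h) = tsum t (\<lambda>h d. p d x * \<phi> h)"
  shows "teq K D s t"
  by (rule SD.teq_sepR) (use assms in \<open>auto simp: mult.commute\<close>)

subsection \<open>Dual bases\<close>

definition bounded :: "('a \<Rightarrow> 'k) \<Rightarrow> bool" where
  "bounded f \<longleftrightarrow> (\<exists>N. \<forall>n\<ge>N. \<forall>x\<in>deg R n. f x = 0)"

lemma boundedE:
  assumes "d \<in> carr D" obtains N where "\<And>n x. n \<ge> N \<Longrightarrow> x \<in> deg R n \<Longrightarrow> p d x = 0"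
proof -
  obtain N where "\<forall>n\<in>{n. \<exists>x\<in>deg R n. p d x \<noteq> 0}. n < N"
    using p_fin[OF assms] finite_nat_set_iff_bounded by blast
  then show ?thesis using that[of N] by (metis (mono_tags, lifting) leD mem_Collect_eq)
qed

text \<open>The element of \<open>D\<close> inducing \<open>f\<close>. Every operation with values
  in \<open>D\<close> is obtained by representing the functional that it should induce.\<close>

definition rep :: "('a \<Rightarrow> 'k) \<Rightarrow> 'd" where
  "rep f = (SOME d. d \<in> carr D \<and> (\<forall>x\<in>carr R. p d x = f x))"

lemma rep:
  assumes "lin R kk f" "bounded f"
  shows rep_mem: "rep f \<in> carr D" and p_rep: "x \<in> carr R \<Longrightarrow> p (rep f) x = f x"
proof -
  obtain N where N: "\<forall>n\<ge>N. \<forall>x\<in>deg R n. f x = 0" using assms(2) by (auto simp: bounded_def)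
  have "{n. \<exists>x\<in>deg R n. f x \<noteq> 0} \<subseteq> {..<N}" using N by (auto simp: not_le[symmetric])
  then have "finite {n. \<exists>x\<in>deg R n. f x \<noteq> 0}" using finite_subset by blast
  from p_repr[OF assms(1) this] have "\<exists>d. d \<in> carr D \<and> (\<forall>x\<in>carr R. p d x = f x)" by blast
  from someI_ex[OF this] show "rep f \<in> carr D" "x \<in> carr R \<Longrightarrow> p (rep f) x = f x"
    unfolding rep_def by auto
qed

definition ddeg :: "nat \<Rightarrow> 'd set" where
  "ddeg n = {d \<in> carr D. \<forall>m x. x \<in> deg R m \<longrightarrow> m \<noteq> n \<longrightarrow> p d x = 0}"

lemma ddeg_mem: "d \<in> ddeg n \<Longrightarrow> d \<in> carr D"
  by (simp add: ddeg_def)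

lemma ddeg_subspace: "D.VS.subspace (ddeg n)"
  unfolding D.VS.subspace_def
  by (auto simp: ddeg_def D.zero_mem D.add_mem D.scl_mem lin_0[OF p_lin1 D.vs_axioms] deg_mem
      lin_add[OF p_lin1] lin_scl[OF p_lin1])

lemma ddeg_proj: assumes d: "d \<in> ddeg n" and x: "x \<in> carr R" shows "p d (proj n x) = p d x"
proof (rule lin_eq_homog[OF _ _ _ x, of kk])
  fix m x assume "x \<in> deg R m"
  then show "p d (proj n x) = p d x"
    using d lin_0[OF p_lin2[OF ddeg_mem[OF d]] R.vs_axioms] by (auto simp: ddeg_def proj_homog)
qed (intro lins ddeg_mem[OF d])+

lemma ddeg_deg: "d \<in> ddeg n \<Longrightarrow> x \<in> deg R m \<Longrightarrow> m \<noteq> n \<Longrightarrow> p d x = 0"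
  by (auto simp: ddeg_def)

lemma rep_ddeg:
  assumes "lin R kk f" "\<And>m x. x \<in> deg R m \<Longrightarrow> m \<noteq> n \<Longrightarrow> f x = 0"
  shows "rep f \<in> ddeg n" "\<And>x. x \<in> carr R \<Longrightarrow> p (rep f) x = f x"
proof -
  have b: "bounded f" unfolding bounded_def using assms(2) by (intro exI[of _ "Suc n"]) auto
  show "rep f \<in> ddeg n" using assms rep_mem[OF assms(1) b] p_rep[OF assms(1) b] by (auto simp: ddeg_def deg_mem)
  show "\<And>x. x \<in> carr R \<Longrightarrow> p (rep f) x = f x" by (rule p_rep[OF assms(1) b])
qed

text \<open>The basis of \<open>ddeg n\<close> dual to \<open>bas n\<close>.\<close>

definition dl :: "nat \<Rightarrow> 'a \<Rightarrow> 'd" where "dl n b = rep (crd n b)"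

lemma dl: "dl n b \<in> ddeg n" "x \<in> carr R \<Longrightarrow> p (dl n b) x = crd n b x"
  unfolding dl_def by (intro rep_ddeg lin_crd crd_deg; assumption)+

lemma ddeg_expand: assumes d: "d \<in> ddeg n" shows "d = (\<Sum>b\<in>bas n. scl D (p d b) (dl n b))"
proof (rule p_eqI)
  have m: "scl D (p d b) (dl n b) \<in> carr D" for b using ddeg_mem[OF dl(1)] by (rule D.scl_mem)
  then show "(\<Sum>b\<in>bas n. scl D (p d b) (dl n b)) \<in> carr D" by (rule D.sum_mem)
  fix x assume x: "x \<in> carr R"
  have "p (\<Sum>b\<in>bas n. scl D (p d b) (dl n b)) x = (\<Sum>b\<in>bas n. p (scl D (p d b) (dl n b)) x)"
    by (rule lin_sum[OF p_lin1[OF x] D.vs_axioms m])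
  also have "\<dots> = (\<Sum>b\<in>bas n. crd n b x * p d b)"
    by (simp add: lin_scl[OF p_lin1[OF x] ddeg_mem[OF dl(1)]] dl(2)[OF x] mult.commute)
  also have "\<dots> = p d (proj n x)" using lin_expand[OF p_lin2[OF ddeg_mem[OF d]] x vs_kk] by simp
  also have "\<dots> = p d x" by (rule ddeg_proj[OF d x])
  finally show "p d x = p (\<Sum>b\<in>bas n. scl D (p d b) (dl n b)) x" by simp
qed (rule ddeg_mem[OF d])

definition dproj :: "nat \<Rightarrow> 'd \<Rightarrow> 'd" where "dproj n d = rep (\<lambda>x. p d (proj n x))"

lemma dproj: assumes d: "d \<in> carr D"
  shows "dproj n d \<in> ddeg n" "x \<in> carr R \<Longrightarrow> p (dproj n d) x = p d (proj n x)"
proof -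
  have l: "lin R kk (\<lambda>x. p d (proj n x))" by (intro lins d)
  have z: "p d (proj n x) = 0" if "x \<in> deg R m" "m \<noteq> n" for m x
    using that lin_0[OF p_lin2[OF d] R.vs_axioms] by (simp add: proj_homog)
  show "dproj n d \<in> ddeg n" "x \<in> carr R \<Longrightarrow> p (dproj n d) x = p d (proj n x)"
    unfolding dproj_def by (intro rep_ddeg l z; assumption)+
qed

lemma dproj_sum:
  assumes d: "d \<in> carr D" and N: "\<And>n x. n \<ge> N \<Longrightarrow> x \<in> deg R n \<Longrightarrow> p d x = 0"
  shows "d = (\<Sum>n<N. dproj n d)"
proof (rule p_eqI[OF d])
  note m = ddeg_mem[OF dproj(1)[OF d]]
  show "(\<Sum>n<N. dproj n d) \<in> carr D" by (intro D.sum_mem m)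
  fix x assume x: "x \<in> carr R"
  have "p (\<Sum>n<N. dproj n d) x = (\<Sum>n<N. p (dproj n d) x)"
    by (rule lin_sum[OF p_lin1[OF x] D.vs_axioms m])
  also have "\<dots> = (\<Sum>n<N. p d (proj n x))" by (simp add: dproj(2)[OF d x])
  also have "\<dots> = p d x"
  proof (rule lin_eq_homog[OF _ _ _ x, of kk])
    fix k x assume x: "x \<in> deg R k"
    have "(\<Sum>n<N. p d (proj n x)) = (\<Sum>n<N. if n = k then p d x else 0)"
      using x lin_0[OF p_lin2[OF d] R.vs_axioms] by (intro sum.cong) (auto simp: proj_homog)
    then show "(\<Sum>n<N. p d (proj n x)) = p d x" using N[of k x] x by (simp add: not_less[symmetric])
  qed (intro lins d)+
  finally show "p d x = p (\<Sum>n<N. dproj n d) x" by simp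
qed

subsection \<open>The structure maps\<close>

text \<open>Each structure map is the transpose of one of \<open>R\<close>. \<open>K\<close> acts
  through its antipode and coacts through the inverse antipode, as in \<open>yd_dual\<close>.
  Coproduct and coaction are lists, so they are chosen by their values under the pairing, and
  existence has to be shown separately.\<close>

definition dmul where "dmul d e = rep (\<lambda>x. tsum (cop R x) (\<lambda>a b. p d b * p e a))"
definition dunit where "dunit = rep (eps R)"
definition dantip where "dantip d = rep (\<lambda>x. p d (antip R x))"
definition dact where "dact h d = rep (\<lambda>x. p d (hact R (antip K h) x))"
definition dcop where "dcop d = (SOME t. set t \<subseteq> carr D \<times> carr D \<and>
   (\<forall>x\<in>carr R. \<forall>y\<in>carr R. tsum t (\<lambda>d1 d2. p d1 y * p d2 x) = p d (mul R x y)))"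
definition dcoact where "dcoact d = (SOME t. set t \<subseteq> carr K \<times> carr D \<and>
   (\<forall>x\<in>carr R. tsum t (\<lambda>h e. scl K (p e x) h) = tsum (hcoact R x) (\<lambda>h w. scl K (p d w) (ainv h))))"

definition dual :: "('k, 'h, 'd) yd_hopf" where
  "dual = \<lparr>carr = carr D, scl = scl D, mul = dmul, unit = dunit, cop = dcop, eps = (\<lambda>d. p d (unit R)),
     antip = dantip, hact = dact, hcoact = dcoact, deg = ddeg\<rparr>"

lemma dmul: assumes d: "d \<in> carr D" and e: "e \<in> carr D"
  shows dmul_mem [mems]: "dmul d e \<in> carr D"
    and p_dmul: "x \<in> carr R \<Longrightarrow> p (dmul d e) x = tsum (cop R x) (\<lambda>a b. p d b * p e a)"
proof -
  have l: "lin R kk (\<lambda>x. tsum (cop R x) (\<lambda>a b. p d b * p e a))" by (intro lins d e)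
  obtain N where N: "\<And>n x. n \<ge> N \<Longrightarrow> x \<in> deg R n \<Longrightarrow> p d x = 0" using boundedE[OF d] by blast
  obtain M where M: "\<And>n x. n \<ge> M \<Longrightarrow> x \<in> deg R n \<Longrightarrow> p e x = 0" using boundedE[OF e] by blast
  have "bounded (\<lambda>x. tsum (cop R x) (\<lambda>a b. p d b * p e a))"
    unfolding bounded_def
  \<comment> \<open>If n \<ge> N + M, then in each bidegree (i, n - i) one has i \<ge> M or n - i
    \<ge> N, so one of the two factors vanishes.\<close>
  proof (intro exI[of _ "N + M"] allI impI ballI)
    fix n x assume n: "n \<ge> N + M" and x: "x \<in> deg R n"
    have b: "bilin R R kk (\<lambda>a b. p d b * p e a)" by (intro bilinI lins d e)
    have "tsum (cop R x) (\<lambda>a b. p d b * p e a) = (\<Sum>i\<le>n. tsum (cop R x) (\<lambda>a b. p d (proj (n - i) b) * p e (proj i a)))"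
      by (rule cop_homog[OF x b vs_kk])
    also have "\<dots> = (\<Sum>i\<le>n. tsum (cop R x) (\<lambda>a b. 0))"
    proof (intro sum.cong refl R.cop_cong deg_mem[OF x])
      fix i a b assume i: "i \<in> {..n}" and ab: "a \<in> carr R" "b \<in> carr R"
      have "n - i \<ge> N \<or> i \<ge> M" using n i by auto
      then show "p d (proj (n - i) b) * p e (proj i a) = 0"
        using N[of "n - i" "proj (n - i) b"] M[of i "proj i a"] proj_deg ab by auto
    qed
    finally show "tsum (cop R x) (\<lambda>a b. p d b * p e a) = 0" by simp
  qed
  from rep_mem[OF l this] p_rep[OF l this]
  show "dmul d e \<in> carr D" "x \<in> carr R \<Longrightarrow> p (dmul d e) x = tsum (cop R x) (\<lambda>a b. p d b * p e a)"
    by (simp_all add: dmul_def)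
qed

lemma dunit: shows dunit_ddeg: "dunit \<in> ddeg 0" and p_dunit: "x \<in> carr R \<Longrightarrow> p dunit x = eps R x"
proof -
  have l: "lin R kk (eps R)" by (intro lins)
  from rep_ddeg[OF l, of 0] show "dunit \<in> ddeg 0" "x \<in> carr R \<Longrightarrow> p dunit x = eps R x"
    unfolding dunit_def by (auto simp: deg_eps)
qed

lemma dunit_mem [mems]: "dunit \<in> carr D" by (rule ddeg_mem[OF dunit_ddeg])

lemma rep_comp:
  assumes d: "d \<in> carr D" and f: "lin R R f" "\<And>n x. x \<in> deg R n \<Longrightarrow> f x \<in> deg R n"
  shows "rep (\<lambda>x. p d (f x)) \<in> carr D" "x \<in> carr R \<Longrightarrow> p (rep (\<lambda>x. p d (f x))) x = p d (f x)"
    "d \<in> ddeg n \<Longrightarrow> rep (\<lambda>x. p d (f x)) \<in> ddeg n"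
proof -
  have l: "lin R kk (\<lambda>x. p d (f x))" by (intro lins d f)
  obtain N where "\<And>n x. n \<ge> N \<Longrightarrow> x \<in> deg R n \<Longrightarrow> p d x = 0" using boundedE[OF d] by blast
  then have b: "bounded (\<lambda>x. p d (f x))" unfolding bounded_def using f(2) by blast
  show "rep (\<lambda>x. p d (f x)) \<in> carr D" "x \<in> carr R \<Longrightarrow> p (rep (\<lambda>x. p d (f x))) x = p d (f x)"
    by (rule rep_mem[OF l b], rule p_rep[OF l b])
  show "rep (\<lambda>x. p d (f x)) \<in> ddeg n" if dn: "d \<in> ddeg n"
  proof (rule rep_ddeg(1)[OF l])
    fix m x assume "x \<in> deg R m" "m \<noteq> n"
    then show "p d (f x) = 0" using ddeg_deg[OF dn f(2)] by blast
  qed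
qed

lemma dantip: assumes d: "d \<in> carr D"
  shows dantip_mem [mems]: "dantip d \<in> carr D"
    and p_dantip: "x \<in> carr R \<Longrightarrow> p (dantip d) x = p d (antip R x)"
    and dantip_ddeg: "d \<in> ddeg n \<Longrightarrow> dantip d \<in> ddeg n"
  unfolding dantip_def by (intro rep_comp[OF d R.antip_lin] deg_antip; assumption)+

lemma dact: assumes h: "h \<in> carr K" and d: "d \<in> carr D"
  shows dact_mem [mems]: "dact h d \<in> carr D"
    and p_dact: "x \<in> carr R \<Longrightarrow> p (dact h d) x = p d (hact R (antip K h) x)"
    and dact_ddeg: "d \<in> ddeg n \<Longrightarrow> dact h d \<in> ddeg n"
proof -
  have l: "lin R R (\<lambda>x. hact R (antip K h) x)" by (intro lins mems h)
  show "dact h d \<in> carr D" "x \<in> carr R \<Longrightarrow> p (dact h d) x = p d (hact R (antip K h) x)"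
    "d \<in> ddeg n \<Longrightarrow> dact h d \<in> ddeg n"
    unfolding dact_def by (intro rep_comp[OF d l] deg_act YD.K.antip_mem h; assumption)+
qed

lemma p_mul_homog:
  assumes d: "d \<in> ddeg n" and x: "x \<in> carr R" and y: "y \<in> carr R"
  shows "p d (mul R x y) = (\<Sum>i\<le>n. p d (mul R (proj (n - i) x) (proj i y)))"
proof -
  note dc = ddeg_mem[OF d]
  have 1: "p d (mul R x y) = (\<Sum>i\<le>n. p d (mul R (proj (n - i) x) (proj i y)))" if x: "x \<in> deg R m" for m x
  proof (rule lin_eq_homog[OF _ _ _ y, of kk])
    note xc = deg_mem[OF x]
    fix k y assume y: "y \<in> deg R k"
    have "(\<Sum>i\<le>n. p d (mul R (proj (n - i) x) (proj i y))) =
        (\<Sum>i\<le>n. if i = k then p d (mul R (proj (n - i) x) y) else 0)"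
      using y lin_0[OF p_lin2[OF dc] R.vs_axioms] lin_0[OF R.mul_lin_right R.vs_axioms] proj_mem[OF xc]
      by (intro sum.cong) (auto simp: proj_homog)
    also have "\<dots> = (if k \<le> n then p d (mul R (proj (n - k) x) y) else 0)" by simp
    also have "\<dots> = p d (mul R x y)"
      using ddeg_deg[OF d deg_mul[OF x y]] x lin_0[OF p_lin2[OF dc] R.vs_axioms]
        lin_0[OF R.mul_lin_left[OF deg_mem[OF y]] R.vs_axioms] by (auto simp: proj_homog)
    finally show "p d (mul R x y) = (\<Sum>i\<le>n. p d (mul R (proj (n - i) x) (proj i y)))" by simp
  qed (intro lins mems dc deg_mem[OF x]; assumption?)+
  show ?thesis
    by (rule lin_eq_homog[OF _ _ 1 x, of kk]) (intro lins mems dc y; assumption?)+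
qed

text \<open>Here local finiteness is essential: the transpose of the multiplication must be a finite
  sum of pure tensors. In degree \<open>n\<close> only finitely many bidegrees occur, each with a
  finite basis.\<close>

lemma dcop_homog_ex:
  assumes d: "d \<in> ddeg n"
  shows "\<exists>t. set t \<subseteq> (\<Union>i\<le>n. ddeg i \<times> ddeg (n - i)) \<and>
     (\<forall>x\<in>carr R. \<forall>y\<in>carr R. tsum t (\<lambda>d1 d2. p d1 y * p d2 x) = p d (mul R x y))"
proof -
  note dc = ddeg_mem[OF d]
  have "\<forall>i. \<exists>l. set l = bas i \<and> (\<forall>f :: 'a \<Rightarrow> 'k. sum_list (map f l) = sum f (bas i))"
    using sum_list_bas by blast
  then obtain l where l: "\<And>i. set (l i) = bas i" "\<And>i (f :: 'a \<Rightarrow> 'k). sum_list (map f (l i)) = sum f (bas i)"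
    by metis
  \<comment> \<open>The expansion in dual bases: the sum of d(cb) b' \<otimes> c', where b' and c'
    are dual to \<open>b\<close> of degree \<open>i\<close> and \<open>c\<close> of degree
    \<open>n - i\<close>. Multiplying \<open>c\<close> by \<open>b\<close> in this order reflects
    the exchanged legs.\<close>
  define t where "t = concat (map (\<lambda>i. concat (map (\<lambda>b. map (\<lambda>c.
      (scl D (p d (mul R c b)) (dl i b), dl (n - i) c)) (l (n - i))) (l i))) [0..<Suc n])"
  have "set t \<subseteq> (\<Union>i\<le>n. ddeg i \<times> ddeg (n - i))"
    using dl(1) D.VS.subspace_scale[OF ddeg_subspace] by (fastforce simp: t_def)
  moreover have "tsum t (\<lambda>d1 d2. p d1 y * p d2 x) = p d (mul R x y)" if x: "x \<in> carr R" and y: "y \<in> carr R" for x y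
  proof -
    have 1: "p d (mul R (proj (n - i) x) (proj i y)) =
      (\<Sum>b\<in>bas i. \<Sum>c\<in>bas (n - i). crd (n - i) c x * crd i b y * p d (mul R c b))" for i
    proof -
      have "p d (mul R (proj (n - i) x) (proj i y)) = (\<Sum>b\<in>bas i. crd i b y * p d (mul R (proj (n - i) x) b))"
        using lin_expand[of kk "\<lambda>z. p d (mul R (proj (n - i) x) z)" y i] y x dc by (simp add: lins mems)
      also have "\<dots> = (\<Sum>b\<in>bas i. crd i b y * (\<Sum>c\<in>bas (n - i). crd (n - i) c x * p d (mul R c b)))"
      proof (intro sum.cong refl arg_cong2[where f="(*)"])
        fix b assume "b \<in> bas i"
        then have b: "b \<in> carr R" using bas_deg deg_mem by blast
        show "p d (mul R (proj (n - i) x) b) = (\<Sum>c\<in>bas (n - i). crd (n - i) c x * p d (mul R c b))"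
          using lin_expand[of kk "\<lambda>z. p d (mul R z b)" x "n - i"] b x dc by (simp add: lins mems)
      qed
      finally show ?thesis by (simp add: sum_distrib_left mult.assoc mult.left_commute)
    qed
    have "tsum t (\<lambda>d1 d2. p d1 y * p d2 x) =
       (\<Sum>i\<leftarrow>[0..<Suc n]. \<Sum>b\<in>bas i. \<Sum>c\<in>bas (n - i). p (scl D (p d (mul R c b)) (dl i b)) y * p (dl (n - i) c) x)"
      unfolding t_def tsum_concat_map tsum_map_list l(2) ..
    also have "\<dots> = (\<Sum>i\<leftarrow>[0..<Suc n]. p d (mul R (proj (n - i) x) (proj i y)))"
      unfolding 1 by (simp add: lin_scl[OF p_lin1[OF y] ddeg_mem[OF dl(1)]] dl(2) x y mult.assoc mult.left_commute mult.commute
          del: upt_Suc)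
    also have "\<dots> = p d (mul R x y)"
      unfolding p_mul_homog[OF d x y] by (simp add: sum_list_distinct_conv_sum_set atLeast0LessThan lessThan_Suc_atMost del: upt_Suc)
    finally show ?thesis .
  qed
  ultimately show ?thesis by blast
qed

lemma dcop_ex:
  assumes d: "d \<in> carr D"
  shows "\<exists>t. set t \<subseteq> carr D \<times> carr D \<and>
     (\<forall>x\<in>carr R. \<forall>y\<in>carr R. tsum t (\<lambda>d1 d2. p d1 y * p d2 x) = p d (mul R x y))"
proof -
  obtain N where N: "\<And>n x. n \<ge> N \<Longrightarrow> x \<in> deg R n \<Longrightarrow> p d x = 0" using boundedE[OF d] by blast
  have "\<forall>n. \<exists>t. set t \<subseteq> (\<Union>i\<le>n. ddeg i \<times> ddeg (n - i)) \<and>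
     (\<forall>x\<in>carr R. \<forall>y\<in>carr R. tsum t (\<lambda>d1 d2. p d1 y * p d2 x) = p (dproj n d) (mul R x y))"
    by (intro allI dcop_homog_ex dproj d)
  from choice[OF this] obtain t where t0: "\<forall>n. set (t n) \<subseteq> (\<Union>i\<le>n. ddeg i \<times> ddeg (n - i)) \<and>
     (\<forall>x\<in>carr R. \<forall>y\<in>carr R. tsum (t n) (\<lambda>d1 d2. p d1 y * p d2 x) = p (dproj n d) (mul R x y))" ..
  have "(\<Union>i\<le>n. ddeg i \<times> ddeg (n - i)) \<subseteq> carr D \<times> carr D" for n using ddeg_mem by blast
  with t0 have t: "\<And>n. set (t n) \<subseteq> carr D \<times> carr D"
     "\<And>n x y. x \<in> carr R \<Longrightarrow> y \<in> carr R \<Longrightarrow> tsum (t n) (\<lambda>d1 d2. p d1 y * p d2 x) = p (dproj n d) (mul R x y)"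
    by blast+
  show ?thesis
  proof (intro exI[of _ "concat (map t [0..<N])"] conjI ballI)
    show "set (concat (map t [0..<N])) \<subseteq> carr D \<times> carr D"
      using t(1) by (simp add: UN_least)
  next
    fix x y assume x: "x \<in> carr R" and y: "y \<in> carr R"
    have "tsum (concat (map t [0..<N])) (\<lambda>d1 d2. p d1 y * p d2 x) = (\<Sum>n<N. p (dproj n d) (mul R x y))"
      by (simp add: tsum_concat_map t(2) x y sum_list_distinct_conv_sum_set atLeast0LessThan)
    also have "\<dots> = p (\<Sum>n<N. dproj n d) (mul R x y)"
      by (rule lin_sum[OF p_lin1[OF R.mul_mem[OF x y]] D.vs_axioms, symmetric]) (rule ddeg_mem[OF dproj(1)[OF d]])
    also have "(\<Sum>n<N. dproj n d) = d" by (rule dproj_sum[OF d N, symmetric])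
    finally show "tsum (concat (map t [0..<N])) (\<lambda>d1 d2. p d1 y * p d2 x) = p d (mul R x y)" .
  qed
qed

lemma dcop: assumes d: "d \<in> carr D"
  shows dcop_mem: "set (dcop d) \<subseteq> carr D \<times> carr D"
    and p_dcop: "x \<in> carr R \<Longrightarrow> y \<in> carr R \<Longrightarrow> tsum (dcop d) (\<lambda>d1 d2. p d1 y * p d2 x) = p d (mul R x y)"
  using someI_ex[OF dcop_ex[OF d]] unfolding dcop_def by auto

lemma lin_coact_form: "d \<in> carr D \<Longrightarrow> lin R K (\<lambda>x. tsum (hcoact R x) (\<lambda>h w. scl K (p d w) (ainv h)))"
  by (intro lins mems)

text \<open>The witness is the sum of \<open>?G b\<close> \<otimes> \<open>dl n b\<close> over the
  basis \<open>bas n\<close>: a linear map into \<open>K\<close> factoring through degree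
  \<open>n\<close> is determined by its values on that basis.\<close>

lemma dcoact_homog_ex:
  assumes d: "d \<in> ddeg n"
  shows "\<exists>t. set t \<subseteq> carr K \<times> ddeg n \<and>
     (\<forall>x\<in>carr R. tsum t (\<lambda>h e. scl K (p e x) h) = tsum (hcoact R x) (\<lambda>h w. scl K (p d w) (ainv h)))"
proof -
  note dc = ddeg_mem[OF d]
  let ?G = "\<lambda>x. tsum (hcoact R x) (\<lambda>h w. scl K (p d w) (ainv h))"
  note lG = lin_coact_form[OF dc]
  obtain l where l: "set l = bas n" "\<And>f :: 'a \<Rightarrow> 'h. sum_list (map f l) = sum f (bas n)"
    using sum_list_bas by metis
  have "set (map (\<lambda>b. (?G b, dl n b)) l) \<subseteq> carr K \<times> ddeg n"
    using l(1) dl(1) lin_mem[OF lG deg_mem[OF bas_deg]] by auto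
  moreover have "tsum (map (\<lambda>b. (?G b, dl n b)) l) (\<lambda>h e. scl K (p e x) h) = ?G x" if x: "x \<in> carr R" for x
  proof -
    have "tsum (map (\<lambda>b. (?G b, dl n b)) l) (\<lambda>h e. scl K (p e x) h) = (\<Sum>b\<in>bas n. scl K (crd n b x) (?G b))"
      by (simp add: tsum_map_list l(2) dl(2)[OF x])
    also have "\<dots> = ?G (proj n x)"
      by (rule lin_expand[OF lG x YD.K.vs_axioms, symmetric])
    also have "\<dots> = ?G x"
    proof (rule lin_eq_homog[OF _ lG _ x])
      show "lin R K (\<lambda>x. ?G (proj n x))" by (intro lin_comp[OF lG] lins)
    next
      fix m x assume x: "x \<in> deg R m"
      have b: "bilin K R K (\<lambda>h w. scl K (p d w) (ainv h))" by (intro bilinI lins mems dc)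
      show "?G (proj n x) = ?G x"
      proof (cases "m = n")
        case False
        have "?G x = tsum (hcoact R x) (\<lambda>h w. scl K (p d (proj m w)) (ainv h))"
          by (rule hcoact_homog[OF x b YD.K.vs_axioms])
        also have "\<dots> = tsum (hcoact R x) (\<lambda>h w. 0)"
          using ddeg_deg[OF d proj_deg False] by (intro hcoact_cong deg_mem[OF x]) simp
        finally have "?G x = 0" by simp
        moreover have "?G 0 = 0" by (rule lin_0[OF lG R.vs_axioms])
        ultimately show ?thesis using False x by (simp add: proj_homog)
      qed (use x in \<open>simp add: proj_homog\<close>)
    qed
    finally show ?thesis .
  qed
  ultimately show ?thesis by blast
qed

lemma dcoact_ex:
  assumes d: "d \<in> carr D"
  shows "\<exists>t. set t \<subseteq> carr K \<times> carr D \<and>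
     (\<forall>x\<in>carr R. tsum t (\<lambda>h e. scl K (p e x) h) = tsum (hcoact R x) (\<lambda>h w. scl K (p d w) (ainv h)))"
proof -
  obtain N where N: "\<And>n x. n \<ge> N \<Longrightarrow> x \<in> deg R n \<Longrightarrow> p d x = 0" using boundedE[OF d] by blast
  have "\<forall>n. \<exists>t. set t \<subseteq> carr K \<times> ddeg n \<and> (\<forall>x\<in>carr R.
     tsum t (\<lambda>h e. scl K (p e x) h) = tsum (hcoact R x) (\<lambda>h w. scl K (p (dproj n d) w) (ainv h)))"
    by (intro allI dcoact_homog_ex dproj d)
  from choice[OF this] obtain t where t0: "\<forall>n. set (t n) \<subseteq> carr K \<times> ddeg n \<and> (\<forall>x\<in>carr R.
     tsum (t n) (\<lambda>h e. scl K (p e x) h) = tsum (hcoact R x) (\<lambda>h w. scl K (p (dproj n d) w) (ainv h)))" ..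
  have "carr K \<times> ddeg n \<subseteq> carr K \<times> carr D" for n using ddeg_mem by blast
  with t0 have t: "\<And>n. set (t n) \<subseteq> carr K \<times> carr D"
     "\<And>n x. x \<in> carr R \<Longrightarrow> tsum (t n) (\<lambda>h e. scl K (p e x) h) = tsum (hcoact R x) (\<lambda>h w. scl K (p (dproj n d) w) (ainv h))"
    by blast+
  show ?thesis
  proof (intro exI[of _ "concat (map t [0..<N])"] conjI ballI)
    show "set (concat (map t [0..<N])) \<subseteq> carr K \<times> carr D"
      using t(1) by (simp add: UN_least)
  next
    fix x assume x: "x \<in> carr R"
    have "tsum (concat (map t [0..<N])) (\<lambda>h e. scl K (p e x) h) =
        (\<Sum>n<N. tsum (hcoact R x) (\<lambda>h w. scl K (p (dproj n d) w) (ainv h)))"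
      by (simp add: tsum_concat_map t(2) x sum_list_distinct_conv_sum_set atLeast0LessThan)
    also have "\<dots> = tsum (hcoact R x) (\<lambda>h w. scl K (\<Sum>n<N. p (dproj n d) w) (ainv h))"
      by (simp add: tsum_sum YD.K.VS.scale_sum_left)
    also have "\<dots> = tsum (hcoact R x) (\<lambda>h w. scl K (p (\<Sum>n<N. dproj n d) w) (ainv h))"
      by (intro hcoact_cong x) (simp add: lin_sum[OF p_lin1 D.vs_axioms] ddeg_mem[OF dproj(1)[OF d]])
    also have "(\<Sum>n<N. dproj n d) = d" by (rule dproj_sum[OF d N, symmetric])
    finally show "tsum (concat (map t [0..<N])) (\<lambda>h e. scl K (p e x) h) =
        tsum (hcoact R x) (\<lambda>h w. scl K (p d w) (ainv h))" .
  qed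
qed

lemma dcoact0: assumes d: "d \<in> carr D"
  shows dcoact_mem: "set (dcoact d) \<subseteq> carr K \<times> carr D"
    and dcoact_spec: "x \<in> carr R \<Longrightarrow> tsum (dcoact d) (\<lambda>h e. scl K (p e x) h) = tsum (hcoact R x) (\<lambda>h w. scl K (p d w) (ainv h))"
  using someI_ex[OF dcoact_ex[OF d]] unfolding dcoact_def by auto

text \<open>Stated for any list with the defining property of the coaction, because the homogeneous
  list of \<open>dcoact_homog_ex\<close> has to be compared with the chosen one in
  \<open>dual_graded\<close>.\<close>

lemma p_dcoact_list:
  assumes t: "set t \<subseteq> carr K \<times> carr D"
     "\<And>x. x \<in> carr R \<Longrightarrow> tsum t (\<lambda>h e. scl K (p e x) h) = tsum (hcoact R x) (\<lambda>h w. scl K (p d w) (ainv h))"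
    and x: "x \<in> carr R" and f: "lin K Z f"
  shows "tsum t (\<lambda>h e. scl Z (p e x) (f h)) = tsum (hcoact R x) (\<lambda>h w. scl Z (p d w) (f (ainv h)))"
proof -
  have "tsum t (\<lambda>h e. scl Z (p e x) (f h)) = tsum t (\<lambda>h e. f (scl K (p e x) h))"
    by (rule tsum_congC[OF t(1)]) (simp add: lin_scl[OF f])
  also have "\<dots> = f (tsum t (\<lambda>h e. scl K (p e x) h))"
    using t(1) by (intro lin_tsum_out[OF f YD.K.vs_axioms, symmetric] mems) auto
  also have "\<dots> = f (tsum (hcoact R x) (\<lambda>h w. scl K (p d w) (ainv h)))"
    by (simp add: t(2) x)
  also have "\<dots> = tsum (hcoact R x) (\<lambda>h w. f (scl K (p d w) (ainv h)))"
    using hcoact_mem[OF x] by (intro lin_tsum_out[OF f YD.K.vs_axioms] mems) auto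
  also have "\<dots> = tsum (hcoact R x) (\<lambda>h w. scl Z (p d w) (f (ainv h)))"
    by (intro hcoact_cong x) (simp add: lin_scl[OF f] KB.ainv_mem)
  finally show ?thesis .
qed

lemma p_dcoact:
  assumes d: "d \<in> carr D" and x: "x \<in> carr R" and f: "lin K Z f"
  shows "tsum (dcoact d) (\<lambda>h e. scl Z (p e x) (f h)) = tsum (hcoact R x) (\<lambda>h w. scl Z (p d w) (f (ainv h)))"
  by (rule p_dcoact_list[OF dcoact_mem[OF d] dcoact_spec[OF d] x f])

lemma p_dcoactk:
  assumes "d \<in> carr D" "x \<in> carr R" "lin K kk f"
  shows "tsum (dcoact d) (\<lambda>h e. p e x * f h) = tsum (hcoact R x) (\<lambda>h w. p d w * f (ainv h))"
  using p_dcoact[OF assms] by simp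

end

section \<open>The dual as a braided Hopf algebra\<close>

context dual_pairing
begin

lemma dual_sel [simp]: "carr dual = carr D" "scl dual = scl D" "mul dual = dmul" "unit dual = dunit"
  "cop dual = dcop" "eps dual d = p d (unit R)" "antip dual = dantip" "hact dual = dact"
  "hcoact dual = dcoact" "deg dual = ddeg"
  by (simp_all add: dual_def)

lemma lin_dual [simp]: "lin X dual f = lin X D f" "lin dual Y g = lin D Y g"
  by (simp_all add: lin_def)

lemma vs_dual [simp]: "vs dual = vs D" by (simp add: vs_def)

lemma teq_dual [simp]: "teq dual dual s t = teq D D s t" "teq K dual s' t' = teq K D s' t'"
  by (simp_all add: teq_iff bilin_def)

lemma teq3_dual [simp]: "teq3 dual dual dual s t = teq3 D D D s t"
  "teq3 K dual dual s' t' = teq3 K D D s' t'" "teq3 K K dual s'' t'' = teq3 K K D s'' t''"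
  by (simp_all add: teq3_iff trilin_def)

lemma lin_tensor_dual [simp]: "lin_tensor dual dual dual f = lin_tensor D D D f"
  "lin_tensor dual K dual g = lin_tensor D K D g"
  by (simp_all add: lin_tensor_def)

lemma dcop_lin: "lin_tensor D D D dcop"
  unfolding lin_tensor_def
proof (intro conjI ballI allI)
  fix d assume d: "d \<in> carr D"
  show "set (dcop d) \<subseteq> carr D \<times> carr D" by (rule dcop_mem[OF d])
  fix e assume e: "e \<in> carr D"
  show "teq D D (dcop (d + e)) (dcop d @ dcop e)"
    using dcop_mem d e by (intro teqD) (simp_all add: D.add_mem p_dcop lin_add[OF p_lin1] R.mul_mem)
next
  fix c d assume d: "d \<in> carr D"
  note m = dcop_mem[OF d]
  show "teq D D (dcop (scl D c d)) [(scl D c y, z). (y, z) \<leftarrow> dcop d]"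
  proof (rule teqD)
    show "set (dcop (scl D c d)) \<subseteq> carr D \<times> carr D" by (intro dcop_mem D.scl_mem d)
    show "set [(scl D c y, z). (y, z) \<leftarrow> dcop d] \<subseteq> carr D \<times> carr D" using m by (auto intro: D.scl_mem)
    fix x y assume x: "x \<in> carr R" and y: "y \<in> carr R"
    have "tsum (dcop d) (\<lambda>a b. p (scl D c a) y * p b x) = tsum (dcop d) (\<lambda>a b. c * (p a y * p b x))"
      by (rule tsum_congC[OF m]) (simp add: lin_scl[OF p_lin1[OF y]])
    then show "tsum (dcop (scl D c d)) (\<lambda>d e. p d y * p e x) =
        tsum [(scl D c y, z). (y, z) \<leftarrow> dcop d] (\<lambda>d e. p d y * p e x)"
      using d x y by (simp add: p_dcop D.scl_mem lin_scl[OF p_lin1] R.mul_mem tsum_mult_left)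
  qed
qed

lemma dcop_cong:
  "d \<in> carr D \<Longrightarrow> (\<And>a b. a \<in> carr D \<Longrightarrow> b \<in> carr D \<Longrightarrow> f a b = g a b) \<Longrightarrow>
   tsum (dcop d) f = tsum (dcop d) g"
  by (rule tsum_congC[OF dcop_mem])

lemma dcoact_cong:
  "d \<in> carr D \<Longrightarrow> (\<And>a b. a \<in> carr K \<Longrightarrow> b \<in> carr D \<Longrightarrow> f a b = g a b) \<Longrightarrow>
   tsum (dcoact d) f = tsum (dcoact d) g"
  by (rule tsum_congC[OF dcoact_mem])

lemma dcoact_lin: "lin_tensor D K D dcoact"
  unfolding lin_tensor_def
proof (intro conjI ballI allI)
  fix d assume d: "d \<in> carr D"
  show "set (dcoact d) \<subseteq> carr K \<times> carr D" by (rule dcoact_mem[OF d])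
  fix e assume e: "e \<in> carr D"
  show "teq K D (dcoact (d + e)) (dcoact d @ dcoact e)"
  proof (rule teqK)
    fix \<phi> x assume f: "lin K kk \<phi>" and x: "x \<in> carr R"
    have "tsum (hcoact R x) (\<lambda>h w. p (d + e) w * \<phi> (ainv h)) =
        tsum (hcoact R x) (\<lambda>h w. p d w * \<phi> (ainv h) + p e w * \<phi> (ainv h))"
      by (intro hcoact_cong x) (simp add: lin_add[OF p_lin1] d e algebra_simps)
    then show "tsum (dcoact (d + e)) (\<lambda>h d. p d x * \<phi> h) = tsum (dcoact d @ dcoact e) (\<lambda>h d. p d x * \<phi> h)"
      by (simp add: p_dcoactk d e x f D.add_mem tsum_add)
  qed (use dcoact_mem d e D.add_mem in auto)
next
  fix c d assume d: "d \<in> carr D"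
  note m = dcoact_mem[OF d]
  show "teq K D (dcoact (scl D c d)) [(scl K c y, z). (y, z) \<leftarrow> dcoact d]"
  proof (rule teqK)
    show "set (dcoact (scl D c d)) \<subseteq> carr K \<times> carr D" by (intro dcoact_mem D.scl_mem d)
    show "set [(scl K c y, z). (y, z) \<leftarrow> dcoact d] \<subseteq> carr K \<times> carr D" using m by (auto intro: YD.K.scl_mem)
    fix \<phi> x assume f: "lin K kk \<phi>" and x: "x \<in> carr R"
    have 1: "tsum (dcoact d) (\<lambda>h e. p e x * \<phi> (scl K c h)) = tsum (dcoact d) (\<lambda>h e. c * (p e x * \<phi> h))"
      by (rule tsum_congC[OF m]) (simp add: lin_scl[OF f])
    have 2: "tsum (hcoact R x) (\<lambda>h w. p (scl D c d) w * \<phi> (ainv h)) = tsum (hcoact R x) (\<lambda>h w. c * (p d w * \<phi> (ainv h)))"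
      by (intro hcoact_cong x) (simp add: lin_scl[OF p_lin1] d)
    show "tsum (dcoact (scl D c d)) (\<lambda>h d. p d x * \<phi> h) =
        tsum [(scl K c y, z). (y, z) \<leftarrow> dcoact d] (\<lambda>h d. p d x * \<phi> h)"
      by (simp add: p_dcoactk d x f D.scl_mem 1 2 tsum_mult_left)
  qed
qed

lemma lin_dact [lins]:
  "lin U K f \<Longrightarrow> vs U \<Longrightarrow> d \<in> carr D \<Longrightarrow> lin U D (\<lambda>u. dact (f u) d)"
  "lin U D g \<Longrightarrow> vs U \<Longrightarrow> h \<in> carr K \<Longrightarrow> lin U D (\<lambda>u. dact h (g u))"
proof -
  show "lin U D (\<lambda>u. dact (f u) d)" if f: "lin U K f" and U: "vs U" and d: "d \<in> carr D"
  proof (rule linDI[OF _ _ U])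
    fix x assume x: "x \<in> carr R"
    have "lin U kk (\<lambda>u. p d (hact R (antip K (f u)) x))" by (intro lins f d x)
    then show "lin U kk (\<lambda>u. p (dact (f u) d) x)"
      by (rule lin_cong[OF _ _ U]) (simp add: p_dact d x lin_mem[OF f])
  qed (simp add: dact_mem d lin_mem[OF f])
  show "lin U D (\<lambda>u. dact h (g u))" if g: "lin U D g" and U: "vs U" and h: "h \<in> carr K"
  proof (rule linDI[OF _ _ U])
    fix x assume x: "x \<in> carr R"
    have "lin U kk (\<lambda>u. p (g u) (hact R (antip K h) x))" by (intro lins mems g h x)
    then show "lin U kk (\<lambda>u. p (dact h (g u)) x)"
      by (rule lin_cong[OF _ _ U]) (simp add: p_dact h x lin_mem[OF g])
  qed (simp add: dact_mem h lin_mem[OF g])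
qed

lemma lin_dmul:
  "b \<in> carr D \<Longrightarrow> lin D D (\<lambda>a. dmul a b)" "a \<in> carr D \<Longrightarrow> lin D D (\<lambda>b. dmul a b)"
proof -
  show "lin D D (\<lambda>a. dmul a b)" if b: "b \<in> carr D"
  proof (rule linDI[OF _ _ D.vs_axioms])
    fix x assume x: "x \<in> carr R"
    have "lin D kk (\<lambda>d. tsum (cop R x) (\<lambda>u v. p d v * p b u))" by (intro lins x)
    then show "lin D kk (\<lambda>a. p (dmul a b) x)"
      by (rule lin_cong[OF _ _ D.vs_axioms]) (simp add: p_dmul b x)
  qed (simp add: dmul_mem b)
  show "lin D D (\<lambda>b. dmul a b)" if a: "a \<in> carr D"
  proof (rule linDI[OF _ _ D.vs_axioms])
    fix x assume x: "x \<in> carr R"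
    have "lin D kk (\<lambda>d. tsum (cop R x) (\<lambda>u v. p a v * p d u))" by (intro lins x)
    then show "lin D kk (\<lambda>b. p (dmul a b) x)"
      by (rule lin_cong[OF _ _ D.vs_axioms]) (simp add: p_dmul a x)
  qed (simp add: dmul_mem a)
qed

lemma dual_algebra: "algebra dual"
proof (intro algebra.intro algebra_axioms.intro)
  show "vs dual" using D.vs_axioms by simp
next
  fix d assume "d \<in> carr dual"
  then have d: "d \<in> carr D" by simp
  show "lin dual dual (\<lambda>a. mul dual a d)" "lin dual dual (\<lambda>b. mul dual d b)" using lin_dmul d by simp_all
  show "mul dual (unit dual) d = d"
  proof (rule p_eqI)
    fix x assume x: "x \<in> carr R"
    have "p (dmul dunit d) x = tsum (cop R x) (\<lambda>a b. eps R b * p d a)"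
      unfolding p_dmul[OF dunit_mem d x] by (intro R.cop_cong x) (simp add: p_dunit)
    also have "\<dots> = p d x" using R.eps_cop_right[OF x p_lin2[OF d]] by simp
    finally show "p (mul dual (unit dual) d) x = p d x" by simp
  qed (simp_all add: d mems)
  show "mul dual d (unit dual) = d"
  proof (rule p_eqI)
    fix x assume x: "x \<in> carr R"
    have "p (dmul d dunit) x = tsum (cop R x) (\<lambda>a b. eps R a * p d b)"
      unfolding p_dmul[OF d dunit_mem x] by (intro R.cop_cong x) (simp add: p_dunit)
    also have "\<dots> = p d x" using R.eps_cop_left[OF x p_lin2[OF d]] by simp
    finally show "p (mul dual d (unit dual)) x = p d x" by simp
  qed (simp_all add: d mems)
next
  fix d e f assume "d \<in> carr dual" "e \<in> carr dual" "f \<in> carr dual"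
  then have m: "d \<in> carr D" "e \<in> carr D" "f \<in> carr D" by simp_all
  have "dmul (dmul d e) f = dmul d (dmul e f)"
  proof (rule p_eqI)
    fix x assume x: "x \<in> carr R"
    \<comment> \<open>The exchange of legs makes the left-bracketed product use the second leg of
      the coproduct, so coassociativity is read from right to left.\<close>
    have "p (dmul (dmul d e) f) x = tsum (cop R x) (\<lambda>a b. tsum (cop R b) (\<lambda>b1 b2. p d b2 * p e b1 * p f a))"
      unfolding p_dmul[OF dmul_mem[OF m(1,2)] m(3) x]
      by (intro R.cop_cong x) (simp add: p_dmul m tsum_mult_right)
    also have "\<dots> = tsum (cop R x) (\<lambda>a b. tsum (cop R a) (\<lambda>a1 a2. p d b * p e a2 * p f a1))"
      by (rule R.cop_assoc[OF x _ vs_kk, symmetric]) (intro trilinI lins m; assumption?)+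
    also have "\<dots> = p (dmul d (dmul e f)) x"
      unfolding p_dmul[OF m(1) dmul_mem[OF m(2,3)] x]
      by (intro R.cop_cong x) (simp add: p_dmul m tsum_mult_left mult.assoc)
    finally show "p (dmul (dmul d e) f) x = p (dmul d (dmul e f)) x" .
  qed (intro mems m)+
  then show "mul dual (mul dual d e) f = mul dual d (mul dual e f)" by simp
qed (simp add: dunit_mem)

lemma dual_coalgebra: "coalgebra dual"
proof (intro coalgebra.intro coalgebra_axioms.intro)
  show "vs dual" using D.vs_axioms by simp
  show "lin_tensor dual dual dual (cop dual)" using dcop_lin by simp
  show "lform dual (eps dual)" unfolding lform_lin using p_lin1[OF R.unit_carr] by (simp add: dual_def lin_def)
next
  fix d assume "d \<in> carr dual"
  then have d: "d \<in> carr D" by simp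
  note m = dcop_mem[OF d]
  have mm: "a \<in> carr D \<and> b \<in> carr D" if "(a, b) \<in> set (dcop d)" for a b using m that by auto
  have "teq3 D D D [(a1, a2, b). (a, b) \<leftarrow> dcop d, (a1, a2) \<leftarrow> dcop a]
                 [(a, b1, b2). (a, b) \<leftarrow> dcop d, (b1, b2) \<leftarrow> dcop b]"
  proof (rule SD.teq3_sep3)
    show "set [(a1, a2, b). (a, b) \<leftarrow> dcop d, (a1, a2) \<leftarrow> dcop a] \<subseteq> carr D \<times> carr D \<times> carr D"
      "set [(a, b1, b2). (a, b) \<leftarrow> dcop d, (b1, b2) \<leftarrow> dcop b] \<subseteq> carr D \<times> carr D \<times> carr D"
      using mm dcop_mem by fastforce+
  next
    fix q q' q'' assume "q \<in> (\<lambda>x d. p d x) ` carr R" "q' \<in> (\<lambda>x d. p d x) ` carr R" "q'' \<in> (\<lambda>x d. p d x) ` carr R"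
    then obtain x y z where q: "q = (\<lambda>d. p d x)" "x \<in> carr R" "q' = (\<lambda>d. p d y)" "y \<in> carr R"
      "q'' = (\<lambda>d. p d z)" "z \<in> carr R" by auto
    have "tsum (dcop d) (\<lambda>a b. tsum (dcop a) (\<lambda>a1 a2. p a1 x * p a2 y * p b z)) =
        tsum (dcop d) (\<lambda>a b. p a (mul R y x) * p b z)"
      by (intro dcop_cong d) (simp add: tsum_mult_right p_dcop q)
    also have "\<dots> = p d (mul R z (mul R y x))" by (simp add: p_dcop d q R.mul_mem)
    also have "\<dots> = tsum (dcop d) (\<lambda>a b. p a x * p b (mul R z y))" by (simp add: p_dcop d q R.mul_mem R.mul_assoc)
    also have "\<dots> = tsum (dcop d) (\<lambda>a b. tsum (dcop b) (\<lambda>b1 b2. p a x * p b1 y * p b2 z))"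
      by (intro dcop_cong d) (simp add: tsum_mult_left p_dcop q mult.assoc)
    finally show "tsum3 [(a1, a2, b). (a, b) \<leftarrow> dcop d, (a1, a2) \<leftarrow> dcop a] (\<lambda>x d e. q x * q' d * q'' e) =
      tsum3 [(a, b1, b2). (a, b) \<leftarrow> dcop d, (b1, b2) \<leftarrow> dcop b] (\<lambda>x d e. q x * q' d * q'' e)"
      by (simp add: q)
  qed
  then show "teq3 dual dual dual [(a1, a2, b). (a, b) \<leftarrow> cop dual d, (a1, a2) \<leftarrow> cop dual a]
                 [(a, b1, b2). (a, b) \<leftarrow> cop dual d, (b1, b2) \<leftarrow> cop dual b]"
    unfolding teq3_dual by simp
  have "tsum (dcop d) (\<lambda>a b. scl D (p a (unit R)) b) = d"
  proof (rule p_eqI)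
    show "tsum (dcop d) (\<lambda>a b. scl D (p a (unit R)) b) \<in> carr D" using mm by (intro D.tsum_mem D.scl_mem) auto
    fix x assume x: "x \<in> carr R"
    have "p (tsum (dcop d) (\<lambda>a b. scl D (p a (unit R)) b)) x = tsum (dcop d) (\<lambda>a b. p (scl D (p a (unit R)) b) x)"
      using mm by (intro lin_tsum_out[OF p_lin1[OF x] D.vs_axioms] D.scl_mem) auto
    also have "\<dots> = tsum (dcop d) (\<lambda>a b. p a (unit R) * p b x)"
      by (intro dcop_cong d) (simp add: lin_scl[OF p_lin1[OF x]])
    finally show "p (tsum (dcop d) (\<lambda>a b. scl D (p a (unit R)) b)) x = p d x"
      by (simp add: p_dcop d x R.unit_carr R.unit_right)
  qed (rule d)
  then show "(\<Sum>(a, b)\<leftarrow>cop dual d. scl dual (eps dual a) b) = d" by (simp add: tsum_def)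
  have "tsum (dcop d) (\<lambda>a b. scl D (p b (unit R)) a) = d"
  proof (rule p_eqI)
    show "tsum (dcop d) (\<lambda>a b. scl D (p b (unit R)) a) \<in> carr D" using mm by (intro D.tsum_mem D.scl_mem) auto
    fix x assume x: "x \<in> carr R"
    have "p (tsum (dcop d) (\<lambda>a b. scl D (p b (unit R)) a)) x = tsum (dcop d) (\<lambda>a b. p (scl D (p b (unit R)) a) x)"
      using mm by (intro lin_tsum_out[OF p_lin1[OF x] D.vs_axioms] D.scl_mem) auto
    also have "\<dots> = tsum (dcop d) (\<lambda>a b. p a x * p b (unit R))"
      by (intro dcop_cong d) (simp add: lin_scl[OF p_lin1[OF x]])
    finally show "p (tsum (dcop d) (\<lambda>a b. scl D (p b (unit R)) a)) x = p d x"
      by (simp add: p_dcop d x R.unit_carr R.unit_left)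
  qed (rule d)
  then show "(\<Sum>(a, b)\<leftarrow>cop dual d. scl dual (eps dual b) a) = d" by (simp add: tsum_def)
qed

text \<open>The compatibility of product and coproduct is self-dual: evaluated at \<open>y\<close>
  and \<open>x\<close>, both sides become the expression for the coproduct of
  \<open>mul R x y\<close>, with the roles of the two maps exchanged.\<close>

lemma dual_braided: "braided_hopf dual (yd_braiding dual)"
proof (intro braided_hopf.intro braided_hopf_axioms.intro dual_algebra dual_coalgebra)
  fix d e assume "d \<in> carr dual" "e \<in> carr dual"
  then have d: "d \<in> carr D" and e: "e \<in> carr D" by simp_all
  let ?L = "[(dmul a u, dmul v b'). (a, b) \<leftarrow> dcop d, (a', b') \<leftarrow> dcop e, (u, v) \<leftarrow> yd_braiding dual b a']"
  have "teq D D (dcop (dmul d e)) ?L"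
  proof (rule teqD)
    show "set (dcop (dmul d e)) \<subseteq> carr D \<times> carr D" by (intro dcop_mem mems d e)
    show "set ?L \<subseteq> carr D \<times> carr D"
    proof
      fix z assume "z \<in> set ?L"
      then obtain a b a' b' h v where z: "(a, b) \<in> set (dcop d)" "(a', b') \<in> set (dcop e)" "(h, v) \<in> set (dcoact b)"
        "z = (dmul a (dact h a'), dmul v b')" by (auto simp: yd_braiding_def)
      then have "a \<in> carr D" "b \<in> carr D" "a' \<in> carr D" "b' \<in> carr D" using dcop_mem d e by blast+
      moreover have "h \<in> carr K" "v \<in> carr D" using z(3) dcoact_mem[OF \<open>b \<in> carr D\<close>] by auto
      ultimately show "z \<in> carr D \<times> carr D" unfolding z by (auto intro!: mems)
    qed
    fix x y assume x: "x \<in> carr R" and y: "y \<in> carr R"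
    \<comment> \<open>The braiding of the dual is the transpose of that of \<open>R\<close>: its
      coaction contributes the inverse antipode and its action the antipode, and the two
      cancel.\<close>
    have inner: "tsum (dcoact d2) (\<lambda>h w. (p d1 b' * p e1 (hact R (antip K h) a')) * (p w b * p e2 a)) =
        tsum (hcoact R b) (\<lambda>h w. (p d1 b' * p d2 w) * (p e1 (hact R h a') * p e2 a))"
      if m: "d1 \<in> carr D" "d2 \<in> carr D" "e1 \<in> carr D" "e2 \<in> carr D"
        "a \<in> carr R" "b \<in> carr R" "a' \<in> carr R" "b' \<in> carr R" for d1 d2 e1 e2 a b a' b'
    proof -
      have l: "lin K kk (\<lambda>h. p d1 b' * p e1 (hact R (antip K h) a') * p e2 a)" by (intro lins m)
      have "tsum (dcoact d2) (\<lambda>h w. (p d1 b' * p e1 (hact R (antip K h) a')) * (p w b * p e2 a)) =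
          tsum (dcoact d2) (\<lambda>h w. p w b * (p d1 b' * p e1 (hact R (antip K h) a') * p e2 a))"
        by (simp add: mult_ac)
      also have "\<dots> = tsum (hcoact R b) (\<lambda>h w. p d2 w * (p d1 b' * p e1 (hact R (antip K (ainv h)) a') * p e2 a))"
        by (rule p_dcoactk[OF m(2,6) l])
      also have "\<dots> = tsum (hcoact R b) (\<lambda>h w. (p d1 b' * p d2 w) * (p e1 (hact R h a') * p e2 a))"
        by (intro hcoact_cong m) (simp add: mult_ac)
      finally show ?thesis .
    qed
    have "tsum ?L (\<lambda>d e. p d y * p e x) = tsum (dcop d) (\<lambda>d1 d2. tsum (dcop e) (\<lambda>e1 e2.
        tsum (dcoact d2) (\<lambda>h w. p (dmul d1 (dact h e1)) y * p (dmul w e2) x)))"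
      by (simp add: yd_braiding_def del: map_map)
    also have "\<dots> = tsum (dcop d) (\<lambda>d1 d2. tsum (dcop e) (\<lambda>e1 e2. tsum (dcoact d2) (\<lambda>h w.
        tsum (cop R x) (\<lambda>a b. tsum (cop R y) (\<lambda>a' b'. (p d1 b' * p e1 (hact R (antip K h) a')) * (p w b * p e2 a))))))"
    proof (intro dcop_cong dcoact_cong d e)
      fix d1 d2 e1 e2 h w assume m: "d1 \<in> carr D" "d2 \<in> carr D" "e1 \<in> carr D" "e2 \<in> carr D" "h \<in> carr K" "w \<in> carr D"
      have "p (dmul d1 (dact h e1)) y = tsum (cop R y) (\<lambda>a' b'. p d1 b' * p e1 (hact R (antip K h) a'))"
        unfolding p_dmul[OF m(1) dact_mem[OF m(5,3)] y] by (intro R.cop_cong y) (simp add: p_dact m)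
      moreover have "p (dmul w e2) x = tsum (cop R x) (\<lambda>a b. p w b * p e2 a)"
        by (rule p_dmul[OF m(6,4) x])
      ultimately show "p (dmul d1 (dact h e1)) y * p (dmul w e2) x =
         tsum (cop R x) (\<lambda>a b. tsum (cop R y) (\<lambda>a' b'. (p d1 b' * p e1 (hact R (antip K h) a')) * (p w b * p e2 a)))"
        by (simp only: tsum_prod tsum_swap[of "cop R y"])
    qed assumption+
    \<comment> \<open>The sums over \<open>R\<close> move outside, so that the sums over the dual
      can be evaluated one after the other: first the coaction by \<open>inner\<close>, then the two
      coproducts by \<open>p_dcop\<close>.\<close>
    also have "\<dots> = tsum (cop R x) (\<lambda>a b. tsum (cop R y) (\<lambda>a' b'. tsum (dcop d) (\<lambda>d1 d2. tsum (dcop e) (\<lambda>e1 e2.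
        tsum (dcoact d2) (\<lambda>h w. (p d1 b' * p e1 (hact R (antip K h) a')) * (p w b * p e2 a))))))"
      by (simp only: tsum_swap[of "dcop d" "cop R x"] tsum_swap[of "dcop e" "cop R x"] tsum_swap[of "dcop d" "cop R y"]
          tsum_swap[of "dcop e" "cop R y"] tsum_swap[where s="dcoact d2" and t="cop R x" for d2]
          tsum_swap[where s="dcoact d2" and t="cop R y" for d2])
    also have "\<dots> = tsum (cop R x) (\<lambda>a b. tsum (cop R y) (\<lambda>a' b'. tsum (dcop d) (\<lambda>d1 d2. tsum (dcop e) (\<lambda>e1 e2.
        tsum (hcoact R b) (\<lambda>h w. (p d1 b' * p d2 w) * (p e1 (hact R h a') * p e2 a))))))"
      by (intro R.cop_cong x y dcop_cong d e inner)
    also have "\<dots> = tsum (cop R x) (\<lambda>a b. tsum (cop R y) (\<lambda>a' b'. tsum (hcoact R b) (\<lambda>h w.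
        tsum (dcop d) (\<lambda>d1 d2. p d1 b' * p d2 w) * tsum (dcop e) (\<lambda>e1 e2. p e1 (hact R h a') * p e2 a))))"
      by (simp only: tsum_prod tsum_swap[where s="dcop d" and t="hcoact R b" for b] tsum_swap[where s="dcop e" and t="hcoact R b" for b])
    also have "\<dots> = tsum (cop R x) (\<lambda>a b. tsum (cop R y) (\<lambda>a' b'. tsum (hcoact R b) (\<lambda>h w.
        p d (mul R w b') * p e (mul R a (hact R h a')))))"
      by (intro R.cop_cong hcoact_cong x y) (simp_all add: p_dcop d e hact_mem)
    also have "\<dots> = tsum (cop R (mul R x y)) (\<lambda>a b. p d b * p e a)"
      by (rule cop_mul_R[OF x y _ vs_kk, symmetric]) (intro bilinI lins d e)
    also have "\<dots> = tsum (dcop (dmul d e)) (\<lambda>d e. p d y * p e x)"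
      by (simp add: p_dcop dmul_mem d e x y p_dmul R.mul_mem)
    finally show "tsum (dcop (dmul d e)) (\<lambda>d e. p d y * p e x) = tsum ?L (\<lambda>d e. p d y * p e x)" by simp
  qed
  then show "teq dual dual (cop dual (mul dual d e)) [(mul dual a u, mul dual v b').
      (a, b) \<leftarrow> cop dual d, (a', b') \<leftarrow> cop dual e, (u, v) \<leftarrow> yd_braiding dual b a']"
    by (simp del: map_map)
  have "p (dmul d e) (unit R) = tsum (cop R (unit R)) (\<lambda>a b. p d b * p e a)" by (rule p_dmul[OF d e R.unit_carr])
  also have "\<dots> = p d (unit R) * p e (unit R)" by (rule R.cop_unit_tsum[OF _ vs_kk]) (intro bilinI lins d e)
  finally show "eps dual (mul dual d e) = eps dual d * eps dual e" by simp
next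
  have "teq D D (dcop dunit) [(dunit, dunit)]"
    by (rule teqD) (simp_all add: dcop_mem dunit_mem p_dcop p_dunit R.mul_mem R.eps_mul mult.commute)
  then show "teq dual dual (cop dual (unit dual)) [(unit dual, unit dual)]" by simp
  show "eps dual (unit dual) = 1" by (simp add: p_dunit R.unit_carr R.eps_unit)
  have "lin D D dantip"
  proof (rule linDI[OF _ _ D.vs_axioms])
    fix x assume x: "x \<in> carr R"
    have "lin D kk (\<lambda>d. p d (antip R x))" by (intro lins mems x)
    then show "lin D kk (\<lambda>d. p (dantip d) x)"
      by (rule lin_cong[OF _ _ D.vs_axioms]) (simp add: p_dantip x)
  qed (simp add: dantip_mem)
  then show "lin dual dual (antip dual)" by simp
next
  fix d assume "d \<in> carr dual"
  then have d: "d \<in> carr D" by simp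
  have mm: "a \<in> carr D \<and> b \<in> carr D" if "(a, b) \<in> set (dcop d)" for a b using dcop_mem[OF d] that by auto
  have "tsum (dcop d) (\<lambda>a b. dmul (dantip a) b) = scl D (p d (unit R)) dunit"
  proof (rule p_eqI)
    show "tsum (dcop d) (\<lambda>a b. dmul (dantip a) b) \<in> carr D" using mm by (intro D.tsum_mem mems) auto
    show "scl D (p d (unit R)) dunit \<in> carr D" by (intro mems)
    fix x assume x: "x \<in> carr R"
    have "p (tsum (dcop d) (\<lambda>a b. dmul (dantip a) b)) x = tsum (dcop d) (\<lambda>a b. p (dmul (dantip a) b) x)"
      using mm by (intro lin_tsum_out[OF p_lin1[OF x] D.vs_axioms] mems) auto
    also have "\<dots> = tsum (dcop d) (\<lambda>a b. tsum (cop R x) (\<lambda>u v. p a (antip R v) * p b u))"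
    proof (intro dcop_cong d)
      fix a b assume m: "a \<in> carr D" "b \<in> carr D"
      show "p (dmul (dantip a) b) x = tsum (cop R x) (\<lambda>u v. p a (antip R v) * p b u)"
        unfolding p_dmul[OF dantip_mem[OF m(1)] m(2) x] by (intro R.cop_cong x) (simp add: p_dantip m)
    qed
    \<comment> \<open>The left antipode axiom of the dual is the right antipode axiom of
      \<open>R\<close>, again because the legs are exchanged.\<close>
    also have "\<dots> = tsum (cop R x) (\<lambda>u v. p d (mul R u (antip R v)))"
      unfolding tsum_swap[of "dcop d"] by (intro R.cop_cong x) (simp add: p_dcop d R.antip_mem)
    also have "\<dots> = eps R x * p d (unit R)" using R.antip_cop_right[OF x p_lin2[OF d]] by simp
    finally show "p (tsum (dcop d) (\<lambda>a b. dmul (dantip a) b)) x = p (scl D (p d (unit R)) dunit) x"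
      by (simp add: lin_scl[OF p_lin1[OF x] dunit_mem] p_dunit x)
  qed
  then show "(\<Sum>(a, b)\<leftarrow>cop dual d. mul dual (antip dual a) b) = scl dual (eps dual d) (unit dual)"
    by (simp add: tsum_def)
  have "tsum (dcop d) (\<lambda>a b. dmul a (dantip b)) = scl D (p d (unit R)) dunit"
  proof (rule p_eqI)
    show "tsum (dcop d) (\<lambda>a b. dmul a (dantip b)) \<in> carr D" using mm by (intro D.tsum_mem mems) auto
    show "scl D (p d (unit R)) dunit \<in> carr D" by (intro mems)
    fix x assume x: "x \<in> carr R"
    have "p (tsum (dcop d) (\<lambda>a b. dmul a (dantip b))) x = tsum (dcop d) (\<lambda>a b. p (dmul a (dantip b)) x)"
      using mm by (intro lin_tsum_out[OF p_lin1[OF x] D.vs_axioms] mems) auto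
    also have "\<dots> = tsum (dcop d) (\<lambda>a b. tsum (cop R x) (\<lambda>u v. p a v * p b (antip R u)))"
    proof (intro dcop_cong d)
      fix a b assume m: "a \<in> carr D" "b \<in> carr D"
      show "p (dmul a (dantip b)) x = tsum (cop R x) (\<lambda>u v. p a v * p b (antip R u))"
        unfolding p_dmul[OF m(1) dantip_mem[OF m(2)] x] by (intro R.cop_cong x) (simp add: p_dantip m)
    qed
    also have "\<dots> = tsum (cop R x) (\<lambda>u v. p d (mul R (antip R u) v))"
      unfolding tsum_swap[of "dcop d"] by (intro R.cop_cong x) (simp add: p_dcop d R.antip_mem)
    also have "\<dots> = eps R x * p d (unit R)" using R.antip_cop_left[OF x p_lin2[OF d]] by simp
    finally show "p (tsum (dcop d) (\<lambda>a b. dmul a (dantip b))) x = p (scl D (p d (unit R)) dunit) x"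
      by (simp add: lin_scl[OF p_lin1[OF x] dunit_mem] p_dunit x)
  qed
  then show "(\<Sum>(a, b)\<leftarrow>cop dual d. mul dual a (antip dual b)) = scl dual (eps dual d) (unit dual)"
    by (simp add: tsum_def)
qed

end

section \<open>The Yetter-Drinfeld structure of the dual\<close>

context dual_pairing
begin

lemma lin_dcoact [lins]:
  assumes "vs W" "lin U D f" "\<And>y. y \<in> carr D \<Longrightarrow> lin K W (\<lambda>x. B x y)"
    "\<And>x. x \<in> carr K \<Longrightarrow> lin D W (\<lambda>y. B x y)"
  shows "lin U W (\<lambda>x. tsum (dcoact (f x)) B)"
  using assms by (intro lin_tensor_lin[OF dcoact_lin] bilinI)

lemma lin_dcoact_const [lins]:
  assumes "d \<in> carr D" "vs W" "\<And>a b. a \<in> carr K \<Longrightarrow> b \<in> carr D \<Longrightarrow> lin U W (\<lambda>u. T u a b)"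
  shows "lin U W (\<lambda>u. tsum (dcoact d) (T u))"
  using assms dcoact_mem[OF assms(1)] by (intro lin_tsum_const) auto

text \<open>The symmetric form \<open>yd_braid\<close> of the compatibility for the dual. It is the
  transpose of the same identity of \<open>R\<close> at S(h); \<open>antip_cop\<close> is used
  before and after, so the legs of \<open>h\<close> are exchanged twice.\<close>

lemma dcoact_braid:
  assumes h: "h \<in> carr K" and d: "d \<in> carr D" and f: "lin K kk \<phi>" and x: "x \<in> carr R"
  shows "tsum (cop K h) (\<lambda>h1 h2. tsum (dcoact (dact h1 d)) (\<lambda>g w. p w x * \<phi> (mul K g h2))) =
    tsum (cop K h) (\<lambda>h1 h2. tsum (dcoact d) (\<lambda>g w. p (dact h2 w) x * \<phi> (mul K h1 g)))"
proof -
  note [lins] = lin_comp[OF f]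
  have "tsum (cop K h) (\<lambda>h1 h2. tsum (dcoact (dact h1 d)) (\<lambda>g w. p w x * \<phi> (mul K g h2))) =
    tsum (cop K h) (\<lambda>h1 h2. tsum (hcoact R x) (\<lambda>g w. p d (hact R (antip K h1) w) * \<phi> (ainv (mul K (antip K h2) g))))"
  proof (intro YD.K.cop_cong h)
    fix h1 h2 assume m: "h1 \<in> carr K" "h2 \<in> carr K"
    have l: "lin K kk (\<lambda>g. \<phi> (mul K g h2))" by (intro lins m)
    show "tsum (dcoact (dact h1 d)) (\<lambda>g w. p w x * \<phi> (mul K g h2)) =
        tsum (hcoact R x) (\<lambda>g w. p d (hact R (antip K h1) w) * \<phi> (ainv (mul K (antip K h2) g)))"
      unfolding p_dcoactk[OF dact_mem[OF m(1) d] x l]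
      by (intro hcoact_cong x) (simp add: p_dact m d KB.ainv_mult YD.K.antip_mem)
  qed
  also have "\<dots> = tsum (cop K (antip K h)) (\<lambda>k1 k2. tsum (hcoact R x) (\<lambda>g w. p d (hact R k2 w) * \<phi> (ainv (mul K k1 g))))"
    by (rule YD.K.antip_cop[OF h _ vs_kk, symmetric]) (intro bilinI lins mems d x; assumption?)+
  also have "\<dots> = tsum (cop K (antip K h)) (\<lambda>k1 k2. tsum (hcoact R (hact R k1 x)) (\<lambda>g w. p d w * \<phi> (ainv (mul K g k2))))"
    by (rule hyd_braid[OF YD.K.antip_mem[OF h] x _ vs_kk, symmetric]) (intro bilinI lins mems d; assumption?)+
  also have "\<dots> = tsum (cop K h) (\<lambda>h1 h2. tsum (hcoact R (hact R (antip K h2) x)) (\<lambda>g w. p d w * \<phi> (ainv (mul K g (antip K h1)))))"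
    by (rule YD.K.antip_cop[OF h _ vs_kk]) (intro bilinI lins mems d x; assumption?)+
  also have "\<dots> = tsum (cop K h) (\<lambda>h1 h2. tsum (dcoact d) (\<lambda>g w. p (dact h2 w) x * \<phi> (mul K h1 g)))"
  proof (intro YD.K.cop_cong h)
    fix h1 h2 assume m: "h1 \<in> carr K" "h2 \<in> carr K"
    have l: "lin K kk (\<lambda>g. \<phi> (mul K h1 g))" by (intro lins m)
    have xm: "hact R (antip K h2) x \<in> carr R" by (intro mems m x)
    have "tsum (dcoact d) (\<lambda>g w. p (dact h2 w) x * \<phi> (mul K h1 g)) =
        tsum (dcoact d) (\<lambda>g w. p w (hact R (antip K h2) x) * \<phi> (mul K h1 g))"
      by (intro dcoact_cong d) (simp add: p_dact m x)
    also have "\<dots> = tsum (hcoact R (hact R (antip K h2) x)) (\<lambda>g w. p d w * \<phi> (mul K h1 (ainv g)))"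
      by (rule p_dcoactk[OF d xm l])
    also have "\<dots> = tsum (hcoact R (hact R (antip K h2) x)) (\<lambda>g w. p d w * \<phi> (ainv (mul K g (antip K h1))))"
      by (intro hcoact_cong xm) (simp add: m KB.ainv_mult YD.K.antip_mem)
    finally show "tsum (hcoact R (hact R (antip K h2) x)) (\<lambda>g w. p d w * \<phi> (ainv (mul K g (antip K h1)))) =
        tsum (dcoact d) (\<lambda>g w. p (dact h2 w) x * \<phi> (mul K h1 g))" by simp
  qed
  finally show ?thesis .
qed

text \<open>Converse to the derivation of \<open>yd_braid\<close>: multiplying
  \<open>dcoact_braid\<close> by S(\<open>h3\<close>) on the right yields a factor \<open>h2\<close>
  S(\<open>h3\<close>) on one side, which the antipode axiom contracts.\<close>

lemma dual_compat:
  assumes h: "h \<in> carr K" and d: "d \<in> carr D" and f: "lin K kk \<phi>" and x: "x \<in> carr R"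
  shows "tsum (dcoact (dact h d)) (\<lambda>g w. p w x * \<phi> g) = tsum (cop K h) (\<lambda>h1 h'. tsum (cop K h') (\<lambda>h2 h3.
    tsum (dcoact d) (\<lambda>g w. p (dact h2 w) x * \<phi> (mul K (mul K h1 g) (antip K h3)))))"
proof -
  note [lins] = lin_comp[OF f]
  have "tsum (cop K h) (\<lambda>h1 h'. tsum (cop K h') (\<lambda>h2 h3.
      tsum (dcoact d) (\<lambda>g w. p (dact h2 w) x * \<phi> (mul K (mul K h1 g) (antip K h3))))) =
    tsum (cop K h) (\<lambda>h' h3. tsum (cop K h') (\<lambda>h1 h2.
      tsum (dcoact d) (\<lambda>g w. p (dact h2 w) x * \<phi> (mul K (mul K h1 g) (antip K h3)))))"
    by (rule YD.K.cop_assoc[OF h _ vs_kk, symmetric]) (intro trilinI lins mems d x YD.K.vs_axioms; assumption?)+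
  also have "\<dots> = tsum (cop K h) (\<lambda>h' h3. tsum (cop K h') (\<lambda>h1 h2.
      tsum (dcoact (dact h1 d)) (\<lambda>g w. p w x * \<phi> (mul K (mul K g h2) (antip K h3)))))"
  proof (rule YD.K.cop_cong[OF h])
    fix h' h3 assume m: "h' \<in> carr K" "h3 \<in> carr K"
    have "lin K kk (\<lambda>g. \<phi> (mul K g (antip K h3)))" by (intro lins mems m)
    from dcoact_braid[OF m(1) d this x]
    show "tsum (cop K h') (\<lambda>h1 h2. tsum (dcoact d) (\<lambda>g w. p (dact h2 w) x * \<phi> (mul K (mul K h1 g) (antip K h3)))) =
       tsum (cop K h') (\<lambda>h1 h2. tsum (dcoact (dact h1 d)) (\<lambda>g w. p w x * \<phi> (mul K (mul K g h2) (antip K h3))))"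
      by simp
  qed
  also have "\<dots> = tsum (cop K h) (\<lambda>h1 s. tsum (cop K s) (\<lambda>h2 h3.
      tsum (dcoact (dact h1 d)) (\<lambda>g w. p w x * \<phi> (mul K (mul K g h2) (antip K h3)))))"
    by (rule YD.K.cop_assoc[OF h _ vs_kk]) (intro trilinI lins mems d x YD.K.vs_axioms; assumption?)+
  also have "\<dots> = tsum (cop K h) (\<lambda>h1 s. eps K s * tsum (dcoact (dact h1 d)) (\<lambda>g w. p w x * \<phi> g))"
  proof (rule YD.K.cop_cong[OF h])
    fix h1 s assume m: "h1 \<in> carr K" "s \<in> carr K"
    have dm: "dact h1 d \<in> carr D" by (intro mems m d)
    have "tsum (cop K s) (\<lambda>h2 h3. tsum (dcoact (dact h1 d)) (\<lambda>g w. p w x * \<phi> (mul K (mul K g h2) (antip K h3)))) =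
       tsum (cop K s) (\<lambda>h2 h3. (\<lambda>z. tsum (dcoact (dact h1 d)) (\<lambda>g w. p w x * \<phi> (mul K g z))) (mul K h2 (antip K h3)))"
      by (intro YD.K.cop_cong dcoact_cong m dm) (simp_all add: YD.K.mul_assoc YD.K.antip_mem)
    also have "\<dots> = scl kk (eps K s) (tsum (dcoact (dact h1 d)) (\<lambda>g w. p w x * \<phi> (mul K g (unit K))))"
      by (rule YD.K.antip_cop_right) (intro lins mems m dm d x; assumption?)+
    also have "tsum (dcoact (dact h1 d)) (\<lambda>g w. p w x * \<phi> (mul K g (unit K))) = tsum (dcoact (dact h1 d)) (\<lambda>g w. p w x * \<phi> g)"
      by (intro dcoact_cong dm) (simp add: YD.K.unit_right)
    finally show "tsum (cop K s) (\<lambda>h2 h3. tsum (dcoact (dact h1 d)) (\<lambda>g w. p w x * \<phi> (mul K (mul K g h2) (antip K h3)))) =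
       eps K s * tsum (dcoact (dact h1 d)) (\<lambda>g w. p w x * \<phi> g)" by simp
  qed
  also have "\<dots> = tsum (dcoact (dact h d)) (\<lambda>g w. p w x * \<phi> g)"
  proof -
    have "lin K kk (\<lambda>h1. tsum (dcoact (dact h1 d)) (\<lambda>g w. p w x * \<phi> g))" by (intro lins mems d x YD.K.vs_axioms)
    from YD.K.eps_cop_right[OF h this] show ?thesis by simp
  qed
  finally show ?thesis by simp
qed

lemma dual_yd: "yd_module K (yd_of dual)"
proof (intro yd_module.intro yd_module_axioms.intro YD.K.hopf_algebra_axioms)
  show "vs (yd_of dual)" using D.vs_axioms by simp
  show "lin_tensor (yd_of dual) K (yd_of dual) (coact (yd_of dual))"
    unfolding lin_tensor_conv yd_of_sel lin_tensor_dual using dcoact_lin by simp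
next
  fix d assume "d \<in> carr (yd_of dual)"
  then have d: "d \<in> carr D" by simp
  show "lin K (yd_of dual) (\<lambda>h. act (yd_of dual) h d)"
    using lin_dact(1)[OF lin_id YD.K.vs_axioms d] by simp
  have "dact (unit K) d = d"
    by (rule p_eqI) (simp_all add: mems d p_dact YD.K.unit_carr YD.K.antip_unit hact_unit)
  then show "act (yd_of dual) (unit K) d = d" by simp
  have mm: "a \<in> carr K \<and> b \<in> carr D" if "(a, b) \<in> set (dcoact d)" for a b using dcoact_mem[OF d] that by auto
  have "teq3 K K D [(h1, h2, w). (h, w) \<leftarrow> dcoact d, (h1, h2) \<leftarrow> cop K h]
                 [(h, g, u). (h, w) \<leftarrow> dcoact d, (g, u) \<leftarrow> dcoact w]"
  proof (rule SD.teq3_sep)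
    show "set [(h1, h2, w). (h, w) \<leftarrow> dcoact d, (h1, h2) \<leftarrow> cop K h] \<subseteq> carr K \<times> carr K \<times> carr D"
      using mm YD.K.cop_mem by fastforce
    show "set [(h, g, u). (h, w) \<leftarrow> dcoact d, (g, u) \<leftarrow> dcoact w] \<subseteq> carr K \<times> carr K \<times> carr D"
      using mm dcoact_mem by fastforce
  next
    fix \<beta> q assume b: "bilin K K kk \<beta>" and "q \<in> (\<lambda>x d. p d x) ` carr R"
    then obtain x where q: "q = (\<lambda>d. p d x)" and x: "x \<in> carr R" by auto
    note [lins] = bilinD[OF b]
    have l: "lin K kk (\<lambda>h. tsum (cop K h) \<beta>)" by (intro lins)
    have "tsum (dcoact d) (\<lambda>h w. tsum (cop K h) (\<lambda>h1 h2. \<beta> h1 h2 * p w x)) =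
        tsum (dcoact d) (\<lambda>h w. p w x * tsum (cop K h) \<beta>)"
      by (simp add: tsum_mult_right mult.commute)
    also have "\<dots> = tsum (hcoact R x) (\<lambda>h w. p d w * tsum (cop K (ainv h)) \<beta>)"
      by (rule p_dcoactk[OF d x l])
    \<comment> \<open>The inverse antipode reverses the coproduct of \<open>K\<close>. Transposing
      the iterated coaction reverses the order as well, so the legs come out in the right
      order.\<close>
    also have "\<dots> = tsum (hcoact R x) (\<lambda>h w. tsum (cop K h) (\<lambda>h1 h2. p d w * \<beta> (ainv h2) (ainv h1)))"
      by (intro hcoact_cong x) (simp add: KB.ainv_cop[OF _ b vs_kk] tsum_mult_left)
    also have "\<dots> = tsum (hcoact R x) (\<lambda>h w. tsum (hcoact R w) (\<lambda>g u. p d u * \<beta> (ainv g) (ainv h)))"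
      by (rule hcoact_assoc[OF x _ vs_kk]) (intro trilinI lins mems d; assumption?)+
    also have "\<dots> = tsum (hcoact R x) (\<lambda>h w. tsum (dcoact d) (\<lambda>g u. p u w * \<beta> g (ainv h)))"
      by (intro hcoact_cong x p_dcoactk[symmetric] d lins mems)
    also have "\<dots> = tsum (dcoact d) (\<lambda>g u. tsum (hcoact R x) (\<lambda>h w. p u w * \<beta> g (ainv h)))"
      by (rule tsum_swap)
    also have "\<dots> = tsum (dcoact d) (\<lambda>g u. tsum (dcoact u) (\<lambda>h w. p w x * \<beta> g h))"
      by (intro dcoact_cong d p_dcoactk[symmetric] x lins mems)
    finally show "tsum3 [(h1, h2, w). (h, w) \<leftarrow> dcoact d, (h1, h2) \<leftarrow> cop K h] (\<lambda>x y d. \<beta> x y * q d) =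
        tsum3 [(h, g, u). (h, w) \<leftarrow> dcoact d, (g, u) \<leftarrow> dcoact w] (\<lambda>x y d. \<beta> x y * q d)"
      by (simp add: q mult.commute)
  qed
  then show "teq3 K K (yd_of dual) [(h1, h2, w). (h, w) \<leftarrow> coact (yd_of dual) d, (h1, h2) \<leftarrow> cop K h]
                 [(h, g, u). (h, w) \<leftarrow> coact (yd_of dual) d, (g, u) \<leftarrow> coact (yd_of dual) w]" by simp
  have "tsum (dcoact d) (\<lambda>h w. scl D (eps K h) w) = d"
  proof (rule p_eqI[OF _ d])
    show "tsum (dcoact d) (\<lambda>h w. scl D (eps K h) w) \<in> carr D" using mm by (intro D.tsum_mem D.scl_mem) auto
    fix x assume x: "x \<in> carr R"
    have "p (tsum (dcoact d) (\<lambda>h w. scl D (eps K h) w)) x = tsum (dcoact d) (\<lambda>h w. p (scl D (eps K h) w) x)"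
      using mm by (intro lin_tsum_out[OF p_lin1[OF x] D.vs_axioms] D.scl_mem) auto
    also have "\<dots> = tsum (dcoact d) (\<lambda>h w. p w x * eps K h)"
      by (intro dcoact_cong d) (simp add: lin_scl[OF p_lin1[OF x]] mult.commute)
    also have "\<dots> = tsum (hcoact R x) (\<lambda>h w. p d w * eps K (ainv h))"
      by (rule p_dcoactk[OF d x]) (intro lins)
    also have "\<dots> = tsum (hcoact R x) (\<lambda>h w. eps K h * p d w)"
      by (intro hcoact_cong x) (simp add: KB.eps_ainv mult.commute)
    also have "\<dots> = p d x" using eps_hcoact[OF x p_lin2[OF d]] by simp
    finally show "p (tsum (dcoact d) (\<lambda>h w. scl D (eps K h) w)) x = p d x" .
  qed
  then show "(\<Sum>(h, w)\<leftarrow>coact (yd_of dual) d. scl (yd_of dual) (eps K h) w) = d" by (simp add: tsum_def)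
next
  fix h assume h: "h \<in> carr K"
  show "lin (yd_of dual) (yd_of dual) (act (yd_of dual) h)"
    using lin_dact(2)[OF lin_id D.vs_axioms h] by simp
next
  fix g h d assume m: "g \<in> carr K" "h \<in> carr K" and "d \<in> carr (yd_of dual)"
  then have d: "d \<in> carr D" by simp
  have "dact (mul K g h) d = dact g (dact h d)"
    by (rule p_eqI) (simp_all add: mems m d p_dact YD.K.antip_mult hact_mul)
  then show "act (yd_of dual) (mul K g h) d = act (yd_of dual) g (act (yd_of dual) h d)" by simp
next
  fix h d assume h: "h \<in> carr K" and "d \<in> carr (yd_of dual)"
  then have d: "d \<in> carr D" by simp
  have "teq K D (dcoact (dact h d)) [(mul K (mul K h1 g) (antip K h3), dact h2 w).
           (h1, h') \<leftarrow> cop K h, (h2, h3) \<leftarrow> cop K h', (g, w) \<leftarrow> dcoact d]" (is "teq K D _ ?t")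
  proof (rule teqK)
    show "set (dcoact (dact h d)) \<subseteq> carr K \<times> carr D" by (intro dcoact_mem mems h d)
    show "set ?t \<subseteq> carr K \<times> carr D"
    proof
      fix z assume "z \<in> set ?t"
      then obtain h1 h' h2 h3 g w where z: "(h1, h') \<in> set (cop K h)" "(h2, h3) \<in> set (cop K h')" "(g, w) \<in> set (dcoact d)"
        "z = (mul K (mul K h1 g) (antip K h3), dact h2 w)" by auto
      have m1: "h1 \<in> carr K" "h' \<in> carr K" using z(1) YD.K.cop_mem[OF h] by auto
      have m2: "h2 \<in> carr K" "h3 \<in> carr K" using z(2) YD.K.cop_mem[OF m1(2)] by auto
      have m3: "g \<in> carr K" "w \<in> carr D" using z(3) dcoact_mem[OF d] by auto
      show "z \<in> carr K \<times> carr D" unfolding z(4) by (intro SigmaI mems m1 m2 m3)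
    qed
    fix \<phi> x assume "lin K kk \<phi>" "x \<in> carr R"
    from dual_compat[OF h d this]
    show "tsum (dcoact (dact h d)) (\<lambda>h d. p d x * \<phi> h) = tsum ?t (\<lambda>h d. p d x * \<phi> h)"
      by simp
  qed
  then show "teq K (yd_of dual) (coact (yd_of dual) (act (yd_of dual) h d))
        [(mul K (mul K h1 g) (antip K h3), act (yd_of dual) h2 w).
           (h1, h') \<leftarrow> cop K h, (h2, h3) \<leftarrow> cop K h', (g, w) \<leftarrow> coact (yd_of dual) d]" by simp
qed

lemma dual_yd_hopf: "yd_hopf_algebra K dual"
proof (intro yd_hopf_algebra.intro yd_hopf_algebra_axioms.intro dual_yd dual_braided)
  fix h d e assume h: "h \<in> carr K" and "d \<in> carr dual" "e \<in> carr dual"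
  then have d: "d \<in> carr D" and e: "e \<in> carr D" by simp_all
  have hm: "a \<in> carr K \<and> b \<in> carr K" if "(a, b) \<in> set (cop K h)" for a b using YD.K.cop_mem[OF h] that by auto
  have "dact h (dmul d e) = tsum (cop K h) (\<lambda>h1 h2. dmul (dact h1 d) (dact h2 e))"
  proof (rule p_eqI)
    show "dact h (dmul d e) \<in> carr D" by (intro mems h d e)
    show "tsum (cop K h) (\<lambda>h1 h2. dmul (dact h1 d) (dact h2 e)) \<in> carr D"
      by (intro mems h d e D.vs_axioms)
    fix x assume x: "x \<in> carr R"
    have "p (dact h (dmul d e)) x = tsum (cop R (hact R (antip K h) x)) (\<lambda>a b. p d b * p e a)"
      using h d e x by (simp add: p_dact dmul_mem p_dmul hact_mem YD.K.antip_mem)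
    also have "\<dots> = tsum (cop K (antip K h)) (\<lambda>h1 h2. tsum (cop R x) (\<lambda>a b. p d (hact R h2 b) * p e (hact R h1 a)))"
      by (rule cop_hact[OF YD.K.antip_mem[OF h] x _ vs_kk]) (intro bilinI lins d e)
    \<comment> \<open>The antipode exchanges the legs of \<open>h\<close> and the pairing those of
      \<open>x\<close>, so \<open>h1\<close> is again attached to \<open>d\<close> and
      \<open>h2\<close> to \<open>e\<close>.\<close>
    also have "\<dots> = tsum (cop K h) (\<lambda>h1 h2. tsum (cop R x) (\<lambda>a b. p d (hact R (antip K h1) b) * p e (hact R (antip K h2) a)))"
      by (rule YD.K.antip_cop[OF h _ vs_kk]) (intro bilinI lins mems x d e; assumption?)+
    also have "\<dots> = tsum (cop K h) (\<lambda>h1 h2. p (dmul (dact h1 d) (dact h2 e)) x)"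
    proof (intro YD.K.cop_cong h)
      fix h1 h2 assume m: "h1 \<in> carr K" "h2 \<in> carr K"
      show "tsum (cop R x) (\<lambda>a b. p d (hact R (antip K h1) b) * p e (hact R (antip K h2) a)) = p (dmul (dact h1 d) (dact h2 e)) x"
        unfolding p_dmul[OF dact_mem[OF m(1) d] dact_mem[OF m(2) e] x]
        by (intro R.cop_cong x) (simp add: p_dact m d e)
    qed
    also have "\<dots> = p (tsum (cop K h) (\<lambda>h1 h2. dmul (dact h1 d) (dact h2 e))) x"
      using hm by (intro lin_tsum_out[OF p_lin1[OF x] D.vs_axioms, symmetric] mems d e) auto
    finally show "p (dact h (dmul d e)) x = p (tsum (cop K h) (\<lambda>h1 h2. dmul (dact h1 d) (dact h2 e))) x" .
  qed
  then show "hact dual h (mul dual d e) = (\<Sum>(h1, h2)\<leftarrow>cop K h. mul dual (hact dual h1 d) (hact dual h2 e))"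
    by (simp add: tsum_def)
next
  fix h assume h: "h \<in> carr K"
  have "dact h dunit = scl D (eps K h) dunit"
    by (rule p_eqI) (simp_all add: mems h p_dact p_dunit act_eps_R YD.K.eps_antip lin_scl[OF p_lin1])
  then show "hact dual h (unit dual) = scl dual (eps K h) (unit dual)" by simp
next
  fix d e assume "d \<in> carr dual" "e \<in> carr dual"
  then have d: "d \<in> carr D" and e: "e \<in> carr D" by simp_all
  have "teq K D (dcoact (dmul d e)) [(mul K g h, dmul u w). (g, u) \<leftarrow> dcoact d, (h, w) \<leftarrow> dcoact e]" (is "teq K D _ ?t")
  proof (rule teqK)
    show "set (dcoact (dmul d e)) \<subseteq> carr K \<times> carr D" by (intro dcoact_mem mems d e)
    show "set ?t \<subseteq> carr K \<times> carr D"
      using dcoact_mem[OF d] dcoact_mem[OF e] by (fastforce intro!: mems)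
    fix \<phi> x assume f: "lin K kk \<phi>" and x: "x \<in> carr R"
    note [lins] = lin_comp[OF f]
    have "tsum (dcoact (dmul d e)) (\<lambda>h d. p d x * \<phi> h) = tsum (hcoact R x) (\<lambda>h w. p (dmul d e) w * \<phi> (ainv h))"
      by (rule p_dcoactk[OF dmul_mem[OF d e] x f])
    also have "\<dots> = tsum (hcoact R x) (\<lambda>h w. tsum (cop R w) (\<lambda>a b. p d b * p e a * \<phi> (ainv h)))"
      by (intro hcoact_cong x) (simp add: p_dmul d e tsum_mult_right)
    also have "\<dots> = tsum (cop R x) (\<lambda>a b. tsum (hcoact R a) (\<lambda>g u. tsum (hcoact R b) (\<lambda>h w. p d w * p e u * \<phi> (ainv (mul K g h)))))"
      by (rule hcoact_cop[OF x _ vs_kk]) (intro trilinI lins d e; assumption?)+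
    \<comment> \<open>The factor \<open>h\<close> belonging to \<open>d\<close> stands on the right
      here; since \<open>ainv\<close> reverses products it ends up on the left, as the coaction on a
      product requires.\<close>
    also have "\<dots> = tsum (cop R x) (\<lambda>a b. tsum (dcoact d) (\<lambda>h w. tsum (dcoact e) (\<lambda>g u. p w b * p u a * \<phi> (mul K h g))))"
    proof (intro R.cop_cong x)
      fix a b assume m: "a \<in> carr R" "b \<in> carr R"
      have "tsum (dcoact d) (\<lambda>h w. tsum (dcoact e) (\<lambda>g u. p w b * p u a * \<phi> (mul K h g))) =
         tsum (dcoact d) (\<lambda>h w. p w b * tsum (dcoact e) (\<lambda>g u. p u a * \<phi> (mul K h g)))"
        by (simp add: tsum_mult_left mult.assoc)
      also have "\<dots> = tsum (dcoact d) (\<lambda>h w. p w b * tsum (hcoact R a) (\<lambda>g u. p e u * \<phi> (mul K h (ainv g))))"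
        by (intro dcoact_cong d arg_cong2[where f="(*)"] refl p_dcoactk e m lins)
      also have "\<dots> = tsum (hcoact R b) (\<lambda>h w. p d w * tsum (hcoact R a) (\<lambda>g u. p e u * \<phi> (mul K (ainv h) (ainv g))))"
        by (rule p_dcoactk[OF d m(2)]) (intro lins mems e m; assumption?)+
      also have "\<dots> = tsum (hcoact R b) (\<lambda>h w. tsum (hcoact R a) (\<lambda>g u. p d w * p e u * \<phi> (ainv (mul K g h))))"
        unfolding tsum_mult_left[symmetric] by (intro hcoact_cong m) (simp_all add: KB.ainv_mult mult.assoc)
      also have "\<dots> = tsum (hcoact R a) (\<lambda>g u. tsum (hcoact R b) (\<lambda>h w. p d w * p e u * \<phi> (ainv (mul K g h))))"
        by (rule tsum_swap)
      finally show "tsum (hcoact R a) (\<lambda>g u. tsum (hcoact R b) (\<lambda>h w. p d w * p e u * \<phi> (ainv (mul K g h)))) =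
        tsum (dcoact d) (\<lambda>h w. tsum (dcoact e) (\<lambda>g u. p w b * p u a * \<phi> (mul K h g)))" by simp
    qed
    also have "\<dots> = tsum (dcoact d) (\<lambda>h w. tsum (dcoact e) (\<lambda>g u. tsum (cop R x) (\<lambda>a b. p w b * p u a * \<phi> (mul K h g))))"
      by (simp only: tsum_swap[of "cop R x"])
    also have "\<dots> = tsum (dcoact d) (\<lambda>h w. tsum (dcoact e) (\<lambda>g u. p (dmul w u) x * \<phi> (mul K h g)))"
      by (intro dcoact_cong d e) (simp add: p_dmul x tsum_mult_right)
    finally show "tsum (dcoact (dmul d e)) (\<lambda>h d. p d x * \<phi> h) = tsum ?t (\<lambda>h d. p d x * \<phi> h)" by simp
  qed
  then show "teq K dual (hcoact dual (mul dual d e))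
        [(mul K g h, mul dual u w). (g, u) \<leftarrow> hcoact dual d, (h, w) \<leftarrow> hcoact dual e]" by simp
next
  have "teq K D (dcoact dunit) [(unit K, dunit)]"
  proof (rule teqK)
    fix \<phi> x assume f: "lin K kk \<phi>" and x: "x \<in> carr R"
    have "tsum (dcoact dunit) (\<lambda>h d. p d x * \<phi> h) = tsum (hcoact R x) (\<lambda>h w. p dunit w * \<phi> (ainv h))"
      by (rule p_dcoactk[OF dunit_mem x f])
    also have "\<dots> = tsum (hcoact R x) (\<lambda>h w. scl kk (eps R w) (\<phi> (ainv h)))"
      by (intro hcoact_cong x) (simp add: p_dunit)
    also have "\<dots> = scl kk (eps R x) (\<phi> (ainv (unit K)))"
      by (rule hcoact_eps[OF x]) (intro lin_comp[OF f] lins)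
    finally show "tsum (dcoact dunit) (\<lambda>h d. p d x * \<phi> h) = tsum [(unit K, dunit)] (\<lambda>h d. p d x * \<phi> h)"
      by (simp add: KB.ainv_unit p_dunit x)
  qed (use dcoact_mem[OF dunit_mem] dunit_mem YD.K.unit_carr in auto)
  then show "teq K dual (hcoact dual (unit dual)) [(unit K, unit dual)]" by simp
next
  fix h d assume h: "h \<in> carr K" and "d \<in> carr dual"
  then have d: "d \<in> carr D" by simp
  have mm: "a \<in> carr D \<and> b \<in> carr D" if "(a, b) \<in> set (dcop d)" for a b using dcop_mem[OF d] that by auto
  have hm: "a \<in> carr K \<and> b \<in> carr K" if "(a, b) \<in> set (cop K h)" for a b using YD.K.cop_mem[OF h] that by auto
  have "teq D D (dcop (dact h d)) [(dact h1 a, dact h2 b). (h1, h2) \<leftarrow> cop K h, (a, b) \<leftarrow> dcop d]" (is "teq D D _ ?t")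
  proof (rule teqD)
    show "set (dcop (dact h d)) \<subseteq> carr D \<times> carr D" by (intro dcop_mem mems h d)
    show "set ?t \<subseteq> carr D \<times> carr D" using mm hm by (fastforce intro!: mems)
    fix x y assume x: "x \<in> carr R" and y: "y \<in> carr R"
    have "tsum ?t (\<lambda>d e. p d y * p e x) = tsum (cop K h) (\<lambda>h1 h2. tsum (dcop d) (\<lambda>a b. p (dact h1 a) y * p (dact h2 b) x))"
      by simp
    also have "\<dots> = tsum (cop K h) (\<lambda>h1 h2. tsum (dcop d) (\<lambda>a b. p a (hact R (antip K h1) y) * p b (hact R (antip K h2) x)))"
      by (intro YD.K.cop_cong h dcop_cong d) (simp add: p_dact x y)
    also have "\<dots> = tsum (cop K h) (\<lambda>h1 h2. p d (mul R (hact R (antip K h2) x) (hact R (antip K h1) y)))"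
      by (intro YD.K.cop_cong h p_dcop d mems x y)
    also have "\<dots> = tsum (cop K (antip K h)) (\<lambda>h1 h2. p d (mul R (hact R h1 x) (hact R h2 y)))"
      by (rule YD.K.antip_cop[OF h _ vs_kk, symmetric]) (intro bilinI lins mems x y d; assumption?)+
    also have "\<dots> = p d (tsum (cop K (antip K h)) (\<lambda>h1 h2. mul R (hact R h1 x) (hact R h2 y)))"
      using YD.K.cop_mem[OF YD.K.antip_mem[OF h]]
      by (intro lin_tsum_out[OF p_lin2[OF d] R.vs_axioms, symmetric] mems x y) auto
    also have "\<dots> = p d (hact R (antip K h) (mul R x y))" using hact_mult[OF YD.K.antip_mem[OF h] x y] by simp
    also have "\<dots> = tsum (dcop (dact h d)) (\<lambda>d e. p d y * p e x)"
      by (simp add: p_dcop dact_mem h d x y p_dact R.mul_mem)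
    finally show "tsum (dcop (dact h d)) (\<lambda>d e. p d y * p e x) = tsum ?t (\<lambda>d e. p d y * p e x)" by simp
  qed
  then show "teq dual dual (cop dual (hact dual h d))
        [(hact dual h1 a, hact dual h2 b). (h1, h2) \<leftarrow> cop K h, (a, b) \<leftarrow> cop dual d]" by simp
  show "eps dual (hact dual h d) = eps K h * eps dual d"
    using h d by (simp add: p_dact R.unit_carr act_unit_R YD.K.antip_mem YD.K.eps_antip lin_scl[OF p_lin2])
  have "dantip (dact h d) = dact h (dantip d)"
    by (rule p_eqI) (simp_all add: mems h d p_dantip p_dact act_antip_R)
  then show "antip dual (hact dual h d) = hact dual h (antip dual d)" by simp
next
  fix d assume "d \<in> carr dual"
  then have d: "d \<in> carr D" by simp
  have mm: "a \<in> carr D \<and> b \<in> carr D" if "(a, b) \<in> set (dcop d)" for a b using dcop_mem[OF d] that by auto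
  have cm: "a \<in> carr K \<and> b \<in> carr D" if "(a, b) \<in> set (dcoact d)" for a b using dcoact_mem[OF d] that by auto
  have "teq3 K D D [(h, a, b). (h, w) \<leftarrow> dcoact d, (a, b) \<leftarrow> dcop w]
        [(mul K g h, u, w). (a, b) \<leftarrow> dcop d, (g, u) \<leftarrow> dcoact a, (h, w) \<leftarrow> dcoact b]" (is "teq3 K D D ?s ?t")
  proof (rule SD.teq3_sep2)
    show "set ?s \<subseteq> carr K \<times> carr D \<times> carr D" using cm dcop_mem by fastforce
    show "set ?t \<subseteq> carr K \<times> carr D \<times> carr D"
    proof
      fix z assume "z \<in> set ?t"
      then obtain a b g u h w where z: "(a, b) \<in> set (dcop d)" "(g, u) \<in> set (dcoact a)" "(h, w) \<in> set (dcoact b)"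
        "z = (mul K g h, u, w)" by auto
      have m: "a \<in> carr D" "b \<in> carr D" using z(1) mm by auto
      have "g \<in> carr K" "u \<in> carr D" using z(2) dcoact_mem[OF m(1)] by auto
      moreover have "h \<in> carr K" "w \<in> carr D" using z(3) dcoact_mem[OF m(2)] by auto
      ultimately show "z \<in> carr K \<times> carr D \<times> carr D" unfolding z(4) by (intro SigmaI mems)
    qed
    fix \<phi> q q' assume f: "lin K kk \<phi>" and "q \<in> (\<lambda>x d. p d x) ` carr R" "q' \<in> (\<lambda>x d. p d x) ` carr R"
    then obtain x y where q: "q = (\<lambda>d. p d y)" "q' = (\<lambda>d. p d x)" and x: "x \<in> carr R" and y: "y \<in> carr R" by auto
    note [lins] = lin_comp[OF f]
    have "tsum (dcoact d) (\<lambda>h w. tsum (dcop w) (\<lambda>a b. \<phi> h * p a y * p b x)) = tsum (dcoact d) (\<lambda>h w. p w (mul R x y) * \<phi> h)"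
    proof (intro dcoact_cong d)
      fix h w assume w: "w \<in> carr D"
      have "tsum (dcop w) (\<lambda>a b. \<phi> h * p a y * p b x) = \<phi> h * tsum (dcop w) (\<lambda>a b. p a y * p b x)"
        unfolding tsum_mult_left[symmetric] by (simp add: mult.assoc)
      then show "tsum (dcop w) (\<lambda>a b. \<phi> h * p a y * p b x) = p w (mul R x y) * \<phi> h"
        by (simp add: p_dcop w x y mult.commute)
    qed
    also have "\<dots> = tsum (hcoact R (mul R x y)) (\<lambda>h w. p d w * \<phi> (ainv h))"
      by (rule p_dcoactk[OF d R.mul_mem[OF x y] f])
    also have "\<dots> = tsum (hcoact R x) (\<lambda>h w. tsum (hcoact R y) (\<lambda>g u. p d (mul R w u) * \<phi> (ainv (mul K h g))))"
      by (rule hcoact_mul[OF x y _ vs_kk]) (intro bilinI lins d; assumption?)+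
    also have "\<dots> = tsum (hcoact R x) (\<lambda>h w. tsum (hcoact R y) (\<lambda>g u. tsum (dcop d) (\<lambda>a b. p a u * p b w * \<phi> (mul K (ainv g) (ainv h)))))"
      by (intro hcoact_cong x y) (simp add: tsum_mult_right p_dcop d KB.ainv_mult)
    also have "\<dots> = tsum (dcop d) (\<lambda>a b. tsum (hcoact R x) (\<lambda>h w. tsum (hcoact R y) (\<lambda>g u. p a u * p b w * \<phi> (mul K (ainv g) (ainv h)))))"
      by (simp only: tsum_swap[of _ "dcop d"])
    also have "\<dots> = tsum (dcop d) (\<lambda>a b. tsum (dcoact a) (\<lambda>g u. tsum (dcoact b) (\<lambda>h w. \<phi> (mul K g h) * p u y * p w x)))"
    proof (intro dcop_cong d)
      fix a b assume m: "a \<in> carr D" "b \<in> carr D"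
      have "tsum (dcoact a) (\<lambda>g u. tsum (dcoact b) (\<lambda>h w. \<phi> (mul K g h) * p u y * p w x)) =
          tsum (dcoact a) (\<lambda>g u. p u y * tsum (dcoact b) (\<lambda>h w. p w x * \<phi> (mul K g h)))"
        by (simp add: tsum_mult_left[symmetric] mult_ac)
      also have "\<dots> = tsum (dcoact a) (\<lambda>g u. p u y * tsum (hcoact R x) (\<lambda>h w. p b w * \<phi> (mul K g (ainv h))))"
        by (intro dcoact_cong m arg_cong2[where f="(*)"] refl p_dcoactk x lins)
      also have "\<dots> = tsum (hcoact R y) (\<lambda>g u. p a u * tsum (hcoact R x) (\<lambda>h w. p b w * \<phi> (mul K (ainv g) (ainv h))))"
        by (rule p_dcoactk[OF m(1) y]) (intro lins mems m x; assumption?)+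
      also have "\<dots> = tsum (hcoact R y) (\<lambda>g u. tsum (hcoact R x) (\<lambda>h w. p a u * p b w * \<phi> (mul K (ainv g) (ainv h))))"
        by (simp add: tsum_mult_left[symmetric] mult.assoc)
      also have "\<dots> = tsum (hcoact R x) (\<lambda>h w. tsum (hcoact R y) (\<lambda>g u. p a u * p b w * \<phi> (mul K (ainv g) (ainv h))))"
        by (rule tsum_swap)
      finally show "tsum (hcoact R x) (\<lambda>h w. tsum (hcoact R y) (\<lambda>g u. p a u * p b w * \<phi> (mul K (ainv g) (ainv h)))) =
        tsum (dcoact a) (\<lambda>g u. tsum (dcoact b) (\<lambda>h w. \<phi> (mul K g h) * p u y * p w x))" by simp
    qed
    finally show "tsum3 ?s (\<lambda>x d e. \<phi> x * q d * q' e) = tsum3 ?t (\<lambda>x d e. \<phi> x * q d * q' e)"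
      by (simp add: q)
  qed
  then show "teq3 K dual dual [(h, a, b). (h, w) \<leftarrow> hcoact dual d, (a, b) \<leftarrow> cop dual w]
        [(mul K g h, u, w). (a, b) \<leftarrow> cop dual d, (g, u) \<leftarrow> hcoact dual a, (h, w) \<leftarrow> hcoact dual b]" by simp
  have "tsum (dcoact d) (\<lambda>h w. scl K (p w (unit R)) h) = tsum (hcoact R (unit R)) (\<lambda>h w. scl K (p d w) (ainv h))"
    by (rule dcoact_spec[OF d R.unit_carr])
  also have "\<dots> = scl K (p d (unit R)) (ainv (unit K))"
    by (rule hcoact_unit[OF _ YD.K.vs_axioms]) (intro bilinI lins mems d; assumption?)+
  finally show "(\<Sum>(h, w)\<leftarrow>hcoact dual d. scl K (eps dual w) h) = scl K (eps dual d) (unit K)"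
    by (simp add: tsum_def KB.ainv_unit)
  have "teq K D (dcoact (dantip d)) [(h, dantip w). (h, w) \<leftarrow> dcoact d]"
  proof (rule teqK)
    show "set (dcoact (dantip d)) \<subseteq> carr K \<times> carr D" by (intro dcoact_mem mems d)
    show "set [(h, dantip w). (h, w) \<leftarrow> dcoact d] \<subseteq> carr K \<times> carr D" using cm by (auto intro!: mems)
    fix \<phi> x assume f: "lin K kk \<phi>" and x: "x \<in> carr R"
    have "tsum (dcoact (dantip d)) (\<lambda>h d. p d x * \<phi> h) = tsum (hcoact R x) (\<lambda>h w. p (dantip d) w * \<phi> (ainv h))"
      by (rule p_dcoactk[OF dantip_mem[OF d] x f])
    also have "\<dots> = tsum (hcoact R x) (\<lambda>h w. p d (antip R w) * \<phi> (ainv h))"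
      by (intro hcoact_cong x) (simp add: p_dantip d)
    also have "\<dots> = tsum (hcoact R (antip R x)) (\<lambda>h w. p d w * \<phi> (ainv h))"
      by (rule hcoact_antip[OF x _ vs_kk, symmetric]) (intro bilinI lins d lin_comp[OF f]; assumption?)+
    also have "\<dots> = tsum (dcoact d) (\<lambda>h w. p w (antip R x) * \<phi> h)"
      by (rule p_dcoactk[OF d R.antip_mem[OF x] f, symmetric])
    also have "\<dots> = tsum (dcoact d) (\<lambda>h w. p (dantip w) x * \<phi> h)"
      by (intro dcoact_cong d) (simp add: p_dantip x)
    finally show "tsum (dcoact (dantip d)) (\<lambda>h d. p d x * \<phi> h) = tsum [(h, dantip w). (h, w) \<leftarrow> dcoact d] (\<lambda>h d. p d x * \<phi> h)"
      by simp
  qed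
  then show "teq K dual (hcoact dual (antip dual d)) [(h, antip dual w). (h, w) \<leftarrow> hcoact dual d]" by simp
qed

section \<open>The grading of the dual\<close>

lemma dmul_ddeg:
  assumes d: "d \<in> ddeg m" and e: "e \<in> ddeg n" shows "dmul d e \<in> ddeg (m + n)"
proof -
  note dc = ddeg_mem[OF d] and ec = ddeg_mem[OF e]
  have "p (dmul d e) x = 0" if x: "x \<in> deg R k" and k: "k \<noteq> m + n" for k x
  proof -
    note xc = deg_mem[OF x]
    have "p (dmul d e) x = (\<Sum>i\<le>k. tsum (cop R x) (\<lambda>a b. p d (proj (k - i) b) * p e (proj i a)))"
      unfolding p_dmul[OF dc ec xc] by (rule cop_homog[OF x _ vs_kk]) (intro bilinI lins dc ec)
    also have "\<dots> = (\<Sum>i\<le>k. tsum (cop R x) (\<lambda>a b. 0))"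
    proof (intro sum.cong refl R.cop_cong xc)
      fix i a b assume i: "i \<in> {..k}" and ab: "a \<in> carr R" "b \<in> carr R"
      have "k - i \<noteq> m \<or> i \<noteq> n" using k i by auto
      then show "p d (proj (k - i) b) * p e (proj i a) = 0"
        using ddeg_deg[OF d proj_deg[OF ab(2)]] ddeg_deg[OF e proj_deg[OF ab(1)]] by auto
    qed
    finally show ?thesis by simp
  qed
  then show ?thesis using dmul_mem[OF dc ec] by (auto simp: ddeg_def)
qed

lemma dual_direct_sum:
  assumes d: "d \<in> carr D"
  shows "\<exists>!c. (\<forall>n. c n \<in> ddeg n) \<and> finite {n. c n \<noteq> 0} \<and> d = (\<Sum>n | c n \<noteq> 0. c n)"
proof (rule ex1I[of _ "\<lambda>n. dproj n d"])
  obtain N where N: "\<And>n x. n \<ge> N \<Longrightarrow> x \<in> deg R n \<Longrightarrow> p d x = 0" using boundedE[OF d] by blast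
  have z: "dproj n d = 0" if "n \<ge> N" for n
    by (rule p_nondeg[OF ddeg_mem[OF dproj(1)[OF d]]]) (use N[OF that proj_deg] dproj(2)[OF d] in auto)
  then have sub: "{n. dproj n d \<noteq> 0} \<subseteq> {..<N}" by (auto simp: not_le[symmetric])
  then have fin: "finite {n. dproj n d \<noteq> 0}" using finite_subset by blast
  have "(\<Sum>n<N. dproj n d) = (\<Sum>n | dproj n d \<noteq> 0. dproj n d)"
    by (rule sum.mono_neutral_right[OF _ sub]) auto
  then show "(\<forall>n. dproj n d \<in> ddeg n) \<and> finite {n. dproj n d \<noteq> 0} \<and> d = (\<Sum>n | dproj n d \<noteq> 0. dproj n d)"
    using fin dproj(1)[OF d] dproj_sum[OF d N] by simp
next
  fix c assume c: "(\<forall>n. c n \<in> ddeg n) \<and> finite {n. c n \<noteq> 0} \<and> d = (\<Sum>n | c n \<noteq> 0. c n)"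
  then have cm: "c n \<in> carr D" for n using ddeg_mem by blast
  show "c = (\<lambda>n. dproj n d)"
  proof
    fix n
    show "c n = dproj n d"
    proof (rule p_eqI[OF cm ddeg_mem[OF dproj(1)[OF d]]])
      fix x assume x: "x \<in> carr R"
      have pn: "proj n x \<in> deg R n" by (rule proj_deg[OF x])
      have z: "p (c m) (proj n x) = 0" if "m \<noteq> n" for m
        using ddeg_deg[OF _ pn, of "c m" m] c that by auto
      have "p (dproj n d) x = p (\<Sum>n | c n \<noteq> 0. c n) (proj n x)" using dproj(2)[OF d x] c by simp
      also have "\<dots> = (\<Sum>m | c m \<noteq> 0. p (c m) (proj n x))"
        by (rule lin_sum[OF p_lin1[OF deg_mem[OF pn]] D.vs_axioms cm])
      also have "\<dots> = (\<Sum>m | c m \<noteq> 0. if m = n then p (c n) (proj n x) else 0)"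
        using z by (intro sum.cong) auto
      also have "\<dots> = p (c n) (proj n x)"
        using c lin_0[OF p_lin1[OF deg_mem[OF pn]] D.vs_axioms] by simp
      also have "\<dots> = p (c n) x" using c x by (intro ddeg_proj) auto
      finally show "p (c n) x = p (dproj n d) x" by simp
    qed
  qed
qed

lemma dual_graded: "graded_connected_hopf K dual"
proof (intro graded_connected_hopf.intro graded_connected_hopf_axioms.intro dual_yd_hopf)
  fix n
  show "deg dual n \<subseteq> carr dual \<and> module.subspace (scl dual) (deg dual n)"
    using ddeg_mem ddeg_subspace by auto
next
  fix d assume "d \<in> carr dual"
  then show "\<exists>!c. (\<forall>n. c n \<in> deg dual n) \<and> finite {n. c n \<noteq> 0} \<and> d = (\<Sum>n | c n \<noteq> 0. c n)"
    using dual_direct_sum by simp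
next
  fix d n assume "d \<in> deg dual n"
  then have d: "d \<in> ddeg n" by simp
  note dc = ddeg_mem[OF d]
  obtain t where t: "set t \<subseteq> (\<Union>i\<le>n. ddeg i \<times> ddeg (n - i))"
     "\<And>x y. x \<in> carr R \<Longrightarrow> y \<in> carr R \<Longrightarrow> tsum t (\<lambda>d1 d2. p d1 y * p d2 x) = p d (mul R x y)"
    using dcop_homog_ex[OF d] by blast
  have "teq D D (dcop d) t"
  proof (rule teqD[OF dcop_mem[OF dc]])
    have "(\<Union>i\<le>n. ddeg i \<times> ddeg (n - i)) \<subseteq> carr D \<times> carr D" using ddeg_mem by blast
    then show "set t \<subseteq> carr D \<times> carr D" using t(1) by blast
  qed (simp add: p_dcop dc t(2))
  then show "in_tensor dual dual (\<Union>i\<le>n. deg dual i \<times> deg dual (n - i)) (cop dual d)"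
    unfolding in_tensor_def using t(1) by auto
  obtain t where t: "set t \<subseteq> carr K \<times> ddeg n"
     "\<And>x. x \<in> carr R \<Longrightarrow> tsum t (\<lambda>h e. scl K (p e x) h) = tsum (hcoact R x) (\<lambda>h w. scl K (p d w) (ainv h))"
    using dcoact_homog_ex[OF d] by blast
  have tc: "set t \<subseteq> carr K \<times> carr D" using t(1) ddeg_mem by blast
  have "teq K D (dcoact d) t"
  proof (rule teqK[OF dcoact_mem[OF dc] tc])
    fix \<phi> x assume f: "lin K kk \<phi>" and x: "x \<in> carr R"
    show "tsum (dcoact d) (\<lambda>h d. p d x * \<phi> h) = tsum t (\<lambda>h d. p d x * \<phi> h)"
      using p_dcoactk[OF dc x f] p_dcoact_list[OF tc t(2) x f] by simp
  qed
  then show "in_tensor K dual (carr K \<times> deg dual n) (hcoact dual d)"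
    unfolding in_tensor_def using t(1) by auto
  show "eps dual d = 0" if "n > 0" using ddeg_deg[OF d deg_unit] that by simp
  show "antip dual d \<in> deg dual n" using dantip_ddeg[OF dc d] by simp
  show "hact dual h d \<in> deg dual n" if "h \<in> carr K" for h using dact_ddeg[OF that dc d] by simp
next
  show "deg dual 0 = range (\<lambda>c. scl dual c (unit dual))"
  proof
    show "range (\<lambda>c. scl dual c (unit dual)) \<subseteq> deg dual 0"
      using dunit_ddeg D.VS.subspace_scale[OF ddeg_subspace] by auto
    show "deg dual 0 \<subseteq> range (\<lambda>c. scl dual c (unit dual))"
    proof
      fix d assume "d \<in> deg dual 0"
      then have d: "d \<in> ddeg 0" by simp
      note dc = ddeg_mem[OF d]
      have "d = scl D (p d (unit R)) dunit"
      proof (rule p_eqI[OF dc])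
        show "scl D (p d (unit R)) dunit \<in> carr D" by (intro mems)
        fix x assume x: "x \<in> carr R"
        have "p d x = p d (proj 0 x)" using ddeg_proj[OF d x] by simp
        also have "\<dots> = eps R x * p d (unit R)"
          using lin_scl[OF p_lin2[OF dc] R.unit_carr] by (simp add: proj0 x)
        finally show "p d x = p (scl D (p d (unit R)) dunit) x"
          by (simp add: lin_scl[OF p_lin1[OF x] dunit_mem] p_dunit x)
      qed
      then show "d \<in> range (\<lambda>c. scl dual c (unit dual))" by auto
    qed
  qed
qed (use dmul_ddeg dunit_ddeg in auto)

end

section \<open>Primitive elements and generation in degree one\<close>

text \<open>A basis of \<open>U\<close> stays independent when \<open>x\<close> is added, so a
  functional can be prescribed as 0 on it and 1 at \<open>x\<close>.\<close>

lemma (in vs) separate_from_subspace: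
  assumes U: "VS.subspace U" and x: "x \<notin> U"
  obtains g where "Vector_Spaces.linear (scl X) (*) g" "\<And>u. u \<in> U \<Longrightarrow> g u = 0" "g x \<noteq> 0"
proof -
  interpret K: vs "kk :: ('k, 'k) vspace" by (rule vs_kk)
  interpret vector_space_pair "scl X" "(*) :: 'k \<Rightarrow> 'k \<Rightarrow> 'k"
    using VS.vector_space_axioms K.ambient by (simp add: vector_space_pair_def)
  obtain B where B: "B \<subseteq> U" "VS.independent B" "U \<subseteq> VS.span B" by (rule VS.maximal_independent_subset)
  have sB: "VS.span B = U" using B(3) VS.span_minimal[OF B(1) U] by auto
  have "VS.independent (insert x B)" using B(2) x sB by (simp add: VS.independent_insert)
  from linear_independent_extend[OF this, of "\<lambda>v. if v = x then 1 else 0"]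
  obtain g where g: "Vector_Spaces.linear (scl X) (*) g" "g x = 1" "\<And>b. b \<in> B \<Longrightarrow> b \<noteq> x \<Longrightarrow> g b = 0" by auto
  interpret g: Vector_Spaces.linear "scl X" "(*)" g by fact
  have gB: "g b = 0" if "b \<in> B" for b using g(3)[OF that] that B(1) x by auto
  have "g u = 0" if "u \<in> U" for u
  proof -
    have "u \<in> VS.span B" using that sB by simp
    then show ?thesis by (induction rule: VS.span_induct_alt) (simp_all add: g.zero g.add g.scale gB)
  qed
  then show thesis using that[of g] g by simp
qed

context graded_connected_hopf
begin

lemma gen_upto_1: "gen_upto 1 = generated R (deg R 1)"
proof
  have d1: "deg R 1 \<subseteq> carr R" using deg_mem by blast
  show "gen_upto 1 \<subseteq> generated R (deg R 1)"
  proof (rule gen_upto_subset[OF R.generated_subspace R.generated_unit])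
    fix g w assume "g \<in> gens 1" and w: "w \<in> generated R (deg R 1)"
    have wc: "w \<in> carr R" using w R.generated_carr[OF d1] by auto
    have "{..1} = {0, 1 :: nat}" by auto
    with \<open>g \<in> gens 1\<close> have "g \<in> deg R 0 \<or> g \<in> deg R 1" by (simp add: gens_def)
    then show "mul R g w \<in> generated R (deg R 1)"
    proof
      assume "g \<in> deg R 0"
      then obtain c where "g = scl R c (unit R)" using connected by auto
      then show ?thesis using wc w R.VS.subspace_scale[OF R.generated_subspace]
        by (simp add: R.mul_scl R.unit_carr R.unit_left)
    next
      assume "g \<in> deg R 1"
      then show ?thesis by (rule R.generated_mul_left[OF d1 _ w])
    qed
  qed
  show "generated R (deg R 1) \<subseteq> gen_upto 1"
    unfolding gen_upto_def by (rule R.generated_mono) (auto simp: gens_def)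
qed

lemma carr_subset_if_degs:
  assumes "R.VS.subspace T" "\<And>n. deg R n \<subseteq> T" shows "carr R \<subseteq> T"
proof
  fix x assume x: "x \<in> carr R"
  have "(\<Sum>n | proj n x \<noteq> 0. proj n x) \<in> T"
    using assms(2) proj_deg[OF x] by (intro R.VS.subspace_sum[OF assms(1)]) auto
  then show "x \<in> T" using proj_sum[OF x] by simp
qed

lemma proj_hact: assumes h: "h \<in> carr K" and x: "x \<in> carr R" shows "proj n (hact R h x) = hact R h (proj n x)"
proof (rule lin_eq_homog[OF _ _ _ x])
  show "lin R R (\<lambda>x. proj n (hact R h x))" "lin R R (\<lambda>x. hact R h (proj n x))" by (intro lins h)+
  fix m x assume x: "x \<in> deg R m"
  have "lin R R (\<lambda>x. hact R h x)" by (intro lins h)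
  from lin_0[OF this R.vs_axioms] show "proj n (hact R h x) = hact R h (proj n x)"
    using x deg_act[OF h x] by (simp add: proj_homog)
qed

end

section \<open>Duality exchanges generators and primitive elements\<close>

context dual_pairing
begin

lemma crd_separates: "x \<in> deg R n \<Longrightarrow> (\<And>e. e \<in> ddeg n \<Longrightarrow> p e x = 0) \<Longrightarrow> x = 0"
proof -
  assume x: "x \<in> deg R n" and z: "\<And>e. e \<in> ddeg n \<Longrightarrow> p e x = 0"
  have "x = (\<Sum>b\<in>bas n. scl R (crd n b x) b)" using crd_expand[OF deg_mem[OF x], of n] x by (simp add: proj_homog)
  also have "\<dots> = 0" using z[OF dl(1)] dl(2)[OF deg_mem[OF x]] by (intro sum.neutral) auto
  finally show "x = 0" .
qed

text \<open>Let n \<ge> 2 be such that lower degrees are generated while \<open>d\<close> of degree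
  \<open>n\<close> is not. A functional on \<open>D\<close> that vanishes on the subalgebra but not
  at \<open>d\<close> is, on \<open>ddeg n\<close>, evaluation at some \<open>x\<close> of degree
  \<open>n\<close>. It kills all products from lower degrees, so the middle components of the
  coproduct of \<open>x\<close> vanish; then \<open>x\<close> is primitive of degree
  \<open>n\<close>, hence zero, a contradiction.\<close>

lemma dual_generated:
  assumes prim: "primitives R = deg R 1" shows "generated dual (ddeg 1) = carr D"
proof -
  interpret DG: graded_connected_hopf K dual by (rule dual_graded)
  have d1: "ddeg 1 \<subseteq> carr dual" using ddeg_mem by auto
  let ?G = "generated dual (ddeg 1)"
  have Gs: "D.VS.subspace ?G" using DG.R.generated_subspace by simp
  have "ddeg n \<subseteq> ?G" for n
  proof (induction n rule: less_induct)
    case (less n)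
    consider "n = 0" | "n = 1" | "n \<ge> 2" by linarith
    then show ?case
    proof cases
      case 1
      have "ddeg 0 = range (\<lambda>c. scl D c dunit)" using DG.connected by simp
      then show ?thesis using 1 DG.R.generated_unit[of "ddeg 1"] D.VS.subspace_scale[OF Gs] by auto
    next
      case 2
      then show ?thesis using DG.R.generated_base[OF d1] by simp
    next
      case 3
      show ?thesis
      proof (rule ccontr)
        assume "\<not> ddeg n \<subseteq> ?G"
        then obtain d where d: "d \<in> ddeg n" "d \<notin> ?G" by auto
        obtain g where g: "Vector_Spaces.linear (scl D) (*) g" "\<And>u. u \<in> ?G \<Longrightarrow> g u = 0" "g d \<noteq> 0"
          using D.separate_from_subspace[OF Gs d(2)] by blast
        have gl: "lin D kk g" by (rule linear_lin[OF g(1)])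
        \<comment> \<open>Finite-dimensionality of degree \<open>n\<close> makes every functional on
          \<open>ddeg n\<close> an evaluation; the coordinates of the point are the values on the
          dual basis.\<close>
        define x where "x = (\<Sum>b\<in>bas n. scl R (g (dl n b)) b)"
        have bm: "b \<in> carr R" if "b \<in> bas n" for b using deg_mem[OF bas_deg[OF that]] .
        have x: "x \<in> deg R n" unfolding x_def using bas_deg by (intro deg_sum deg_scl)
        have gx: "g e = p e x" if e: "e \<in> ddeg n" for e
        proof -
          have dm: "dl n b \<in> carr D" for b by (rule ddeg_mem[OF dl(1)])
          have "g e = g (\<Sum>b\<in>bas n. scl D (p e b) (dl n b))" using ddeg_expand[OF e] by simp
          also have "\<dots> = (\<Sum>b\<in>bas n. p e b * g (dl n b))"
            by (subst lin_sum[OF gl D.vs_axioms]) (simp_all add: D.scl_mem dm lin_scl[OF gl])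
          also have "\<dots> = p e x"
            unfolding x_def
            by (subst lin_sum[OF p_lin2[OF ddeg_mem[OF e]] R.vs_axioms])
               (simp_all add: R.scl_mem bm lin_scl[OF p_lin2[OF ddeg_mem[OF e]]] mult.commute)
          finally show ?thesis .
        qed
        have "x \<in> primitives R"
        proof (rule prim_criterion[OF x, of "\<lambda>i. p ` ddeg i"])
          fix i q q' assume i: "0 < i" "i < n" and "q \<in> p ` ddeg i" "q' \<in> p ` ddeg (n - i)"
          then obtain e f where e: "e \<in> ddeg i" "q = p e" and f: "f \<in> ddeg (n - i)" "q' = p f" by auto
          have "e \<in> ?G" "f \<in> ?G" using less.IH[of i] less.IH[of "n - i"] i e f by auto
          then have "dmul f e \<in> ?G" using DG.R.generated_mul[OF d1] by simp
          moreover have "dmul f e \<in> ddeg n" using dmul_ddeg[OF f(1) e(1)] i by simp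
          ultimately have z: "p (dmul f e) x = 0" using gx g(2) by metis
          have "tsum (cop R x) (\<lambda>a b. q (proj i a) * q' (proj (n - i) b)) = tsum (cop R x) (\<lambda>a b. p f b * p e a)"
            using ddeg_proj[OF e(1)] ddeg_proj[OF f(1)]
            by (intro R.cop_cong deg_mem[OF x]) (simp add: e f mult.commute)
          also have "\<dots> = p (dmul f e) x" by (rule p_dmul[OF ddeg_mem[OF f(1)] ddeg_mem[OF e(1)] deg_mem[OF x], symmetric])
          finally show "tsum (cop R x) (\<lambda>a b. q (proj i a) * q' (proj (n - i) b)) = 0" using z by simp
        next
          fix i z assume "z \<in> deg R i" and q0: "\<And>q. q \<in> p ` ddeg i \<Longrightarrow> q z = 0"
          then show "z = 0" by (intro crd_separates) auto
        qed (use 3 p_lin2 ddeg_mem in auto)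
        then have "x \<in> deg R 1" using prim by simp
        then have "proj n x = 0" using 3 proj_homog[of x 1 n] by simp
        then have "x = 0" using x by (simp add: proj_homog)
        then have "p d x = 0" using lin_0[OF p_lin2[OF ddeg_mem[OF d(1)]] R.vs_axioms] by simp
        then show False using gx[OF d(1)] g(3) by simp
      qed
    qed
  qed
  then have "carr dual \<subseteq> ?G" using Gs by (intro DG.carr_subset_if_degs) simp_all
  then show ?thesis using DG.R.generated_carr[OF d1] by auto
qed

text \<open>Primitive elements of the dual are the derivations of \<open>R\<close> with values in
  the base field, on which \<open>R\<close> acts through the counit.\<close>

lemma dual_primitive_iff:
  "d \<in> primitives dual \<longleftrightarrow> d \<in> carr D \<and> (\<forall>x\<in>carr R. \<forall>y\<in>carr R. p d (mul R x y) = p d y * eps R x + eps R y * p d x)"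
proof -
  have "teq D D (dcop d) [(d, dunit), (dunit, d)] \<longleftrightarrow>
      (\<forall>x\<in>carr R. \<forall>y\<in>carr R. p d (mul R x y) = p d y * eps R x + eps R y * p d x)" if d: "d \<in> carr D"
  proof
    assume t: "teq D D (dcop d) [(d, dunit), (dunit, d)]"
    show "\<forall>x\<in>carr R. \<forall>y\<in>carr R. p d (mul R x y) = p d y * eps R x + eps R y * p d x"
    proof (intro ballI)
      fix x y assume x: "x \<in> carr R" and y: "y \<in> carr R"
      have "bilin D D kk (\<lambda>a b. p a y * p b x)" by (intro bilinI lins x y)
      from teq_tsum[OF t this vs_kk] show "p d (mul R x y) = p d y * eps R x + eps R y * p d x"
        by (simp add: p_dcop d x y p_dunit)
    qed
  next
    assume "\<forall>x\<in>carr R. \<forall>y\<in>carr R. p d (mul R x y) = p d y * eps R x + eps R y * p d x"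
    then show "teq D D (dcop d) [(d, dunit), (dunit, d)]"
      using dcop_mem[OF d] d dunit_mem by (intro teqD) (simp_all add: p_dcop p_dunit)
  qed
  then show ?thesis by (auto simp: primitives_def)
qed

text \<open>Such a derivation vanishes at the unit, and on a product g w with \<open>g\<close> of
  degree one it takes the value \<open>eps R w * p d g\<close>. If \<open>R\<close> is generated in
  degree one, it therefore depends on the component of degree one only.\<close>

lemma dual_primitives:
  assumes gen: "generated R (deg R 1) = carr R" shows "primitives dual = ddeg 1"
proof
  interpret DG: graded_connected_hopf K dual by (rule dual_graded)
  show "ddeg 1 \<subseteq> primitives dual" using DG.deg_1_prim by auto
  show "primitives dual \<subseteq> ddeg 1"
  proof
    fix d assume "d \<in> primitives dual"
    then have d: "d \<in> carr D" and e: "\<And>x y. x \<in> carr R \<Longrightarrow> y \<in> carr R \<Longrightarrow> p d (mul R x y) = p d y * eps R x + eps R y * p d x"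
      by (auto simp: dual_primitive_iff)
    have pz: "p d 0 = 0" by (rule lin_0[OF p_lin2[OF d] R.vs_axioms])
    have "p d (unit R) = p d (unit R) + p d (unit R)"
      using e[OF R.unit_carr R.unit_carr] by (simp add: R.unit_left R.unit_carr R.eps_unit)
    then have pu: "p d (unit R) = 0" by (metis add_cancel_left_right)
    have d1: "deg R 1 \<subseteq> carr R" using deg_mem by blast
    have "generated R (deg R 1) \<subseteq> {x \<in> carr R. p d x = p d (proj 1 x)}"
    proof (rule R.generated_subset[OF d1])
      show "R.VS.subspace {x \<in> carr R. p d x = p d (proj 1 x)}"
        by (rule subspace_eq[where Z=kk]) (intro lins d)+
      show "unit R \<in> {x \<in> carr R. p d x = p d (proj 1 x)}"
        using pu pz by (simp add: R.unit_carr proj_homog[OF deg_unit])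
    next
      fix g w assume g: "g \<in> deg R 1" and "w \<in> {x \<in> carr R. p d x = p d (proj 1 x)}"
      then have w: "w \<in> carr R" by simp
      note gc = deg_mem[OF g]
      have "p d (proj 1 (mul R g w)) = p d (scl R (eps R w) g)"
        by (simp add: proj_mul_homog[OF g w] proj0 w R.mul_scl gc R.unit_carr R.unit_right)
      also have "\<dots> = eps R w * p d g" using lin_scl[OF p_lin2[OF d] gc] by simp
      also have "\<dots> = p d (mul R g w)" using e[OF gc w] deg_eps[OF g] by simp
      finally show "mul R g w \<in> {x \<in> carr R. p d x = p d (proj 1 x)}" using gc w by (simp add: R.mul_mem)
    qed
    then have "p d x = p d (proj 1 x)" if "x \<in> carr R" for x using gen that by blast
    then have "p d x = 0" if "x \<in> deg R m" "m \<noteq> 1" for m x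
      using that deg_mem pz by (metis proj_homog)
    then show "d \<in> ddeg 1" using d by (auto simp: ddeg_def)
  qed
qed

text \<open>In the first degree n \<ge> 2 that degree one does not generate, some functional is
  nonzero but vanishes on all elements generated in degree one. Extended by zero to the other
  degrees it kills all products of components of lower positive degree, so it is a derivation, that
  is, a primitive element of degree \<open>n\<close>.\<close>

lemma generated_if_dual_primitives:
  assumes prim: "primitives dual = ddeg 1" shows "generated R (deg R 1) = carr R"
proof -
  let ?S = "gen_upto 1"
  have "deg R n \<subseteq> ?S" for n
  proof (induction n rule: less_induct)
    case (less n)
    show ?case
    proof (cases "n \<le> 1")
      case True
      then show ?thesis by (rule deg_gen_upto)
    next
      case False
      show ?thesis
      proof (rule ccontr)
        assume "\<not> deg R n \<subseteq> ?S"
        then obtain x where x: "x \<in> deg R n" "x \<notin> ?S" by auto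
        obtain g where g: "Vector_Spaces.linear (scl R) (*) g" "\<And>u. u \<in> ?S \<Longrightarrow> g u = 0" "g x \<noteq> 0"
          using R.separate_from_subspace[OF gen_upto_subspace x(2)] by blast
        have gl: "lin R kk g" by (rule linear_lin[OF g(1)])
        have l: "lin R kk (\<lambda>z. g (proj n z))" by (intro lin_comp[OF gl] lins)
        define d where "d = rep (\<lambda>z. g (proj n z))"
        have d: "d \<in> ddeg n" "\<And>z. z \<in> carr R \<Longrightarrow> p d z = g (proj n z)"
          unfolding d_def using lin_0[OF gl R.vs_axioms] rep_ddeg[OF l, of n] by (auto simp: proj_homog)
        note dc = ddeg_mem[OF d(1)]
        have "p d (mul R u v) = p d v * eps R u + eps R v * p d u" if u: "u \<in> carr R" and v: "v \<in> carr R" for u v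
        proof -
          have z: "p d (mul R (proj (n - i) u) (proj i v)) = 0" if i: "i \<in> {0<..<n}" for i
          proof -
            have "proj (n - i) u \<in> ?S" "proj i v \<in> ?S"
              using less.IH[of i] less.IH[of "n - i"] proj_deg[OF u] proj_deg[OF v] i by auto
            then have s: "mul R (proj (n - i) u) (proj i v) \<in> ?S" by (rule gen_upto_mul)
            have m: "mul R (proj (n - i) u) (proj i v) \<in> deg R n" using deg_mul[OF proj_deg[OF u] proj_deg[OF v], of "n - i" i] i by simp
            show ?thesis using d(2)[OF deg_mem[OF m]] m s g(2) by (simp add: proj_homog)
          qed
          have "{..n} = insert 0 (insert n {0<..<n})" using False by auto
          then have "p d (mul R u v) = p d (mul R (proj n u) (proj 0 v)) + p d (mul R (proj 0 u) (proj n v))"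
            using False by (simp add: p_mul_homog[OF d(1) u v] z)
          also have "\<dots> = eps R v * p d (proj n u) + eps R u * p d (proj n v)"
            by (simp add: proj0 u v R.mul_scl R.unit_carr R.unit_left R.unit_right proj_mem lin_scl[OF p_lin2[OF dc]])
          finally show ?thesis by (simp add: ddeg_proj[OF d(1)] u v mult.commute add.commute)
        qed
        then have "d \<in> ddeg 1" using prim dc dual_primitive_iff by blast
        then have "p d x = 0" using ddeg_deg[of d 1 x n] x(1) False by simp
        then show False using d(2)[OF deg_mem[OF x(1)]] x(1) g(3) by (simp add: proj_homog)
      qed
    qed
  qed
  then have "carr R \<subseteq> ?S" by (intro carr_subset_if_degs gen_upto_subspace)
  then show ?thesis using gen_upto_carr gen_upto_1 by auto
qed

section \<open>The component of degree one of the dual\<close>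

lemma ddeg_hcoact:
  assumes d: "d \<in> ddeg n" and x: "x \<in> carr R" and f: "lin K kk \<phi>"
  shows "tsum (hcoact R (proj n x)) (\<lambda>h w. p d w * \<phi> (ainv h)) = tsum (hcoact R x) (\<lambda>h w. p d w * \<phi> (ainv h))"
proof (rule lin_eq_homog[OF _ _ _ x, of kk])
  note dc = ddeg_mem[OF d]
  note [lins] = lin_comp[OF f]
  have l: "lin R kk (\<lambda>x. tsum (hcoact R x) (\<lambda>h w. p d w * \<phi> (ainv h)))" by (intro lins dc)
  then show "lin R kk (\<lambda>x. tsum (hcoact R x) (\<lambda>h w. p d w * \<phi> (ainv h)))" .
  show "lin R kk (\<lambda>x. tsum (hcoact R (proj n x)) (\<lambda>h w. p d w * \<phi> (ainv h)))" by (intro lins dc)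
  fix m x assume x: "x \<in> deg R m"
  show "tsum (hcoact R (proj n x)) (\<lambda>h w. p d w * \<phi> (ainv h)) = tsum (hcoact R x) (\<lambda>h w. p d w * \<phi> (ainv h))"
  proof (cases "m = n")
    case False
    have "tsum (hcoact R x) (\<lambda>h w. p d w * \<phi> (ainv h)) = tsum (hcoact R x) (\<lambda>h w. p d (proj m w) * \<phi> (ainv h))"
      by (rule hcoact_homog[OF x _ vs_kk]) (intro bilinI lins dc; assumption?)+
    also have "\<dots> = tsum (hcoact R x) (\<lambda>h w. 0)"
      using ddeg_deg[OF d proj_deg False] by (intro hcoact_cong deg_mem[OF x]) simp
    finally show ?thesis using lin_0[OF l R.vs_axioms] False x by (simp add: proj_homog)
  qed (use x in \<open>simp add: proj_homog\<close>)
qed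

text \<open>The second clause normalizes the identification: \<open>\<kappa> f\<close> restricts to
  \<open>f\<close> on \<open>V\<close>. It is what later shows that the restriction maps between
  duals are the canonical maps of the poset.\<close>

lemma dual_degree_one_iso:
  assumes V: "yd_module K V" and io: "degree_one_iso K V R \<iota>"
  shows "\<exists>\<kappa>. degree_one_iso K (yd_dual K V) dual \<kappa> \<and>
    (\<forall>f\<in>carr (yd_dual K V). \<forall>v\<in>carr V. p (\<kappa> f) (\<iota> v) = f v)"
proof -
  interpret V: yd_module K V by fact
  have il: "lin V R \<iota>" and ib: "bij_betw \<iota> (carr V) (deg R 1)"
    and ia: "\<And>h v. h \<in> carr K \<Longrightarrow> v \<in> carr V \<Longrightarrow> \<iota> (act V h v) = hact R h (\<iota> v)"
    and ic: "\<And>v. v \<in> carr V \<Longrightarrow> teq K R (hcoact R (\<iota> v)) [(h, \<iota> w). (h, w) \<leftarrow> coact V v]"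
    using io by (auto simp: degree_one_iso_def)
  define j where "j = inv_into (carr V) \<iota>"
  have j: "j y \<in> carr V" "\<iota> (j y) = y" if "y \<in> deg R 1" for y
    using that ib unfolding j_def by (auto simp: bij_betw_def inv_into_into f_inv_into_f)
  have ji: "j (\<iota> v) = v" if "v \<in> carr V" for v
    using that ib unfolding j_def by (simp add: bij_betw_def)
  have i1: "\<iota> v \<in> deg R 1" if "v \<in> carr V" for v using that ib by (auto simp: bij_betw_def)
  have iI: "\<iota> v = \<iota> w \<Longrightarrow> v \<in> carr V \<Longrightarrow> w \<in> carr V \<Longrightarrow> v = w" for v w using ji by metis
  have jl: "lin R V (\<lambda>x. j (proj 1 x))"
    unfolding lin_def
  proof (intro conjI ballI allI)
    fix x y assume x: "x \<in> carr R" and y: "y \<in> carr R"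
    note px = proj_deg[OF x, of 1] and py = proj_deg[OF y, of 1]
    show "j (proj 1 (x + y)) = j (proj 1 x) + j (proj 1 y)"
      using j[OF px] j[OF py] j[OF deg_add[OF px py]]
      by (intro iI) (simp_all add: lin_add[OF lin_proj0] x y lin_add[OF il] V.V.add_mem)
  next
    fix c x assume x: "x \<in> carr R"
    note px = proj_deg[OF x, of 1]
    show "j (proj 1 (scl R c x)) = scl V c (j (proj 1 x))"
      using j[OF px] j[OF deg_scl[OF px]]
      by (intro iI) (simp_all add: lin_scl[OF lin_proj0] x lin_scl[OF il] V.V.scl_mem)
  qed (use j proj_deg in auto)
  \<comment> \<open>A form on \<open>V\<close> is extended by zero to the other degrees, after
    \<open>V\<close> has been identified with degree one through the inverse \<open>j\<close> of
    \<open>\<iota>\<close>.\<close>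
  define \<kappa> where "\<kappa> f = rep (\<lambda>x. f (j (proj 1 x)))" for f
  have dc: "f \<in> carr (yd_dual K V) \<longleftrightarrow> lin V kk f \<and> (\<forall>x. x \<notin> carr V \<longrightarrow> f x = 0)" for f
    by (simp add: yd_dual_def dual_vspace_def lform_lin)
  have dc': "carr (dual_vspace V) = carr (yd_dual K V)" by (simp add: yd_dual_def)
  have sc: "scl (yd_dual K V) c f = (\<lambda>x. c * f x)" for c f by (simp add: yd_dual_def dual_vspace_def)
  have k: "\<kappa> f \<in> ddeg 1" "\<And>x. x \<in> carr R \<Longrightarrow> p (\<kappa> f) x = f (j (proj 1 x))" if f: "f \<in> carr (yd_dual K V)" for f
  proof -
    have fl: "lin V kk f" using f dc by blast
    have l: "lin R kk (\<lambda>x. f (j (proj 1 x)))" by (rule lin_comp[OF fl jl])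
    have z: "f (j (proj 1 x)) = 0" if "x \<in> deg R m" "m \<noteq> 1" for m x
      using that lin_0[OF fl V.V.vs_axioms] lin_0[OF jl R.vs_axioms] lin_0[OF lin_proj0 R.vs_axioms]
      by (simp add: proj_homog)
    show "\<kappa> f \<in> ddeg 1" "\<And>x. x \<in> carr R \<Longrightarrow> p (\<kappa> f) x = f (j (proj 1 x))"
      unfolding \<kappa>_def by (rule rep_ddeg[where n=1, OF l], rule z, assumption+)+
  qed
  have kc: "\<kappa> f \<in> carr D" if "f \<in> carr (yd_dual K V)" for f using k(1)[OF that] by (rule ddeg_mem)
  have kv: "p (\<kappa> f) (\<iota> v) = f v" if "f \<in> carr (yd_dual K V)" "v \<in> carr V" for f v
    using k(2)[OF that(1) deg_mem[OF i1[OF that(2)]]] i1[OF that(2)] that(2) by (simp add: proj_homog ji)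
  have res: "(\<lambda>v. if v \<in> carr V then p d (\<iota> v) else 0) \<in> carr (yd_dual K V)" if d: "d \<in> carr D" for d
  proof -
    have "lin V kk (\<lambda>v. p d (\<iota> v))" by (rule lin_comp[OF p_lin2[OF d] il])
    then have "lin V kk (\<lambda>v. if v \<in> carr V then p d (\<iota> v) else 0)" by (rule lin_cong[OF _ _ V.V.vs_axioms]) simp
    then show ?thesis by (simp add: dc)
  qed
  have "degree_one_iso K (yd_dual K V) dual \<kappa>"
    unfolding degree_one_iso_def
  proof (intro conjI ballI)
    have add: "(\<lambda>x. f x + g x) \<in> carr (yd_dual K V)" if "f \<in> carr (yd_dual K V)" "g \<in> carr (yd_dual K V)" for f g
      using that by (auto simp: dc intro!: lin_plus vs_kk)
    have scm: "(\<lambda>x. c * f x) \<in> carr (yd_dual K V)" if "f \<in> carr (yd_dual K V)" for f c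
      using that by (auto simp: dc intro!: lins)
    have "\<kappa> (\<lambda>x. f x + g x) = \<kappa> f + \<kappa> g" if "f \<in> carr (yd_dual K V)" "g \<in> carr (yd_dual K V)" for f g
      by (rule p_eqI) (simp_all add: that add kc D.add_mem k lin_add[OF p_lin1])
    moreover have "\<kappa> (\<lambda>x. c * f x) = scl D c (\<kappa> f)" if "f \<in> carr (yd_dual K V)" for f c
      by (rule p_eqI) (simp_all add: that scm kc D.scl_mem k lin_scl[OF p_lin1])
    ultimately show "lin (yd_dual K V) dual \<kappa>"
      using kc by (auto simp: lin_def sc plus_fun_def)
    show "bij_betw \<kappa> (carr (yd_dual K V)) (deg dual 1)"
      unfolding bij_betw_def
    proof
      show "inj_on \<kappa> (carr (yd_dual K V))"
      proof (rule inj_onI)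
        fix f g assume f: "f \<in> carr (yd_dual K V)" and g: "g \<in> carr (yd_dual K V)" and e: "\<kappa> f = \<kappa> g"
        show "f = g"
        proof
          fix v show "f v = g v"
            using kv[OF f, of v] kv[OF g, of v] e f g by (cases "v \<in> carr V") (auto simp: dc)
        qed
      qed
      show "\<kappa> ` carr (yd_dual K V) = deg dual 1"
      proof
        show "\<kappa> ` carr (yd_dual K V) \<subseteq> deg dual 1" using k by auto
        show "deg dual 1 \<subseteq> \<kappa> ` carr (yd_dual K V)"
        proof
          fix d assume "d \<in> deg dual 1"
          then have d: "d \<in> ddeg 1" by simp
          let ?f = "\<lambda>v. if v \<in> carr V then p d (\<iota> v) else 0"
          note f = res[OF ddeg_mem[OF d]]
          have "d = \<kappa> ?f"
          proof (rule p_eqI[OF ddeg_mem[OF d] kc[OF f]])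
            fix x assume x: "x \<in> carr R"
            show "p d x = p (\<kappa> ?f) x"
              using k(2)[OF f x] j[OF proj_deg[OF x, of 1]] ddeg_proj[OF d x] by simp
          qed
          then show "d \<in> \<kappa> ` carr (yd_dual K V)" using f by blast
        qed
      qed
    qed
  next
    fix h f assume h: "h \<in> carr K" and f: "f \<in> carr (yd_dual K V)"
    let ?g = "act (yd_dual K V) h f"
    have g: "?g = (\<lambda>v. if v \<in> carr V then f (act V (antip K h) v) else 0)" by (simp add: yd_dual_def)
    have fl: "lin V kk f" using f dc by blast
    have Sh: "antip K h \<in> carr K" by (rule YD.K.antip_mem[OF h])
    have "lin V kk (\<lambda>v. f (act V (antip K h) v))" by (rule lin_comp[OF fl V.act_lin_right[OF Sh]])
    then have "lin V kk ?g" unfolding g by (rule lin_cong[OF _ _ V.V.vs_axioms]) simp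
    then have gc: "?g \<in> carr (yd_dual K V)" by (simp add: dc g)
    have "\<kappa> ?g = dact h (\<kappa> f)"
    proof (rule p_eqI[OF kc[OF gc] dact_mem[OF h kc[OF f]]])
      fix x assume x: "x \<in> carr R"
      note px = proj_deg[OF x, of 1]
      have jh: "j (hact R (antip K h) (proj 1 x)) = act V (antip K h) (j (proj 1 x))"
        by (rule iI) (simp_all add: j[OF px] j[OF deg_act[OF Sh px]] ia Sh V.act_mem del: One_nat_def)
      show "p (\<kappa> ?g) x = p (dact h (\<kappa> f)) x"
        unfolding k(2)[OF gc x] p_dact[OF h kc[OF f] x] k(2)[OF f hact_mem[OF Sh x]] proj_hact[OF Sh x] jh
        using j(1)[OF px] by (simp add: g)
    qed
    then show "\<kappa> (act (yd_dual K V) h f) = hact dual h (\<kappa> f)" by simp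
  next
    fix f assume f: "f \<in> carr (yd_dual K V)"
    have fl: "lin V kk f" using f dc by blast
    have hc: "tsum (hcoact R (\<iota> v)) (\<lambda>h w. scl Z (p (\<kappa> f) w) (G (ainv h))) = tsum (coact V v) (\<lambda>h w. scl Z (f w) (G (ainv h)))"
      if v: "v \<in> carr V" and G: "lin K Z G" and Z: "vs Z"
      for v and Z :: "('k, 'w::ab_group_add) vspace" and G :: "'h \<Rightarrow> 'w"
    proof -
      have "bilin K R Z (\<lambda>h w. scl Z (p (\<kappa> f) w) (G (ainv h)))"
        using Z lin_mem[OF G] by (intro bilinI lins lin_comp[OF G] kc f) (auto intro: mems)
      from teq_tsum[OF ic[OF v] this Z]
      have "tsum (hcoact R (\<iota> v)) (\<lambda>h w. scl Z (p (\<kappa> f) w) (G (ainv h))) =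
         tsum (coact V v) (\<lambda>h w. scl Z (p (\<kappa> f) (\<iota> w)) (G (ainv h)))" by simp
      also have "\<dots> = tsum (coact V v) (\<lambda>h w. scl Z (f w) (G (ainv h)))"
        by (intro V.coact_cong v) (simp add: kv f)
      finally show ?thesis .
    qed
    \<comment> \<open>The underlying vector space of \<open>K\<close>, so that \<open>hc\<close> can
      be used with values in \<open>K\<close>.\<close>
    let ?K = "\<lparr>carr = carr K, scl = scl K\<rparr>"
    have Kv: "vs ?K" using YD.K.vs_axioms by (simp add: vs_def)
    have Kl: "lin K ?K (\<lambda>h. h)" by (auto simp: lin_def)
    let ?P = "\<lambda>t. set t \<subseteq> carr K \<times> carr (dual_vspace V) \<and>
        (\<forall>v\<in>carr V. (\<Sum>(h, g)\<leftarrow>t. scl K (g v) h) =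
           (\<Sum>(h, w)\<leftarrow>coact V v. scl K (f w) (inv_into (carr K) (antip K) h)))"
    \<comment> \<open>The coaction of \<open>yd_dual\<close> is a chosen list, so its defining
      property is available only once some list satisfies it. The coaction of the dual, restricted
      to \<open>V\<close>, provides one.\<close>
    let ?t0 = "map (\<lambda>(h, e). (h, \<lambda>v. if v \<in> carr V then p e (\<iota> v) else 0)) (dcoact (\<kappa> f))"
    have "?P ?t0"
    proof (intro conjI ballI)
      show "set ?t0 \<subseteq> carr K \<times> carr (dual_vspace V)"
        using dcoact_mem[OF kc[OF f]] res unfolding dc' by auto
      fix v assume v: "v \<in> carr V"
      have "(\<Sum>(h, g)\<leftarrow>?t0. scl K (g v) h) = tsum ?t0 (\<lambda>h g. scl K (g v) h)" by (simp add: tsum_def)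
      also have "\<dots> = tsum (dcoact (\<kappa> f)) (\<lambda>h e. scl K (p e (\<iota> v)) h)" using v by simp
      also have "\<dots> = tsum (hcoact R (\<iota> v)) (\<lambda>h w. scl K (p (\<kappa> f) w) (ainv h))"
        by (rule dcoact_spec[OF kc[OF f] deg_mem[OF i1[OF v]]])
      also have "\<dots> = tsum (coact V v) (\<lambda>h w. scl K (f w) (ainv h))"
        using hc[OF v Kl Kv] by simp
      finally show "(\<Sum>(h, g)\<leftarrow>?t0. scl K (g v) h) = (\<Sum>(h, w)\<leftarrow>coact V v. scl K (f w) (inv_into (carr K) (antip K) h))"
        by (simp add: tsum_def KB.ainv_def)
    qed
    then have P: "?P (coact (yd_dual K V) f)"
      unfolding yd_dual_def by (simp only: yd.select_convs) (rule someI)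
    let ?c = "coact (yd_dual K V) f"
    have P1: "set ?c \<subseteq> carr K \<times> carr (yd_dual K V)" using P dc' by simp
    have P2: "tsum ?c (\<lambda>h g. scl K (g v) h) = tsum (coact V v) (\<lambda>h w. scl K (f w) (ainv h))" if "v \<in> carr V" for v
      using P that by (simp add: tsum_def KB.ainv_def)
    have "teq K D (dcoact (\<kappa> f)) [(h, \<kappa> w). (h, w) \<leftarrow> ?c]"
    proof (rule teqK)
      show "set (dcoact (\<kappa> f)) \<subseteq> carr K \<times> carr D" by (rule dcoact_mem[OF kc[OF f]])
      show "set [(h, \<kappa> w). (h, w) \<leftarrow> ?c] \<subseteq> carr K \<times> carr D" using P1 kc by auto
      fix \<phi> x assume ph: "lin K kk \<phi>" and x: "x \<in> carr R"
      define v where "v = j (proj 1 x)"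
      have v: "v \<in> carr V" "\<iota> v = proj 1 x" unfolding v_def using j[OF proj_deg[OF x, of 1]] by auto
      have "tsum (dcoact (\<kappa> f)) (\<lambda>h d. p d x * \<phi> h) = tsum (hcoact R x) (\<lambda>h w. p (\<kappa> f) w * \<phi> (ainv h))"
        by (rule p_dcoactk[OF kc[OF f] x ph])
      also have "\<dots> = tsum (hcoact R (\<iota> v)) (\<lambda>h w. p (\<kappa> f) w * \<phi> (ainv h))"
        unfolding v(2) by (rule ddeg_hcoact[OF k(1)[OF f] x ph, symmetric])
      also have "\<dots> = tsum (coact V v) (\<lambda>h w. f w * \<phi> (ainv h))"
        using hc[OF v(1) ph vs_kk] by simp
      also have "\<dots> = tsum (coact V v) (\<lambda>h w. \<phi> (scl K (f w) (ainv h)))"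
        by (intro V.coact_cong v) (simp add: lin_scl[OF ph] KB.ainv_mem)
      also have "\<dots> = \<phi> (tsum (coact V v) (\<lambda>h w. scl K (f w) (ainv h)))"
        using V.coact_mem[OF v(1)] by (intro lin_tsum_out[OF ph YD.K.vs_axioms, symmetric] YD.K.scl_mem KB.ainv_mem) auto
      also have "\<dots> = \<phi> (tsum ?c (\<lambda>h g. scl K (g v) h))" by (simp add: P2[OF v(1)])
      also have "\<dots> = tsum ?c (\<lambda>h g. \<phi> (scl K (g v) h))"
        using P1 by (intro lin_tsum_out[OF ph YD.K.vs_axioms] YD.K.scl_mem) auto
      also have "\<dots> = tsum ?c (\<lambda>h g. p (\<kappa> g) x * \<phi> h)"
        by (rule tsum_congC[OF P1]) (simp add: lin_scl[OF ph] k(2) x v_def)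
      finally show "tsum (dcoact (\<kappa> f)) (\<lambda>h d. p d x * \<phi> h) = tsum [(h, \<kappa> w). (h, w) \<leftarrow> ?c] (\<lambda>h d. p d x * \<phi> h)"
        by simp
    qed
    then show "teq K dual (hcoact dual (\<kappa> f)) [(h, \<kappa> w). (h, w) \<leftarrow> ?c]" by simp
  qed
  then show ?thesis using kv by blast
qed

end

section \<open>Restriction of functionals to a Hopf subalgebra\<close>

text \<open>The map is restriction of functionals along the inclusion of \<open>R\<close> in
  \<open>R'\<close>. Every structure map of a dual is fixed by its pairing with \<open>R\<close> or
  \<open>R'\<close>, so compatibility follows from that of the inclusion. The homogeneous projection
  \<open>P\<close> extends functionals, which gives surjectivity.\<close>

lemma restriction_hom:
  fixes K :: "('k::field, 'h::ab_group_add, 'y) hopf_scheme"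
    and R R' :: "('k, 'h, 'a::ab_group_add, 'z) yd_hopf_scheme"
    and D D' :: "('k, 'd::ab_group_add) vspace"
  assumes A: "dual_pairing K R D p" and A': "dual_pairing K R' D' p'"
    and sub: "carr R \<subseteq> carr R'"
    and sel: "scl R = scl R'" "mul R = mul R'" "unit R = unit R'" "eps R = eps R'"
      "antip R = antip R'" "hact R = hact R'" "\<And>n. deg R n = deg R' n \<inter> carr R"
    and cop: "\<And>x \<beta>. x \<in> carr R \<Longrightarrow> bilin R' R' kk \<beta> \<Longrightarrow> tsum (cop R x) \<beta> = tsum (cop R' x) \<beta>"
    and hcoact: "\<And>x \<gamma>. x \<in> carr R \<Longrightarrow> bilin K R' kk \<gamma> \<Longrightarrow> tsum (hcoact R x) \<gamma> = tsum (hcoact R' x) \<gamma>"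
    and P: "lin R' R P" "\<And>x. x \<in> carr R \<Longrightarrow> P x = x" "\<And>n x. x \<in> deg R' n \<Longrightarrow> P x \<in> deg R n"
  shows "\<exists>\<pi>. graded_hopf_hom K (dual_pairing.dual K R' D' p') (dual_pairing.dual K R D p) \<pi> \<and>
      (\<forall>d\<in>carr D'. \<pi> d \<in> carr D \<and> (\<forall>x\<in>carr R. p (\<pi> d) x = p' d x)) \<and>
      \<pi> ` carr D' = carr D \<and> (carr R \<noteq> carr R' \<longrightarrow> \<not> inj_on \<pi> (carr D'))"
proof -
  interpret A: dual_pairing K R D p by (rule A)
  interpret B: dual_pairing K R' D' p' by (rule A')
  have c: "x \<in> carr R'" if "x \<in> carr R" for x using sub that by auto
  have dg: "x \<in> deg R' n" if "x \<in> deg R n" for x n using that sel(7)[of n] by simp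
  have ls: "lin R Z f" if "lin R' Z f" for Z :: "('k, 'w::ab_group_add) vspace" and f
    using that sub sel(1) by (auto simp: lin_def)
  define \<pi> where "\<pi> d = A.rep (p' d)" for d
  have pi: "\<pi> d \<in> carr D" "\<And>x. x \<in> carr R \<Longrightarrow> p (\<pi> d) x = p' d x" if d: "d \<in> carr D'" for d
  proof -
    have l: "lin R kk (p' d)" by (rule ls[OF B.p_lin2[OF d]])
    obtain N where "\<And>n x. n \<ge> N \<Longrightarrow> x \<in> deg R' n \<Longrightarrow> p' d x = 0" using B.boundedE[OF d] by blast
    then have b: "A.bounded (p' d)" unfolding A.bounded_def using dg by blast
    show "\<pi> d \<in> carr D" "\<And>x. x \<in> carr R \<Longrightarrow> p (\<pi> d) x = p' d x"
      unfolding \<pi>_def by (rule A.rep_mem[OF l b], rule A.p_rep[OF l b])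
  qed
  have hom: "graded_hopf_hom K B.dual A.dual \<pi>"
    unfolding graded_hopf_hom_def
  proof (intro conjI ballI allI)
    have "lin D' D \<pi>"
    proof (rule A.linDI[OF _ _ B.D.vs_axioms])
      fix x assume x: "x \<in> carr R"
      show "lin D' kk (\<lambda>d. p (\<pi> d) x)"
        by (rule lin_cong[OF B.p_lin1[OF c[OF x]] _ B.D.vs_axioms]) (simp add: pi x)
    qed (rule pi)
    then show "lin B.dual A.dual \<pi>" by simp
  next
    fix d e assume "d \<in> carr B.dual" "e \<in> carr B.dual"
    then have d: "d \<in> carr D'" and e: "e \<in> carr D'" by simp_all
    have "\<pi> (B.dmul d e) = A.dmul (\<pi> d) (\<pi> e)"
    proof (rule A.p_eqI)
      fix x assume x: "x \<in> carr R"
      have b: "bilin R' R' kk (\<lambda>a b. p' d b * p' e a)" by (intro bilinI lins d e)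
      have "p (\<pi> (B.dmul d e)) x = tsum (cop R' x) (\<lambda>a b. p' d b * p' e a)"
        using pi(2)[OF B.dmul_mem[OF d e] x] B.p_dmul[OF d e c[OF x]] by simp
      also have "\<dots> = tsum (cop R x) (\<lambda>a b. p' d b * p' e a)" by (rule cop[OF x b, symmetric])
      also have "\<dots> = tsum (cop R x) (\<lambda>a b. p (\<pi> d) b * p (\<pi> e) a)"
        by (intro A.R.cop_cong x) (simp add: pi d e)
      also have "\<dots> = p (A.dmul (\<pi> d) (\<pi> e)) x" by (rule A.p_dmul[OF pi(1)[OF d] pi(1)[OF e] x, symmetric])
      finally show "p (\<pi> (B.dmul d e)) x = p (A.dmul (\<pi> d) (\<pi> e)) x" .
    qed (intro pi A.dmul_mem B.dmul_mem d e)+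
    then show "\<pi> (mul B.dual d e) = mul A.dual (\<pi> d) (\<pi> e)" by simp
  next
    have "\<pi> B.dunit = A.dunit"
      by (rule A.p_eqI) (simp_all add: pi B.dunit_mem A.dunit_mem A.p_dunit B.p_dunit c sel)
    then show "\<pi> (unit B.dual) = unit A.dual" by simp
  next
    fix d assume "d \<in> carr B.dual"
    then have d: "d \<in> carr D'" by simp
    have "teq D D (A.dcop (\<pi> d)) [(\<pi> a, \<pi> b). (a, b) \<leftarrow> B.dcop d]"
    proof (rule A.teqD)
      show "set (A.dcop (\<pi> d)) \<subseteq> carr D \<times> carr D" by (intro A.dcop_mem pi d)
      show "set [(\<pi> a, \<pi> b). (a, b) \<leftarrow> B.dcop d] \<subseteq> carr D \<times> carr D"
        using B.dcop_mem[OF d] pi(1) by auto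
      fix x y assume x: "x \<in> carr R" and y: "y \<in> carr R"
      have "tsum (B.dcop d) (\<lambda>a b. p (\<pi> a) y * p (\<pi> b) x) = tsum (B.dcop d) (\<lambda>a b. p' a y * p' b x)"
        by (intro B.dcop_cong d) (simp add: pi x y)
      also have "\<dots> = p' d (mul R x y)" by (simp add: B.p_dcop d x y c sel)
      finally show "tsum (A.dcop (\<pi> d)) (\<lambda>d e. p d y * p e x) =
          tsum [(\<pi> a, \<pi> b). (a, b) \<leftarrow> B.dcop d] (\<lambda>d e. p d y * p e x)"
        by (simp add: A.p_dcop pi d x y A.R.mul_mem)
    qed
    then show "teq A.dual A.dual (cop A.dual (\<pi> d)) [(\<pi> a, \<pi> b). (a, b) \<leftarrow> cop B.dual d]" by simp
    show "eps A.dual (\<pi> d) = eps B.dual d" using pi(2)[OF d A.R.unit_carr] by (simp add: sel)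
    have "A.dantip (\<pi> d) = \<pi> (B.dantip d)"
      by (rule A.p_eqI) (simp_all add: pi d A.dantip_mem B.dantip_mem A.p_dantip B.p_dantip c A.R.antip_mem sel(5)[symmetric])
    then show "antip A.dual (\<pi> d) = \<pi> (antip B.dual d)" by simp
    show "hact A.dual h (\<pi> d) = \<pi> (hact B.dual h d)" if h: "h \<in> carr K" for h
    proof -
      have Sh: "antip K h \<in> carr K" by (rule A.YD.K.antip_mem[OF h])
      have "A.dact h (\<pi> d) = \<pi> (B.dact h d)"
        by (rule A.p_eqI) (simp_all add: pi d A.dact_mem B.dact_mem h A.p_dact B.p_dact c A.hact_mem Sh sel(6)[symmetric])
      then show ?thesis by simp
    qed
    have "teq K D (A.dcoact (\<pi> d)) [(h, \<pi> w). (h, w) \<leftarrow> B.dcoact d]"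
    proof (rule A.teqK)
      show "set (A.dcoact (\<pi> d)) \<subseteq> carr K \<times> carr D" by (intro A.dcoact_mem pi d)
      show "set [(h, \<pi> w). (h, w) \<leftarrow> B.dcoact d] \<subseteq> carr K \<times> carr D"
        using B.dcoact_mem[OF d] pi(1) by auto
      fix \<phi> x assume f: "lin K kk \<phi>" and x: "x \<in> carr R"
      have b: "bilin K R' kk (\<lambda>h w. p' d w * \<phi> (A.ainv h))" by (intro bilinI lins lin_comp[OF f] d)
      have "tsum (B.dcoact d) (\<lambda>h w. p (\<pi> w) x * \<phi> h) = tsum (B.dcoact d) (\<lambda>h w. p' w x * \<phi> h)"
        by (intro B.dcoact_cong d) (simp add: pi x)
      also have "\<dots> = tsum (hcoact R' x) (\<lambda>h w. p' d w * \<phi> (A.ainv h))"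
        by (rule B.p_dcoactk[OF d c[OF x] f])
      also have "\<dots> = tsum (hcoact R x) (\<lambda>h w. p' d w * \<phi> (A.ainv h))"
        by (rule hcoact[OF x b, symmetric])
      also have "\<dots> = tsum (hcoact R x) (\<lambda>h w. p (\<pi> d) w * \<phi> (A.ainv h))"
        by (intro A.hcoact_cong x) (simp add: pi d)
      also have "\<dots> = tsum (A.dcoact (\<pi> d)) (\<lambda>h w. p w x * \<phi> h)"
        by (rule A.p_dcoactk[OF pi(1)[OF d] x f, symmetric])
      finally show "tsum (A.dcoact (\<pi> d)) (\<lambda>h d. p d x * \<phi> h) =
          tsum [(h, \<pi> w). (h, w) \<leftarrow> B.dcoact d] (\<lambda>h d. p d x * \<phi> h)" by simp
    qed
    then show "teq K A.dual (hcoact A.dual (\<pi> d)) [(h, \<pi> w). (h, w) \<leftarrow> hcoact B.dual d]" by simp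
  next
    fix n
    show "\<pi> ` deg B.dual n \<subseteq> deg A.dual n"
    proof
      fix e assume "e \<in> \<pi> ` deg B.dual n"
      then obtain d where d: "d \<in> B.ddeg n" "e = \<pi> d" by auto
      note dc = B.ddeg_mem[OF d(1)]
      have "p (\<pi> d) x = 0" if "x \<in> deg R m" "m \<noteq> n" for m x
        using pi(2)[OF dc A.deg_mem[OF that(1)]] B.ddeg_deg[OF d(1) dg[OF that(1)] that(2)] by simp
      then show "e \<in> deg A.dual n" using pi(1)[OF dc] d(2) by (simp add: A.ddeg_def)
    qed
  qed
  have lP: "lin R' kk (\<lambda>x. f (P x))" if "lin R kk f" for f by (rule lin_comp[OF that P(1)])
  have surj: "\<pi> ` carr D' = carr D"
  proof
    show "\<pi> ` carr D' \<subseteq> carr D" using pi by auto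
    show "carr D \<subseteq> \<pi> ` carr D'"
    proof
      fix e assume e: "e \<in> carr D"
      let ?f = "\<lambda>x. p e (P x)"
      note l = lP[OF A.p_lin2[OF e]]
      obtain N where "\<And>n x. n \<ge> N \<Longrightarrow> x \<in> deg R n \<Longrightarrow> p e x = 0" using A.boundedE[OF e] by blast
      then have b: "B.bounded ?f" unfolding B.bounded_def using P(3) by blast
      have m: "B.rep ?f \<in> carr D'" by (rule B.rep_mem[OF l b])
      have "\<pi> (B.rep ?f) = e"
        by (rule A.p_eqI) (simp_all add: pi[OF m] e B.p_rep[OF l b] c P(2))
      then show "e \<in> \<pi> ` carr D'" using m by (metis imageI)
    qed
  qed
  have "\<not> inj_on \<pi> (carr D')" if ne: "carr R \<noteq> carr R'"
  proof -
    have Rs: "B.R.VS.subspace (carr R)" using A.R.subspace_carr sel(1) by simp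
    have "\<not> carr R' \<subseteq> carr R" using ne sub by auto
    then obtain n x where x: "x \<in> deg R' n" "x \<notin> carr R" using B.carr_subset_if_degs[OF Rs] by blast
    obtain g where g: "Vector_Spaces.linear (scl R') (*) g" "\<And>u. u \<in> carr R \<Longrightarrow> g u = 0" "g x \<noteq> 0"
      using B.R.separate_from_subspace[OF Rs x(2)] by blast
    have gl: "lin R' kk g" by (rule linear_lin[OF g(1)])
    have l: "lin R' kk (\<lambda>z. g (B.proj n z))" by (intro lin_comp[OF gl] lins)
    \<comment> \<open>A nonzero element of the kernel. Restricting \<open>g\<close> to degree
      \<open>n\<close> makes it representable, and the functional still vanishes on
      \<open>carr R\<close> because that subspace contains the components of its elements.\<close>
    define d where "d = B.rep (\<lambda>z. g (B.proj n z))"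
    have d: "d \<in> B.ddeg n" "\<And>z. z \<in> carr R' \<Longrightarrow> p' d z = g (B.proj n z)"
      unfolding d_def using lin_0[OF gl B.R.vs_axioms] B.rep_ddeg[OF l, of n] by (auto simp: B.proj_homog)
    note dc = B.ddeg_mem[OF d(1)]
    have pj: "B.proj n z \<in> carr R" if z: "z \<in> carr R" for z
    proof -
      have "B.proj n z = A.proj n z"
      proof (rule B.proj_unique[where I="{n. A.proj n z \<noteq> 0}"])
        show "A.proj n z \<in> deg R' n" for n using A.proj_deg[OF z] dg by blast
      qed (use A.proj_fin[OF z] A.proj_sum[OF z] in auto)
      then show ?thesis using A.proj_mem[OF z] by simp
    qed
    have "p (\<pi> d) z = 0" if z: "z \<in> carr R" for z
      using pi(2)[OF dc z] d(2)[OF c[OF z]] g(2)[OF pj[OF z]] by simp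
    then have "\<pi> d = 0" using A.p_nondeg[OF pi(1)[OF dc]] by blast
    moreover have "\<pi> 0 = 0"
      by (rule A.p_nondeg) (simp_all add: pi B.D.zero_mem lin_0[OF B.p_lin1 B.D.vs_axioms] c)
    moreover have "d \<noteq> 0"
    proof
      assume "d = 0"
      then have "p' d x = 0" using lin_0[OF B.p_lin1[OF B.deg_mem[OF x(1)]] B.D.vs_axioms] by simp
      then show False using d(2)[OF B.deg_mem[OF x(1)]] x(1) g(3) by (simp add: B.proj_homog)
    qed
    ultimately show ?thesis using dc B.D.zero_mem unfolding inj_on_def by metis
  qed
  then show ?thesis using hom surj pi by (intro exI[of _ \<pi>]) blast
qed

section \<open>Realization on finitely supported sequences\<close>

definition pscale :: "'k::field \<Rightarrow> ('i \<Rightarrow>\<^sub>0 'k) \<Rightarrow> ('i \<Rightarrow>\<^sub>0 'k)" where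
  "pscale c = Poly_Mapping.map ((*) c)"

lemma lookup_pscale [simp]: "poly_mapping.lookup (pscale c q) i = c * poly_mapping.lookup q i"
  unfolding pscale_def by transfer (simp add: when_def)

lemma vector_space_pscale: "vector_space (pscale :: 'k::field \<Rightarrow> ('i \<Rightarrow>\<^sub>0 'k) \<Rightarrow> _)"
  by unfold_locales (auto intro!: poly_mapping_eqI simp: lookup_add algebra_simps)

context locally_finite_hopf
begin

text \<open>By local finiteness the union of the bases is countable, and an element of the graded
  dual is a finitely supported family of coordinates with respect to the dual bases. Numbering the
  basis turns it into a finitely supported sequence.\<close>

lemma dual_pairing_exists:
  assumes "hopf_bij K"
  shows "\<exists>(D :: ('k, nat \<Rightarrow>\<^sub>0 'k) vspace) p. dual_pairing K R D p"
proof -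
  \<comment> \<open>The degree is recorded with the vector, so that a number determines the
    coordinate form \<open>crd n b\<close> to be used.\<close>
  define B where "B = (SIGMA n:UNIV. bas n)"
  have cB: "countable B" unfolding B_def using bas(1) by (intro countable_SIGMA) (auto intro: countable_finite)
  define ix where "ix = to_nat_on B"
  define el where "el = from_nat_into B"
  have inj: "inj_on ix B" unfolding ix_def by (rule inj_on_to_nat_on[OF cB])
  have el: "el (ix b) = b" if "b \<in> B" for b unfolding el_def ix_def using cB that by simp
  define c where "c i x = (case el i of (n, b) \<Rightarrow> crd n b x)" for i x
  have lc: "lin R kk (c i)" for i unfolding c_def by (cases "el i") (simp add: lin_crd)
  \<comment> \<open>The support is confined to the numbers that occur, since \<open>B\<close> may be
    finite; otherwise the pairing need not be nondegenerate.\<close>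
  define D :: "('k, nat \<Rightarrow>\<^sub>0 'k) vspace" where "D = \<lparr>carr = {q. Poly_Mapping.keys q \<subseteq> ix ` B}, scl = pscale\<rparr>"
  define p where "p q x = (\<Sum>i\<in>Poly_Mapping.keys q. poly_mapping.lookup q i * c i x)" for q :: "nat \<Rightarrow>\<^sub>0 'k" and x
  have Dc: "carr D = {q. Poly_Mapping.keys q \<subseteq> ix ` B}" and Ds: "scl D = pscale" by (simp_all add: D_def)
  have p_over: "p q x = (\<Sum>i\<in>I. poly_mapping.lookup q i * c i x)" if "finite I" "Poly_Mapping.keys q \<subseteq> I" for q x I
    unfolding p_def using that by (intro sum.mono_neutral_left) (auto dest: not_in_keys_iff_lookup_eq_zero[THEN iffD1])
  interpret PV: vector_space "pscale :: 'k \<Rightarrow> (nat \<Rightarrow>\<^sub>0 'k) \<Rightarrow> _" by (rule vector_space_pscale)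
  have Dv: "vs D"
    unfolding vs_def Dc Ds
  proof
    show "PV.subspace {q. Poly_Mapping.keys q \<subseteq> ix ` B}"
      unfolding PV.subspace_def
      by (auto simp: in_keys_iff lookup_add subset_iff) (metis add.right_neutral)
  qed (rule vector_space_pscale)
  have cdelta: "c (ix (n, b)) b' = (if m = n \<and> b = b' then 1 else 0)" if "b \<in> bas n" "b' \<in> bas m" for n b m b'
  proof -
    have e: "c (ix (n, b)) b' = crd n b b'" using that by (simp add: c_def el B_def)
    show ?thesis
    proof (cases "m = n")
      case True
      then show ?thesis unfolding e using crd_bas[of b n b'] that by auto
    next
      case False
      then show ?thesis unfolding e using crd_deg[OF bas_deg[OF that(2)]] by simp
    qed
  qed
  have p_bas: "p q b = poly_mapping.lookup q (ix (n, b))" if q: "q \<in> carr D" and b: "b \<in> bas n" for q n b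
  proof -
    have "p q b = (\<Sum>i\<in>insert (ix (n, b)) (Poly_Mapping.keys q). poly_mapping.lookup q i * c i b)"
      by (rule p_over) auto
    also have "\<dots> = (\<Sum>i\<in>insert (ix (n, b)) (Poly_Mapping.keys q). if i = ix (n, b) then poly_mapping.lookup q i else 0)"
    proof (intro sum.cong refl)
      fix i assume "i \<in> insert (ix (n, b)) (Poly_Mapping.keys q)"
      then have "i \<in> ix ` B" using q b by (auto simp: Dc B_def)
      then obtain m b' where m: "i = ix (m, b')" "b' \<in> bas m" by (auto simp: B_def)
      have "i = ix (n, b) \<longleftrightarrow> (m, b') = (n, b)"
        unfolding m(1) using m(2) b by (intro inj_on_eq_iff[OF inj]) (auto simp: B_def)
      then show "poly_mapping.lookup q i * c i b = (if i = ix (n, b) then poly_mapping.lookup q i else 0)"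
        using cdelta[OF m(2) b] m by auto
    qed
    finally show ?thesis by simp
  qed
  have "dual_pairing K R D p"
  proof (intro dual_pairing.intro locally_finite_hopf_axioms assms Dv dual_pairing_axioms.intro)
    fix x assume x: "x \<in> carr R"
    show "lin D kk (\<lambda>d. p d x)"
      unfolding lin_def
    proof (intro conjI ballI allI)
      fix q q'
      have "p (q + q') x = (\<Sum>i\<in>Poly_Mapping.keys q \<union> Poly_Mapping.keys q'. poly_mapping.lookup (q + q') i * c i x)"
        by (rule p_over) (auto simp: in_keys_iff lookup_add)
      also have "\<dots> = p q x + p q' x"
        by (subst (1 2) p_over[of "Poly_Mapping.keys q \<union> Poly_Mapping.keys q'"]) (auto simp: lookup_add algebra_simps sum.distrib)
      finally show "p (q + q') x = p q x + p q' x" .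
    next
      fix a q
      have "p (pscale a q) x = (\<Sum>i\<in>Poly_Mapping.keys q. poly_mapping.lookup (pscale a q) i * c i x)"
        by (rule p_over) (auto simp: in_keys_iff)
      then show "p (scl D a q) x = scl kk a (p q x)"
        by (simp add: Ds p_def sum_distrib_left mult.assoc)
    qed simp
  next
    fix q assume q: "q \<in> carr D"
    show "lin R kk (p q)" unfolding p_def by (intro lins lc)
    show "q = 0" if z: "\<And>x. x \<in> carr R \<Longrightarrow> p q x = 0"
    proof (rule poly_mapping_eqI)
      fix i show "poly_mapping.lookup q i = poly_mapping.lookup 0 i"
      proof (cases "i \<in> Poly_Mapping.keys q")
        case True
        then obtain n b where "i = ix (n, b)" "b \<in> bas n" using q by (auto simp: Dc B_def)
        then show ?thesis using p_bas[OF q, of b n] z[OF deg_mem[OF bas_deg, of b n]] by simp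
      qed (simp add: in_keys_iff)
    qed
    show "finite {n. \<exists>x\<in>deg R n. p q x \<noteq> 0}"
    proof (rule finite_subset)
      show "finite ((\<lambda>i. fst (el i)) ` Poly_Mapping.keys q)" by simp
      show "{n. \<exists>x\<in>deg R n. p q x \<noteq> 0} \<subseteq> (\<lambda>i. fst (el i)) ` Poly_Mapping.keys q"
      proof
        fix n assume "n \<in> {n. \<exists>x\<in>deg R n. p q x \<noteq> 0}"
        then obtain x where x: "x \<in> deg R n" "p q x \<noteq> 0" by auto
        have "\<exists>i\<in>Poly_Mapping.keys q. c i x \<noteq> 0"
        proof (rule ccontr)
          assume "\<not> (\<exists>i\<in>Poly_Mapping.keys q. c i x \<noteq> 0)"
          then have "p q x = 0" unfolding p_def by (intro sum.neutral) simp
          then show False using x(2) by simp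
        qed
        then obtain i where i: "i \<in> Poly_Mapping.keys q" "c i x \<noteq> 0" by blast
        obtain m b where e: "el i = (m, b)" by (cases "el i")
        then have "m = n" using i(2) crd_deg[OF x(1), of m b] by (cases "m = n") (simp_all add: c_def)
        then have "fst (el i) = n" using e by simp
        then show "n \<in> (\<lambda>i. fst (el i)) ` Poly_Mapping.keys q" using i by auto
      qed
    qed
  next
    fix f assume f: "lin R kk f" and fin: "finite {n. \<exists>x\<in>deg R n. f x \<noteq> 0}"
    let ?N = "{n. \<exists>x\<in>deg R n. f x \<noteq> 0}"
    define g where "g i = (if i \<in> ix ` (SIGMA n:?N. bas n) then f (snd (el i)) else 0)" for i
    have fI: "finite (ix ` (SIGMA n:?N. bas n))" using fin bas(1) by (intro finite_imageI finite_SigmaI) auto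
    then have fg: "finite {i. g i \<noteq> 0}" by (rule finite_subset[rotated]) (auto simp: g_def split: if_split_asm)
    define q where "q = Abs_poly_mapping g"
    have lq: "poly_mapping.lookup q = g" unfolding q_def using fg by simp
    have kq: "Poly_Mapping.keys q \<subseteq> ix ` (SIGMA n:?N. bas n)" by (auto simp: in_keys_iff lq g_def split: if_split_asm)
    have q: "q \<in> carr D" using kq by (auto simp: Dc B_def)
    have "p q x = f x" if x: "x \<in> carr R" for x
    proof (rule lin_eq_homog[OF _ f _ x])
      show "lin R kk (p q)" unfolding p_def by (intro lins lc)
      fix n x assume x: "x \<in> deg R n"
      have "p q x = (\<Sum>i\<in>ix ` (SIGMA n:?N. bas n). g i * c i x)"
        unfolding p_over[OF fI kq] lq ..
      also have "\<dots> = (\<Sum>b\<in>(SIGMA n:?N. bas n). g (ix b) * c (ix b) x)"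
        by (rule sum.reindex_cong[OF inj_on_subset[OF inj] refl refl]) (auto simp: B_def)
      also have "\<dots> = (\<Sum>(m, b)\<in>(SIGMA n:?N. bas n). f b * crd m b x)"
        by (intro sum.cong refl) (auto simp: g_def c_def el B_def)
      also have "\<dots> = (\<Sum>m\<in>?N. \<Sum>b\<in>bas m. f b * crd m b x)"
        using fin bas(1) by (intro sum.Sigma[symmetric]) auto
      also have "\<dots> = (\<Sum>m\<in>?N. f (proj m x))"
        using lin_expand[OF f deg_mem[OF x] vs_kk] by (simp add: mult.commute)
      also have "\<dots> = (\<Sum>m\<in>?N. if m = n then f x else 0)"
        using lin_0[OF f R.vs_axioms] by (intro sum.cong refl) (simp add: proj_homog[OF x])
      also have "\<dots> = f x" using fin x by auto
      finally show "p q x = f x" .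
    qed
    then show "\<exists>d\<in>carr D. \<forall>x\<in>carr R. p d x = f x" using q by blast
  qed
  then show ?thesis by blast
qed

end

section \<open>Gelfand-Kirillov dimension\<close>

text \<open>Passing from base N n to base n multiplies the logarithm by ln (N n) / ln n, which tends
  to 1. So rescaling the argument by a constant does not increase the growth exponent.\<close>

lemma limsup_log_rescale:
  fixes H :: "nat \<Rightarrow> nat"
  assumes H: "\<And>n. H n \<ge> 1" and N: "N \<ge> 1"
  shows "limsup (\<lambda>n. ereal (log (real n) (real (H (N * n))))) \<le> limsup (\<lambda>n. ereal (log (real n) (real (H n))))"
    (is "?A \<le> ?L")
proof (rule ccontr)
  assume "\<not> ?A \<le> ?L"
  then have "?L < ?A" by simp
  then obtain r where r: "?L < ereal r" "ereal r < ?A" using ereal_dense2 by blast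
  obtain r' where r': "?L < ereal r'" "ereal r' < ereal r" using ereal_dense2[OF r(1)] by blast
  obtain M where M: "\<And>k. k \<ge> M \<Longrightarrow> log (real k) (real (H k)) < r'"
    using Limsup_lessD[OF r'(1)] by (auto simp: eventually_sequentially)
  have pos: "0 \<le> log (real (k + 2)) (real (H (k + 2)))" for k using H[of "k + 2"] by simp
  have r0: "r' > 0" using M[of "M + 2"] pos[of M] by simp
  \<comment> \<open>The factor in parentheses is ln (N n) / ln n; the gap between \<open>r'\<close>
    and \<open>r\<close> absorbs its deviation from 1.\<close>
  have "((\<lambda>n. r' * (1 + ln (real N) / ln (real n))) \<longlongrightarrow> r' * (1 + 0)) sequentially"
    by (intro tendsto_intros tendsto_divide_0[OF tendsto_const] filterlim_at_top_imp_at_infinity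
        filterlim_compose[OF ln_at_top filterlim_real_sequentially])
  then have "\<forall>\<^sub>F n in sequentially. r' * (1 + ln (real N) / ln (real n)) < r"
    using r'(2) by (intro order_tendstoD(2)) auto
  moreover have "\<forall>\<^sub>F n in sequentially. n \<ge> max M 2" by (rule eventually_ge_at_top)
  ultimately have "\<forall>\<^sub>F n in sequentially. ereal (log (real n) (real (H (N * n)))) \<le> ereal r"
  proof eventually_elim
    case (elim n)
    then have n: "n \<ge> 2" "n \<ge> M" by auto
    have Nn: "N * n \<ge> n" using N by simp
    have "1 < N * n" using n Nn by linarith
    then have "1 < real (N * n)" by (metis of_nat_1 of_nat_less_iff)
    then have l: "ln (real n) > 0" "ln (real (N * n)) > 0" using n by (simp, intro ln_gt_zero)
    have "ln (real (H (N * n))) < r' * ln (real (N * n))"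
      using M[of "N * n"] Nn n(2) pos_divide_less_eq[OF l(2)] by (simp add: log_def del: of_nat_mult)
    also have "ln (real (N * n)) = ln (real N) + ln (real n)" using N n by (simp add: ln_mult)
    finally have "log (real n) (real (H (N * n))) < r' * (1 + ln (real N) / ln (real n))"
      using l(1) by (simp add: log_def field_simps)
    then show ?case using elim(1) by simp
  qed
  then have "?A \<le> ereal r" by (rule Limsup_bounded)
  then show False using r(2) by simp
qed

text \<open>\<open>dim\<close> is 0 on infinite-dimensional spaces, so monotonicity needs the larger
  space to have a finite spanning set.\<close>

lemma (in vs) dim_mono:
  assumes "finite B" "W \<subseteq> VS.span B" "U \<subseteq> VS.span W" shows "VS.dim U \<le> VS.dim W"
proof -
  obtain BU where BU: "BU \<subseteq> U" "VS.independent BU" "U \<subseteq> VS.span BU" "card BU = VS.dim U" by (rule VS.basis_exists)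
  obtain BW where BW: "BW \<subseteq> W" "VS.independent BW" "W \<subseteq> VS.span BW" "card BW = VS.dim W" by (rule VS.basis_exists)
  have "finite BW" using VS.independent_span_bound[OF assms(1) BW(2)] BW(1) assms(2) by auto
  moreover have "BU \<subseteq> VS.span BW" using BU(1) assms(3) VS.span_minimal[OF BW(3) VS.subspace_span] by blast
  ultimately have "card BU \<le> card BW" using VS.independent_span_bound[OF _ BU(2)] by blast
  then show ?thesis using BU(4) BW(4) by simp
qed

section \<open>Growth computed by a filtration\<close>

context algebra
begin

lemma words_upto_subspace: "VS.subspace (words_upto A W n)"
  unfolding words_upto_def by (rule VS.subspace_span)

lemma words_upto_mono: "m \<le> n \<Longrightarrow> words_upto A W m \<subseteq> words_upto A W n"
  unfolding words_upto_def by (intro VS.span_mono) auto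

lemma unit_words_upto: "unit A \<in> words_upto A W n"
  unfolding words_upto_def by (rule VS.span_base, rule CollectI, rule exI[of _ "[]"]) simp

lemma mul_words_upto:
  assumes W: "W \<subseteq> carr A" and g: "g \<in> W" and w: "w \<in> words_upto A W n"
  shows "mul A g w \<in> words_upto A W (Suc n)"
proof (rule lin_span_closed[where f="mul A g" and G="{foldr (mul A) xs (unit A) |xs. set xs \<subseteq> W \<and> length xs \<le> n}",
      OF _ _ words_upto_subspace])
  show "lin A A (mul A g)" using mul_lin_right W g by auto
  show "{foldr (mul A) xs (unit A) |xs. set xs \<subseteq> W \<and> length xs \<le> n} \<subseteq> carr A" using W foldr_mem by blast
  show "w \<in> VS.span {foldr (mul A) xs (unit A) |xs. set xs \<subseteq> W \<and> length xs \<le> n}" using w by (simp add: words_upto_def)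
next
  fix w assume "w \<in> {foldr (mul A) xs (unit A) |xs. set xs \<subseteq> W \<and> length xs \<le> n}"
  then obtain xs where xs: "w = foldr (mul A) xs (unit A)" "set xs \<subseteq> W" "length xs \<le> n" by auto
  show "mul A g w \<in> words_upto A W (Suc n)"
    unfolding words_upto_def
    by (rule VS.span_base, rule CollectI, rule exI[of _ "g # xs"]) (use xs g in simp)
qed

text \<open>Every admissible \<open>W\<close> lies in some \<open>F N\<close>, so its words of
  length at most \<open>n\<close> lie in \<open>F (N * n)\<close>, and rescaling does not increase
  the exponent. Conversely \<open>F e\<close> is itself admissible, and by \<open>gen\<close> its
  words of length at most \<open>n\<close> span at least \<open>F n\<close>.\<close>

lemma GKdim_filtration:
  assumes fin: "\<And>n. \<exists>B. finite B \<and> F n = VS.span B" and sub: "\<And>n. F n \<subseteq> carr A"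
    and unit: "unit A \<in> F 0" "unit A \<noteq> 0" and mono: "\<And>m n. m \<le> n \<Longrightarrow> F m \<subseteq> F n"
    and mul: "\<And>m n x y. x \<in> F m \<Longrightarrow> y \<in> F n \<Longrightarrow> mul A x y \<in> F (m + n)"
    and exh: "\<And>x. x \<in> carr A \<Longrightarrow> \<exists>n. x \<in> F n"
    and gen: "\<And>n. F n \<subseteq> words_upto A (F e) n"
  shows "GKdim A = limsup (\<lambda>n. ereal (log (real n) (real (VS.dim (F n)))))"
proof -
  have Fs: "VS.subspace (F n)" for n using fin[of n] VS.subspace_span by auto
  have one: "VS.dim {unit A} = 1" using VS.dim_eq_card_independent[of "{unit A}"] unit(2) by simp
  have words: "words_upto A W n \<subseteq> F (N * n)" if W: "W \<subseteq> F N" for W N n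
    unfolding words_upto_def
  proof (rule VS.span_minimal[OF _ Fs], clarify)
    fix xs assume "set xs \<subseteq> W" "length xs \<le> n"
    then show "foldr (mul A) xs (unit A) \<in> F (N * n)"
    proof (induction xs arbitrary: n)
      case Nil then show ?case using unit(1) mono[of 0] by auto
    next
      case (Cons x xs)
      then obtain k where k: "n = Suc k" by (cases n) auto
      have "foldr (mul A) xs (unit A) \<in> F (N * k)" using Cons k by auto
      then show ?case using Cons.prems mul[of x N _ "N * k"] W k by (auto simp: add.commute)
    qed
  qed
  have dim1: "1 \<le> VS.dim U" if "unit A \<in> U" "U \<subseteq> F n" for U n
  proof -
    obtain B where "finite B" "F n = VS.span B" using fin by blast
    then show ?thesis using VS.dim_eq_card_independent that one VS.span_superset[of U] dim_mono[of B U "{unit A}"] by auto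
  qed
  have dimle: "VS.dim U \<le> VS.dim W" if "U \<subseteq> W" "W \<subseteq> F n" for U W n
  proof -
    obtain B where "finite B" "F n = VS.span B" using fin by blast
    then show ?thesis using that VS.span_superset[of W] by (intro dim_mono[of B]) auto
  qed
  have loglim: "limsup (\<lambda>n. ereal (log (real n) (real (f n)))) \<le> limsup (\<lambda>n. ereal (log (real n) (real (g n))))"
    if "\<And>n. 1 \<le> f n" "\<And>n. f n \<le> g n" for f g :: "nat \<Rightarrow> nat"
  proof (rule Limsup_mono)
    have "\<forall>\<^sub>F n in sequentially. n \<ge> (2::nat)" by (rule eventually_ge_at_top)
    then show "\<forall>\<^sub>F n in sequentially. ereal (log (real n) (real (f n))) \<le> ereal (log (real n) (real (g n)))"
    proof eventually_elim
      case (elim n)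
      have "0 < real (f n)" using that(1)[of n] by simp
      moreover have "real (f n) \<le> real (g n)" using that(2)[of n] by simp
      ultimately show ?case using elim by simp
    qed
  qed
  show ?thesis
  proof (rule antisym)
    show "GKdim A \<le> limsup (\<lambda>n. ereal (log (real n) (real (VS.dim (F n)))))"
      unfolding GKdim_def
    proof (rule SUP_least)
      fix W assume "W \<in> {W. W \<subseteq> carr A \<and> (\<exists>F. finite F \<and> W = VS.span F)}"
      then obtain G where G: "W \<subseteq> carr A" "finite G" "W = VS.span G" by auto
      have "\<forall>x\<in>G. \<exists>n. x \<in> F n" using exh G(1,3) VS.span_superset[of G] by blast
      then obtain h where h: "\<forall>x\<in>G. x \<in> F (h x)" by metis
      have "G \<subseteq> F (Max (insert 0 (h ` G)))"
      proof
        fix x assume x: "x \<in> G"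
        have "h x \<le> Max (insert 0 (h ` G))" using x G(2) by simp
        then show "x \<in> F (Max (insert 0 (h ` G)))" using h x mono by blast
      qed
      then obtain N0 where N0: "G \<subseteq> F N0" by auto
      \<comment> \<open>The rescaling lemma requires a factor of at least 1.\<close>
      define N where "N = max N0 1"
      have "G \<subseteq> F N" using N0 mono[of N0 N] by (auto simp: N_def)
      then have WN: "W \<subseteq> F N" unfolding G(3) by (rule VS.span_minimal[OF _ Fs])
      have "limsup (\<lambda>n. ereal (log (real n) (real (VS.dim (words_upto A W n))))) \<le>
          limsup (\<lambda>n. ereal (log (real n) (real (VS.dim (F (N * n))))))"
        by (rule loglim) (use dim1[OF unit_words_upto words[OF WN]] dimle[OF words[OF WN] subset_refl] in auto)
      also have "\<dots> \<le> limsup (\<lambda>n. ereal (log (real n) (real (VS.dim (F n)))))"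
      proof (rule limsup_log_rescale)
        show "1 \<le> VS.dim (F n)" for n using dim1[of "F n" n] unit(1) mono[of 0 n] by auto
      qed (simp add: N_def)
      finally show "limsup (\<lambda>n. ereal (log (real n) (real (VS.dim (words_upto A W n))))) \<le>
          limsup (\<lambda>n. ereal (log (real n) (real (VS.dim (F n)))))" .
    qed
    show "limsup (\<lambda>n. ereal (log (real n) (real (VS.dim (F n))))) \<le> GKdim A"
      unfolding GKdim_def
    proof (rule SUP_upper2)
      show "F e \<in> {W. W \<subseteq> carr A \<and> (\<exists>F. finite F \<and> W = VS.span F)}" using fin sub by auto
      show "limsup (\<lambda>n. ereal (log (real n) (real (VS.dim (F n))))) \<le>
        limsup (\<lambda>n. ereal (log (real n) (real (VS.dim (words_upto A (F e) n)))))"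
      proof (rule loglim)
        show "1 \<le> VS.dim (F n)" for n using dim1[of "F n" n] unit(1) mono[of 0 n] by auto
        show "VS.dim (F n) \<le> VS.dim (words_upto A (F e) n)" for n
          by (rule dimle[OF gen words[OF subset_refl]])
      qed
    qed
  qed
qed

end

section \<open>Growth computed by the Hilbert series\<close>

context locally_finite_hopf
begin

definition fil :: "nat \<Rightarrow> 'a set" where "fil n = R.VS.span (\<Union>i\<le>n. bas i)"

lemma bas_carr: "(\<Union>i\<le>n. bas i) \<subseteq> carr R" using deg_mem[OF bas_deg] by auto

lemma fil_subspace: "R.VS.subspace (fil n)" unfolding fil_def by (rule R.VS.subspace_span)

lemma deg_fil: "i \<le> n \<Longrightarrow> deg R i \<subseteq> fil n"
  unfolding fil_def bas(3)[symmetric] by (intro R.VS.span_mono) auto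

lemma fil_mul: assumes x: "x \<in> fil m" and y: "y \<in> fil n" shows "mul R x y \<in> fil (m + n)"
proof -
  have 1: "mul R b y \<in> fil (m + n)" if b: "b \<in> (\<Union>i\<le>m. bas i)" for b
  proof (rule R.lin_span_closed[where f="mul R b", OF _ bas_carr fil_subspace])
    show "lin R R (mul R b)" using R.mul_lin_right b bas_carr by blast
    show "y \<in> R.VS.span (\<Union>i\<le>n. bas i)" using y by (simp add: fil_def)
    fix w assume w: "w \<in> (\<Union>i\<le>n. bas i)"
    obtain i j where "i \<le> m" "b \<in> deg R i" "j \<le> n" "w \<in> deg R j" using b w bas_deg by blast
    then have "mul R b w \<in> deg R (i + j)" "i + j \<le> m + n" by (auto intro: deg_mul)
    then show "mul R b w \<in> fil (m + n)" using deg_fil by blast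
  qed
  have yc: "y \<in> carr R" using y R.span_carr[OF bas_carr] by (auto simp: fil_def)
  show ?thesis
    by (rule R.lin_span_closed[where f="\<lambda>x. mul R x y", OF R.mul_lin_left[OF yc] bas_carr fil_subspace 1])
       (use x in \<open>simp_all add: fil_def\<close>)
qed

text \<open>The form \<open>crd m b\<close> reads off the coefficient of \<open>b\<close>; basis
  vectors of different degrees are distinct because they are nonzero.\<close>

lemma bas_union_independent: "R.VS.independent (\<Union>i\<le>n. bas i)"
proof (rule R.VS.independent_if_scalars_zero)
  show "finite (\<Union>i\<le>n. bas i)" using bas(1) by auto
  fix f b assume s: "(\<Sum>x\<in>(\<Union>i\<le>n. bas i). scl R (f x) x) = 0" and "b \<in> (\<Union>i\<le>n. bas i)"
  then obtain m where m: "m \<le> n" "b \<in> bas m" by auto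
  have "0 = crd m b (\<Sum>x\<in>(\<Union>i\<le>n. bas i). scl R (f x) x)"
    unfolding s using lin_0[OF lin_crd R.vs_axioms] by simp
  also have "\<dots> = (\<Sum>x\<in>(\<Union>i\<le>n. bas i). f x * crd m b x)"
    using bas_carr by (subst lin_sum[OF lin_crd R.vs_axioms]) (auto intro!: sum.cong R.scl_mem simp: lin_scl[OF lin_crd] subset_iff)
  also have "\<dots> = (\<Sum>x\<in>(\<Union>i\<le>n. bas i). if x = b then f x else 0)"
  proof (intro sum.cong refl)
    fix x assume "x \<in> (\<Union>i\<le>n. bas i)"
    then obtain i where i: "x \<in> bas i" by auto
    show "f x * crd m b x = (if x = b then f x else 0)"
    proof (cases "i = m")
      case True
      then show ?thesis using crd_bas[of b m x] i m(2) by auto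
    next
      case False
      then have "x \<noteq> b" using proj_homog[OF bas_deg[OF i], of i] proj_homog[OF bas_deg[OF m(2)], of i]
          R.VS.dependent_zero bas(2)[of m] m(2) by auto
      then show ?thesis using crd_deg[OF bas_deg[OF i] False] by simp
    qed
  qed
  also have "\<dots> = f b" using bas(1) m by (subst sum.delta) auto
  finally show "f b = 0" by simp
qed

lemma dim_fil: "R.VS.dim (fil n) = (\<Sum>i\<le>n. R.VS.dim (deg R i))"
proof -
  have "R.VS.dim (fil n) = card (\<Union>i\<le>n. bas i)"
    unfolding fil_def by (rule R.VS.dim_span_eq_card_independent[OF bas_union_independent])
  also have "\<dots> = (\<Sum>i\<le>n. card (bas i))"
  proof (rule card_UN_disjoint)
    show "\<forall>i\<in>{..n}. \<forall>j\<in>{..n}. i \<noteq> j \<longrightarrow> bas i \<inter> bas j = {}"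
    proof (intro ballI impI, rule ccontr)
      fix i j assume "i \<noteq> j" "bas i \<inter> bas j \<noteq> {}"
      then obtain b where b: "b \<in> bas i" "b \<in> bas j" by auto
      have "b = 0" using proj_homog[OF bas_deg[OF b(1)], of i] proj_homog[OF bas_deg[OF b(2)], of i] \<open>i \<noteq> j\<close> by simp
      then show False using R.VS.dependent_zero bas(2)[of i] b(1) by blast
    qed
  qed (auto simp: bas(1))
  also have "\<dots> = (\<Sum>i\<le>n. R.VS.dim (deg R i))"
    using R.VS.dim_span_eq_card_independent[OF bas(2)] by (simp add: bas(3))
  finally show ?thesis .
qed

text \<open>Generators of degree 0 are scalars and the others raise the degree by at least one, so
  an element of degree \<open>k\<close> needs words of at most \<open>k\<close> generators. The
  induction proves this for all homogeneous components at once.\<close>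

lemma fil_gen:
  assumes gen: "gen_upto m = carr R" shows "fil n \<subseteq> words_upto R (fil m) n"
proof -
  let ?W = "words_upto R (fil m)"
  have fc: "fil m \<subseteq> carr R" unfolding fil_def by (rule R.span_carr[OF bas_carr])
  have "gen_upto m \<subseteq> (\<Inter>k. {x \<in> carr R. proj k x \<in> ?W k})"
  proof (rule gen_upto_subset)
    show "R.VS.subspace (\<Inter>k. {x \<in> carr R. proj k x \<in> ?W k})"
      by (rule R.VS.subspace_Inter) (auto intro!: subspace_vimage[OF lin_proj0 R.vs_axioms R.words_upto_subspace])
    show "unit R \<in> (\<Inter>k. {x \<in> carr R. proj k x \<in> ?W k})"
      using R.unit_words_upto R.VS.subspace_0[OF R.words_upto_subspace] by (simp add: R.unit_carr proj_homog[OF deg_unit])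
  next
    fix g w assume "g \<in> gens m" and w: "w \<in> (\<Inter>k. {x \<in> carr R. proj k x \<in> ?W k})"
    then obtain i where i: "i \<le> m" and g: "g \<in> deg R i" by (auto simp: gens_def)
    note gc = deg_mem[OF g]
    have wc: "w \<in> carr R" using w by auto
    have "proj k (mul R g w) \<in> ?W k" for k
    proof (cases "i \<le> k")
      case True
      have pw: "proj (k - i) w \<in> ?W (k - i)" using w by auto
      have "mul R g (proj (k - i) w) \<in> ?W k"
      proof (cases "i = 0")
        case True
        then obtain c where "g = scl R c (unit R)" using g connected by auto
        then show ?thesis using True pw wc R.VS.subspace_scale[OF R.words_upto_subspace]
          by (simp add: R.mul_scl R.unit_carr R.unit_left proj_mem)
      next
        case False
        have "g \<in> fil m" using g deg_fil[OF i] by auto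
        then have "mul R g (proj (k - i) w) \<in> ?W (Suc (k - i))" by (rule R.mul_words_upto[OF fc _ pw])
        moreover have "Suc (k - i) \<le> k" using False \<open>i \<le> k\<close> by linarith
        ultimately show ?thesis using R.words_upto_mono[of "Suc (k - i)" k] by blast
      qed
      then show ?thesis using True by (simp add: proj_mul_homog[OF g wc])
    qed (simp add: proj_mul_homog[OF g wc] R.VS.subspace_0[OF R.words_upto_subspace])
    then show "mul R g w \<in> (\<Inter>k. {x \<in> carr R. proj k x \<in> ?W k})" using gc wc by (auto intro: R.mul_mem)
  qed
  then have p: "proj k x \<in> ?W k" if "x \<in> carr R" for x k using that gen by auto
  show ?thesis
    unfolding fil_def[of n]
  proof (rule R.VS.span_minimal[OF _ R.words_upto_subspace], rule subsetI)
    fix b assume "b \<in> (\<Union>i\<le>n. bas i)"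
    then obtain i where i: "i \<le> n" "b \<in> deg R i" using bas_deg by auto
    then have "b \<in> ?W i" using p[OF deg_mem[OF i(2)], of i] by (simp add: proj_homog)
    then show "b \<in> ?W n" using R.words_upto_mono[OF i(1)] by auto
  qed
qed

lemma GKdim_hilbert:
  assumes gen: "gen_upto m = carr R"
  shows "GKdim R = limsup (\<lambda>n. ereal (log (real n) (real (\<Sum>i\<le>n. R.VS.dim (deg R i)))))"
  unfolding dim_fil[symmetric]
proof (rule R.GKdim_filtration[where e=m])
  show "\<exists>B. finite B \<and> fil n = R.VS.span B" for n unfolding fil_def using bas(1) by (intro exI[of _ "\<Union>i\<le>n. bas i"]) auto
  show "fil n \<subseteq> carr R" for n unfolding fil_def by (rule R.span_carr[OF bas_carr])
  show "unit R \<in> fil 0" using deg_unit deg_fil by blast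
  show "unit R \<noteq> 0" by (rule unit_nz)
  show "fil k \<subseteq> fil n" if "k \<le> n" for k n unfolding fil_def using that by (intro R.VS.span_mono) force
  show "\<exists>n. x \<in> fil n" if x: "x \<in> carr R" for x
  proof -
    obtain N where N: "\<forall>n\<in>{n. proj n x \<noteq> 0}. n < N" using proj_fin[OF x] finite_nat_set_iff_bounded by blast
    have "(\<Sum>n | proj n x \<noteq> 0. proj n x) \<in> fil N"
      using N proj_deg[OF x] deg_fil by (intro R.VS.subspace_sum[OF fil_subspace]) (metis less_imp_le_nat subsetD)
    then show ?thesis using proj_sum[OF x] by auto
  qed
qed (use fil_mul fil_gen[OF gen] in auto)

end

section \<open>The dual has the same growth\<close>

context dual_pairing
begin

text \<open>Injectivity and independence are read off by pairing with the basis
  \<open>bas n\<close>, which produces a Kronecker delta.\<close>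

lemma dl_basis: "inj_on (dl n) (bas n)" "D.VS.independent (dl n ` bas n)" "ddeg n = D.VS.span (dl n ` bas n)"
proof -
  have bc: "b \<in> carr R" if "b \<in> bas n" for b using deg_mem[OF bas_deg[OF that]] .
  have d: "p (dl n b) b' = (if b = b' then 1 else 0)" if "b \<in> bas n" "b' \<in> bas n" for b b'
    using dl(2)[OF bc[OF that(2)], of n b] crd_bas[OF that] by simp
  show inj: "inj_on (dl n) (bas n)"
  proof (rule inj_onI)
    fix b b' assume b: "b \<in> bas n" "b' \<in> bas n" and e: "dl n b = dl n b'"
    show "b = b'"
    proof (rule ccontr)
      assume "b \<noteq> b'"
      then have "p (dl n b) b = 1" "p (dl n b') b = 0" using d[OF b(1) b(1)] d[OF b(2) b(1)] by simp_all
      then show False using e by simp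
    qed
  qed
  show "D.VS.independent (dl n ` bas n)"
  proof (rule D.VS.independent_if_scalars_zero)
    show "finite (dl n ` bas n)" using bas(1) by simp
    fix f v assume s: "(\<Sum>x\<in>dl n ` bas n. scl D (f x) x) = 0" and "v \<in> dl n ` bas n"
    then obtain b where b: "b \<in> bas n" "v = dl n b" by auto
    have dm: "dl n c \<in> carr D" for c by (rule ddeg_mem[OF dl(1)])
    have "0 = p (\<Sum>x\<in>dl n ` bas n. scl D (f x) x) b"
      unfolding s using lin_0[OF p_lin1[OF bc[OF b(1)]] D.vs_axioms] by simp
    also have "(\<Sum>x\<in>dl n ` bas n. scl D (f x) x) = (\<Sum>c\<in>bas n. scl D (f (dl n c)) (dl n c))"
      by (rule sum.reindex_cong[OF inj]) auto
    also have "p \<dots> b = (\<Sum>c\<in>bas n. f (dl n c) * p (dl n c) b)"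
      by (subst lin_sum[OF p_lin1[OF bc[OF b(1)]] D.vs_axioms]) (simp_all add: D.scl_mem dm lin_scl[OF p_lin1[OF bc[OF b(1)]]])
    also have "\<dots> = (\<Sum>c\<in>bas n. if c = b then f (dl n c) else 0)"
      by (intro sum.cong refl) (simp add: d b(1))
    also have "\<dots> = f v" using b bas(1) by simp
    finally show "f v = 0" by simp
  qed
  show "ddeg n = D.VS.span (dl n ` bas n)"
  proof
    show "D.VS.span (dl n ` bas n) \<subseteq> ddeg n" using dl(1) by (intro D.VS.span_minimal ddeg_subspace) auto
    show "ddeg n \<subseteq> D.VS.span (dl n ` bas n)"
    proof
      fix d assume "d \<in> ddeg n"
      then have "d = (\<Sum>b\<in>bas n. scl D (p d b) (dl n b))" by (rule ddeg_expand)
      also have "\<dots> \<in> D.VS.span (dl n ` bas n)"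
        by (intro D.VS.span_sum D.VS.span_scale D.VS.span_base) auto
      finally show "d \<in> D.VS.span (dl n ` bas n)" .
    qed
  qed
qed

lemma dim_ddeg: "D.VS.dim (ddeg n) = R.VS.dim (deg R n)"
proof -
  have "D.VS.dim (ddeg n) = card (dl n ` bas n)"
    unfolding dl_basis(3) by (rule D.VS.dim_span_eq_card_independent[OF dl_basis(2)])
  also have "\<dots> = card (bas n)" by (rule card_image[OF dl_basis(1)])
  also have "\<dots> = R.VS.dim (deg R n)"
    using R.VS.dim_span_eq_card_independent[OF bas(2)] by (simp add: bas(3))
  finally show ?thesis .
qed

text \<open>The dual has the same Hilbert series, and both algebras are generated in bounded degree:
  \<open>R\<close> by assumption, the dual in degree one because the primitive elements of
  \<open>R\<close> have degree one.\<close>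

lemma GKdim_dual:
  assumes prim: "primitives R = deg R 1" and gen: "gen_upto m = carr R"
  shows "GKdim dual = GKdim R"
proof -
  interpret DG: graded_connected_hopf K dual by (rule dual_graded)
  interpret DL: locally_finite_hopf K dual
  proof
    fix n show "\<exists>F. finite F \<and> deg dual n = DG.R.VS.span F"
      using dl_basis(3)[of n] bas(1)[of n] by (intro exI[of _ "dl n ` bas n"]) simp
  qed
  have "DG.gen_upto 1 = carr dual" using DG.gen_upto_1 dual_generated[OF prim] by simp
  from DL.GKdim_hilbert[OF this] show ?thesis by (simp add: GKdim_hilbert[OF gen] dim_ddeg)
qed

end

context locally_finite_hopf
begin

text \<open>The graded dual is the instance of \<open>dual\<close> for the evaluation pairing on
  functionals. Only the underlying algebras have to be compared.\<close>

lemma GKdim_graded_dual: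
  assumes S: "hopf_bij K" and prim: "primitives R = deg R 1" and gen: "gen_upto m = carr R"
  shows "GKdim (graded_dual R) = GKdim R"
proof -
  define D :: "('k, 'a \<Rightarrow> 'k) vspace" where "D = \<lparr>carr = carr (graded_dual R), scl = scl (dual_vspace R)\<rparr>"
  have Dc: "f \<in> carr D \<longleftrightarrow> lin R kk f \<and> (\<forall>x. x \<notin> carr R \<longrightarrow> f x = 0) \<and> finite {n. \<exists>x\<in>deg R n. f x \<noteq> 0}" for f
    by (auto simp: D_def graded_dual_def dual_vspace_def lform_lin)
  have Ds: "scl D = (\<lambda>c f x. c * f x)" by (simp add: D_def dual_vspace_def)
  have amb: "vector_space (scl D)" unfolding Ds by unfold_locales (auto simp: fun_eq_iff algebra_simps)
  interpret VD: vector_space "scl D" by (rule amb)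
  have Dv: "vs D"
    unfolding vs_def VD.subspace_def
  proof (intro conjI amb ballI allI)
    show "0 \<in> carr D" by (simp add: Dc lin_zero vs_kk zero_fun_def)
    fix f g assume f: "f \<in> carr D" and g: "g \<in> carr D"
    have "{n. \<exists>x\<in>deg R n. f x + g x \<noteq> 0} \<subseteq> {n. \<exists>x\<in>deg R n. f x \<noteq> 0} \<union> {n. \<exists>x\<in>deg R n. g x \<noteq> 0}" by force
    then have "finite {n. \<exists>x\<in>deg R n. f x + g x \<noteq> 0}" using f g by (auto simp: Dc intro: finite_subset)
    then show "f + g \<in> carr D" using f g by (auto simp: Dc plus_fun_def intro!: lin_plus vs_kk)
  next
    fix c f assume f: "f \<in> carr D"
    have "{n. \<exists>x\<in>deg R n. c * f x \<noteq> 0} \<subseteq> {n. \<exists>x\<in>deg R n. f x \<noteq> 0}" by force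
    then have "finite {n. \<exists>x\<in>deg R n. c * f x \<noteq> 0}" using f by (auto simp: Dc intro: finite_subset)
    then show "scl D c f \<in> carr D" using f by (auto simp: Dc Ds intro!: lins)
  qed
  have "dual_pairing K R D (\<lambda>f x. f x)"
  proof (intro dual_pairing.intro locally_finite_hopf_axioms S Dv dual_pairing_axioms.intro)
    fix x show "lin D kk (\<lambda>f. f x)" by (simp add: lin_def Ds)
  next
    fix f assume f: "f \<in> carr D"
    show "lin R kk (\<lambda>x. f x)" "finite {n. \<exists>x\<in>deg R n. f x \<noteq> 0}" using f by (simp_all add: Dc)
    show "f = 0" if "\<And>x. x \<in> carr R \<Longrightarrow> f x = 0" using that f by (auto simp: Dc fun_eq_iff)
  next
    fix f assume f: "lin R kk f" "finite {n. \<exists>x\<in>deg R n. f x \<noteq> 0}"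
    \<comment> \<open>Functionals in the graded dual are zero outside the carrier, so the
      representative has to be cut off there.\<close>
    let ?g = "\<lambda>x. if x \<in> carr R then f x else 0"
    have "lin R kk ?g" by (rule lin_cong[OF f(1) _ R.vs_axioms]) simp
    moreover have "{n. \<exists>x\<in>deg R n. ?g x \<noteq> 0} = {n. \<exists>x\<in>deg R n. f x \<noteq> 0}" using deg_mem by (metis (mono_tags, lifting))
    ultimately have "?g \<in> carr D" using f(2) by (simp add: Dc)
    then show "\<exists>d\<in>carr D. \<forall>x\<in>carr R. d x = f x" by (intro bexI[of _ ?g]) auto
  qed
  then interpret P: dual_pairing K R D "\<lambda>f x. f x" .
  interpret DG: graded_connected_hopf K P.dual by (rule P.dual_graded)
  have u: "unit (graded_dual R) = unit P.dual"
  proof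
    fix x show "unit (graded_dual R) x = unit P.dual x"
      using P.dunit_mem P.p_dunit[of x] by (cases "x \<in> carr R") (auto simp: graded_dual_def Dc)
  qed
  have m: "mul (graded_dual R) f g = mul P.dual f g" if f: "f \<in> carr D" and g: "g \<in> carr D" for f g
  proof
    fix x show "mul (graded_dual R) f g x = mul P.dual f g x"
      using P.dmul_mem[OF f g] P.p_dmul[OF f g, of x]
      by (cases "x \<in> carr R") (auto simp: graded_dual_def Dc tsum_def)
  qed
  \<comment> \<open>The two products are compared on elements of \<open>D\<close> only, so equality
    is established for words with letters in \<open>D\<close>.\<close>
  have w: "foldr (mul (graded_dual R)) xs (unit (graded_dual R)) = foldr (mul P.dual) xs (unit P.dual)"
    if "set xs \<subseteq> carr D" for xs
    using that
  proof (induction xs)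
    case (Cons f xs)
    have "foldr (mul P.dual) xs (unit P.dual) \<in> carr P.dual" using Cons.prems by (intro DG.R.foldr_mem) simp
    then show ?case using Cons m by simp
  qed (simp add: u)
  have s: "scl (graded_dual R) = scl P.dual" "carr (graded_dual R) = carr P.dual"
    unfolding P.dual_sel by (simp_all add: D_def graded_dual_def)
  have "words_upto (graded_dual R) W n = words_upto P.dual W n" if W: "W \<subseteq> carr D" for W n
    unfolding words_upto_def s(1)
    by (intro arg_cong[where f="module.span (scl P.dual)"] Collect_cong ex_cong1) (use w W in \<open>auto simp: subset_trans\<close>)
  then have "GKdim (graded_dual R) = GKdim P.dual"
    unfolding GKdim_def s by (intro SUP_cong) auto
  then show ?thesis using P.GKdim_dual[OF prim gen] by simp
qed

end

section \<open>Post-Nichols algebras\<close>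

context sub_hopf
begin

lemma generated_sub: "generated sub F = generated R F"
  by (simp add: generated_def)

lemma sub_degree_one_iso:
  assumes d: "deg R 1 \<subseteq> S" and io: "degree_one_iso K V R \<iota>" and V: "yd_module K V"
  shows "degree_one_iso K V sub \<iota>"
proof -
  interpret V: yd_module K V by fact
  have b: "bij_betw \<iota> (carr V) (deg R 1)" and l: "lin V R \<iota>" using io by (auto simp: degree_one_iso_def)
  have i1: "\<iota> v \<in> S" if "v \<in> carr V" for v using b d that by (auto simp: bij_betw_def)
  show ?thesis
    unfolding degree_one_iso_def
  proof (intro conjI ballI)
    show "lin V sub \<iota>" using l i1 by (auto simp: lin_def)
    have "deg R 1 \<inter> S = deg R 1" using d by auto
    then show "bij_betw \<iota> (carr V) (deg sub 1)" using b by simp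
  next
    fix h v assume "h \<in> carr K" "v \<in> carr V"
    then show "\<iota> (act V h v) = hact sub h (\<iota> v)" using io by (simp add: degree_one_iso_def)
  next
    fix v assume v: "v \<in> carr V"
    show "teq K sub (hcoact sub (\<iota> v)) [(h, \<iota> w). (h, w) \<leftarrow> coact V v]"
      unfolding teq_iff
    proof (intro allI impI)
      fix \<beta> assume \<beta>: "bilin K sub kk \<beta>"
      have t: "teq K R (hcoact R (\<iota> v)) [(h, \<iota> w). (h, w) \<leftarrow> coact V v]" using io v by (simp add: degree_one_iso_def)
      have "tsum (hcoact sub (\<iota> v)) \<beta> = tsum (hcoact R (\<iota> v)) (\<lambda>h w. \<beta> h (P w))" by (simp add: hcoact_sub)
      also have "\<dots> = tsum (coact V v) (\<lambda>h w. \<beta> h (P (\<iota> w)))"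
        using teq_tsum[OF t P_liftK[OF \<beta>] vs_kk] by simp
      also have "\<dots> = tsum (coact V v) (\<lambda>h w. \<beta> h (\<iota> w))"
        by (intro V.coact_cong v) (simp add: P_id i1)
      finally show "tsum (hcoact sub (\<iota> v)) \<beta> = tsum [(h, \<iota> w). (h, w) \<leftarrow> coact V v] \<beta>" by simp
    qed
  qed
qed

end

text \<open>Restriction of functionals is the canonical map of the poset: an element of degree one
  of the dual is determined by its values on \<open>V\<close>, and both \<open>\<kappa>\<close> and
  \<open>\<kappa>'\<close> are normalized there.\<close>

lemma pre_nichols_less_dual:
  fixes K :: "('k::field, 'h::ab_group_add, 'y) hopf_scheme"
    and R :: "('k, 'h, 'a::ab_group_add, 'z) yd_hopf_scheme"
    and D D' :: "('k, 'd::ab_group_add) vspace"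
  assumes A: "sub_hopf K R S P" and A': "sub_hopf K R S' P'" and sub: "S \<subset> S'" and d1: "deg R 1 \<subseteq> S"
    and D: "dual_pairing K (sub_hopf.sub R S P) D p" and D': "dual_pairing K (sub_hopf.sub R S' P') D' p'"
    and io: "degree_one_iso K V R \<iota>"
    and k: "degree_one_iso K (yd_dual K V) (dual_pairing.dual K (sub_hopf.sub R S P) D p) \<kappa>"
      "\<And>f v. f \<in> carr (yd_dual K V) \<Longrightarrow> v \<in> carr V \<Longrightarrow> p (\<kappa> f) (\<iota> v) = f v"
    and k': "degree_one_iso K (yd_dual K V) (dual_pairing.dual K (sub_hopf.sub R S' P') D' p') \<kappa>'"
      "\<And>f v. f \<in> carr (yd_dual K V) \<Longrightarrow> v \<in> carr V \<Longrightarrow> p' (\<kappa>' f) (\<iota> v) = f v"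
  shows "pre_nichols_less K (yd_dual K V) (dual_pairing.dual K (sub_hopf.sub R S' P') D' p') \<kappa>'
     (dual_pairing.dual K (sub_hopf.sub R S P) D p) \<kappa>"
proof -
  interpret A: sub_hopf K R S P by fact
  interpret B: sub_hopf K R S' P' by fact
  interpret DA: dual_pairing K A.sub D p by (rule D)
  interpret DB: dual_pairing K B.sub D' p' by (rule D')
  have "\<exists>\<pi>. graded_hopf_hom K DB.dual DA.dual \<pi> \<and>
      (\<forall>d\<in>carr D'. \<pi> d \<in> carr D \<and> (\<forall>x\<in>carr A.sub. p (\<pi> d) x = p' d x)) \<and>
      \<pi> ` carr D' = carr D \<and> (carr A.sub \<noteq> carr B.sub \<longrightarrow> \<not> inj_on \<pi> (carr D'))"
  proof (rule restriction_hom[OF D D'])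
    fix x \<beta> assume "x \<in> carr A.sub" and b: "bilin B.sub B.sub kk \<beta>"
    then have x: "x \<in> S" by simp
    have "tsum (cop A.sub x) \<beta> = tsum (cop A.sub x) (\<lambda>a b. \<beta> (P' a) (P' b))"
      using sub by (intro A.cop_sub_cong x) (auto simp: B.P_id subset_iff psubset_eq)
    also have "\<dots> = tsum (cop R x) (\<lambda>a b. \<beta> (P' a) (P' b))"
      by (rule A.cop_sub_tsum[OF x B.P_lift[OF b] vs_kk])
    finally show "tsum (cop A.sub x) \<beta> = tsum (cop B.sub x) \<beta>" by (simp add: B.cop_sub)
  next
    fix x \<gamma> assume "x \<in> carr A.sub" and b: "bilin K B.sub kk \<gamma>"
    then have x: "x \<in> S" by simp
    have "tsum (hcoact A.sub x) \<gamma> = tsum (hcoact A.sub x) (\<lambda>a b. \<gamma> a (P' b))"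
      using sub by (intro A.hcoact_sub_cong x) (auto simp: B.P_id subset_iff psubset_eq)
    also have "\<dots> = tsum (hcoact R x) (\<lambda>a b. \<gamma> a (P' b))"
      by (rule A.hcoact_sub_tsum[OF x B.P_liftK[OF b] vs_kk])
    finally show "tsum (hcoact A.sub x) \<gamma> = tsum (hcoact B.sub x) \<gamma>" by (simp add: B.hcoact_sub)
  next
    show "lin B.sub A.sub P" using A.P_lin A.P_mem B.S_carr by (auto simp: lin_def)
    show "P x \<in> deg A.sub n" if "x \<in> deg B.sub n" for n x
      using that A.P_deg A.P_mem[OF B.S_mem] by simp
  qed (use sub A.P_id in auto)
  then obtain \<pi> where hom: "graded_hopf_hom K DB.dual DA.dual \<pi>"
    and pm: "\<And>d. d \<in> carr D' \<Longrightarrow> \<pi> d \<in> carr D"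
    and pp: "\<And>d x. d \<in> carr D' \<Longrightarrow> x \<in> S \<Longrightarrow> p (\<pi> d) x = p' d x"
    and surj: "\<pi> ` carr D' = carr D" and inj: "\<not> inj_on \<pi> (carr D')"
    using sub by auto
  have "\<pi> (\<kappa>' f) = \<kappa> f" if f: "f \<in> carr (yd_dual K V)" for f
  proof -
    have kd: "\<kappa> f \<in> DA.ddeg 1" using k(1) f by (auto simp: degree_one_iso_def bij_betw_def)
    have kd': "\<kappa>' f \<in> DB.ddeg 1" using k'(1) f by (auto simp: degree_one_iso_def bij_betw_def)
    have "\<pi> ` deg DB.dual 1 \<subseteq> deg DA.dual 1" using hom unfolding graded_hopf_hom_def by blast
    then have pkd: "\<pi> (\<kappa>' f) \<in> DA.ddeg 1" using kd' by auto
    show ?thesis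
    proof (rule DA.p_eqI[OF DA.ddeg_mem[OF pkd] DA.ddeg_mem[OF kd]])
      fix x assume x: "x \<in> carr A.sub"
      have y: "DA.proj 1 x \<in> deg R 1" "DA.proj 1 x \<in> S" using DA.proj_deg[OF x, of 1] by simp_all
      have "DA.proj 1 x \<in> \<iota> ` carr V" using y(1) io by (simp add: degree_one_iso_def bij_betw_def)
      then obtain v where v: "v \<in> carr V" "DA.proj 1 x = \<iota> v" by blast
      have "p (\<pi> (\<kappa>' f)) x = p (\<pi> (\<kappa>' f)) (\<iota> v)" using DA.ddeg_proj[OF pkd x] v(2) by simp
      also have "\<dots> = f v" using pp[OF DB.ddeg_mem[OF kd']] y(2) v k'(2)[OF f v(1)] by simp
      also have "\<dots> = p (\<kappa> f) (\<iota> v)" using k(2)[OF f v(1)] by simp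
      also have "\<dots> = p (\<kappa> f) x" using DA.ddeg_proj[OF kd x] v(2) by simp
      finally show "p (\<pi> (\<kappa>' f)) x = p (\<kappa> f) x" .
    qed
  qed
  then show ?thesis unfolding pre_nichols_less_def using hom surj inj by auto
qed

section \<open>The chain of pre-Nichols algebras\<close>

context graded_connected_hopf
begin

text \<open>The hypothesis on primitive elements passes to the Hopf subalgebra and makes it locally
  finite, so that its dual exists and is generated in degree one. The condition
  \<open>m \<ge> 1\<close> keeps \<open>V\<close> inside the subalgebra.\<close>

lemma sub_dual_exists:
  assumes K: "hopf_bij K" and V: "yd_module K V" and io: "degree_one_iso K V R \<iota>"
    and prim: "primitives R = deg R 1" and one: "\<exists>F. finite F \<and> deg R 1 = R.VS.span F" and m: "m \<ge> 1"
  shows "\<exists>P (D :: ('k, nat \<Rightarrow>\<^sub>0 'k) vspace) p \<kappa>. sub_hopf K R (gen_upto m) P \<and>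
    dual_pairing K (sub_hopf.sub R (gen_upto m) P) D p \<and>
    pre_nichols K (yd_dual K V) (dual_pairing.dual K (sub_hopf.sub R (gen_upto m) P) D p) \<kappa> \<and>
    GKdim (dual_pairing.dual K (sub_hopf.sub R (gen_upto m) P) D p) \<le> GKdim R \<and>
    (\<forall>f\<in>carr (yd_dual K V). \<forall>v\<in>carr V. p (\<kappa> f) (\<iota> v) = f v)"
proof -
  obtain P where "sub_hopf K R (gen_upto m) P" using gen_upto_sub_hopf by blast
  then interpret S: sub_hopf K R "gen_upto m" P .
  interpret G: graded_connected_hopf K S.sub by (rule S.sub_graded)
  have d1: "deg R 1 \<subseteq> gen_upto m" by (rule deg_gen_upto[OF m])
  have sp: "primitives S.sub = deg S.sub 1"
  proof
    show "primitives S.sub \<subseteq> deg S.sub 1" using S.sub_primitives prim by (auto simp: primitives_def)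
    show "deg S.sub 1 \<subseteq> primitives S.sub" using G.deg_1_prim by auto
  qed
  have so: "\<exists>F. finite F \<and> deg S.sub 1 = module.span (scl S.sub) F" using one d1 by (simp add: inf_absorb1)
  interpret L: locally_finite_hopf K S.sub
    by unfold_locales (rule G.locally_finite_if_primitives[OF sp so])
  obtain D :: "('k, nat \<Rightarrow>\<^sub>0 'k) vspace" and p where "dual_pairing K S.sub D p"
    using L.dual_pairing_exists[OF K] by blast
  then interpret DP: dual_pairing K S.sub D p .
  have sio: "degree_one_iso K V S.sub \<iota>" by (rule S.sub_degree_one_iso[OF d1 io V])
  obtain \<kappa> where k: "degree_one_iso K (yd_dual K V) DP.dual \<kappa>"
    "\<forall>f\<in>carr (yd_dual K V). \<forall>v\<in>carr V. p (\<kappa> f) (\<iota> v) = f v"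
    using DP.dual_degree_one_iso[OF V sio] by blast
  have "pre_nichols K (yd_dual K V) DP.dual \<kappa>"
    unfolding pre_nichols_def using DP.dual_graded k(1) DP.dual_generated[OF sp] by simp
  \<comment> \<open>The subalgebra is generated in degrees at most \<open>m\<close> also from its
    own point of view. This makes its Hilbert series compute its dimension, which is at most that of
    \<open>R\<close>.\<close>
  moreover have "G.gen_upto m = carr S.sub"
  proof -
    have "deg R i \<inter> gen_upto m = deg R i" if "i \<le> m" for i using deg_gen_upto[OF that] by auto
    then have gg: "G.gens m = gens m" by (simp add: G.gens_def gens_def)
    have "G.gen_upto m = generated S.sub (gens m)" unfolding G.gen_upto_def gg ..
    also have "\<dots> = generated R (gens m)" by (rule S.generated_sub)
    also have "\<dots> = gen_upto m" by (rule gen_upto_def[symmetric])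
    finally show ?thesis by simp
  qed
  then have "GKdim DP.dual \<le> GKdim R" using DP.GKdim_dual[OF sp] S.sub_GKdim by simp
  ultimately show ?thesis using S.sub_hopf_axioms DP.dual_pairing_axioms k(2) by blast
qed

text \<open>\<open>B m\<close> is the dual of \<open>E[m + 1]\<close>, shifted so that
  \<open>V\<close> is always contained. The equivalence is used in both parts of the theorem: at
  \<open>m = 0\<close> it shows that \<open>B 0\<close> is the Nichols algebra, and if all
  \<open>B m\<close> are Nichols algebras it yields \<open>E[m + 1] = E[1]\<close> for every
  \<open>m\<close>.\<close>

lemma dual_chain_exists:
  assumes K: "hopf_bij K" and V: "yd_module K V" and io: "degree_one_iso K V R \<iota>"
    and prim: "primitives R = deg R 1" and one: "\<exists>F. finite F \<and> deg R 1 = R.VS.span F"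
  shows "\<exists>(B :: nat \<Rightarrow> ('k, 'h) countable_yd_hopf) \<kappa>.
    (\<forall>m. pre_nichols K (yd_dual K V) (B m) (\<kappa> m) \<and> GKdim (B m) \<le> GKdim R \<and>
       (primitives (B m) = deg (B m) 1 \<longleftrightarrow> generated R (deg R 1) = gen_upto (Suc m))) \<and>
    (\<forall>m n. gen_upto (Suc m) \<subset> gen_upto (Suc n) \<longrightarrow>
       pre_nichols_less K (yd_dual K V) (B n) (\<kappa> n) (B m) (\<kappa> m))"
proof -
  let ?S = "\<lambda>m. gen_upto (Suc m)"
  \<comment> \<open>The data belonging to one \<open>m\<close> depend on each other and are chosen
    together as a tuple.\<close>
  let ?Q = "\<lambda>m (P, (D :: ('k, nat \<Rightarrow>\<^sub>0 'k) vspace), p, \<kappa>). sub_hopf K R (?S m) P \<and>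
      dual_pairing K (sub_hopf.sub R (?S m) P) D p \<and>
      pre_nichols K (yd_dual K V) (dual_pairing.dual K (sub_hopf.sub R (?S m) P) D p) \<kappa> \<and>
      GKdim (dual_pairing.dual K (sub_hopf.sub R (?S m) P) D p) \<le> GKdim R \<and>
      (\<forall>f\<in>carr (yd_dual K V). \<forall>v\<in>carr V. p (\<kappa> f) (\<iota> v) = f v)"
  have "\<forall>m. \<exists>t. ?Q m t"
    using sub_dual_exists[OF K V io prim one] by (simp add: split_paired_Ex)
  from choice[OF this] obtain t where t: "\<forall>m. ?Q m (t m)" ..
  define P where "P m = fst (t m)" for m
  define D where "D m = fst (snd (t m))" for m
  define p where "p m = fst (snd (snd (t m)))" for m
  define \<kappa> where "\<kappa> m = snd (snd (snd (t m)))" for m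
  define B where "B m = dual_pairing.dual K (sub_hopf.sub R (?S m) (P m)) (D m) (p m)" for m
  have sh: "sub_hopf K R (?S m) (P m)" and dp: "dual_pairing K (sub_hopf.sub R (?S m) (P m)) (D m) (p m)"
    and pn: "pre_nichols K (yd_dual K V) (B m) (\<kappa> m)" and gk: "GKdim (B m) \<le> GKdim R"
    and kv: "\<And>f v. f \<in> carr (yd_dual K V) \<Longrightarrow> v \<in> carr V \<Longrightarrow> p m (\<kappa> m f) (\<iota> v) = f v" for m
    using t[rule_format, of m] by (auto simp: B_def P_def D_def p_def \<kappa>_def split_beta)
  have d1: "deg R 1 \<subseteq> ?S m" for m by (rule deg_gen_upto) simp
  have "primitives (B m) = deg (B m) 1 \<longleftrightarrow> generated R (deg R 1) = ?S m" for m
  proof -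
    interpret S: sub_hopf K R "?S m" "P m" by (rule sh)
    interpret DP: dual_pairing K S.sub "D m" "p m" by (rule dp)
    have "generated S.sub (deg S.sub 1) = generated R (deg R 1)"
      using d1[of m] by (simp add: S.generated_sub inf_absorb1)
    moreover have "deg (B m) 1 = DP.ddeg 1" by (simp add: B_def)
    ultimately show ?thesis using DP.dual_primitives DP.generated_if_dual_primitives by (auto simp: B_def)
  qed
  moreover have "pre_nichols_less K (yd_dual K V) (B n) (\<kappa> n) (B m) (\<kappa> m)" if "?S m \<subset> ?S n" for m n
    using pn[of m] pn[of n] unfolding B_def pre_nichols_def
    by (intro pre_nichols_less_dual[OF sh sh that d1 dp dp io]) (auto simp: kv)
  ultimately show ?thesis using pn gk by blast
qed

lemma finitely_generated_if_gen_upto: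
  assumes lf: "\<And>n. \<exists>F. finite F \<and> deg R n = R.VS.span F" and gen: "gen_upto m = carr R"
  shows "finitely_generated R"
proof -
  from lf obtain F where F: "\<And>n. finite (F n)" "\<And>n. deg R n = R.VS.span (F n)" by metis
  let ?F = "\<Union>i\<le>m. F i"
  have fd: "F n \<subseteq> deg R n" for n using F(2) R.VS.span_superset by simp
  then have Fc: "?F \<subseteq> carr R" using deg_mem by blast
  have gens: "gens m \<subseteq> generated R ?F"
  proof -
    have "deg R i \<subseteq> generated R ?F" if "i \<le> m" for i
      unfolding F(2) using R.generated_base[OF Fc] that by (intro R.VS.span_minimal R.generated_subspace) auto
    then show ?thesis by (auto simp: gens_def)
  qed
  have "gen_upto m \<subseteq> generated R ?F"
    using gens R.generated_mul[OF Fc] by (intro gen_upto_subset R.generated_subspace R.generated_unit) auto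
  then have "generated R ?F = carr R" using gen R.generated_carr[OF Fc] by auto
  then show ?thesis unfolding finitely_generated_def using Fc F(1) by (intro exI[of _ ?F]) auto
qed

end

theorem lemma3p6:
  fixes K :: "('k::{alg_closed_field, field_char_0}, 'h::ab_group_add) hopf"
    and V :: "('k, 'h, 'v::ab_group_add) yd"
    and E :: "('k, 'h, 'e::ab_group_add) yd_hopf"
    and \<iota> :: "'v \<Rightarrow> 'e"
  assumes "hopf_algebra K"
    and "bij_betw (antip K) (carr K) (carr K)"
    and "yd_module K V"
    and "finite_dim V"
    and "post_nichols K V E \<iota>"
    and "GKdim E < \<infinity>"
  shows "(pre_bounded K (yd_dual K V) \<longrightarrow>
            finitely_generated E \<and> GKdim E = GKdim (graded_dual E)) \<and>
         (only_nichols_finite_GKdim K (yd_dual K V) \<longrightarrow> nichols K V E \<iota>)"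
proof -
  have KB: "hopf_bij K" by (intro hopf_bij.intro hopf_bij_axioms.intro assms(1,2))
  have E: "graded_connected_hopf K E" and cg: "coradically_graded E" and io: "degree_one_iso K V E \<iota>"
    using assms(5) by (auto simp: post_nichols_def)
  interpret V: yd_module K V by (rule assms(3))
  interpret E: graded_connected_hopf K E by (rule E)
  have prim: "primitives E = deg E 1" by (rule E.coradically_graded_primitives[OF cg])
  have il: "lin V E \<iota>" and ib: "\<iota> ` carr V = deg E 1" using io by (auto simp: degree_one_iso_def bij_betw_def)
  obtain F where F: "finite F" "V.V.VS.span F = carr V" using assms(4) by (auto simp: finite_dim_def)
  have Fc: "F \<subseteq> carr V" using F(2) V.V.VS.span_superset by blast
  \<comment> \<open>\<open>\<iota>\<close> is linear on \<open>carr V\<close> only, so membership in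
    the carrier is carried along the induction.\<close>
  have "\<iota> v \<in> E.R.VS.span (\<iota> ` F) \<and> v \<in> carr V" if "v \<in> V.V.VS.span F" for v
    using that
  proof (induction rule: V.V.VS.span_induct_alt)
    case base
    then show ?case using lin_0[OF il V.V.vs_axioms] by (simp add: E.R.VS.span_zero V.V.zero_mem)
  next
    case (step c x y)
    have x: "x \<in> carr V" using step Fc by auto
    have "\<iota> x \<in> E.R.VS.span (\<iota> ` F)" using step by (intro E.R.VS.span_base) auto
    then show ?case using step x
      by (simp add: lin_add[OF il] lin_scl[OF il] V.V.scl_mem V.V.add_mem E.R.VS.span_add E.R.VS.span_scale)
  qed
  then have "\<iota> ` carr V \<subseteq> E.R.VS.span (\<iota> ` F)" using F(2) by blast
  then have "deg E 1 \<subseteq> E.R.VS.span (\<iota> ` F)" unfolding ib .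
  moreover have "E.R.VS.span (\<iota> ` F) \<subseteq> deg E 1"
    using ib Fc E.deg_subspace[of 1] by (intro E.R.VS.span_minimal) auto
  ultimately have one: "\<exists>F. finite F \<and> deg E 1 = E.R.VS.span F"
    using F(1) by (intro exI[of _ "\<iota> ` F"]) auto
  note lf = E.locally_finite_if_primitives[OF prim one]
  interpret L: locally_finite_hopf K E by unfold_locales (rule lf)
  obtain B :: "nat \<Rightarrow> ('k, 'h) countable_yd_hopf" and \<kappa> where
    pn: "\<And>m. pre_nichols K (yd_dual K V) (B m) (\<kappa> m)" and gk: "\<And>m. GKdim (B m) \<le> GKdim E"
    and pr: "\<And>m. primitives (B m) = deg (B m) 1 \<longleftrightarrow> generated E (deg E 1) = E.gen_upto (Suc m)"
    and less: "\<And>m n. E.gen_upto (Suc m) \<subset> E.gen_upto (Suc n) \<Longrightarrow>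
       pre_nichols_less K (yd_dual K V) (B n) (\<kappa> n) (B m) (\<kappa> m)"
    using E.dual_chain_exists[OF KB assms(3) io prim one] by blast
  have gk': "GKdim (B m) < \<infinity>" for m using gk[of m] assms(6) by (rule order.strict_trans1)
  \<comment> \<open>The subalgebras exhaust \<open>E\<close>, since \<open>E[n + 1]\<close> contains
    degree \<open>n\<close>. Both conclusions are obtained by bounding all of them by a single
    subspace.\<close>
  have exhaust: "carr E = T" if "E.R.VS.subspace T" "T \<subseteq> carr E" "\<And>m. E.gen_upto (Suc m) \<subseteq> T" for T
  proof -
    have "deg E n \<subseteq> T" for n using E.deg_gen_upto[of n "Suc n"] that(3)[of n] by auto
    then show ?thesis using E.carr_subset_if_degs[OF that(1)] that(2) by auto
  qed
  show ?thesis
  proof (intro conjI impI)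
    assume pb: "pre_bounded K (yd_dual K V)"
    have "\<exists>m. E.gen_upto (Suc m) = carr E"
    proof (rule ccontr)
      assume ne: "\<nexists>m. E.gen_upto (Suc m) = carr E"
      \<comment> \<open>If no later subalgebra were strictly larger, the sequence would be constant
        from \<open>m\<close> on, and \<open>E[m + 1]\<close> would already be all of
        \<open>E\<close>.\<close>
      have step: "\<exists>n. E.gen_upto (Suc m) \<subset> E.gen_upto (Suc n)" for m
      proof (rule ccontr)
        assume c: "\<nexists>n. E.gen_upto (Suc m) \<subset> E.gen_upto (Suc n)"
        have "E.gen_upto (Suc n) \<subseteq> E.gen_upto (Suc m)" for n
        proof (cases "n \<le> m")
          case True
          then show ?thesis by (intro E.gen_upto_mono) simp
        next
          case False
          then have "E.gen_upto (Suc m) \<subseteq> E.gen_upto (Suc n)" by (intro E.gen_upto_mono) simp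
          then show ?thesis using c by blast
        qed
        then have "carr E = E.gen_upto (Suc m)" by (intro exhaust E.gen_upto_subspace E.gen_upto_carr)
        then show False using ne by blast
      qed
      then obtain nx where nx: "\<And>m. E.gen_upto (Suc m) \<subset> E.gen_upto (Suc (nx m))" by metis
      \<comment> \<open>Consecutive subalgebras may coincide, so the chain runs along a subsequence
        with strict inclusions. It starts at index 0, that is at \<open>E[1]\<close>, because the
        chain has to begin with the Nichols algebra.\<close>
      define f where "f = rec_nat 0 (\<lambda>_. nx)"
      have f: "f 0 = 0" "f (Suc k) = nx (f k)" for k by (simp_all add: f_def)
      have "nichols K (yd_dual K V) (B (f 0)) (\<kappa> (f 0))"
        using pn[of 0] pr[of 0] E.gen_upto_1 by (simp add: nichols_def f)
      moreover have "pre_nichols_less K (yd_dual K V) (B (f (Suc k))) (\<kappa> (f (Suc k))) (B (f k)) (\<kappa> (f k))" for k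
        using less[OF nx] by (simp add: f)
      ultimately show False
        using pb pn gk' unfolding pre_bounded_def
        by (elim notE) (intro exI[of _ "\<lambda>k. B (f k)"] exI[of _ "\<lambda>k. \<kappa> (f k)"], auto)
    qed
    then obtain m where m: "E.gen_upto (Suc m) = carr E" by blast
    show "finitely_generated E" by (rule E.finitely_generated_if_gen_upto[OF lf m])
    show "GKdim E = GKdim (graded_dual E)" by (rule L.GKdim_graded_dual[OF KB prim m, symmetric])
  next
    assume only: "only_nichols_finite_GKdim K (yd_dual K V)"
    \<comment> \<open>Each \<open>B m\<close> has finite dimension, bounded by that of
      \<open>E\<close>, so the hypothesis makes it a Nichols algebra.\<close>
    have "primitives (B m) = deg (B m) 1" for m
      using only pn[of m] gk'[of m] unfolding only_nichols_finite_GKdim_def nichols_def by blast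
    then have g: "E.gen_upto (Suc m) = generated E (deg E 1)" for m using pr by simp
    have d1: "deg E 1 \<subseteq> carr E" using E.deg_mem by blast
    \<comment> \<open>All the subalgebras equal the one generated in degree one, which is therefore
      everything. With primitive elements in degree one this is the definition of the Nichols
      algebra.\<close>
    have "carr E = generated E (deg E 1)"
      by (rule exhaust[OF E.R.generated_subspace E.R.generated_carr[OF d1]]) (simp add: g)
    then show "nichols K V E \<iota>"
      unfolding nichols_def pre_nichols_def using E io prim by simp
  qed
qed

end
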